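(* Let $\mathbb{H}$, $\Xi$, $\mathbb{H}_{\alpha}$ be complex Hilbert spaces, let $A$ be the generator of a $C_{0}$-semigroup $G(t)$ in $\mathbb{H}$ with domain $\mathcal{D}(A)$, and let $B \in \mathcal{L}(\Xi;\mathbb{H})$. Suppose $\mathbb{H}_{\alpha}$ is continuously and densely embedded in $\mathbb{H}$ and $\mathcal{D}(A) \subset \mathbb{H}_{\alpha}$. Let $$\mathcal{F}(v,\xi) = (\mathcal{F}_{1}v,v)_{\alpha} + 2\operatorname{Re}(\mathcal{F}_{2}v,\xi)_{\Xi} + (\mathcal{F}_{3}\xi,\xi)_{\Xi},\quad v\in\mathbb{H}_{\alpha},\ \xi\in\Xi,$$ with $\mathcal{F}_{1}^{*}=\mathcal{F}_{1} \in \mathcal{L}(\mathbb{H}_{\alpha})$, $\mathcal{F}_{2} \in \mathcal{L}(\mathbb{H}_{\alpha};\Xi)$, $\mathcal{F}_{3}^{*}=\mathcal{F}_{3} \in \mathcal{L}(\Xi)$. Assume that for every $v_{0} \in \mathbb{H}_{\alpha}$ there exists $\xi(\cdot) \in L_{2}(0,+\infty;\Xi)$ such that $v(\cdot,v_{0},\xi) \in L_{2}(0,+\infty;\mathbb{H}_{\alpha})$. Let $\mathcal{Z}$, $\mathfrak{M}_{v_{0}}$, $\mathcal{J}_{\mathcal{F}}$, $\alpha_{1},\alpha_{2},\alpha_{3}$ be as defined in the context. Then: 1) If $\alpha_{1}>0$, then for every $v_{0} \in \mathbb{H}_{\alpha}$ the functional $\mathcal{J}_{\mathcal{F}}$ has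 a unique minimum $(v^{0}(\cdot,v_{0}),\xi^{0}(\cdot,v_{0}))$ on $\mathfrak{M}_{v_{0}}$, and the map $\mathbb{H}_{\alpha} \ni v_{0} \mapsto (v^{0}(\cdot,v_{0}),\xi^{0}(\cdot,v_{0})) \in \mathcal{Z}$ is a bounded linear operator. Moreover, there exists $P \in \mathcal{L}(\mathbb{H}_{\alpha})$, self-adjoint in $\mathbb{H}_{\alpha}$, such that $(Pv_{0}, v_{0} )_{\alpha} = \mathcal{J}_{\mathcal{F}}(v^{0}(\cdot,v_{0}),\xi^{0}(\cdot,v_{0}))$ for all $v_{0} \in \mathbb{H}_{\alpha}$. For $V(v):=( Pv, v )_{\alpha}$ and any $T \geq 0$ we have $$V(v(T)) - V(v_{0}) + \int_{0}^{T} \mathcal{F}(v(t),\xi(t))\,dt \geq 0$$ whenever $v_{0} \in \mathbb{H}_{\alpha}$, $\xi(\cdot) \in L_{2}(0,T;\Xi)$ and the mild solution $v(t)=v(t,v_{0},\xi)$ satisfies $v(\cdot) \in C([0,T];\mathbb{H}_{\alpha})$. 2) $\alpha_{1}>0$ is equivalent to $\alpha_{2}>0$. If $\alpha_{3}$ is well-defined, then $\alpha_{2}>0$ is equivalent to $\alpha_{3}>0$.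
   Context: $(\cdot,\cdot)_{\alpha}$, $|\cdot|_{\alpha}$ are the inner product and norm of $\mathbb{H}_{\alpha}$. For $v_{0}\in\mathbb{H}$ and $\xi \in L_{2}(0,T;\Xi)$ (for one or all $T>0$), $v(t,v_{0},\xi)=G(t)v_{0}+\int_{0}^{t}G(t-s)B\xi(s)\,ds$ is the mild solution of $\dot v=Av+B\xi$, $v(0)=v_0$. $\mathcal{Z}:= L_{2}(0,+\infty;\mathbb{H}_{\alpha}) \times L_{2}(0,+\infty;\Xi)$. For $v_{0}\in\mathbb{H}_{\alpha}$, $\mathfrak{M}_{v_{0}}$ is the set of all $(v(\cdot),\xi(\cdot))\in\mathcal{Z}$ such that $v(\cdot)=v(\cdot,v_{0},\xi)$. On $\mathcal{Z}$ put $\mathcal{J}_{\mathcal{F}}(v(\cdot),\xi(\cdot)) := \int_{0}^{\infty}\mathcal{F}(v(t),\xi(t))\,dt$. All infima below are over arguments with nonzero denominators: $$\alpha_{1}:= \inf_{(v,\xi) \in \mathfrak{M}_{0}} \frac{\mathcal{J}_{\mathcal{F}}(v(\cdot),\xi(\cdot))}{\|v(\cdot)\|^{2}_{L_{2}(0,+\infty;\mathbb{H}_{\alpha})} + \|\xi(\cdot)\|_{L_{2}(0,+\infty;\Xi)}^{2}},\qquad \alpha_{2} := \inf \frac{ \mathcal{F}(v,\xi) }{ |v|^{2}_{\alpha} + |\xi|^{2}_{\Xi} },$$ where in $\alpha_{2}$ the infimum is over all $\omega \in \mathbb{R}$, $v \in \mathcal{D}(A)$, $\xi \in \Xi$ with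 $i\omega v = Av + B\xi$; and $$\alpha_{3} := \inf_{\omega \in \mathbb{R}} \inf_{ \xi \in \Xi} \frac{\mathcal{F}(-(A-i\omega I)^{-1}B\xi,\xi) }{|\xi|^{2}_{\Xi}}.$$ $\alpha_{3}$ is called well-defined if the spectrum of $A$ does not intersect the imaginary axis and the operators $(A-i\omega I)^{-1}B$ are bounded in the norm of $\mathcal{L}(\Xi;\mathbb{H}_{\alpha})$ uniformly in $\omega \in \mathbb{R}$. *)

theory Defs
  imports "HOL-Analysis.Analysis"
begin

section \<open>Complex Hilbert spaces\<close>

text \<open>The complex inner product is linear in the first argument; the norm and the topology are
  those of the underlying real inner product space, whose inner product is the real part.
  No separability is assumed.\<close>

class complex_hilbert = real_inner + complete_space +
  fixes scaleC :: "complex \<Rightarrow> 'a \<Rightarrow> 'a" (infixr "*\<^sub>C" 75)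
    and cinner :: "'a \<Rightarrow> 'a \<Rightarrow> complex"
  assumes scaleC_add_right: "c *\<^sub>C (x + y) = c *\<^sub>C x + c *\<^sub>C y"
    and scaleC_add_left: "(c + d) *\<^sub>C x = c *\<^sub>C x + d *\<^sub>C x"
    and scaleC_scaleC: "c *\<^sub>C d *\<^sub>C x = (c * d) *\<^sub>C x"
    and scaleR_scaleC: "r *\<^sub>R x = complex_of_real r *\<^sub>C x"
    and cinner_commute: "cinner x y = cnj (cinner y x)"
    and cinner_add_left: "cinner (x + y) z = cinner x z + cinner y z"
    and cinner_scaleC_left: "cinner (c *\<^sub>C x) y = c * cinner x y"
    and inner_eq_Re_cinner: "inner x y = Re (cinner x y)"

instantiation complex :: complex_hilbert
begin

definition scaleC_complex :: "complex \<Rightarrow> complex \<Rightarrow> complex"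
  where "scaleC_complex c x = c * x"

definition cinner_complex :: "complex \<Rightarrow> complex \<Rightarrow> complex"
  where "cinner_complex x y = x * cnj y"

instance
  by standard
    (simp_all add: scaleC_complex_def cinner_complex_def inner_complex_def scaleR_conv_of_real
      algebra_simps)

end

definition bounded_clinear :: "('a::complex_hilbert \<Rightarrow> 'b::complex_hilbert) \<Rightarrow> bool"
  where "bounded_clinear f \<longleftrightarrow> bounded_linear f \<and> (\<forall>c x. f (c *\<^sub>C x) = c *\<^sub>C f x)"

definition self_adjoint :: "('a::complex_hilbert \<Rightarrow> 'a) \<Rightarrow> bool"
  where "self_adjoint f \<longleftrightarrow> (\<forall>x y. cinner (f x) y = cinner x (f y))"

section \<open>Semigroups, generators, resolvents\<close>

text \<open>Values \<open>G t\<close> with \<open>t < 0\<close> are irrelevant.\<close>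

definition C0_semigroup :: "(real \<Rightarrow> 'h::complex_hilbert \<Rightarrow> 'h) \<Rightarrow> bool"
  where "C0_semigroup G \<longleftrightarrow>
    (\<forall>t\<ge>0. bounded_clinear (G t)) \<and> (\<forall>x. G 0 x = x) \<and>
    (\<forall>s\<ge>0. \<forall>t\<ge>0. \<forall>x. G (s + t) x = G s (G t x)) \<and>
    (\<forall>x. ((\<lambda>t. G t x) \<longlongrightarrow> x) (at_right 0))"

text \<open>An unbounded operator is a pair of a domain \<open>D\<close> and a function \<open>A\<close> whose values outside
  \<open>D\<close> are irrelevant.\<close>

definition is_generator :: "'h set \<Rightarrow> ('h \<Rightarrow> 'h) \<Rightarrow> (real \<Rightarrow> 'h::complex_hilbert \<Rightarrow> 'h) \<Rightarrow> bool"
  where "is_generator D A G \<longleftrightarrow>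
    D = {x. \<exists>y. ((\<lambda>t. (G t x - x) /\<^sub>R t) \<longlongrightarrow> y) (at_right 0)} \<and>
    (\<forall>x\<in>D. ((\<lambda>t. (G t x - x) /\<^sub>R t) \<longlongrightarrow> A x) (at_right 0))"

definition resolvent :: "'h set \<Rightarrow> ('h \<Rightarrow> 'h) \<Rightarrow> complex \<Rightarrow> 'h::complex_hilbert \<Rightarrow> 'h"
  where "resolvent D A \<mu> = inv_into D (\<lambda>x. A x - \<mu> *\<^sub>C x)"

definition op_spectrum :: "'h set \<Rightarrow> ('h::complex_hilbert \<Rightarrow> 'h) \<Rightarrow> complex set"
  where "op_spectrum D A =
    {\<mu>. \<not> (bij_betw (\<lambda>x. A x - \<mu> *\<^sub>C x) D UNIV \<and> bounded_clinear (resolvent D A \<mu>))}"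

section \<open>Square-integrable functions\<close>

text \<open>The Bochner integral of the library is restricted to second-countable spaces. For possibly
  non-separable values, strong measurability is therefore stated directly. Lebesgue measure is
  complete, so this notion is invariant under changes on null sets.\<close>

definition strongly_measurable :: "'t measure \<Rightarrow> ('t \<Rightarrow> 'a::topological_space) \<Rightarrow> bool"
  where "strongly_measurable M f \<longleftrightarrow>
    (\<exists>s. (\<forall>n. simple_function M (s n)) \<and> (AE t in M. (\<lambda>n. s n t) \<longlonglongrightarrow> f t))"

text \<open>Elements of \<open>L\<^sub>2\<close> are represented by functions; equality in \<open>L\<^sub>2\<close> is equality almost
  everywhere on \<open>S\<close>.\<close>

definition L2_on :: "real set \<Rightarrow> (real \<Rightarrow> 'a::real_normed_vector) set"
  where "L2_on S = {f. strongly_measurable (lebesgue_on S) f \<and>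
    integrable (lebesgue_on S) (\<lambda>t. (norm (f t))\<^sup>2)}"

definition L2_norm_on :: "real set \<Rightarrow> (real \<Rightarrow> 'a::real_normed_vector) \<Rightarrow> real"
  where "L2_norm_on S f = sqrt (LINT t|lebesgue_on S. (norm (f t))\<^sup>2)"

section \<open>Processes\<close>

text \<open>The integral is the gauge integral, which agrees with the Bochner integral for Bochner
  integrable integrands and needs no separability.\<close>

definition mild_solution ::
    "(real \<Rightarrow> 'h \<Rightarrow> 'h) \<Rightarrow> ('x \<Rightarrow> 'h) \<Rightarrow> 'h \<Rightarrow> (real \<Rightarrow> 'x) \<Rightarrow> real \<Rightarrow> 'h::complex_hilbert"
  where "mild_solution G B v0 \<xi> t = G t v0 + integral {0..t} (\<lambda>s. G (t - s) (B (\<xi> s)))"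

type_synonym ('a, 'x) process = "(real \<Rightarrow> 'a) \<times> (real \<Rightarrow> 'x)"

definition Z_space :: "('a::complex_hilbert, 'x::complex_hilbert) process set"
  where "Z_space = L2_on {0<..} \<times> L2_on {0<..}"

definition Z_eq :: "('a, 'x) process \<Rightarrow> ('a, 'x) process \<Rightarrow> bool"
  where "Z_eq z z' \<longleftrightarrow>
    (AE t in lebesgue_on {0<..}. fst z t = fst z' t) \<and>
    (AE t in lebesgue_on {0<..}. snd z t = snd z' t)"

definition Z_norm :: "('a::complex_hilbert, 'x::complex_hilbert) process \<Rightarrow> real"
  where "Z_norm z = sqrt ((L2_norm_on {0<..} (fst z))\<^sup>2 + (L2_norm_on {0<..} (snd z))\<^sup>2)"

text \<open>Bounded linear operators into \<open>Z_space\<close> modulo \<open>Z_eq\<close>.\<close>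

definition bounded_clinear_Z ::
    "('b::complex_hilbert \<Rightarrow> ('a::complex_hilbert, 'x::complex_hilbert) process) \<Rightarrow> bool"
  where "bounded_clinear_Z \<Phi> \<longleftrightarrow>
    (\<forall>x. \<Phi> x \<in> Z_space) \<and>
    (\<forall>x y. Z_eq (\<Phi> (x + y))
      (\<lambda>t. fst (\<Phi> x) t + fst (\<Phi> y) t, \<lambda>t. snd (\<Phi> x) t + snd (\<Phi> y) t)) \<and>
    (\<forall>c x. Z_eq (\<Phi> (c *\<^sub>C x)) (\<lambda>t. c *\<^sub>C fst (\<Phi> x) t, \<lambda>t. c *\<^sub>C snd (\<Phi> x) t)) \<and>
    (\<exists>C. \<forall>x. Z_norm (\<Phi> x) \<le> C * norm x)"

text \<open>The embedding of the smaller space (type \<open>'a\<close>) into \<open>'h\<close> is an explicit map \<open>j\<close>. The first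
  component is identified with the mild solution as an element of \<open>L\<^sub>2\<close>, hence almost
  everywhere.\<close>

definition admissible ::
    "('a::complex_hilbert \<Rightarrow> 'h::complex_hilbert) \<Rightarrow> (real \<Rightarrow> 'h \<Rightarrow> 'h) \<Rightarrow>
      ('x::complex_hilbert \<Rightarrow> 'h) \<Rightarrow> 'a \<Rightarrow> ('a, 'x) process set"
  where "admissible j G B v0 = {(v, \<xi>) \<in> Z_space.
    AE t in lebesgue_on {0<..}. j (v t) = mild_solution G B (j v0) \<xi> t}"

section \<open>Quadratic functionals and frequency conditions\<close>

text \<open>For self-adjoint \<open>F1\<close> and \<open>F3\<close> the first and the last inner product are real, so taking the
  real part there only changes the type.\<close>

definition quad_form ::
    "('a \<Rightarrow> 'a) \<Rightarrow> ('a \<Rightarrow> 'x) \<Rightarrow> ('x \<Rightarrow> 'x) \<Rightarrow> 'a::complex_hilbert \<Rightarrow> 'x::complex_hilbert \<Rightarrow> real"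
  where "quad_form F1 F2 F3 v \<xi> =
    Re (cinner (F1 v) v) + 2 * Re (cinner (F2 v) \<xi>) + Re (cinner (F3 \<xi>) \<xi>)"

definition functional_J :: "('a \<Rightarrow> 'x \<Rightarrow> real) \<Rightarrow> ('a, 'x) process \<Rightarrow> real"
  where "functional_J F z = (LINT t|lebesgue_on {0<..}. F (fst z t) (snd z t))"

definition minimizer_on :: "('z \<Rightarrow> real) \<Rightarrow> 'z set \<Rightarrow> 'z \<Rightarrow> bool"
  where "minimizer_on f M z \<longleftrightarrow> z \<in> M \<and> (\<forall>z'\<in>M. f z \<le> f z')"

text \<open>The infima are taken in the extended reals; the infimum of the empty set is \<open>\<infinity>\<close>.\<close>

definition alpha1 ::
    "('a::complex_hilbert \<Rightarrow> 'h::complex_hilbert) \<Rightarrow> (real \<Rightarrow> 'h \<Rightarrow> 'h) \<Rightarrow>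
      ('x::complex_hilbert \<Rightarrow> 'h) \<Rightarrow> ('a \<Rightarrow> 'x \<Rightarrow> real) \<Rightarrow> ereal"
  where "alpha1 j G B F = Inf {ereal (functional_J F (v, \<xi>) /
      ((L2_norm_on {0<..} v)\<^sup>2 + (L2_norm_on {0<..} \<xi>)\<^sup>2)) | v \<xi>.
    (v, \<xi>) \<in> admissible j G B 0 \<and>
    (L2_norm_on {0<..} v)\<^sup>2 + (L2_norm_on {0<..} \<xi>)\<^sup>2 \<noteq> 0}"

definition alpha2 ::
    "('a::complex_hilbert \<Rightarrow> 'h::complex_hilbert) \<Rightarrow> 'h set \<Rightarrow> ('h \<Rightarrow> 'h) \<Rightarrow>
      ('x::complex_hilbert \<Rightarrow> 'h) \<Rightarrow> ('a \<Rightarrow> 'x \<Rightarrow> real) \<Rightarrow> ereal"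
  where "alpha2 j D A B F = Inf {ereal (F v \<xi> / ((norm v)\<^sup>2 + (norm \<xi>)\<^sup>2)) | \<omega> v \<xi>.
    j v \<in> D \<and> (\<i> * complex_of_real \<omega>) *\<^sub>C j v = A (j v) + B \<xi> \<and>
    (norm v)\<^sup>2 + (norm \<xi>)\<^sup>2 \<noteq> 0}"

text \<open>The operator \<open>(A - i \<omega> I)\<^sup>-\<^sup>1 B\<close>, regarded as an operator into the smaller space.\<close>

definition transfer_op ::
    "('a::complex_hilbert \<Rightarrow> 'h::complex_hilbert) \<Rightarrow> 'h set \<Rightarrow> ('h \<Rightarrow> 'h) \<Rightarrow>
      ('x::complex_hilbert \<Rightarrow> 'h) \<Rightarrow> real \<Rightarrow> 'x \<Rightarrow> 'a"
  where "transfer_op j D A B \<omega> \<xi> = inv j (resolvent D A (\<i> * complex_of_real \<omega>) (B \<xi>))"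

definition alpha3 ::
    "('a::complex_hilbert \<Rightarrow> 'h::complex_hilbert) \<Rightarrow> 'h set \<Rightarrow> ('h \<Rightarrow> 'h) \<Rightarrow>
      ('x::complex_hilbert \<Rightarrow> 'h) \<Rightarrow> ('a \<Rightarrow> 'x \<Rightarrow> real) \<Rightarrow> ereal"
  where "alpha3 j D A B F = (INF \<omega>. INF \<xi>\<in>{\<xi>. (norm \<xi>)\<^sup>2 \<noteq> 0}.
    ereal (F (- transfer_op j D A B \<omega> \<xi>) \<xi> / (norm \<xi>)\<^sup>2))"

definition alpha3_well_defined ::
    "('a::complex_hilbert \<Rightarrow> 'h::complex_hilbert) \<Rightarrow> 'h set \<Rightarrow> ('h \<Rightarrow> 'h) \<Rightarrow>
      ('x::complex_hilbert \<Rightarrow> 'h) \<Rightarrow> bool"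
  where "alpha3_well_defined j D A B \<longleftrightarrow>
    op_spectrum D A \<inter> range (\<lambda>\<omega>. \<i> * complex_of_real \<omega>) = {} \<and>
    (\<exists>C. \<forall>\<omega>. bounded_clinear (transfer_op j D A B \<omega>) \<and> onorm (transfer_op j D A B \<omega>) \<le> C)"

end

theory Submission
  imports Defs
begin

text \<open>
  The functional is a bounded quadratic form on the Hilbert space of square-integrable pairs, and
  the processes together with their initial states form a closed linear relation. If \<open>\<alpha>\<^sub>1 > 0\<close>, the form is
  coercive on the processes starting at zero, so every fibre of the relation has a unique minimizer,
  which depends linearly on the initial state and boundedly by the closed graph theorem. Continuing
  a trajectory by the optimal process of its end point gives the dissipation inequality.

  For \<open>\<alpha>\<^sub>1 > 0 \<Longrightarrow> \<alpha>\<^sub>2 > 0\<close>, apply the dissipation inequality to the functional perturbed by a small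
  multiple of the squared norm, along the trajectory \<open>exp (i \<omega> t) v\<close> with the control \<open>exp (i \<omega> t) \<xi>\<close>.
  For the converse, cut a process starting at zero at a large time \<open>T\<close> and make it \<open>T\<close>-periodic by
  adding the folded process of minimal norm that steers the end state to zero; this correction is small, since
  processes of minimal norm decay exponentially in the mean. The Fourier coefficients of the periodic
  process solve \<open>i \<omega> v = A v + B \<xi>\<close>, and Parseval's identity sums the frequency inequalities.
\<close>

text \<open>Two obstacles shape the proof. The value spaces may be non-separable, so
  \<open>L2\<close> is a quotient of strongly measurable functions: completeness comes from simple
  functions, and identities for mild solutions are checked for inputs constant on an interval and
  extended by boundedness. Moreover, the smaller space need not be invariant under the semigroup.
  The state of a process lies in it only for almost every time, while a continuation can start only
  from a state in it. In the decay and periodization arguments every restart is therefore made at a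
  time found by averaging, where the state lies in the smaller space and is controlled by the nearby
  mass of the process. Cutting at \<open>T\<close> leaves a jump in the equation for the Fourier
  coefficients, whereas the frequency inequality speaks of exact solutions only. Folding removes the
  jump because the jumps of consecutive pieces telescope. Strict positivity never passes through a
  limit: it is moved into the form as a term -\<delta> times the squared norm, and only
  nonnegativity is carried along.\<close>

instance complex_hilbert \<subseteq> banach ..

section \<open>Complex scalars and products of complex Hilbert spaces\<close>

lemma scaleC_one [simp]: "1 *\<^sub>C x = (x::'a::complex_hilbert)"
  by (metis of_real_1 scaleR_one scaleR_scaleC)

lemma scaleC_of_real [simp]: "complex_of_real r *\<^sub>C x = r *\<^sub>R (x::'a::complex_hilbert)"
  by (simp add: scaleR_scaleC)

lemma scaleC_zero_left [simp]: "0 *\<^sub>C x = (0::'a::complex_hilbert)"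
  by (metis of_real_0 scaleR_zero_left scaleR_scaleC)

lemma scaleC_zero_right [simp]: "c *\<^sub>C 0 = (0::'a::complex_hilbert)"
  by (metis add_cancel_right_right scaleC_add_right)

lemma scaleC_minus_right [simp]: "c *\<^sub>C (- x) = - (c *\<^sub>C (x::'a::complex_hilbert))"
  by (metis add.right_inverse add_eq_0_iff scaleC_add_right scaleC_zero_right)

lemma scaleC_minus_left [simp]: "(- c) *\<^sub>C x = - (c *\<^sub>C (x::'a::complex_hilbert))"
  by (metis add.right_inverse add_eq_0_iff scaleC_add_left scaleC_zero_left)

lemma scaleC_diff_right: "c *\<^sub>C (x - y) = c *\<^sub>C x - c *\<^sub>C (y::'a::complex_hilbert)"
  by (metis scaleC_add_right scaleC_minus_right diff_conv_add_uminus)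

lemma scaleC_diff_left: "(c - d) *\<^sub>C x = c *\<^sub>C x - d *\<^sub>C (x::'a::complex_hilbert)"
  by (metis scaleC_add_left scaleC_minus_left diff_conv_add_uminus)

lemma cinner_scaleC_right: "cinner x (c *\<^sub>C y) = cnj c * cinner x (y::'a::complex_hilbert)"
  by (metis cinner_commute cinner_scaleC_left complex_cnj_mult)

text \<open>The imaginary part is the real inner product with a rotated vector, so a complex form is
  determined by its real part. Throughout, sesquilinear objects appear as real bilinear forms with
  \<open>b (c *\<^sub>C x) y = b x (cnj c *\<^sub>C y)\<close>.\<close>

lemma cinner_eq_Complex: "cinner x y = Complex (inner x y) (inner x (\<i> *\<^sub>C (y::'a::complex_hilbert)))"
  by (simp add: complex_eq_iff inner_eq_Re_cinner cinner_scaleC_right)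

lemma inner_scaleC: "inner (c *\<^sub>C x) y = inner x (cnj c *\<^sub>C (y::'a::complex_hilbert))"
  by (simp add: inner_eq_Re_cinner cinner_scaleC_right cinner_scaleC_left)

lemma norm_scaleC [simp]: "norm (c *\<^sub>C x) = cmod c * norm (x::'a::complex_hilbert)"
proof -
  have "(norm (c *\<^sub>C x))\<^sup>2 = inner x ((cnj c * c) *\<^sub>C x)"
    by (simp add: power2_norm_eq_inner inner_scaleC scaleC_scaleC)
  also have "cnj c * c = complex_of_real ((cmod c)\<^sup>2)"
    by (metis complex_norm_square mult.commute)
  also have "inner x (complex_of_real ((cmod c)\<^sup>2) *\<^sub>C x) = (cmod c * norm x)\<^sup>2"
    unfolding scaleC_of_real
    by (simp add: power2_norm_eq_inner power_mult_distrib)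
  finally show ?thesis
    by (simp add: power2_eq_iff_nonneg)
qed

lemma scaleC_scaleR_commute: "c *\<^sub>C (r *\<^sub>R x) = r *\<^sub>R (c *\<^sub>C (x::'a::complex_hilbert))"
  by (simp add: scaleR_scaleC scaleC_scaleC mult.commute del: scaleC_of_real)

lemma bounded_bilinear_scaleC: "bounded_bilinear (scaleC :: complex \<Rightarrow> 'a::complex_hilbert \<Rightarrow> 'a)"
proof
  show "(r *\<^sub>R c) *\<^sub>C x = r *\<^sub>R c *\<^sub>C x" for r c and x :: 'a
    by (simp add: scaleR_scaleC scaleC_scaleC scaleR_conv_of_real scaleC_complex_def
        del: scaleC_of_real)
  show "\<exists>K. \<forall>a (b::'a). norm (a *\<^sub>C b) \<le> norm a * norm b * K"
    by (intro exI[of _ 1]) simp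
qed (simp_all add: scaleC_add_left scaleC_add_right scaleC_scaleR_commute)

lemmas tendsto_scaleC = bounded_bilinear.tendsto[OF bounded_bilinear_scaleC]
lemmas continuous_on_scaleC = bounded_bilinear.continuous_on[OF bounded_bilinear_scaleC]
lemmas bounded_linear_scaleC_right = bounded_bilinear.bounded_linear_right[OF bounded_bilinear_scaleC]
lemma bounded_clinear_linear: "bounded_clinear f \<Longrightarrow> bounded_linear f"
  by (simp add: bounded_clinear_def)

lemma bounded_clinear_scaleC: "bounded_clinear f \<Longrightarrow> f (c *\<^sub>C x) = c *\<^sub>C f x"
  by (simp add: bounded_clinear_def)

lemma bounded_clinear_compose:
  "bounded_clinear f \<Longrightarrow> bounded_clinear g \<Longrightarrow> bounded_clinear (\<lambda>x. f (g x))"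
  by (simp add: bounded_clinear_def bounded_linear_compose)

text \<open>A state together with a control becomes one function with values in a Hilbert space, so
  that a single \<open>L2\<close> type carries the whole process.\<close>

instantiation prod :: (complex_hilbert, complex_hilbert) complex_hilbert
begin

definition scaleC_prod :: "complex \<Rightarrow> 'a \<times> 'b \<Rightarrow> 'a \<times> 'b"
  where "scaleC_prod c z = (c *\<^sub>C fst z, c *\<^sub>C snd z)"

definition cinner_prod :: "'a \<times> 'b \<Rightarrow> 'a \<times> 'b \<Rightarrow> complex"
  where "cinner_prod z w = cinner (fst z) (fst w) + cinner (snd z) (snd w)"

instance
proof
  fix z w :: "'a \<times> 'b"
  show "cinner z w = cnj (cinner w z)"
    by (simp add: cinner_prod_def cinner_commute[symmetric])
qed (simp_all add: scaleC_prod_def cinner_prod_def scaleC_add_left scaleC_add_right scaleC_scaleC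
    scaleR_scaleC prod_eq_iff cinner_add_left cinner_scaleC_left distrib_left inner_prod_def
    inner_eq_Re_cinner del: scaleC_of_real)

end

lemma fst_scaleC [simp]: "fst (c *\<^sub>C z) = c *\<^sub>C fst z"
  and snd_scaleC [simp]: "snd (c *\<^sub>C z) = c *\<^sub>C snd z"
  by (simp_all add: scaleC_prod_def)

lemma scaleC_Pair: "c *\<^sub>C (x, y) = (c *\<^sub>C x, c *\<^sub>C y)"
  by (simp add: scaleC_prod_def)

lemma norm_Pair_power2: "(norm (x, y))\<^sup>2 = (norm x)\<^sup>2 + (norm y)\<^sup>2"
  by (simp add: norm_prod_def)

section \<open>Boundedness of countably subadditive seminorms\<close>

text \<open>Baire's theorem gives a sublevel set of \<open>q\<close> that is dense in a ball around the origin, and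
  successive approximation turns density into containment (Zabreiko's lemma).\<close>

lemma countably_subadditive_seminorm_bounded:
  fixes q :: "'a::banach \<Rightarrow> real"
  assumes scale: "\<And>c x. q (c *\<^sub>R x) = \<bar>c\<bar> * q x"
    and add: "\<And>x y. q (x + y) \<le> q x + q y"
    and suminf: "\<And>x. summable (\<lambda>n. norm (x n)) \<Longrightarrow> summable (\<lambda>n. q (x n)) \<Longrightarrow>
      q (\<Sum>n. x n) \<le> (\<Sum>n. q (x n))"
  shows "\<exists>C>0. \<forall>x. q x \<le> C * norm x"
proof -
  have q0: "q 0 = 0" using scale[of 0 0] by simp
  have qm: "q (- x) = q x" for x using scale[of "-1" x] by simp
  have qpos: "0 \<le> q x" for x using add[of x "- x"] q0 qm by simp
  define E where "E n = {x. q x \<le> real n}" for n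
  have "\<exists>n. interior (closure (E n)) \<noteq> {}"
  proof (rule ccontr)
    assume "\<not> (\<exists>n. interior (closure (E n)) \<noteq> {})"
    then have "interior (\<Union>n. closure (E n)) = {}"
      using Baire_category_alt[of "euclidean::'a topology" "range (\<lambda>n. closure (E n))"]
      by (auto simp: completely_metrizable_space_euclidean)
    moreover have "(\<Union>n. closure (E n)) = UNIV"
    proof -
      have "x \<in> (\<Union>n. closure (E n))" for x
        using real_arch_simple[of "q x"] closure_subset[of "E _"] by (auto simp: E_def)
      then show ?thesis by blast
    qed
    ultimately show False by simp
  qed
  then obtain n a where "a \<in> interior (closure (E n))" by blast
  then obtain r where r: "r > 0" "ball a r \<subseteq> closure (E n)"
    by (auto simp: mem_interior)
  \<comment> \<open>\<open>E n\<close> is symmetric and convex: halving the difference of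
    approximants of \<open>a + y\<close> and \<open>a - y\<close> moves the ball from
    \<open>a\<close> to the origin.\<close>
  have approx: "\<exists>e\<in>E n. norm (y - e) < \<epsilon>" if y: "norm y < r" and \<epsilon>: "\<epsilon> > 0" for y \<epsilon>
  proof -
    have "a + y \<in> closure (E n)" "a - y \<in> closure (E n)"
      using r y by (auto simp: dist_norm)
    then obtain e1 e2 where e: "e1 \<in> E n" "dist e1 (a + y) < \<epsilon>" "e2 \<in> E n" "dist e2 (a - y) < \<epsilon>"
      using \<epsilon> by (meson closure_approachable)
    define e where "e = (1/2) *\<^sub>R (e1 - e2)"
    have "q e \<le> (1/2) * (q e1 + q e2)"
      unfolding e_def scale using add[of e1 "- e2"] qm[of e2] by simp
    then have "e \<in> E n" using e by (simp add: E_def)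
    moreover have "y - e = (1/2) *\<^sub>R ((a + y - e1) - (a - y - e2))"
      by (simp add: e_def algebra_simps flip: scaleR_2)
    then have "norm (y - e) \<le> (1/2) * (norm (a + y - e1) + norm (a - y - e2))"
      using norm_triangle_ineq4[of "a + y - e1" "a - y - e2"] by simp
    then have "norm (y - e) < \<epsilon>"
      using e by (simp add: dist_norm norm_minus_commute)
    ultimately show ?thesis by blast
  qed
  \<comment> \<open>One round of successive approximation: scale \<open>y\<close> by
    \<open>2^k\<close> into the ball, approximate within \<open>r/2\<close>, and scale back.\<close>
  have step: "\<exists>e. q e \<le> n * (1/2)^k \<and> norm (y - e) < r * (1/2)^Suc k" if "norm y < r * (1/2)^k" for y and k::nat
  proof -
    have "norm ((2^k) *\<^sub>R y) < r" using that by (simp add: power_divide field_simps)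
    then obtain e where e: "e \<in> E n" "norm ((2^k) *\<^sub>R y - e) < r/2"
      using approx[of "(2^k) *\<^sub>R y" "r/2"] r by (meson half_gt_zero)
    have "norm (y - ((1/2)^k) *\<^sub>R e) = (1/2)^k * norm ((2^k) *\<^sub>R y - e)"
    proof -
      have "y - ((1/2)^k) *\<^sub>R e = ((1/2)^k) *\<^sub>R ((2^k) *\<^sub>R y - e)"
        by (simp add: algebra_simps power_divide)
      then show ?thesis by simp
    qed
    also have "\<dots> < (1/2)^k * (r/2)" using e by (intro mult_strict_left_mono) auto
    finally have "norm (y - ((1/2)^k) *\<^sub>R e) < r * (1/2)^Suc k" by (simp add: mult.commute)
    moreover have "q (((1/2)^k) *\<^sub>R e) \<le> n * (1/2)^k"
      using e by (simp add: scale E_def mult.commute[of _ "q e"] mult_right_mono)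
    ultimately show ?thesis by blast
  qed
  have bound: "q x \<le> 2 * n" if x: "norm x < r" for x
  proof -
    define f where "f k y = (SOME e. q e \<le> n * (1/2)^k \<and> norm (y - e) < r * (1/2)^Suc k)" for k y
    have f: "q (f k y) \<le> n * (1/2)^k \<and> norm (y - f k y) < r * (1/2)^Suc k"
      if "norm y < r * (1/2)^k" for k y
      unfolding f_def using someI_ex[OF step[OF that]] .
    define y where "y = rec_nat x (\<lambda>k z. z - f k z)"
    have y0: "y 0 = x" and yS: "y (Suc k) = y k - f k (y k)" for k by (simp_all add: y_def)
    have yn: "norm (y k) < r * (1/2)^k" for k
      by (induction k) (use x f in \<open>auto simp: y0 yS\<close>)
    have "(\<lambda>k. r * (1/2)^k) \<longlonglongrightarrow> 0"
      by (intro tendsto_mult_right_zero LIMSEQ_realpow_zero) auto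
    then have ylim: "y \<longlonglongrightarrow> 0"
      by (rule Lim_null_comparison[rotated]) (use yn in \<open>intro always_eventually allI less_imp_le\<close>)
    have sums: "(\<lambda>k. f k (y k)) sums x"
    proof -
      have "(\<Sum>k<m. f k (y k)) = x - y m" for m
        by (induction m) (auto simp: y0 yS)
      then show ?thesis
        using tendsto_diff[OF tendsto_const[of x] ylim] by (simp add: sums_def)
    qed
    have g: "summable (\<lambda>k. c * (1/2::real)^k)" for c by (intro summable_mult summable_geometric) auto
    have "norm (f k (y k)) \<le> (2*r) * (1/2)^k" for k
    proof -
      have "norm (f k (y k)) \<le> norm (y k) + norm (y k - f k (y k))"
        by (metis add.commute diff_add_cancel norm_minus_commute norm_triangle_sub)
      also have "\<dots> \<le> r * (1/2)^k + r * (1/2)^Suc k"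
        using yn[of k] f[OF yn[of k]] by linarith
      also have "\<dots> \<le> (2*r) * (1/2)^k" using r by simp
      finally show ?thesis .
    qed
    then have s1: "summable (\<lambda>k. norm (f k (y k)))"
      by (intro summable_comparison_test'[OF g, of 0]) auto
    have s2: "summable (\<lambda>k. q (f k (y k)))"
      by (rule summable_comparison_test'[OF g, of 0]) (use f yn qpos in \<open>auto simp: abs_of_nonneg\<close>)
    have "q x \<le> (\<Sum>k. q (f k (y k)))"
      using suminf[OF s1 s2] sums by (simp add: sums_iff)
    also have "\<dots> \<le> (\<Sum>k. n * (1/2::real)^k)"
      using f yn by (intro suminf_le s2 g) auto
    also have "\<dots> = 2 * n" using suminf_geometric[of "1/2::real"] by (simp add: suminf_mult summable_geometric)
    finally show ?thesis .
  qed
  \<comment> \<open>Rescaling \<open>x\<close> to norm \<open>r / 2\<close> puts it in the ball,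
    which gives the factor \<open>4 * n / r\<close>; the added 1 makes the constant positive even
    for \<open>n = 0\<close>.\<close>
  have "q x \<le> (4 * n / r + 1) * norm x" for x
  proof (cases "x = 0")
    case False
    have "q ((r / (2 * norm x)) *\<^sub>R x) \<le> 2 * n"
      using r False by (intro bound) auto
    then have "r * q x \<le> 4 * n * norm x"
      using r False by (simp add: scale field_simps)
    then have "q x \<le> 4 * n / r * norm x"
      using r by (simp add: field_simps)
    then show ?thesis by (simp add: distrib_right add_increasing2)
  qed (simp add: q0)
  then show ?thesis
    by (intro exI[of _ "4 * n / r + 1"]) (use r in \<open>auto intro!: add_nonneg_pos divide_nonneg_pos\<close>)
qed

text \<open>A closed graph lets \<open>S\<close> pass through series whose terms and images have
  summable norms. This is countable subadditivity of \<open>norm (S x)\<close>, and the preceding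
  lemma bounds it.\<close>

lemma closed_graph_bounded_linear:
  fixes S :: "'a::banach \<Rightarrow> 'b::banach"
  assumes "linear S"
    and closed: "\<And>x a b. x \<longlonglongrightarrow> a \<Longrightarrow> (\<lambda>n. S (x n)) \<longlonglongrightarrow> b \<Longrightarrow> S a = b"
  shows "bounded_linear S"
proof -
  interpret S: linear S by fact
  have "\<exists>C>0. \<forall>x. norm (S x) \<le> C * norm x"
  proof (rule countably_subadditive_seminorm_bounded)
    show "norm (S (c *\<^sub>R x)) = \<bar>c\<bar> * norm (S x)" for c x by (simp add: S.scaleR)
    show "norm (S (x + y)) \<le> norm (S x) + norm (S y)" for x y by (simp add: S.add norm_triangle_ineq)
    show "norm (S (\<Sum>n. x n)) \<le> (\<Sum>n. norm (S (x n)))"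
      if 1: "summable (\<lambda>n. norm (x n))" and 2: "summable (\<lambda>n. norm (S (x n)))" for x
    proof -
      have "(\<lambda>n. \<Sum>k<n. x k) \<longlonglongrightarrow> (\<Sum>n. x n)"
        using summable_LIMSEQ[OF summable_norm_cancel[OF 1]] .
      moreover have "(\<lambda>n. S (\<Sum>k<n. x k)) \<longlonglongrightarrow> (\<Sum>n. S (x n))"
        using summable_LIMSEQ[OF summable_norm_cancel[OF 2]] by (simp add: S.sum)
      ultimately have "S (\<Sum>n. x n) = (\<Sum>n. S (x n))" by (rule closed)
      then show ?thesis using summable_norm[OF 2] by simp
    qed
  qed
  then obtain C where "\<And>x. norm (S x) \<le> C * norm x" by blast
  then show ?thesis
    by (intro bounded_linear_intro[of _ C]) (auto simp: S.add S.scaleR mult.commute)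
qed

section \<open>Quadratic minimization on closed subspaces\<close>

text \<open>The direct method for \<open>J x = \<beta> x x - 2 * l x\<close>: coercivity on
  \<open>M\<close> bounds \<open>J\<close> below there, the parallelogram identity makes a
  minimizing sequence Cauchy, and the vanishing first variation at the limit is the asserted
  identity. Positivity concerns \<open>M\<close> alone, since the quadratic functional may be
  indefinite elsewhere.\<close>

lemma symmetric_Lax_Milgram:
  fixes \<beta> :: "'z::{real_normed_vector,complete_space} \<Rightarrow> 'z \<Rightarrow> real"
  assumes \<beta>: "bounded_bilinear \<beta>" and sym: "\<And>x y. \<beta> x y = \<beta> y x"
    and M: "subspace M" "closed M" and \<delta>: "\<delta> > 0" "\<And>x. x \<in> M \<Longrightarrow> \<beta> x x \<ge> \<delta> * (norm x)\<^sup>2"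
    and l: "bounded_linear l"
  shows "\<exists>w\<in>M. \<forall>u\<in>M. \<beta> w u = l u"
proof -
  interpret b: bounded_bilinear \<beta> by fact
  interpret l: bounded_linear l by fact
  define J where "J x = \<beta> x x - 2 * l x" for x
  obtain K where K: "\<And>x. norm (l x) \<le> norm x * K" using l.bounded by blast
  have "J x \<ge> - (K\<^sup>2 / \<delta>)" if "x \<in> M" for x
  proof -
    have "J x \<ge> \<delta> * (norm x)\<^sup>2 - 2 * (norm x * K)"
      unfolding J_def using \<delta>(2)[OF that] K[of x] by (simp add: abs_le_iff)
    moreover have "\<delta> * (norm x)\<^sup>2 - 2 * (norm x * K) + K\<^sup>2 / \<delta> = (\<delta> * norm x - K)\<^sup>2 / \<delta>"
      using \<delta>(1) by (simp add: power2_eq_square field_simps)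
    moreover have "(\<delta> * norm x - K)\<^sup>2 / \<delta> \<ge> 0" using \<delta>(1) by simp
    ultimately show ?thesis by linarith
  qed
  then have bdd: "bdd_below (J ` M)" by (auto intro!: bdd_belowI[of _ "- (K\<^sup>2 / \<delta>)"])
  define m where "m = Inf (J ` M)"
  have M0: "0 \<in> M" using M subspace_0 by blast
  have mle: "m \<le> J x" if "x \<in> M" for x unfolding m_def using bdd that by (auto intro: cInf_lower)
  have "\<exists>x\<in>M. J x < m + 1 / Suc n" for n
  proof -
    have "Inf (J ` M) < m + 1 / Suc n" by (simp add: m_def)
    then show ?thesis using M0 bdd by (subst (asm) cInf_less_iff) auto
  qed
  then obtain x where x: "\<And>n. x n \<in> M" "\<And>n. J (x n) < m + 1 / Suc n" by metis
  \<comment> \<open>At the midpoint, which lies in \<open>M\<close>, \<open>J\<close> cannot fall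
    below \<open>m\<close>; the gap in the parallelogram identity is a quarter of
    \<open>\<beta>\<close> at the difference.\<close>
  have par: "\<delta> / 4 * (norm (x p - x n))\<^sup>2 \<le> 1 / Suc p + 1 / Suc n" for p n
  proof -
    have mid: "(1/2) *\<^sub>R (x p + x n) \<in> M" and d: "x p - x n \<in> M"
      using M(1) x(1) by (auto intro!: subspace_scale subspace_add subspace_diff)
    have "(1/2) * J (x p) + (1/2) * J (x n) - J ((1/2) *\<^sub>R (x p + x n)) = (1/4) * \<beta> (x p - x n) (x p - x n)"
      using sym[of "x p" "x n"]
      by (simp add: J_def b.scaleR_left b.scaleR_right b.add_left b.add_right b.diff_left b.diff_right
          l.scaleR l.add field_simps)
    then have "\<delta> / 4 * (norm (x p - x n))\<^sup>2 \<le> (1/2) * J (x p) + (1/2) * J (x n) - m"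
      using mle[OF mid] \<delta>(2)[OF d] by simp
    moreover have "(0::real) \<le> 1 / Suc p" "(0::real) \<le> 1 / Suc n" by simp_all
    ultimately show ?thesis using x(2)[of p] x(2)[of n] by argo
  qed
  have "Cauchy x"
  proof (rule metric_CauchyI)
    fix e :: real assume e: "e > 0"
    define c where "c = \<delta> * e\<^sup>2 / 8"
    have c: "c > 0" using e \<delta> by (simp add: c_def)
    obtain N where N: "\<And>n. n \<ge> N \<Longrightarrow> 1 / Suc n < c"
    proof -
      obtain N where N: "1 / Suc N < c" using c nat_approx_posE by blast
      have "1 / Suc n < c" if "n \<ge> N" for n
        by (rule le_less_trans[OF _ N]) (use that in \<open>simp add: frac_le\<close>)
      then show ?thesis by (rule that)
    qed
    have "dist (x p) (x n) < e" if "p \<ge> N" "n \<ge> N" for p n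
    proof -
      have "\<delta> / 4 * (norm (x p - x n))\<^sup>2 < \<delta> / 4 * e\<^sup>2"
        using par[of p n] N[OF that(1)] N[OF that(2)] by (simp add: c_def)
      then have "(norm (x p - x n))\<^sup>2 < e\<^sup>2" using \<delta> by simp
      then show ?thesis using e by (simp add: dist_norm power2_less_imp_less)
    qed
    then show "\<exists>N. \<forall>p\<ge>N. \<forall>n\<ge>N. dist (x p) (x n) < e" by blast
  qed
  then obtain w where w: "x \<longlonglongrightarrow> w" using Cauchy_convergent convergent_def by blast
  have wM: "w \<in> M" using M(2) x(1) w closed_sequentially by blast
  have "(\<lambda>n. J (x n)) \<longlonglongrightarrow> J w"
    unfolding J_def by (intro tendsto_intros b.tendsto l.tendsto w)
  moreover have "(\<lambda>n. m + 1 / Suc n) \<longlonglongrightarrow> m + 0"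
    by (intro tendsto_intros lim_1_over_n[THEN LIMSEQ_Suc])
  ultimately have Jw: "J w \<le> m"
    using x(2) by (intro LIMSEQ_le[of "\<lambda>n. J (x n)" _ "\<lambda>n. m + 1 / Suc n"]) (auto intro: less_imp_le)
  have "\<beta> w u = l u" if u: "u \<in> M" for u
  proof -
    have *: "0 \<le> 2 * t * (\<beta> w u - l u) + t\<^sup>2 * \<beta> u u" for t
    proof -
      have "J w \<le> J (w + t *\<^sub>R u)"
        using Jw mle[of "w + t *\<^sub>R u"] M(1) wM u by (auto intro: subspace_add subspace_scale order_trans)
      then show ?thesis
        using sym[of u w]
        by (simp add: J_def b.scaleR_left b.scaleR_right b.add_left b.add_right l.scaleR l.add
            power2_eq_square field_simps)
    qed
    show ?thesis
    proof (rule ccontr)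
      assume ne: "\<beta> w u \<noteq> l u"
      \<comment> \<open>With \<open>B\<close> positive and at least \<open>\<beta> u u\<close>, the
        choice \<open>t = - d / B\<close> makes the quadratic in \<open>t\<close> at most
        \<open>- (d\<^sup>2 / B)\<close>, against minimality.\<close>
      define d where "d = \<beta> w u - l u"
      define B where "B = \<bar>\<beta> u u\<bar> + 1"
      have B: "B > 0" "\<beta> u u \<le> B" unfolding B_def by linarith+
      have "0 \<le> 2 * (- d / B) * d + (- d / B)\<^sup>2 * \<beta> u u" using *[of "- d / B"] by (simp add: d_def)
      also have "\<dots> \<le> 2 * (- d / B) * d + (- d / B)\<^sup>2 * B"
        using B by (intro add_left_mono mult_left_mono) auto
      also have "\<dots> = - (d\<^sup>2 / B)" using B by (simp add: power2_eq_square field_simps)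
      also have "\<dots> < 0" using B ne by (simp add: d_def)
      finally show False by simp
    qed
  qed
  then show ?thesis using wM by blast
qed

lemma Riesz_representation:
  fixes l :: "'z::{real_inner,complete_space} \<Rightarrow> real"
  assumes "bounded_linear l"
  shows "\<exists>w. \<forall>u. inner w u = l u"
  using symmetric_Lax_Milgram[OF bounded_bilinear_inner inner_commute subspace_UNIV closed_UNIV,
      of 1 l] assms
  by (auto simp: power2_norm_eq_inner)

text \<open>\<open>\<Gamma>\<close> plays the role of the set of all pairs of an initial state and an admissible process.\<close>

lemma quadratic_minimizer_over_relation:
  fixes \<Gamma> :: "('a::complex_hilbert \<times> 'z::complex_hilbert) set" and \<beta> :: "'z \<Rightarrow> 'z \<Rightarrow> real"
  assumes \<beta>: "bounded_bilinear \<beta>" and sym: "\<And>x y. \<beta> x y = \<beta> y x"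
    and \<beta>C: "\<And>c x y. \<beta> (c *\<^sub>C x) y = \<beta> x (cnj c *\<^sub>C y)"
    and sub: "\<And>p q. p \<in> \<Gamma> \<Longrightarrow> q \<in> \<Gamma> \<Longrightarrow> p + q \<in> \<Gamma>" "\<And>c p. p \<in> \<Gamma> \<Longrightarrow> c *\<^sub>C p \<in> \<Gamma>"
    and closed: "closed \<Gamma>" and surj: "\<And>v. \<exists>z. (v, z) \<in> \<Gamma>"
    and \<delta>: "\<delta> > 0" "\<And>z. (0, z) \<in> \<Gamma> \<Longrightarrow> \<beta> z z \<ge> \<delta> * (norm z)\<^sup>2"
  obtains z0 where "bounded_clinear z0" "\<And>v. (v, z0 v) \<in> \<Gamma>"
    "\<And>v z. (v, z) \<in> \<Gamma> \<Longrightarrow> \<beta> z z \<ge> \<beta> (z0 v) (z0 v) + \<delta> * (norm (z - z0 v))\<^sup>2"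
proof -
  interpret b: bounded_bilinear \<beta> by fact
  define M where "M = {z. (0::'a, z) \<in> \<Gamma>}"
  have subR: "r *\<^sub>R p \<in> \<Gamma>" if "p \<in> \<Gamma>" for r p using sub(2)[OF that, of "complex_of_real r"] by simp
  have subD: "p - q \<in> \<Gamma>" if "p \<in> \<Gamma>" "q \<in> \<Gamma>" for p q
    using sub(1)[OF that(1) subR[OF that(2), of "-1"]] by simp
  have MC: "c *\<^sub>C w \<in> M" if "w \<in> M" for c w
    using sub(2)[of "(0, w)" c] that by (simp add: M_def scaleC_Pair)
  have M1: "subspace M"
  proof (rule subspaceI)
    show "0 \<in> M" using surj[of 0] subR[of "(0, _)" 0] by (auto simp: M_def)
    show "x + y \<in> M" if "x \<in> M" "y \<in> M" for x y using sub(1)[of "(0,x)" "(0,y)"] that by (simp add: M_def)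
    show "c *\<^sub>R x \<in> M" if "x \<in> M" for c x using subR[of "(0,x)" c] that by (simp add: M_def)
  qed
  have M2: "closed M"
  proof -
    have "M = (\<lambda>z. (0, z)) -` \<Gamma>" by (auto simp: M_def)
    then show ?thesis using closed by (auto intro!: closed_vimage continuous_intros)
  qed
  \<comment> \<open>Take any point of the fibre and subtract its \<open>\<beta>\<close>-orthogonal
    projection onto \<open>M\<close>, the fibre over zero.\<close>
  have "\<exists>z. (v, z) \<in> \<Gamma> \<and> (\<forall>w\<in>M. \<beta> z w = 0)" for v
  proof -
    obtain z1 where z1: "(v, z1) \<in> \<Gamma>" using surj by blast
    obtain y where y: "y \<in> M" "\<forall>w\<in>M. \<beta> y w = \<beta> z1 w"
      using symmetric_Lax_Milgram[OF \<beta> sym M1 M2 \<delta>(1) _ b.bounded_linear_right[of z1]] \<delta>(2)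
      by (auto simp: M_def)
    have "(v, z1 - y) \<in> \<Gamma>" using subD[OF z1, of "(0,y)"] y by (simp add: M_def)
    then show ?thesis using y by (intro exI[of _ "z1 - y"]) (simp add: b.diff_left)
  qed
  then obtain z0 where z0: "\<And>v. (v, z0 v) \<in> \<Gamma>" and orth: "\<And>v w. w \<in> M \<Longrightarrow> \<beta> (z0 v) w = 0" by metis
  have uniq: "z0 v = z" if z: "(v, z) \<in> \<Gamma>" and o: "\<And>w. w \<in> M \<Longrightarrow> \<beta> z w = 0" for v z
  proof -
    have d: "z0 v - z \<in> M" using subD[OF z0[of v] z] by (simp add: M_def)
    have "\<beta> (z0 v - z) (z0 v - z) = 0" using orth[OF d, of v] o[OF d] by (simp add: b.diff_left)
    then have "\<delta> * (norm (z0 v - z))\<^sup>2 \<le> 0" using \<delta>(2)[of "z0 v - z"] d by (simp add: M_def)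
    then have "(norm (z0 v - z))\<^sup>2 \<le> 0" using \<delta>(1) by (simp add: mult_le_0_iff)
    then show ?thesis by simp
  qed
  have z0add: "z0 (v + w) = z0 v + z0 w" for v w
    by (rule uniq) (use sub(1)[OF z0[of v] z0[of w]] orth in \<open>auto simp: b.add_left\<close>)
  have z0C: "z0 (c *\<^sub>C v) = c *\<^sub>C z0 v" for c v
    by (rule uniq) (use sub(2)[OF z0[of v], of c] orth MC in \<open>auto simp: \<beta>C scaleC_Pair\<close>)
  have "linear z0"
    using z0add z0C[of "complex_of_real _"] by (intro linearI) simp_all
  \<comment> \<open>A limit of orthogonal points is orthogonal and stays in the closed relation, so
    uniqueness identifies it: the graph of \<open>z0\<close> is closed.\<close>
  then have "bounded_linear z0"
  proof (rule closed_graph_bounded_linear)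
    fix x a b assume x: "x \<longlonglongrightarrow> a" "(\<lambda>n. z0 (x n)) \<longlonglongrightarrow> b"
    show "z0 a = b"
    proof (rule uniq)
      show "(a, b) \<in> \<Gamma>"
        using closed_sequentially[OF closed, of "\<lambda>n. (x n, z0 (x n))" "(a,b)"] z0 tendsto_Pair[OF x] by blast
      fix w assume w: "w \<in> M"
      have "(\<lambda>n. \<beta> (z0 (x n)) w) \<longlonglongrightarrow> \<beta> b w" by (intro b.tendsto x tendsto_const)
      then show "\<beta> b w = 0" using orth[OF w] LIMSEQ_unique by (auto simp: LIMSEQ_const_iff)
    qed
  qed
  then have "bounded_clinear z0" using z0C by (simp add: bounded_clinear_def)
  moreover have "\<beta> z z \<ge> \<beta> (z0 v) (z0 v) + \<delta> * (norm (z - z0 v))\<^sup>2" if z: "(v, z) \<in> \<Gamma>" for v z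
  proof -
    have d: "z - z0 v \<in> M" using subD[OF z z0[of v]] by (simp add: M_def)
    have "\<beta> z z = \<beta> (z0 v + (z - z0 v)) (z0 v + (z - z0 v))" by simp
    also have "\<dots> = \<beta> (z0 v) (z0 v) + 2 * \<beta> (z0 v) (z - z0 v) + \<beta> (z - z0 v) (z - z0 v)"
      unfolding b.add_left b.add_right using sym[of "z0 v" "z - z0 v"] by simp
    also have "\<dots> = \<beta> (z0 v) (z0 v) + \<beta> (z - z0 v) (z - z0 v)" using orth[OF d] by simp
    finally show ?thesis using \<delta>(2)[of "z - z0 v"] d by (simp add: M_def)
  qed
  ultimately show ?thesis using that z0 by blast
qed

text \<open>\<open>P v\<close> is the Riesz vector of the real functional
  \<open>w \<mapsto> \<beta> (S v) (S w)\<close>. Compatibility of \<open>\<beta>\<close> with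
  complex scalars makes \<open>P\<close> complex linear, and its symmetry makes \<open>P\<close>
  self-adjoint for the complex product as well.\<close>

lemma form_represented_by_self_adjoint:
  fixes \<beta> :: "'z::complex_hilbert \<Rightarrow> 'z \<Rightarrow> real" and S :: "'a::complex_hilbert \<Rightarrow> 'z"
  assumes \<beta>: "bounded_bilinear \<beta>" and sym: "\<And>x y. \<beta> x y = \<beta> y x"
    and \<beta>C: "\<And>c x y. \<beta> (c *\<^sub>C x) y = \<beta> x (cnj c *\<^sub>C y)"
    and S: "bounded_clinear S"
  obtains P where "bounded_clinear P" "self_adjoint P"
    "\<And>v. cinner (P v) v = complex_of_real (\<beta> (S v) (S v))"
proof -
  interpret b: bounded_bilinear \<beta> by fact
  interpret S: bounded_linear S using S by (rule bounded_clinear_linear)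
  have Sb: "bounded_linear S" using S by (rule bounded_clinear_linear)
  have "\<exists>p. \<forall>w. inner p w = \<beta> (S v) (S w)" for v
    by (rule Riesz_representation) (rule bounded_linear_compose[OF b.bounded_linear_right Sb])
  then obtain P where P: "\<And>v w. inner (P v) w = \<beta> (S v) (S w)" by metis
  have eqI: "x = y" if "\<And>w. inner x w = inner y w" for x y :: 'a
    using that vector_eq_rdot by blast
  have SC: "S (c *\<^sub>C v) = c *\<^sub>C S v" for c v using S by (rule bounded_clinear_scaleC)
  have Padd: "P (v + w) = P v + P w" for v w
    by (rule eqI) (simp add: P S.add b.add_left inner_add_left)
  have PC: "P (c *\<^sub>C v) = c *\<^sub>C P v" for c v
    by (rule eqI) (simp add: P inner_scaleC SC \<beta>C)
  obtain K where K: "0 \<le> K" "\<And>a b. norm (\<beta> (S a) (S b)) \<le> norm a * norm b * K"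
    using bounded_bilinear.nonneg_bounded[OF b.comp[OF Sb Sb]] by blast
  have "norm (P v) \<le> norm v * K" for v
  proof (cases "P v = 0")
    case False
    have "norm (P v) * norm (P v) \<le> norm v * norm (P v) * K"
      using K(2)[of v "P v"] P[of v "P v"] by (simp add: power2_norm_eq_inner flip: power2_eq_square)
    then show ?thesis using False by (simp add: mult.commute mult.left_commute)
  next
    case True
    then show ?thesis using K(1) by simp
  qed
  moreover have "P (r *\<^sub>R v) = r *\<^sub>R P v" for r v using PC[of "complex_of_real r" v] by simp
  ultimately have "bounded_clinear P"
    unfolding bounded_clinear_def using Padd PC by (auto intro!: bounded_linear_intro)
  moreover have "inner (P v) w = inner v (P w)" for v w
    by (simp add: P sym[of "S v"] inner_commute[of v])
  then have sa: "self_adjoint P"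
    unfolding self_adjoint_def cinner_eq_Complex by (simp add: PC[symmetric])
  moreover have "cinner (P v) v = complex_of_real (\<beta> (S v) (S v))" for v
  proof -
    have "cinner (P v) v = cnj (cinner (P v) v)"
      using sa cinner_commute[of v "P v"] by (simp add: self_adjoint_def)
    then have "Im (cinner (P v) v) = 0"
      by (metis Reals_cnj_iff complex_is_Real_iff)
    then show ?thesis using P[of v v] by (simp add: complex_eq_iff inner_eq_Re_cinner)
  qed
  ultimately show ?thesis using that by blast
qed

section \<open>Square-integrable functions on the line\<close>

text \<open>Sequential continuity takes the place of Borel measurability: the approximating simple
  functions are composed directly, whatever the size of the value spaces.\<close>

lemma strongly_measurable_compose2:
  fixes h :: "'b::topological_space \<Rightarrow> 'c::topological_space \<Rightarrow> 'd::topological_space"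
  assumes "strongly_measurable M f" "strongly_measurable M g"
    and h: "\<And>u v x y. u \<longlonglongrightarrow> x \<Longrightarrow> v \<longlonglongrightarrow> y \<Longrightarrow> (\<lambda>n. h (u n) (v n)) \<longlonglongrightarrow> h x y"
  shows "strongly_measurable M (\<lambda>t. h (f t) (g t))"
proof -
  obtain s where s: "\<And>n. simple_function M (s n)" "AE t in M. (\<lambda>n. s n t) \<longlonglongrightarrow> f t"
    using assms(1) by (auto simp: strongly_measurable_def)
  obtain s' where s': "\<And>n. simple_function M (s' n)" "AE t in M. (\<lambda>n. s' n t) \<longlonglongrightarrow> g t"
    using assms(2) by (auto simp: strongly_measurable_def)
  show ?thesis
    unfolding strongly_measurable_def
  proof (intro exI[of _ "\<lambda>n t. h (s n t) (s' n t)"] conjI allI)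
    show "simple_function M (\<lambda>t. h (s n t) (s' n t))" for n by (rule simple_function_compose2) (use s s' in auto)
    show "AE t in M. (\<lambda>n. h (s n t) (s' n t)) \<longlonglongrightarrow> h (f t) (g t)" using s(2) s'(2) by eventually_elim (rule h)
  qed
qed

lemma strongly_measurable_simple: "simple_function M f \<Longrightarrow> strongly_measurable M f"
  unfolding strongly_measurable_def by (intro exI[of _ "\<lambda>_. f"]) auto

lemma strongly_measurable_compose1:
  fixes h :: "'b::topological_space \<Rightarrow> 'd::topological_space"
  assumes "strongly_measurable M f"
    and h: "\<And>u x. u \<longlonglongrightarrow> x \<Longrightarrow> (\<lambda>n. h (u n)) \<longlonglongrightarrow> h x"
  shows "strongly_measurable M (\<lambda>t. h (f t))"
  using strongly_measurable_compose2[of M f f "\<lambda>x _. h x"] assms by blast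

lemma strongly_measurable_AE:
  assumes "strongly_measurable M f" "AE t in M. f t = g t"
  shows "strongly_measurable M g"
proof -
  obtain s where s: "\<And>n. simple_function M (s n)" "AE t in M. (\<lambda>n. s n t) \<longlonglongrightarrow> f t"
    using assms(1) by (auto simp: strongly_measurable_def)
  have "AE t in M. (\<lambda>n. s n t) \<longlonglongrightarrow> g t" using s(2) assms(2) by eventually_elim simp
  then show ?thesis using s(1) unfolding strongly_measurable_def by (intro exI[of _ s]) simp
qed

text \<open>Through this equivalence norms and forms of strongly measurable functions become
  ordinary measurable real functions, to which the Lebesgue integral applies.\<close>

lemma strongly_measurable_lebesgue_real_iff:
  fixes f :: "real \<Rightarrow> real"
  shows "strongly_measurable lebesgue f \<longleftrightarrow> f \<in> borel_measurable lebesgue"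
proof
  assume "strongly_measurable lebesgue f"
  then obtain s where s: "\<And>n. simple_function lebesgue (s n)" "AE t in lebesgue. (\<lambda>n. s n t) \<longlonglongrightarrow> f t"
    by (auto simp: strongly_measurable_def)
  have m: "s n \<in> borel_measurable lebesgue" for n by (rule borel_measurable_simple_function) (rule s)
  have "(\<lambda>t. lim (\<lambda>n. s n t)) \<in> borel_measurable lebesgue"
    by (rule borel_measurable_lim_metric) (rule m)
  moreover have "AE t in lebesgue. lim (\<lambda>n. s n t) = f t"
    using s(2) by eventually_elim (rule limI)
  ultimately show "f \<in> borel_measurable lebesgue" by (rule borel_measurable_AE)
next
  assume "f \<in> borel_measurable lebesgue"
  then obtain F where "\<forall>i. simple_function lebesgue (F i)" "\<forall>x\<in>space lebesgue. (\<lambda>i. F i x) \<longlonglongrightarrow> f x"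
    using borel_measurable_implies_sequence_metric[of f lebesgue 0] by blast
  then show "strongly_measurable lebesgue f"
    unfolding strongly_measurable_def by (intro exI[of _ F]) simp
qed

text \<open>Always on the whole line: functions on an interval are extended by zero, so that time
  shifts and sums act on one space.\<close>

definition square_integrable :: "(real \<Rightarrow> 'b::real_normed_vector) \<Rightarrow> bool"
  where "square_integrable f \<longleftrightarrow> strongly_measurable lebesgue f \<and> integrable lebesgue (\<lambda>t. (norm (f t))\<^sup>2)"

lemma L2_on_iff_square_integrable:
  fixes f :: "real \<Rightarrow> 'b::real_normed_vector"
  assumes S: "S \<in> sets lebesgue"
  shows "f \<in> L2_on S \<longleftrightarrow> square_integrable (\<lambda>t. indicator S t *\<^sub>R f t)"
proof -
  have S': "S \<inter> space lebesgue \<in> sets lebesgue" using S by simp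
  have "strongly_measurable (lebesgue_on S) f \<longleftrightarrow> strongly_measurable lebesgue (\<lambda>t. indicator S t *\<^sub>R f t)"
  proof
    assume "strongly_measurable (lebesgue_on S) f"
    then obtain s where s: "\<And>n. simple_function (lebesgue_on S) (s n)" "AE t in lebesgue_on S. (\<lambda>n. s n t) \<longlonglongrightarrow> f t"
      by (auto simp: strongly_measurable_def)
    have "AE t in lebesgue. (\<lambda>n. indicator S t *\<^sub>R s n t) \<longlonglongrightarrow> indicator S t *\<^sub>R f t"
      using s(2) unfolding AE_restrict_space_iff[OF S'] by eventually_elim (auto simp: indicator_def)
    then show "strongly_measurable lebesgue (\<lambda>t. indicator S t *\<^sub>R f t)"
      using s(1) unfolding strongly_measurable_def simple_function_restrict_space[OF S']
      by (intro exI[of _ "\<lambda>n t. indicator S t *\<^sub>R s n t"]) simp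
  next
    assume "strongly_measurable lebesgue (\<lambda>t. indicator S t *\<^sub>R f t)"
    then obtain s where s: "\<And>n. simple_function lebesgue (s n)"
      "AE t in lebesgue. (\<lambda>n. s n t) \<longlonglongrightarrow> indicator S t *\<^sub>R f t"
      by (auto simp: strongly_measurable_def)
    have "simple_function lebesgue (\<lambda>t. indicator S t *\<^sub>R s n t)" for n
      using simple_function_If_set[OF s(1)[of n] simple_function_const[of _ 0] S']
      by (simp add: indicator_scaleR_eq_if)
    moreover have "AE t in lebesgue_on S. (\<lambda>n. s n t) \<longlonglongrightarrow> f t"
      unfolding AE_restrict_space_iff[OF S'] using s(2) by eventually_elim auto
    ultimately show "strongly_measurable (lebesgue_on S) f"
      unfolding strongly_measurable_def simple_function_restrict_space[OF S']
      by (intro exI[of _ s]) simp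
  qed
  moreover have "integrable (lebesgue_on S) (\<lambda>t. (norm (f t))\<^sup>2) \<longleftrightarrow>
      integrable lebesgue (\<lambda>t. (norm (indicator S t *\<^sub>R f t))\<^sup>2)"
    unfolding integrable_restrict_space[OF S']
    by (intro Bochner_Integration.integrable_cong) (auto simp: indicator_def)
  ultimately show ?thesis by (simp add: L2_on_def square_integrable_def)
qed

lemma strongly_measurable_norm:
  fixes f :: "real \<Rightarrow> 'b::real_normed_vector"
  assumes "strongly_measurable lebesgue f"
  shows "(\<lambda>t. norm (f t)) \<in> borel_measurable lebesgue"
  unfolding strongly_measurable_lebesgue_real_iff[symmetric]
  by (rule strongly_measurable_compose1[OF assms]) (rule tendsto_norm)

lemma square_integrable_bound:
  assumes "strongly_measurable lebesgue f" and "square_integrable g"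
    and "AE t in lebesgue. norm (f t) \<le> C * norm (g t)"
  shows "square_integrable f"
  unfolding square_integrable_def
proof
  show "integrable lebesgue (\<lambda>t. (norm (f t))\<^sup>2)"
  proof (rule Bochner_Integration.integrable_bound)
    show "integrable lebesgue (\<lambda>t. C\<^sup>2 * (norm (g t))\<^sup>2)"
      using assms(2) by (simp add: square_integrable_def)
    show "(\<lambda>t. (norm (f t))\<^sup>2) \<in> borel_measurable lebesgue"
      using strongly_measurable_norm[OF assms(1)] by measurable
    show "AE t in lebesgue. norm ((norm (f t))\<^sup>2) \<le> norm (C\<^sup>2 * (norm (g t))\<^sup>2)"
      using assms(3)
    proof eventually_elim
      case (elim t)
      then have "(norm (f t))\<^sup>2 \<le> (C * norm (g t))\<^sup>2" by (rule power_mono) simp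
      then show ?case by (simp add: power_mult_distrib)
    qed
  qed
qed (rule assms(1))

lemma square_integrable_AE:
  assumes "square_integrable f" "AE t in lebesgue. f t = g t"
  shows "square_integrable g"
proof (rule square_integrable_bound[where C = 1])
  show "strongly_measurable lebesgue g"
    using strongly_measurable_AE[of lebesgue f g] assms by (simp add: square_integrable_def)
  show "AE t in lebesgue. norm (g t) \<le> 1 * norm (f t)" using assms(2) by eventually_elim simp
qed (rule assms(1))

lemma square_integrable_add:
  assumes "square_integrable f" "square_integrable g"
  shows "square_integrable (\<lambda>t. f t + g t)"
  unfolding square_integrable_def
proof
  show sm: "strongly_measurable lebesgue (\<lambda>t. f t + g t)"
    using assms unfolding square_integrable_def
    by (intro strongly_measurable_compose2[where h = "(+)"] tendsto_add) (elim conjE, assumption)+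
  show "integrable lebesgue (\<lambda>t. (norm (f t + g t))\<^sup>2)"
  proof (rule Bochner_Integration.integrable_bound)
    show "integrable lebesgue (\<lambda>t. 2 * (norm (f t))\<^sup>2 + 2 * (norm (g t))\<^sup>2)"
      using assms by (simp add: square_integrable_def)
    show "(\<lambda>t. (norm (f t + g t))\<^sup>2) \<in> borel_measurable lebesgue"
      using strongly_measurable_norm[OF sm] by measurable
    have "(norm (f t + g t))\<^sup>2 \<le> 2 * (norm (f t))\<^sup>2 + 2 * (norm (g t))\<^sup>2" for t
    proof -
      have "(norm (f t + g t))\<^sup>2 \<le> (norm (f t) + norm (g t))\<^sup>2" by (intro power_mono norm_triangle_ineq) auto
      also have "\<dots> \<le> 2 * (norm (f t))\<^sup>2 + 2 * (norm (g t))\<^sup>2"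
        using sum_squares_bound[of "norm (f t)" "norm (g t)"] by (simp add: power2_sum)
      finally show ?thesis .
    qed
    then show "AE t in lebesgue. norm ((norm (f t + g t))\<^sup>2) \<le> norm (2 * (norm (f t))\<^sup>2 + 2 * (norm (g t))\<^sup>2)"
      by (auto intro!: always_eventually order_trans[OF _ abs_ge_self])
  qed
qed

lemma square_integrable_bounded_linear:
  assumes "bounded_linear T" "square_integrable f"
  shows "square_integrable (\<lambda>t. T (f t))"
proof -
  interpret T: bounded_linear T by fact
  obtain K where "\<And>x. norm (T x) \<le> norm x * K" using T.bounded by blast
  then have "AE t in lebesgue. norm (T (f t)) \<le> K * norm (f t)" by (simp add: mult.commute)
  moreover have "strongly_measurable lebesgue (\<lambda>t. T (f t))"
    by (rule strongly_measurable_compose1[where h = T])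
      (use assms(2) in \<open>simp_all add: square_integrable_def T.tendsto\<close>)
  ultimately show ?thesis by (rule square_integrable_bound[OF _ assms(2), rotated])
qed

lemma square_integrable_diff:
  assumes "square_integrable f" "square_integrable g"
  shows "square_integrable (\<lambda>t. f t - g t)"
  using square_integrable_add[OF assms(1)
      square_integrable_bounded_linear[OF bounded_linear_minus[OF bounded_linear_ident] assms(2)]]
  by simp

lemma square_integrable_zero: "square_integrable (\<lambda>_. 0)"
  by (simp add: square_integrable_def strongly_measurable_simple)

lemma strongly_measurable_bilinear:
  fixes b :: "'b::real_normed_vector \<Rightarrow> 'c::real_normed_vector \<Rightarrow> real"
    and f :: "real \<Rightarrow> 'b" and g :: "real \<Rightarrow> 'c"
  assumes "bounded_bilinear b" "strongly_measurable lebesgue f" "strongly_measurable lebesgue g"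
  shows "(\<lambda>t. b (f t) (g t)) \<in> borel_measurable lebesgue"
  unfolding strongly_measurable_lebesgue_real_iff[symmetric]
  by (rule strongly_measurable_compose2[OF assms(2,3), where h = b])
    (rule bounded_bilinear.tendsto[OF assms(1)])

lemma integrable_bilinear:
  fixes b :: "'b::real_normed_vector \<Rightarrow> 'c::real_normed_vector \<Rightarrow> real"
  assumes b: "bounded_bilinear b" and f: "square_integrable f" and g: "square_integrable g"
  shows "integrable lebesgue (\<lambda>t. b (f t) (g t))"
proof -
  obtain K where K: "0 \<le> K" "\<And>x y. norm (b x y) \<le> norm x * norm y * K"
    using bounded_bilinear.nonneg_bounded[OF b] by blast
  show ?thesis
  proof (rule Bochner_Integration.integrable_bound)
    show "integrable lebesgue (\<lambda>t. K * ((norm (f t))\<^sup>2 + (norm (g t))\<^sup>2))"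
      using f g by (simp add: square_integrable_def)
    show "(\<lambda>t. b (f t) (g t)) \<in> borel_measurable lebesgue"
      using f g by (intro strongly_measurable_bilinear[OF b]) (auto simp: square_integrable_def)
    have "norm (b (f t) (g t)) \<le> norm (K * ((norm (f t))\<^sup>2 + (norm (g t))\<^sup>2))" for t
    proof -
      have "norm (f t) * norm (g t) \<le> (norm (f t))\<^sup>2 + (norm (g t))\<^sup>2"
        using sum_squares_bound[of "norm (f t)" "norm (g t)"] mult_nonneg_nonneg[OF norm_ge_zero norm_ge_zero, of "f t" "g t"]
        by linarith
      then have "norm (f t) * norm (g t) * K \<le> K * ((norm (f t))\<^sup>2 + (norm (g t))\<^sup>2)"
        using K(1) by (simp add: mult.commute mult_left_mono)
      then show ?thesis using K(2)[of "f t" "g t"] K(1) by simp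
    qed
    then show "AE t in lebesgue. norm (b (f t) (g t)) \<le> norm (K * ((norm (f t))\<^sup>2 + (norm (g t))\<^sup>2))"
      by simp
  qed
qed

lemma square_integrable_simple_approx:
  fixes f :: "real \<Rightarrow> 'b::real_normed_vector"
  assumes f: "square_integrable f"
  obtains s where "\<And>n. simple_function lebesgue (s n)" "\<And>n. square_integrable (s n)"
    "\<And>n t. \<bar>t\<bar> > real n \<Longrightarrow> s n t = 0" "(\<lambda>n. LINT t|lebesgue. (norm (s n t - f t))\<^sup>2) \<longlonglongrightarrow> 0"
proof -
  obtain s where s: "\<And>n. simple_function lebesgue (s n)" "AE t in lebesgue. (\<lambda>n. s n t) \<longlonglongrightarrow> f t"
    using f by (auto simp: strongly_measurable_def square_integrable_def)
  have sm: "strongly_measurable lebesgue f" and int: "integrable lebesgue (\<lambda>t. (norm (f t))\<^sup>2)"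
    using f by (auto simp: square_integrable_def)
  \<comment> \<open>Cutting off where \<open>s n\<close> exceeds twice \<open>f\<close> makes
    \<open>9 * (norm (f t))\<^sup>2\<close> a dominating function for the squared error. Convergence
    survives: where \<open>f t\<close> is nonzero the cut is eventually inactive, and where it is
    zero \<open>u n t\<close> vanishes.\<close>
  define u where "u n t = (if \<bar>t\<bar> \<le> real n \<and> norm (s n t) \<le> 2 * norm (f t) then s n t else 0)" for n t
  have sims: "simple_function lebesgue (u n)" for n
    unfolding u_def
  proof (rule simple_function_If)
    have [measurable]: "(\<lambda>t. norm (f t)) \<in> borel_measurable lebesgue" "(\<lambda>t. norm (s n t)) \<in> borel_measurable lebesgue"
      using sm s(1) by (auto intro!: strongly_measurable_norm strongly_measurable_simple)
    have "{t \<in> space lebesgue. \<bar>t\<bar> \<le> real n \<and> norm (s n t) \<le> 2 * norm (f t)} =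
        {-real n..real n} \<inter> {t \<in> space lebesgue. norm (s n t) \<le> 2 * norm (f t)}" by auto
    moreover have "{t \<in> space lebesgue. norm (s n t) \<le> 2 * norm (f t)} \<in> sets lebesgue" by measurable
    ultimately show "{t \<in> space lebesgue. \<bar>t\<bar> \<le> real n \<and> norm (s n t) \<le> 2 * norm (f t)} \<in> sets lebesgue"
      by (simp add: sets.Int)
  qed (use s in auto)
  have ub: "norm (u n t) \<le> 2 * norm (f t)" for n t by (simp add: u_def)
  have usq: "square_integrable (u n)" for n
    using ub sims by (intro square_integrable_bound[OF _ f, where C = 2]) (auto intro: strongly_measurable_simple)
  have lim: "AE t in lebesgue. (\<lambda>n. (norm (u n t - f t))\<^sup>2) \<longlonglongrightarrow> 0"
    using s(2)
  proof eventually_elim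
    case (elim t)
    have "(\<lambda>n. u n t) \<longlonglongrightarrow> f t"
    proof (cases "f t = 0")
      case True
      then have "u n t = 0" for n using ub[of n t] by simp
      then show ?thesis using True by simp
    next
      case False
      have "eventually (\<lambda>n. norm (s n t) < 2 * norm (f t)) sequentially"
        using tendsto_norm[OF elim] False by (intro order_tendstoD) auto
      moreover have "eventually (\<lambda>n. \<bar>t\<bar> \<le> real n) sequentially"
        by (rule eventually_sequentiallyI[of "nat \<lceil>\<bar>t\<bar>\<rceil>"]) linarith
      ultimately have "eventually (\<lambda>n. s n t = u n t) sequentially"
        by eventually_elim (auto simp: u_def)
      then show ?thesis using elim by (rule Lim_transform_eventually[rotated])
    qed
    then have "(\<lambda>n. u n t - f t) \<longlonglongrightarrow> 0" by (simp add: LIM_zero)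
    then show ?case using tendsto_power[OF tendsto_norm, of "\<lambda>n. u n t - f t" 0 sequentially 2] by simp
  qed
  have "(\<lambda>n. LINT t|lebesgue. (norm (u n t - f t))\<^sup>2) \<longlonglongrightarrow> integral\<^sup>L (lebesgue :: real measure) (\<lambda>_. 0::real)"
  proof (rule integral_dominated_convergence)
    show "integrable lebesgue (\<lambda>t. 9 * (norm (f t))\<^sup>2)" using int by simp
    show "(\<lambda>t. (norm (u n t - f t))\<^sup>2) \<in> borel_measurable lebesgue" for n
      using square_integrable_diff[OF usq f, of n] by (simp only: square_integrable_def borel_measurable_integrable)
    show "AE t in lebesgue. norm ((norm (u n t - f t))\<^sup>2) \<le> 9 * (norm (f t))\<^sup>2" for n
    proof (rule always_eventually, intro allI)
      fix t
      have "norm (u n t - f t) \<le> 3 * norm (f t)"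
        using norm_triangle_ineq4[of "u n t" "f t"] ub[of n t] by linarith
      then have "(norm (u n t - f t))\<^sup>2 \<le> (3 * norm (f t))\<^sup>2" by (rule power_mono) simp
      then show "norm ((norm (u n t - f t))\<^sup>2) \<le> 9 * (norm (f t))\<^sup>2" by (simp add: power_mult_distrib)
    qed
  qed (use lim in auto)
  then show ?thesis using that[of u] sims usq by (simp add: u_def)
qed

section \<open>The Hilbert space of square-integrable functions\<close>

\<comment> \<open>The partial relation confines the type to square-integrable functions. As a type,
  \<open>L2\<close> can enter the Hilbert space class and thus the abstract minimization
  lemma.\<close>
quotient_type (overloaded) 'b L2 = "real \<Rightarrow> 'b::complex_hilbert" / partial:
  "\<lambda>f g. square_integrable f \<and> square_integrable g \<and> (AE t in lebesgue. f t = g t)"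
proof (rule part_equivpI)
  show "\<exists>f::real \<Rightarrow> 'b. square_integrable f \<and> square_integrable f \<and> (AE t in lebesgue. f t = f t)"
    by (intro exI[of _ "\<lambda>_. 0"]) (simp add: square_integrable_zero)
qed (auto intro!: sympI transpI elim: eventually_elim2)

lemma square_integrable_rep [simp]: "square_integrable (rep_L2 x)"
  using Quotient3_rep_reflp[OF Quotient3_L2, of x] by simp

lemma abs_rep_L2 [simp]: "abs_L2 (rep_L2 x) = x"
  by (rule Quotient3_abs_rep[OF Quotient3_L2])

lemma rep_abs_L2: "square_integrable f \<Longrightarrow> AE t in lebesgue. rep_L2 (abs_L2 f) t = f t"
  using rep_abs_rsp_left[OF Quotient3_L2, of f f] by simp

lemma L2_eqI: "AE t in lebesgue. rep_L2 x t = rep_L2 y t \<Longrightarrow> x = y"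
  using Quotient3_rel_rep[OF Quotient3_L2, of x y] by simp

lemma abs_L2_eqI:
  "square_integrable f \<Longrightarrow> AE t in lebesgue. f t = g t \<Longrightarrow> abs_L2 f = abs_L2 g"
  using Quotient3_rel_abs[OF Quotient3_L2, of f g] square_integrable_AE[of f g] by simp

lemma abs_L2_eq_iff:
  "square_integrable f \<Longrightarrow> square_integrable g \<Longrightarrow> abs_L2 f = abs_L2 g \<longleftrightarrow> (AE t in lebesgue. f t = g t)"
  using Quotient3_rel[OF Quotient3_L2, of f g] by auto

instantiation L2 :: (complex_hilbert) real_inner
begin

definition zero_L2 :: "'a L2" where "0 = abs_L2 (\<lambda>_. 0)"
definition plus_L2 :: "'a L2 \<Rightarrow> 'a L2 \<Rightarrow> 'a L2" where "x + y = abs_L2 (\<lambda>t. rep_L2 x t + rep_L2 y t)"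
definition uminus_L2 :: "'a L2 \<Rightarrow> 'a L2" where "- x = abs_L2 (\<lambda>t. - rep_L2 x t)"
definition minus_L2 :: "'a L2 \<Rightarrow> 'a L2 \<Rightarrow> 'a L2" where "x - y = x + - (y :: 'a L2)"
definition scaleR_L2 :: "real \<Rightarrow> 'a L2 \<Rightarrow> 'a L2" where "r *\<^sub>R x = abs_L2 (\<lambda>t. r *\<^sub>R rep_L2 x t)"
definition inner_L2 :: "'a L2 \<Rightarrow> 'a L2 \<Rightarrow> real"
  where "inner x y = (LINT t|lebesgue. inner (rep_L2 x t) (rep_L2 y t))"
definition norm_L2 :: "'a L2 \<Rightarrow> real" where "norm x = sqrt (inner x (x :: 'a L2))"
definition sgn_L2 :: "'a L2 \<Rightarrow> 'a L2" where "sgn x = inverse (norm x) *\<^sub>R (x :: 'a L2)"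
definition dist_L2 :: "'a L2 \<Rightarrow> 'a L2 \<Rightarrow> real" where "dist x y = norm (x - y :: 'a L2)"
definition uniformity_L2 :: "('a L2 \<times> 'a L2) filter"
  where "uniformity_L2 = (INF e\<in>{0<..}. principal {(x, y). dist x y < e})"
definition open_L2 :: "'a L2 set \<Rightarrow> bool"
  where "open_L2 U \<longleftrightarrow> (\<forall>x\<in>U. eventually (\<lambda>(x', y). x' = x \<longrightarrow> y \<in> U) uniformity)"

lemma rep_zero_L2: "AE t in lebesgue. rep_L2 (0 :: 'a L2) t = 0"
  unfolding zero_L2_def by (rule rep_abs_L2[OF square_integrable_zero])

lemma rep_plus_L2: "AE t in lebesgue. rep_L2 (x + y :: 'a L2) t = rep_L2 x t + rep_L2 y t"
  unfolding plus_L2_def by (rule rep_abs_L2) (simp add: square_integrable_add)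

lemma rep_uminus_L2: "AE t in lebesgue. rep_L2 (- x :: 'a L2) t = - rep_L2 x t"
  unfolding uminus_L2_def
  by (rule rep_abs_L2) (auto intro: square_integrable_bounded_linear[OF bounded_linear_minus[OF bounded_linear_ident]])

lemma rep_scaleR_L2: "AE t in lebesgue. rep_L2 (r *\<^sub>R x :: 'a L2) t = r *\<^sub>R rep_L2 x t"
  unfolding scaleR_L2_def
  by (rule rep_abs_L2) (auto intro: square_integrable_bounded_linear[OF bounded_linear_scaleR_right])

lemma integrable_inner_L2: "integrable lebesgue (\<lambda>t. inner (rep_L2 x t) (rep_L2 (y :: 'a L2) t))"
  by (rule integrable_bilinear[OF bounded_bilinear_inner]) simp_all

instance
proof
  fix x y z :: "'a L2" and r s :: real
  show "x + y + z = x + (y + z)"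
    by (rule L2_eqI) (use rep_plus_L2[of "x + y" z] rep_plus_L2[of x y] rep_plus_L2[of x "y + z"] rep_plus_L2[of y z]
      in eventually_elim, simp)
  show "x + y = y + x"
    by (rule L2_eqI) (use rep_plus_L2[of x y] rep_plus_L2[of y x] in eventually_elim, simp)
  show "0 + x = x"
    by (rule L2_eqI) (use rep_plus_L2[of 0 x] rep_zero_L2 in eventually_elim, simp)
  show "- x + x = 0"
    by (rule L2_eqI) (use rep_plus_L2[of "- x" x] rep_uminus_L2[of x] rep_zero_L2 in eventually_elim, simp)
  show "r *\<^sub>R (x + y) = r *\<^sub>R x + r *\<^sub>R y"
    by (rule L2_eqI) (use rep_plus_L2[of x y] rep_plus_L2[of "r *\<^sub>R x" "r *\<^sub>R y"] rep_scaleR_L2[of r "x + y"]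
      rep_scaleR_L2[of r x] rep_scaleR_L2[of r y] in eventually_elim, simp add: scaleR_add_right)
  show "(r + s) *\<^sub>R x = r *\<^sub>R x + s *\<^sub>R x"
    by (rule L2_eqI) (use rep_plus_L2[of "r *\<^sub>R x" "s *\<^sub>R x"] rep_scaleR_L2[of "r + s" x]
      rep_scaleR_L2[of r x] rep_scaleR_L2[of s x] in eventually_elim, simp add: scaleR_add_left)
  show "r *\<^sub>R s *\<^sub>R x = (r * s) *\<^sub>R x"
    by (rule L2_eqI) (use rep_scaleR_L2[of "r" "s *\<^sub>R x"] rep_scaleR_L2[of s x] rep_scaleR_L2[of "r * s" x]
      in eventually_elim, simp)
  show "1 *\<^sub>R x = x"
    by (rule L2_eqI) (use rep_scaleR_L2[of 1 x] in eventually_elim, simp)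
  show "inner x y = inner y x" by (simp add: inner_L2_def inner_commute)
  show "inner (x + y) z = inner x z + inner y z"
  proof -
    have "inner (x + y) z = (LINT t|lebesgue. inner (rep_L2 x t) (rep_L2 z t) + inner (rep_L2 y t) (rep_L2 z t))"
      unfolding inner_L2_def
      by (rule integral_cong_AE) (use integrable_inner_L2[of "x + y" z] integrable_inner_L2[of x z] integrable_inner_L2[of y z]
        rep_plus_L2[of x y] in \<open>auto simp: inner_add_left elim!: eventually_mono\<close>)
    then show ?thesis by (simp add: inner_L2_def integrable_inner_L2)
  qed
  show "inner (r *\<^sub>R x) y = r * inner x y"
  proof -
    have "inner (r *\<^sub>R x) y = (LINT t|lebesgue. r * inner (rep_L2 x t) (rep_L2 y t))"
      unfolding inner_L2_def
      by (rule integral_cong_AE) (use integrable_inner_L2[of "r *\<^sub>R x" y] integrable_inner_L2[of x y]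
        rep_scaleR_L2[of r x] in \<open>auto elim!: eventually_mono\<close>)
    then show ?thesis by (simp add: inner_L2_def)
  qed
  show "0 \<le> inner x x" by (simp add: inner_L2_def)
  show "(inner x x = 0) = (x = 0)"
  proof
    assume "inner x x = 0"
    then have "AE t in lebesgue. inner (rep_L2 x t) (rep_L2 x t) = 0"
      unfolding inner_L2_def using integral_nonneg_eq_0_iff_AE[OF integrable_inner_L2[of x x]] by simp
    then have "AE t in lebesgue. rep_L2 x t = rep_L2 0 t" using rep_zero_L2 by eventually_elim simp
    then show "x = 0" by (rule L2_eqI)
  next
    assume "x = 0"
    have "(LINT t|lebesgue. inner (rep_L2 (0::'a L2) t) (rep_L2 (0::'a L2) t)) = integral\<^sup>L (lebesgue :: real measure) (\<lambda>_. 0)"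
      by (rule integral_cong_AE) (use integrable_inner_L2[of 0 0] rep_zero_L2 in \<open>auto elim!: eventually_mono\<close>)
    with \<open>x = 0\<close> show "inner x x = 0" by (simp add: inner_L2_def)
  qed
qed (simp_all add: minus_L2_def norm_L2_def sgn_L2_def dist_L2_def uniformity_L2_def open_L2_def)

end

lemma rep_diff_L2: "AE t in lebesgue. rep_L2 (x - y) t = rep_L2 x t - rep_L2 y t"
  using rep_plus_L2[of x "- y"] rep_uminus_L2[of y] by eventually_elim simp

lemma norm_L2_power2: "(norm x)\<^sup>2 = (LINT t|lebesgue. (norm (rep_L2 x t))\<^sup>2)"
  by (simp add: power2_norm_eq_inner inner_L2_def)

lemma norm_abs_L2_power2:
  assumes "square_integrable f"
  shows "(norm (abs_L2 f))\<^sup>2 = (LINT t|lebesgue. (norm (f t))\<^sup>2)"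
  unfolding norm_L2_power2
proof (rule integral_cong_AE)
  show "(\<lambda>t. (norm (rep_L2 (abs_L2 f) t))\<^sup>2) \<in> borel_measurable lebesgue"
    using square_integrable_rep[of "abs_L2 f"] by (simp only: square_integrable_def borel_measurable_integrable)
  show "(\<lambda>t. (norm (f t))\<^sup>2) \<in> borel_measurable lebesgue"
    using assms by (simp only: square_integrable_def borel_measurable_integrable)
  show "AE t in lebesgue. (norm (rep_L2 (abs_L2 f) t))\<^sup>2 = (norm (f t))\<^sup>2"
    using rep_abs_L2[OF assms] by eventually_elim simp
qed

lemma abs_L2_add:
  assumes "square_integrable f" "square_integrable g"
  shows "abs_L2 (\<lambda>t. f t + g t) = abs_L2 f + abs_L2 g"
  by (rule L2_eqI) (use rep_abs_L2[OF assms(1)] rep_abs_L2[OF assms(2)]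
      rep_abs_L2[OF square_integrable_add[OF assms]] rep_plus_L2[of "abs_L2 f" "abs_L2 g"]
      in eventually_elim, simp)

lemma L2_simple_approx:
  fixes x :: "'b::complex_hilbert L2"
  assumes "\<epsilon> > 0"
  obtains s where "simple_function lebesgue s" "square_integrable s" "\<exists>R. \<forall>t. \<bar>t\<bar> > R \<longrightarrow> s t = 0"
    "norm (abs_L2 s - x) < \<epsilon>"
proof -
  obtain s where s: "\<And>n. simple_function lebesgue (s n)" "\<And>n. square_integrable (s n)"
    "\<And>n t. \<bar>t\<bar> > real n \<Longrightarrow> s n t = 0" "(\<lambda>n. LINT t|lebesgue. (norm (s n t - rep_L2 x t))\<^sup>2) \<longlonglongrightarrow> 0"
    using square_integrable_simple_approx[OF square_integrable_rep[of x]] by blast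
  have "(norm (abs_L2 (s n) - x))\<^sup>2 = (LINT t|lebesgue. (norm (s n t - rep_L2 x t))\<^sup>2)" for n
  proof -
    have "abs_L2 (s n) - x = abs_L2 (\<lambda>t. s n t - rep_L2 x t)"
      by (rule L2_eqI) (use rep_diff_L2[of "abs_L2 (s n)" x] rep_abs_L2[OF s(2)[of n]]
        rep_abs_L2[OF square_integrable_diff[OF s(2)[of n] square_integrable_rep[of x]]] in eventually_elim, simp)
    then show ?thesis
      by (simp add: norm_abs_L2_power2[OF square_integrable_diff[OF s(2)[of n] square_integrable_rep[of x]]])
  qed
  then have "eventually (\<lambda>n. (norm (abs_L2 (s n) - x))\<^sup>2 < \<epsilon>\<^sup>2) sequentially"
    using order_tendstoD(2)[OF s(4), of "\<epsilon>\<^sup>2"] assms by simp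
  then obtain n where "(norm (abs_L2 (s n) - x))\<^sup>2 < \<epsilon>\<^sup>2"
    using eventually_happens' sequentially_bot by blast
  then have "norm (abs_L2 (s n) - x) < \<epsilon>" using assms by (simp add: power2_less_imp_less)
  then show ?thesis using that[of "s n"] s by blast
qed

lemma fast_Cauchy_bound:
  fixes U :: "nat \<Rightarrow> 'b::real_normed_vector"
  assumes fast: "\<And>k. norm (U (Suc k) - U k) \<le> (1/4)^k" and "k \<le> m"
  shows "norm (U m - U k) \<le> 2 * (1/4)^k"
proof -
  \<comment> \<open>The subtracted remainder carries the induction: \<open>(1/4)^m\<close> equals
    \<open>4/3 * (1/4)^m - 4/3 * (1/4)^Suc m\<close>.\<close>
  have "norm (U m - U k) \<le> 2 * (1/4)^k - 4/3 * (1/4)^m"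
    using \<open>k \<le> m\<close>
  proof (induction m rule: dec_induct)
    case (step m)
    have "norm (U (Suc m) - U k) \<le> norm (U (Suc m) - U m) + norm (U m - U k)"
      using norm_triangle_ineq[of "U (Suc m) - U m" "U m - U k"] by simp
    then show ?case using step.IH fast[of m] by simp
  qed simp
  also have "\<dots> \<le> 2 * (1/4)^k" by simp
  finally show ?thesis .
qed

text \<open>The Riesz-Fischer argument, run on simple functions so that their almost everywhere
  limit is strongly measurable by definition.\<close>

lemma L2_fast_Cauchy_limit:
  fixes s :: "nat \<Rightarrow> real \<Rightarrow> 'b::complex_hilbert"
  assumes s: "\<And>k. simple_function lebesgue (s k)" "\<And>k. square_integrable (s k)"
    and fast: "\<And>k. norm (abs_L2 (s (Suc k)) - abs_L2 (s k)) \<le> (1/4)^k"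
  shows "\<exists>y. (\<lambda>k. abs_L2 (s k)) \<longlonglongrightarrow> y"
proof -
  have sq: "square_integrable (\<lambda>t. s m t - s k t)" for m k by (rule square_integrable_diff[OF s(2) s(2)])
  have int: "integrable lebesgue (\<lambda>t. (norm (s m t - s k t))\<^sup>2)" for m k
    using sq[of m k] by (simp add: square_integrable_def)
  have eq: "(norm (abs_L2 (s m) - abs_L2 (s k)))\<^sup>2 = (LINT t|lebesgue. (norm (s m t - s k t))\<^sup>2)" for m k
  proof -
    have "abs_L2 (s m) - abs_L2 (s k) = abs_L2 (\<lambda>t. s m t - s k t)"
      by (rule L2_eqI) (use rep_diff_L2[of "abs_L2 (s m)" "abs_L2 (s k)"] rep_abs_L2[OF s(2)[of m]]
        rep_abs_L2[OF s(2)[of k]] rep_abs_L2[OF sq[of m k]] in eventually_elim, simp)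
    then show ?thesis by (simp add: norm_abs_L2_power2[OF sq])
  qed
  have nn: "(\<integral>\<^sup>+t. ennreal ((norm (s m t - s k t))\<^sup>2) \<partial>lebesgue) =
      ennreal ((norm (abs_L2 (s m) - abs_L2 (s k)))\<^sup>2)" for m k
    unfolding eq by (rule nn_integral_eq_integral[OF int]) simp
  have meas: "(\<lambda>t. (norm (s m t - s k t))\<^sup>2) \<in> borel_measurable lebesgue" for m k
    using int by (rule borel_measurable_integrable)
  \<comment> \<open>The weight \<open>4^k\<close> leaves integrals of at most
    \<open>(1/4)^k\<close>, still summable, while finiteness of the pointwise sum forces increments
    of order \<open>(1/2)^k\<close>.\<close>
  define d where "d k t = 4^k * (norm (s (Suc k) t - s k t))\<^sup>2" for k t
  have dm0: "d k \<in> borel_measurable lebesgue" for k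
    unfolding d_def using meas[of "Suc k" k] by measurable
  then have dm: "(\<lambda>t. ennreal (d k t)) \<in> borel_measurable lebesgue" for k by measurable
  have "(\<integral>\<^sup>+t. (\<Sum>k. ennreal (d k t)) \<partial>lebesgue) = (\<Sum>k. \<integral>\<^sup>+t. ennreal (d k t) \<partial>lebesgue)"
    by (rule nn_integral_suminf) (rule dm)
  also have "\<dots> \<le> (\<Sum>k. ennreal ((1/4)^k))"
  proof (intro suminf_le summableI)
    fix k
    have "(\<integral>\<^sup>+t. ennreal (d k t) \<partial>lebesgue) =
        ennreal (4^k) * (\<integral>\<^sup>+t. ennreal ((norm (s (Suc k) t - s k t))\<^sup>2) \<partial>lebesgue)"
      unfolding d_def by (subst nn_integral_cmult[symmetric]) (use meas in \<open>auto simp: ennreal_mult\<close>)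
    also have "\<dots> = ennreal (4^k * (norm (abs_L2 (s (Suc k)) - abs_L2 (s k)))\<^sup>2)"
      unfolding nn by (simp add: ennreal_mult)
    also have "\<dots> \<le> ennreal ((1/4)^k)"
    proof (rule ennreal_leI)
      have "(norm (abs_L2 (s (Suc k)) - abs_L2 (s k)))\<^sup>2 \<le> ((1/4)^k)\<^sup>2"
        by (intro power_mono fast) simp
      then have "4^k * (norm (abs_L2 (s (Suc k)) - abs_L2 (s k)))\<^sup>2 \<le> 4^k * ((1/4)^k)\<^sup>2" by simp
      also have "\<dots> = (1/4)^k" by (simp add: power2_eq_square power_divide)
      finally show "4^k * (norm (abs_L2 (s (Suc k)) - abs_L2 (s k)))\<^sup>2 \<le> (1/4)^k" .
    qed
    finally show "(\<integral>\<^sup>+t. ennreal (d k t) \<partial>lebesgue) \<le> ennreal ((1/4)^k)" .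
  qed
  also have "\<dots> = ennreal (\<Sum>k. (1/4)^k)"
    by (rule suminf_ennreal2) (auto intro: summable_geometric)
  also have "\<dots> < \<infinity>" by simp
  finally have "(\<integral>\<^sup>+t. (\<Sum>k. ennreal (d k t)) \<partial>lebesgue) \<noteq> \<infinity>" by simp
  then have "AE t in lebesgue. (\<Sum>k. ennreal (d k t)) \<noteq> \<infinity>"
    using dm0 by (intro nn_integral_PInf_AE) (measurable, simp)
  then have conv: "AE t in lebesgue. convergent (\<lambda>k. s k t)"
  proof eventually_elim
    case (elim t)
    then obtain c where c: "(\<Sum>k. ennreal (d k t)) = ennreal c" "c \<ge> 0" by (cases "\<Sum>k. ennreal (d k t)") auto
    have "norm (s (Suc k) t - s k t) \<le> sqrt c * (1/2)^k" for k
    proof -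
      have "ennreal (d k t) \<le> ennreal c"
        unfolding c(1)[symmetric] using sum_le_suminf[of "\<lambda>k. ennreal (d k t)" "{k}"] by simp
      then have "4^k * (norm (s (Suc k) t - s k t))\<^sup>2 \<le> c" using c(2) by (simp add: d_def)
      moreover have "((2::real)^k)\<^sup>2 = 4^k" by (simp add: power2_eq_square flip: power_mult_distrib)
      ultimately have "(2^k * norm (s (Suc k) t - s k t))\<^sup>2 \<le> c" by (simp add: power_mult_distrib)
      then have "2^k * norm (s (Suc k) t - s k t) \<le> sqrt c" by (rule real_le_rsqrt)
      then show ?thesis by (simp add: power_divide field_simps)
    qed
    then have "summable (\<lambda>k. s (Suc k) t - s k t)"
      by - (rule summable_comparison_test'[OF summable_mult[OF summable_geometric]], auto)
    then have "convergent (\<lambda>n. (\<Sum>k<n. s (Suc k) t - s k t) + s 0 t)"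
      by (intro convergent_add convergent_const) (simp add: summable_iff_convergent)
    then show ?case by (simp add: sum_lessThan_telescope[of "\<lambda>k. s k t"])
  qed
  define f where "f t = lim (\<lambda>k. s k t)" for t
  have lim: "AE t in lebesgue. (\<lambda>k. s k t) \<longlonglongrightarrow> f t"
    using conv by eventually_elim (simp add: f_def convergent_LIMSEQ_iff)
  have smf: "strongly_measurable lebesgue f"
    unfolding strongly_measurable_def using s(1) lim by (intro exI[of _ s]) simp
  \<comment> \<open>Fatou's lemma transfers the Cauchy bound from \<open>s m - s k\<close> to the
    limit.\<close>
  have bound: "(\<integral>\<^sup>+t. ennreal ((norm (f t - s k t))\<^sup>2) \<partial>lebesgue) \<le> ennreal ((2 * (1/4)^k)\<^sup>2)" for k
  proof -
    have "(\<integral>\<^sup>+t. ennreal ((norm (f t - s k t))\<^sup>2) \<partial>lebesgue) =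
        (\<integral>\<^sup>+t. liminf (\<lambda>m. ennreal ((norm (s m t - s k t))\<^sup>2)) \<partial>lebesgue)"
    proof (rule nn_integral_cong_AE)
      show "AE t in lebesgue. ennreal ((norm (f t - s k t))\<^sup>2) = liminf (\<lambda>m. ennreal ((norm (s m t - s k t))\<^sup>2))"
        using lim
      proof eventually_elim
        case (elim t)
        have "(\<lambda>m. ennreal ((norm (s m t - s k t))\<^sup>2)) \<longlonglongrightarrow> ennreal ((norm (f t - s k t))\<^sup>2)"
          by (intro tendsto_ennrealI tendsto_intros elim)
        then show ?case by (rule lim_imp_Liminf[OF sequentially_bot, symmetric])
      qed
    qed
    also have "\<dots> \<le> liminf (\<lambda>m. \<integral>\<^sup>+t. ennreal ((norm (s m t - s k t))\<^sup>2) \<partial>lebesgue)"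
      by (rule nn_integral_liminf) (rule measurable_compose[OF meas measurable_ennreal])
    also have "\<dots> \<le> ennreal ((2 * (1/4)^k)\<^sup>2)"
    proof (rule Liminf_le)
      show "eventually (\<lambda>m. (\<integral>\<^sup>+t. ennreal ((norm (s m t - s k t))\<^sup>2) \<partial>lebesgue) \<le> ennreal ((2 * (1/4)^k)\<^sup>2)) sequentially"
        unfolding nn
        by (rule eventually_sequentiallyI[of k])
          (intro ennreal_leI power_mono fast_Cauchy_bound[of "\<lambda>k. abs_L2 (s k)"] fast, auto)
    qed simp
    finally show ?thesis .
  qed
  have sqd: "square_integrable (\<lambda>t. f t - s k t)" for k
    unfolding square_integrable_def
  proof
    show sm: "strongly_measurable lebesgue (\<lambda>t. f t - s k t)"
      by (rule strongly_measurable_compose2[OF smf strongly_measurable_simple[OF s(1)], where h = "(-)"])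
        (rule tendsto_diff)
    show "integrable lebesgue (\<lambda>t. (norm (f t - s k t))\<^sup>2)"
      unfolding integrable_iff_bounded
    proof
      show "(\<lambda>t. (norm (f t - s k t))\<^sup>2) \<in> borel_measurable lebesgue"
        using strongly_measurable_norm[OF sm] by measurable
      show "(\<integral>\<^sup>+ t. ennreal (norm ((norm (f t - s k t))\<^sup>2)) \<partial>lebesgue) < \<infinity>"
        using le_less_trans[OF bound[of k] ennreal_less_top] by simp
    qed
  qed
  have sqf: "square_integrable f" using square_integrable_add[OF sqd[of 0] s(2)[of 0]] by simp
  have nb: "norm (abs_L2 (s k) - abs_L2 f) \<le> 2 * (1/4)^k" for k
  proof -
    have "abs_L2 f - abs_L2 (s k) = abs_L2 (\<lambda>t. f t - s k t)"
      by (rule L2_eqI) (use rep_diff_L2[of "abs_L2 f" "abs_L2 (s k)"] rep_abs_L2[OF s(2)[of k]]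
        rep_abs_L2[OF sqf] rep_abs_L2[OF sqd[of k]] in eventually_elim, simp)
    then have "(norm (abs_L2 (s k) - abs_L2 f))\<^sup>2 = (LINT t|lebesgue. (norm (f t - s k t))\<^sup>2)"
      by (simp add: norm_minus_commute norm_abs_L2_power2[OF sqd])
    moreover have "ennreal (LINT t|lebesgue. (norm (f t - s k t))\<^sup>2) \<le> ennreal ((2 * (1/4)^k)\<^sup>2)"
      using bound[of k] nn_integral_eq_integral[of lebesgue "\<lambda>t. (norm (f t - s k t))\<^sup>2"] sqd[of k]
      by (simp add: square_integrable_def)
    ultimately have "(norm (abs_L2 (s k) - abs_L2 f))\<^sup>2 \<le> (2 * (1/4)^k)\<^sup>2" by (simp add: ennreal_le_iff)
    then show ?thesis by (rule power2_le_imp_le) simp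
  qed
  have "(\<lambda>k. abs_L2 (s k) - abs_L2 f) \<longlonglongrightarrow> 0"
  proof (rule Lim_null_comparison)
    show "(\<lambda>k. 2 * (1/4::real)^k) \<longlonglongrightarrow> 0" by (intro tendsto_mult_right_zero LIMSEQ_realpow_zero) auto
  qed (use nb in auto)
  then show ?thesis by (auto simp: LIM_zero_iff)
qed

instance L2 :: (complex_hilbert) complete_space
proof
  fix X :: "nat \<Rightarrow> 'a L2"
  assume X: "Cauchy X"
  have "\<exists>s. simple_function lebesgue s \<and> square_integrable s \<and> norm (abs_L2 s - X n) < (1/2)^n" for n
    using L2_simple_approx[of "(1/2)^n" "X n"] by (metis zero_less_divide_1_iff zero_less_numeral zero_less_power)
  then obtain s where s: "\<And>n. simple_function lebesgue (s n)" "\<And>n. square_integrable (s n)"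
    "\<And>n. norm (abs_L2 (s n) - X n) < (1/2)^n" by metis
  have d0: "(\<lambda>n. abs_L2 (s n) - X n) \<longlonglongrightarrow> 0"
  proof (rule Lim_null_comparison)
    show "(\<lambda>k. (1/2::real)^k) \<longlonglongrightarrow> 0" by (intro LIMSEQ_realpow_zero) auto
  qed (use s(3) in \<open>intro always_eventually allI less_imp_le\<close>)
  have "Cauchy (\<lambda>n. abs_L2 (s n))"
  proof (rule CauchyI)
    fix e :: real assume "e > 0"
    then have "e / 2 > 0" by simp
    obtain M1 where M1: "\<And>m n. m \<ge> M1 \<Longrightarrow> n \<ge> M1 \<Longrightarrow> norm (X m - X n) < e / 2"
      using CauchyD[OF X \<open>e / 2 > 0\<close>] by blast
    obtain M2 where M2: "\<And>m n. m \<ge> M2 \<Longrightarrow> n \<ge> M2 \<Longrightarrow>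
        norm ((abs_L2 (s m) - X m) - (abs_L2 (s n) - X n)) < e / 2"
      using CauchyD[OF LIMSEQ_imp_Cauchy[OF d0] \<open>e / 2 > 0\<close>] by blast
    have "norm (abs_L2 (s m) - abs_L2 (s n)) < e" if "m \<ge> max M1 M2" "n \<ge> max M1 M2" for m n
    proof -
      have "abs_L2 (s m) - abs_L2 (s n) = (X m - X n) + ((abs_L2 (s m) - X m) - (abs_L2 (s n) - X n))" by simp
      then show ?thesis
        using norm_triangle_ineq[of "X m - X n" "(abs_L2 (s m) - X m) - (abs_L2 (s n) - X n)"]
          M1[of m n] M2[of m n] that by simp
    qed
    then show "\<exists>M. \<forall>m\<ge>M. \<forall>n\<ge>M. norm (abs_L2 (s m) - abs_L2 (s n)) < e" by blast
  qed
  then have "\<exists>N. \<forall>m\<ge>N. \<forall>n\<ge>N. norm (abs_L2 (s m) - abs_L2 (s n)) < (1/4)^k" for k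
    by (rule CauchyD) simp
  then obtain N where N: "\<And>k m n. m \<ge> N k \<Longrightarrow> n \<ge> N k \<Longrightarrow> norm (abs_L2 (s m) - abs_L2 (s n)) < (1/4)^k"
    by metis
  \<comment> \<open>The summand \<open>k\<close> makes the subsequence strictly increasing; the sum
    puts it beyond every \<open>N i\<close> with \<open>i \<le> k\<close>.\<close>
  define r where "r k = k + (\<Sum>i\<le>k. N i)" for k
  have rN: "r k \<ge> N k" for k unfolding r_def by (intro trans_le_add2 member_le_sum) auto
  have r: "strict_mono r" by (rule strict_monoI_Suc) (simp add: r_def)
  have "\<exists>y. (\<lambda>k. abs_L2 (s (r k))) \<longlonglongrightarrow> y"
  proof (rule L2_fast_Cauchy_limit)
    show "norm (abs_L2 (s (r (Suc k))) - abs_L2 (s (r k))) \<le> (1/4)^k" for k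
      using N[of k "r (Suc k)" "r k"] rN[of k] strict_mono_less_eq[OF r, of k "Suc k"] by auto
  qed (use s in auto)
  then obtain y where y: "(\<lambda>k. abs_L2 (s (r k))) \<longlonglongrightarrow> y" by blast
  have "(\<lambda>k. abs_L2 (s (r k)) - (abs_L2 (s (r k)) - X (r k))) \<longlonglongrightarrow> y - 0"
    using LIMSEQ_subseq_LIMSEQ[OF d0 r] by (intro tendsto_diff y) (simp add: o_def)
  then have "(\<lambda>k. X (r k)) \<longlonglongrightarrow> y" by simp
  then show "convergent X"
    using Cauchy_converges_subseq[OF X r, of y] by (auto simp: convergent_def o_def)
qed

instantiation L2 :: (complex_hilbert) complex_hilbert
begin

definition scaleC_L2 :: "complex \<Rightarrow> 'a L2 \<Rightarrow> 'a L2" where "c *\<^sub>C x = abs_L2 (\<lambda>t. c *\<^sub>C rep_L2 x t)"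
text \<open>The formula of \<open>cinner_eq_Complex\<close>, which keeps every integral
  real-valued.\<close>

definition cinner_L2 :: "'a L2 \<Rightarrow> 'a L2 \<Rightarrow> complex"
  where "cinner x y = Complex (inner x y) (inner x (abs_L2 (\<lambda>t. \<i> *\<^sub>C rep_L2 y t)))"

lemma rep_scaleC_L2: "AE t in lebesgue. rep_L2 (c *\<^sub>C x :: 'a L2) t = c *\<^sub>C rep_L2 x t"
  unfolding scaleC_L2_def
  by (rule rep_abs_L2) (rule square_integrable_bounded_linear[OF bounded_linear_scaleC_right square_integrable_rep])

instance
proof
  fix x y z :: "'a L2" and c d :: complex and r :: real
  show a: "c *\<^sub>C (x + y) = c *\<^sub>C x + c *\<^sub>C y" for c :: complex and x y :: "'a L2"
    by (rule L2_eqI) (use rep_plus_L2[of x y] rep_plus_L2[of "c *\<^sub>C x" "c *\<^sub>C y"] rep_scaleC_L2[of c "x + y"]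
      rep_scaleC_L2[of c x] rep_scaleC_L2[of c y] in eventually_elim, simp add: scaleC_add_right)
  show b: "(c + d) *\<^sub>C x = c *\<^sub>C x + d *\<^sub>C x" for c d :: complex and x :: "'a L2"
    by (rule L2_eqI) (use rep_plus_L2[of "c *\<^sub>C x" "d *\<^sub>C x"] rep_scaleC_L2[of "c + d" x]
      rep_scaleC_L2[of c x] rep_scaleC_L2[of d x] in eventually_elim, simp add: scaleC_add_left)
  show s: "c *\<^sub>C d *\<^sub>C x = (c * d) *\<^sub>C x" for c d :: complex and x :: "'a L2"
    by (rule L2_eqI) (use rep_scaleC_L2[of c "d *\<^sub>C x"] rep_scaleC_L2[of d x] rep_scaleC_L2[of "c * d" x]
      in eventually_elim, simp add: scaleC_scaleC)
  show r: "r *\<^sub>R x = complex_of_real r *\<^sub>C x" for r :: real and x :: "'a L2"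
    by (rule L2_eqI) (use rep_scaleC_L2[of "complex_of_real r" x] rep_scaleR_L2[of r x] in eventually_elim, simp)
  have i: "inner (c *\<^sub>C x) y = inner x (cnj c *\<^sub>C y)" for c :: complex and x y :: "'a L2"
    unfolding inner_L2_def
  proof (rule integral_cong_AE)
    show "AE t in lebesgue. inner (rep_L2 (c *\<^sub>C x) t) (rep_L2 y t) = inner (rep_L2 x t) (rep_L2 (cnj c *\<^sub>C y) t)"
      using rep_scaleC_L2[of c x] rep_scaleC_L2[of "cnj c" y] by eventually_elim (simp add: inner_scaleC)
  qed (rule borel_measurable_integrable integrable_inner_L2)+
  have m1: "(- 1) *\<^sub>C x = - x" for x :: "'a L2" using r[of "-1" x] by simp
  have ni: "(- c) *\<^sub>C x = - (c *\<^sub>C x)" for c and x :: "'a L2" using s[of "- 1" c x] m1 by simp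
  have ci: "c *\<^sub>C x = Re c *\<^sub>R x + Im c *\<^sub>R (\<i> *\<^sub>C x)" for c and x :: "'a L2"
  proof -
    have "c = complex_of_real (Re c) + complex_of_real (Im c) * \<i>" by (simp add: complex_eq_iff)
    then have "c *\<^sub>C x = (complex_of_real (Re c) + complex_of_real (Im c) * \<i>) *\<^sub>C x" by (rule arg_cong)
    then show ?thesis by (simp only: b r s)
  qed
  have cinner: "cinner x y = Complex (inner x y) (inner x (\<i> *\<^sub>C y))" for x y :: "'a L2"
    by (simp add: cinner_L2_def scaleC_L2_def)
  have ii: "\<i> *\<^sub>C \<i> *\<^sub>C x = - x" for x :: "'a L2" using s[of \<i> \<i> x] m1 by simp
  show "cinner x y = cnj (cinner y x)"
    using i[of \<i> x y] by (simp add: cinner complex_eq_iff inner_commute ni)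
  show "cinner (x + y) z = cinner x z + cinner y z"
    by (simp add: cinner complex_eq_iff inner_add_left)
  have "inner (c *\<^sub>C x) y = Re c * inner x y - Im c * inner x (\<i> *\<^sub>C y)" for x y :: "'a L2"
    using i[of \<i> x y] by (simp add: ci[of c x] inner_add_left ni)
  then show "cinner (c *\<^sub>C x) y = c * cinner x y"
    by (simp add: cinner complex_eq_iff ii)
  show "inner x y = Re (cinner x y)" by (simp add: cinner)
qed

end

text \<open>The optimal weight is the quotient of the two roots; a small \<open>d\<close> is added
  to both so that it exists when a root vanishes. This turns weighted bounds into Cauchy-Schwarz
  inequalities.\<close>

lemma le_sqrt_mult_of_weighted:
  fixes I A B :: real
  assumes A: "A \<ge> 0" and B: "B \<ge> 0" and le: "\<And>r. r > 0 \<Longrightarrow> 2 * I \<le> r * A + B / r"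
  shows "I \<le> sqrt A * sqrt B"
proof (rule field_le_epsilon)
  fix e :: real assume e: "e > 0"
  define a where "a = sqrt A + e / (sqrt A + sqrt B + e + 1)"
  define b where "b = sqrt B + e / (sqrt A + sqrt B + e + 1)"
  define d where "d = e / (sqrt A + sqrt B + e + 1)"
  have pos: "sqrt A \<ge> 0" "sqrt B \<ge> 0" using A B by auto
  have den: "sqrt A + sqrt B + e + 1 > 0" using pos e by linarith
  have d: "d > 0" "d \<le> 1"
    unfolding d_def using divide_pos_pos[OF e den] divide_le_eq_1_pos[OF den, of e] pos by linarith+
  have ab: "a = sqrt A + d" "b = sqrt B + d" by (auto simp: a_def b_def d_def)
  have ab0: "a > 0" "b > 0" using ab d pos by linarith+
  have "2 * I \<le> (b / a) * A + B / (b / a)" by (rule le) (use ab0 in simp)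
  also have "\<dots> \<le> (b / a) * a\<^sup>2 + b\<^sup>2 / (b / a)"
  proof (intro add_mono mult_left_mono divide_right_mono)
    show "A \<le> a\<^sup>2" using A d power_mono[of "sqrt A" a 2] pos by (simp add: ab)
    show "B \<le> b\<^sup>2" using B d power_mono[of "sqrt B" b 2] pos by (simp add: ab)
  qed (use ab0 in auto)
  also have "\<dots> = 2 * (a * b)" using ab0 by (simp add: power2_eq_square)
  finally have "I \<le> a * b" by simp
  also have "\<dots> = sqrt A * sqrt B + d * (sqrt A + sqrt B + d)" by (simp add: ab algebra_simps)
  also have "d * (sqrt A + sqrt B + d) \<le> d * (sqrt A + sqrt B + e + 1)"
    using d e by (intro mult_left_mono) auto
  also have "\<dots> = e" using den by (simp add: d_def)
  finally show "I \<le> sqrt A * sqrt B + e" by simp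
qed

section \<open>Forms and operators on square-integrable functions\<close>

definition form_L2 :: "('b \<Rightarrow> 'b \<Rightarrow> real) \<Rightarrow> 'b::complex_hilbert L2 \<Rightarrow> 'b L2 \<Rightarrow> real"
  where "form_L2 b x y = (LINT t|lebesgue. b (rep_L2 x t) (rep_L2 y t))"

lemma form_L2_inner: "form_L2 inner = inner"
  by (intro ext) (simp add: form_L2_def inner_L2_def)

context
  fixes b :: "'b::complex_hilbert \<Rightarrow> 'b \<Rightarrow> real"
  assumes b: "bounded_bilinear b"
begin

lemma integrable_form_L2: "integrable lebesgue (\<lambda>t. b (rep_L2 x t) (rep_L2 y t))"
  by (rule integrable_bilinear[OF b]) simp_all

lemma form_L2_eq:
  assumes "AE t in lebesgue. b (rep_L2 x t) (rep_L2 y t) = g t" "g \<in> borel_measurable lebesgue"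
  shows "form_L2 b x y = (LINT t|lebesgue. g t)"
  unfolding form_L2_def
  by (rule integral_cong_AE[OF borel_measurable_integrable[OF integrable_form_L2] assms(2,1)])

lemma form_L2_abs:
  assumes "square_integrable f" "square_integrable g"
  shows "form_L2 b (abs_L2 f) (abs_L2 g) = (LINT t|lebesgue. b (f t) (g t))"
proof (rule form_L2_eq)
  show "AE t in lebesgue. b (rep_L2 (abs_L2 f) t) (rep_L2 (abs_L2 g) t) = b (f t) (g t)"
    using rep_abs_L2[OF assms(1)] rep_abs_L2[OF assms(2)] by eventually_elim simp
qed (rule borel_measurable_integrable[OF integrable_bilinear[OF b assms]])

text \<open>Continuity comes from integrating the pointwise inequality
  \<open>p * q \<le> r / 2 * p\<^sup>2 + q\<^sup>2 / (2 * r)\<close> and optimizing over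
  \<open>r\<close> only afterwards.\<close>

lemma bounded_bilinear_form_L2: "bounded_bilinear (form_L2 b)"
proof -
  interpret b: bounded_bilinear b by (rule b)
  have m: "(\<lambda>t. b (rep_L2 x t) (rep_L2 y t)) \<in> borel_measurable lebesgue" for x y
    by (rule borel_measurable_integrable[OF integrable_form_L2])
  obtain K where K: "0 \<le> K" "\<And>x y. norm (b x y) \<le> norm x * norm y * K" using b.nonneg_bounded by blast
  show ?thesis
  proof
    fix x x' y :: "'b L2" and r :: real
    have "form_L2 b (x + x') y = (LINT t|lebesgue. b (rep_L2 x t) (rep_L2 y t) + b (rep_L2 x' t) (rep_L2 y t))"
    proof (rule form_L2_eq)
      show "AE t in lebesgue. b (rep_L2 (x + x') t) (rep_L2 y t) = b (rep_L2 x t) (rep_L2 y t) + b (rep_L2 x' t) (rep_L2 y t)"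
        using rep_plus_L2[of x x'] by eventually_elim (simp add: b.add_left)
    qed (intro borel_measurable_add m)
    then show "form_L2 b (x + x') y = form_L2 b x y + form_L2 b x' y"
      by (simp add: form_L2_def integrable_form_L2)
    have "form_L2 b y (x + x') = (LINT t|lebesgue. b (rep_L2 y t) (rep_L2 x t) + b (rep_L2 y t) (rep_L2 x' t))"
    proof (rule form_L2_eq)
      show "AE t in lebesgue. b (rep_L2 y t) (rep_L2 (x + x') t) = b (rep_L2 y t) (rep_L2 x t) + b (rep_L2 y t) (rep_L2 x' t)"
        using rep_plus_L2[of x x'] by eventually_elim (simp add: b.add_right)
    qed (intro borel_measurable_add m)
    then show "form_L2 b y (x + x') = form_L2 b y x + form_L2 b y x'"
      by (simp add: form_L2_def integrable_form_L2)
    have "form_L2 b (r *\<^sub>R x) y = (LINT t|lebesgue. r * b (rep_L2 x t) (rep_L2 y t))"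
    proof (rule form_L2_eq)
      show "AE t in lebesgue. b (rep_L2 (r *\<^sub>R x) t) (rep_L2 y t) = r * b (rep_L2 x t) (rep_L2 y t)"
        using rep_scaleR_L2[of r x] by eventually_elim (simp add: b.scaleR_left)
    qed (intro borel_measurable_times borel_measurable_const m)
    then show "form_L2 b (r *\<^sub>R x) y = r *\<^sub>R form_L2 b x y" by (simp add: form_L2_def)
    have "form_L2 b x (r *\<^sub>R y) = (LINT t|lebesgue. r * b (rep_L2 x t) (rep_L2 y t))"
    proof (rule form_L2_eq)
      show "AE t in lebesgue. b (rep_L2 x t) (rep_L2 (r *\<^sub>R y) t) = r * b (rep_L2 x t) (rep_L2 y t)"
        using rep_scaleR_L2[of r y] by eventually_elim (simp add: b.scaleR_right)
    qed (intro borel_measurable_times borel_measurable_const m)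
    then show "form_L2 b x (r *\<^sub>R y) = r *\<^sub>R form_L2 b x y" by (simp add: form_L2_def)
    show "\<exists>K. \<forall>x y. norm (form_L2 b x y) \<le> norm x * norm y * K"
    proof (intro exI allI)
      fix x y :: "'b L2"
      have int: "integrable lebesgue (\<lambda>t. (norm (rep_L2 z t))\<^sup>2)" for z :: "'b L2"
        using square_integrable_rep[of z] unfolding square_integrable_def by blast
      have "norm (form_L2 b x y) \<le> sqrt (K * (norm x)\<^sup>2) * sqrt (K * (norm y)\<^sup>2)"
      proof (rule le_sqrt_mult_of_weighted)
        fix r :: real assume r: "r > 0"
        have "norm (form_L2 b x y) \<le> (LINT t|lebesgue. norm (b (rep_L2 x t) (rep_L2 y t)))"
          unfolding form_L2_def by (rule integral_norm_bound)
        also have "\<dots> \<le> (LINT t|lebesgue. r * K / 2 * (norm (rep_L2 x t))\<^sup>2 + K / (2 * r) * (norm (rep_L2 y t))\<^sup>2)"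
        proof (rule integral_mono)
          fix t
          define p where "p = norm (rep_L2 x t)"
          define q where "q = norm (rep_L2 y t)"
          have "0 \<le> (r * p - q)\<^sup>2 / (2 * r)" using r by simp
          also have "\<dots> = r / 2 * p\<^sup>2 + q\<^sup>2 / (2 * r) - p * q"
            using r by (simp add: power2_eq_square field_simps)
          finally have "p * q * K \<le> (r / 2 * p\<^sup>2 + q\<^sup>2 / (2 * r)) * K" using K(1) by (intro mult_right_mono) auto
          then show "norm (b (rep_L2 x t) (rep_L2 y t)) \<le>
              r * K / 2 * (norm (rep_L2 x t))\<^sup>2 + K / (2 * r) * (norm (rep_L2 y t))\<^sup>2"
            using K(2)[of "rep_L2 x t" "rep_L2 y t"] unfolding p_def q_def by (simp add: algebra_simps)
        qed (intro integrable_norm integrable_form_L2 Bochner_Integration.integrable_add integrable_mult_right int)+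
        also have "\<dots> = r * K / 2 * (norm x)\<^sup>2 + K / (2 * r) * (norm y)\<^sup>2"
          by (subst Bochner_Integration.integral_add) (simp_all add: int norm_L2_power2)
        finally show "2 * norm (form_L2 b x y) \<le> r * (K * (norm x)\<^sup>2) + K * (norm y)\<^sup>2 / r"
          using r by (simp add: field_simps)
      qed (use K in auto)
      also have "\<dots> = norm x * norm y * K" using K(1) by (simp add: real_sqrt_mult flip: power2_eq_square)
      finally show "norm (form_L2 b x y) \<le> norm x * norm y * K" .
    qed
  qed
qed

lemma form_L2_sym:
  assumes "\<And>x y. b x y = b y x"
  shows "form_L2 b x y = form_L2 b y x"
  unfolding form_L2_def using assms by simp

lemma form_L2_scaleC:
  assumes "\<And>c x y. b (c *\<^sub>C x) y = b x (cnj c *\<^sub>C y)"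
  shows "form_L2 b (c *\<^sub>C x) y = form_L2 b x (cnj c *\<^sub>C y)"
  unfolding form_L2_def[of b x]
proof (rule form_L2_eq)
  show "AE t in lebesgue. b (rep_L2 (c *\<^sub>C x) t) (rep_L2 y t) = b (rep_L2 x t) (rep_L2 (cnj c *\<^sub>C y) t)"
    using rep_scaleC_L2[of c x] rep_scaleC_L2[of "cnj c" y] by eventually_elim (simp add: assms)
qed (rule borel_measurable_integrable[OF integrable_form_L2])

end

section \<open>Restriction to sets, shifts in time, and density of step functions\<close>

definition restrict_L2 :: "real set \<Rightarrow> 'b::complex_hilbert L2 \<Rightarrow> 'b L2"
  where "restrict_L2 S x = abs_L2 (\<lambda>t. indicator S t *\<^sub>R rep_L2 x t)"

lemma strongly_measurable_indicator_scaleR: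
  fixes f :: "real \<Rightarrow> 'b::real_normed_vector"
  assumes "S \<in> sets lebesgue" "strongly_measurable lebesgue f"
  shows "strongly_measurable lebesgue (\<lambda>t. indicator S t *\<^sub>R f t)"
proof (rule strongly_measurable_compose2[where h = scaleR, OF _ assms(2)])
  show "strongly_measurable lebesgue (indicat_real S)"
    unfolding strongly_measurable_lebesgue_real_iff using assms(1) by simp
qed (rule tendsto_scaleR)

lemma square_integrable_indicator_scaleR:
  fixes f :: "real \<Rightarrow> 'b::real_normed_vector"
  assumes "S \<in> sets lebesgue" "square_integrable f"
  shows "square_integrable (\<lambda>t. indicator S t *\<^sub>R f t)"
proof (rule square_integrable_bound[OF _ assms(2), where C = 1])
  show "strongly_measurable lebesgue (\<lambda>t. indicator S t *\<^sub>R f t)"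
    using assms by (intro strongly_measurable_indicator_scaleR) (simp_all add: square_integrable_def)
qed (auto simp: indicator_def)

lemma rep_restrict_L2:
  "S \<in> sets lebesgue \<Longrightarrow> AE t in lebesgue. rep_L2 (restrict_L2 S x) t = indicator S t *\<^sub>R rep_L2 x t"
  unfolding restrict_L2_def by (rule rep_abs_L2) (simp add: square_integrable_indicator_scaleR)

lemma norm_restrict_L2_power2:
  assumes "S \<in> sets lebesgue"
  shows "(norm (restrict_L2 S x))\<^sup>2 = (LINT t|lebesgue_on S. (norm (rep_L2 x t))\<^sup>2)"
proof -
  have "(norm (restrict_L2 S x))\<^sup>2 = (LINT t|lebesgue. (norm (indicator S t *\<^sub>R rep_L2 x t))\<^sup>2)"
    unfolding restrict_L2_def
    by (rule norm_abs_L2_power2) (simp add: square_integrable_indicator_scaleR assms)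
  also have "\<dots> = (LINT t|lebesgue. indicator S t *\<^sub>R (norm (rep_L2 x t))\<^sup>2)"
    by (rule Bochner_Integration.integral_cong) (auto simp: indicator_def)
  finally show ?thesis using assms by (simp add: integral_restrict_space)
qed

lemma norm_restrict_L2_Pythagoras:
  assumes "S \<in> sets lebesgue"
  shows "(norm x)\<^sup>2 = (norm (restrict_L2 S x))\<^sup>2 + (norm (restrict_L2 (- S) x))\<^sup>2"
proof -
  have S': "- S \<in> sets lebesgue" using assms by (simp add: Compl_in_sets_lebesgue)
  have int: "integrable lebesgue (\<lambda>t. (norm (rep_L2 x t))\<^sup>2)"
    using square_integrable_rep[of x] unfolding square_integrable_def by blast
  have "(norm x)\<^sup>2 = (LINT t|lebesgue. indicator S t *\<^sub>R (norm (rep_L2 x t))\<^sup>2 + indicator (- S) t *\<^sub>R (norm (rep_L2 x t))\<^sup>2)"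
    unfolding norm_L2_power2 by (rule Bochner_Integration.integral_cong) (auto simp: indicator_def)
  also have "\<dots> = (LINT t|lebesgue. indicator S t *\<^sub>R (norm (rep_L2 x t))\<^sup>2) + (LINT t|lebesgue. indicator (- S) t *\<^sub>R (norm (rep_L2 x t))\<^sup>2)"
    by (intro Bochner_Integration.integral_add integrable_mult_indicator int assms S')
  finally show ?thesis
    unfolding norm_restrict_L2_power2[OF assms] norm_restrict_L2_power2[OF S']
    using assms S' by (simp add: integral_restrict_space)
qed

lemma bounded_linear_restrict_L2:
  assumes "S \<in> sets lebesgue"
  shows "bounded_linear (restrict_L2 S :: 'b::complex_hilbert L2 \<Rightarrow> 'b L2)"
proof (rule bounded_linear_intro[of _ 1])
  fix x y :: "'b L2" and r :: real
  show "restrict_L2 S (x + y) = restrict_L2 S x + restrict_L2 S y"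
    by (rule L2_eqI) (use rep_restrict_L2[OF assms, of "x + y"] rep_restrict_L2[OF assms, of x]
      rep_restrict_L2[OF assms, of y] rep_plus_L2[of x y] rep_plus_L2[of "restrict_L2 S x" "restrict_L2 S y"]
      in eventually_elim, simp add: scaleR_add_right)
  show "restrict_L2 S (r *\<^sub>R x) = r *\<^sub>R restrict_L2 S x"
    by (rule L2_eqI) (use rep_restrict_L2[OF assms, of "r *\<^sub>R x"] rep_restrict_L2[OF assms, of x]
      rep_scaleR_L2[of r x] rep_scaleR_L2[of r "restrict_L2 S x"] in eventually_elim, simp)
  have "(norm (restrict_L2 S x))\<^sup>2 \<le> (norm x)\<^sup>2" using norm_restrict_L2_Pythagoras[OF assms, of x] by simp
  then show "norm (restrict_L2 S x) \<le> norm x * 1" by simp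
qed

lemma restrict_L2_restrict_L2:
  assumes "S \<in> sets lebesgue" "S' \<in> sets lebesgue"
  shows "restrict_L2 S (restrict_L2 S' x) = restrict_L2 (S \<inter> S') x"
  by (rule L2_eqI) (use rep_restrict_L2[OF assms(1), of "restrict_L2 S' x"] rep_restrict_L2[OF assms(2), of x]
      rep_restrict_L2[OF sets.Int[OF assms], of x] in eventually_elim, simp add: indicator_def)

lemma norm_restrict_L2_mono:
  assumes "S \<in> sets lebesgue" "S' \<in> sets lebesgue" "S \<subseteq> S'"
  shows "norm (restrict_L2 S x) \<le> norm (restrict_L2 S' x)"
proof -
  have "(norm (restrict_L2 S (restrict_L2 S' x)))\<^sup>2 \<le> (norm (restrict_L2 S' x))\<^sup>2"
    using norm_restrict_L2_Pythagoras[OF assms(1), of "restrict_L2 S' x"] by simp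
  moreover have "S \<inter> S' = S" using assms(3) by blast
  ultimately show ?thesis by (simp add: restrict_L2_restrict_L2 assms)
qed

lemma AE_lebesgue_shift:
  fixes P :: "real \<Rightarrow> bool"
  assumes "AE t in lebesgue. P t"
  shows "AE t in lebesgue. P (t + c)"
proof -
  have "negligible {t. \<not> P t}"
    using assms unfolding completion.AE_iff_null_sets by (simp add: negligible_iff_null_sets)
  then have "negligible ((+) (- c) ` {t. \<not> P t})" by (rule negligible_translation)
  moreover have "(+) (- c) ` {t. \<not> P t} = {t. \<not> P (t + c)}"
    by (auto simp: image_iff intro!: exI[of _ "_ + c"])
  ultimately show ?thesis
    unfolding completion.AE_iff_null_sets by (simp add: negligible_iff_null_sets)
qed

lemma strongly_measurable_shift:
  fixes f :: "real \<Rightarrow> 'b::topological_space"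
  assumes "strongly_measurable lebesgue f"
  shows "strongly_measurable lebesgue (\<lambda>t. f (t + c))"
proof -
  obtain s where s: "\<And>n. simple_function lebesgue (s n)" "AE t in lebesgue. (\<lambda>n. s n t) \<longlonglongrightarrow> f t"
    using assms by (auto simp: strongly_measurable_def)
  have m: "(\<lambda>t. t + c) \<in> lebesgue \<rightarrow>\<^sub>M lebesgue"
    using lebesgue_affine_measurable[where c= "\<lambda>x::real. 1" and t = c] by (simp add: add.commute)
  show ?thesis
    unfolding strongly_measurable_def
  proof (intro exI[of _ "\<lambda>n t. s n (t + c)"] conjI allI)
    show "simple_function lebesgue (\<lambda>t. s n (t + c))" for n by (rule simple_function_comp[OF m s(1)])
    show "AE t in lebesgue. (\<lambda>n. s n (t + c)) \<longlonglongrightarrow> f (t + c)" by (rule AE_lebesgue_shift[OF s(2)])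
  qed
qed

lemma square_integrable_shift:
  fixes f :: "real \<Rightarrow> 'b::real_normed_vector"
  assumes "square_integrable f"
  shows "square_integrable (\<lambda>t. f (t + c))"
    and "(LINT t|lebesgue. (norm (f (t + c)))\<^sup>2) = (LINT t|lebesgue. (norm (f t))\<^sup>2)"
  using assms strongly_measurable_shift[of f c]
    lebesgue_integrable_real_affine_iff[of 1 "\<lambda>t. (norm (f t))\<^sup>2" c]
    lebesgue_integral_real_affine[of 1 "\<lambda>t. (norm (f t))\<^sup>2" c]
  by (auto simp: square_integrable_def add.commute)

text \<open>Positive \<open>c\<close> moves functions to the left; \<open>shift_L2 (- T)\<close> is
  the delay that attaches a continuation at time \<open>T\<close>.\<close>

definition shift_L2 :: "real \<Rightarrow> 'b::complex_hilbert L2 \<Rightarrow> 'b L2"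
  where "shift_L2 c x = abs_L2 (\<lambda>t. rep_L2 x (t + c))"

lemma rep_shift_L2: "AE t in lebesgue. rep_L2 (shift_L2 c x) t = rep_L2 x (t + c)"
  unfolding shift_L2_def by (rule rep_abs_L2) (simp add: square_integrable_shift)

lemma norm_shift_L2 [simp]: "norm (shift_L2 c x) = norm x"
proof -
  have "(norm (shift_L2 c x))\<^sup>2 = (norm x)\<^sup>2"
    unfolding shift_L2_def norm_abs_L2_power2[OF square_integrable_shift(1)[OF square_integrable_rep]]
      norm_L2_power2[of x]
    by (rule square_integrable_shift(2)) simp
  then show ?thesis by simp
qed

text \<open>Serves norm limits of functions that are characterized by identities holding almost
  everywhere, as in \<open>closed_processes\<close>.\<close>

lemma L2_convergent_subseq_AE:
  fixes X :: "nat \<Rightarrow> 'b::complex_hilbert L2"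
  assumes "X \<longlonglongrightarrow> x"
  obtains r where "strict_mono r" "AE t in lebesgue. (\<lambda>n. rep_L2 (X (r n)) t) \<longlonglongrightarrow> rep_L2 x t"
proof -
  have sq: "square_integrable (\<lambda>t. rep_L2 (X n) t - rep_L2 x t)" for n
    by (intro square_integrable_diff square_integrable_rep)
  have int: "integrable lebesgue (\<lambda>t. (norm (rep_L2 (X n) t - rep_L2 x t))\<^sup>2)" for n
    using sq[of n] by (simp add: square_integrable_def)
  have "(LINT t|lebesgue. norm ((norm (rep_L2 (X n) t - rep_L2 x t))\<^sup>2)) = (norm (X n - x))\<^sup>2" for n
    unfolding norm_L2_power2
  proof (rule integral_cong_AE)
    show "AE t in lebesgue. norm ((norm (rep_L2 (X n) t - rep_L2 x t))\<^sup>2) = (norm (rep_L2 (X n - x) t))\<^sup>2"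
      using rep_diff_L2[of "X n" x] by eventually_elim simp
    show "(\<lambda>t. (norm (rep_L2 (X n - x) t))\<^sup>2) \<in> borel_measurable lebesgue"
      using square_integrable_rep[of "X n - x"] unfolding square_integrable_def
      by (blast intro: borel_measurable_integrable)
    show "(\<lambda>t. norm ((norm (rep_L2 (X n) t - rep_L2 x t))\<^sup>2)) \<in> borel_measurable lebesgue"
      by (rule borel_measurable_integrable[OF integrable_norm[OF int]])
  qed
  moreover have "(\<lambda>n. (norm (X n - x))\<^sup>2) \<longlonglongrightarrow> 0"
    using tendsto_power[OF tendsto_norm[OF LIM_zero[OF assms]], of 2] by simp
  ultimately have "(\<lambda>n. LINT t|lebesgue. norm ((norm (rep_L2 (X n) t - rep_L2 x t))\<^sup>2)) \<longlonglongrightarrow> 0" by simp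
  then obtain r where r: "strict_mono r"
    "AE t in lebesgue. (\<lambda>n. (norm (rep_L2 (X (r n)) t - rep_L2 x t))\<^sup>2) \<longlonglongrightarrow> 0"
    using tendsto_L1_AE_subseq[of lebesgue "\<lambda>n t. (norm (rep_L2 (X n) t - rep_L2 x t))\<^sup>2", OF int] by blast
  have "AE t in lebesgue. (\<lambda>n. rep_L2 (X (r n)) t) \<longlonglongrightarrow> rep_L2 x t"
    using r(2)
  proof eventually_elim
    case (elim t)
    have "(\<lambda>n. norm (rep_L2 (X (r n)) t - rep_L2 x t)) \<longlonglongrightarrow> 0"
      using tendsto_real_sqrt[OF elim] by simp
    then show ?case by (simp add: tendsto_norm_zero_iff LIM_zero_iff)
  qed
  then show ?thesis using that r(1) by blast
qed

lemma lmeasurable_Int_bounded: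
  fixes E S :: "real set"
  assumes "E \<in> sets lebesgue" "S \<in> sets lebesgue" "bounded S"
  shows "E \<inter> S \<in> lmeasurable"
  using assms by (intro bounded_set_imp_lmeasurable bounded_Int) auto

lemma square_integrable_indicator:
  fixes x :: "'b::real_normed_vector"
  assumes "E \<in> lmeasurable"
  shows "square_integrable (\<lambda>t. indicator E t *\<^sub>R x)"
proof -
  have E: "E \<in> sets lebesgue" using assms by (rule fmeasurableD)
  have "(\<lambda>t. (norm (indicator E t *\<^sub>R x))\<^sup>2) = (\<lambda>t. indicat_real E t * (norm x)\<^sup>2)"
    by (auto simp: indicator_def)
  moreover have "integrable lebesgue (indicat_real E)" using assms by (simp add: lmeasurable_iff_integrable)
  ultimately have "integrable lebesgue (\<lambda>t. (norm (indicator E t *\<^sub>R x))\<^sup>2)" by simp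
  then show ?thesis
    using strongly_measurable_indicator_scaleR[OF E strongly_measurable_simple[OF simple_function_const]]
    by (simp add: square_integrable_def)
qed

lemma norm_abs_L2_indicator_power2:
  assumes "E \<in> lmeasurable"
  shows "(norm (abs_L2 (\<lambda>t. indicator E t *\<^sub>R x)))\<^sup>2 = measure lebesgue E * (norm x)\<^sup>2"
proof -
  have "(LINT t|lebesgue. (norm (indicator E t *\<^sub>R x))\<^sup>2) = (LINT t|lebesgue. indicat_real E t * (norm x)\<^sup>2)"
    by (rule Bochner_Integration.integral_cong) (auto simp: indicator_def)
  also have "\<dots> = measure lebesgue E * (norm x)\<^sup>2" by simp
  finally show ?thesis by (simp add: norm_abs_L2_power2 square_integrable_indicator assms)
qed

text \<open>Dynkin's lemma passes from intervals to measurable sets.\<close>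

theorem L2_closed_subspace_eq_UNIV:
  fixes V :: "'b::complex_hilbert L2 set"
  assumes V: "subspace V" "closed V"
    and ivl: "\<And>a b x. a < b \<Longrightarrow> abs_L2 (\<lambda>t. indicator {a<..b} t *\<^sub>R x) \<in> V"
  shows "V = UNIV"
proof -
  have V0: "0 \<in> V" using V(1) by (rule subspace_0)
  have ivl': "abs_L2 (\<lambda>t. indicator {a<..b} t *\<^sub>R x) \<in> V" for a b x
    using ivl[of a b x] V0 by (cases "a < b") (auto simp: zero_L2_def)
  \<comment> \<open>The window keeps all sets of finite measure, so that indicators of complements
    stay in \<open>L2\<close>.\<close>
  have borel: "abs_L2 (\<lambda>t. indicator (E \<inter> {-R<..R}) t *\<^sub>R x) \<in> V" if E: "E \<in> sets borel" for E R x
  proof -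
    let ?I = "{-R<..R}"
    let ?f = "\<lambda>E. abs_L2 (\<lambda>t. indicator (E \<inter> ?I) t *\<^sub>R x)"
    have lm: "E \<inter> ?I \<in> lmeasurable" if "E \<in> sets borel" for E
      using that by (intro lmeasurable_Int_bounded) auto
    have "E \<in> sigma_sets UNIV (range (\<lambda>(a, b). {a<..b::real}))"
      using E unfolding borel_sigma_sets_Ioc by simp
    have Int: "Int_stable (range (\<lambda>(a, b). {a<..b::real}))"
      by (auto simp: Int_stable_def intro!: rev_image_eqI[of "(max _ _, min _ _)"])
    have sets: "A \<in> sets borel" if "A \<in> sigma_sets UNIV (range (\<lambda>(a, b). {a<..b::real}))" for A
      using that unfolding borel_sigma_sets_Ioc by simp
    have union_eq: "?f (A \<union> B) = ?f A + ?f B" if "A \<in> sets borel" "B \<in> sets borel" "A \<inter> B = {}" for A B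
    proof -
      have "(\<lambda>t. indicator ((A \<union> B) \<inter> ?I) t *\<^sub>R x) =
          (\<lambda>t. indicator (A \<inter> ?I) t *\<^sub>R x + indicator (B \<inter> ?I) t *\<^sub>R x)"
        using that(3) by (auto simp: indicator_def fun_eq_iff)
      then show ?thesis by (simp add: abs_L2_add square_integrable_indicator lm that)
    qed
    show ?thesis
      using Int subset_UNIV[of "range (\<lambda>(a, b). {a<..b::real})", folded Pow_UNIV] \<open>E \<in> sigma_sets UNIV (range (\<lambda>(a, b). {a<..b::real}))\<close>
    proof (induction E rule: sigma_sets_induct_disjoint)
      case (basic A)
      then obtain a b where "A = {a<..b}" by auto
      then have "A \<inter> ?I = {max a (-R)<..min b R}" by auto
      then show ?case using ivl' by simp
    next
      case empty
      then show ?case using V0 by (simp add: zero_L2_def)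
    next
      case (compl A)
      have "?f (UNIV :: real set) = ?f (A \<union> (UNIV - A))" by simp
      also have "\<dots> = ?f A + ?f (UNIV - A)"
        by (rule union_eq) (use sets[OF compl(1)] in auto)
      finally have "?f (UNIV - A) = ?f UNIV - ?f A" by simp
      moreover have "?f UNIV \<in> V" using ivl'[of "-R" R x] by simp
      ultimately show ?case using compl(2) V(1) by (simp add: subspace_diff)
    next
      case (union A)
      have A: "A i \<in> sets borel" for i using union(2) sets by blast
      have part: "?f (\<Union>i<n. A i) \<in> V" for n
      proof (induction n)
        case (Suc n)
        have "?f (\<Union>i<Suc n. A i) = ?f ((\<Union>i<n. A i) \<union> A n)" by (simp add: lessThan_Suc Un_commute)
        also have "\<dots> = ?f (\<Union>i<n. A i) + ?f (A n)"
        proof (rule union_eq)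
          have "A i \<inter> A n = {}" if "i < n" for i
            using union(1) that by (simp add: disjoint_family_on_def)
          then show "(\<Union>i<n. A i) \<inter> A n = {}" by blast
        qed (use A in auto)
        finally show ?case using Suc union(3) V(1) by (simp add: subspace_add)
      qed (use V0 in \<open>simp add: zero_L2_def\<close>)
      let ?B = "\<lambda>n. ((\<Union>i. A i) - (\<Union>i<n. A i)) \<inter> ?I"
      have Bm: "((\<Union>i. A i) - (\<Union>i<n. A i)) \<in> sets borel" for n using A by auto
      have diff: "?f (\<Union>i. A i) - ?f (\<Union>i<n. A i) = ?f ((\<Union>i. A i) - (\<Union>i<n. A i))" for n
      proof -
        have "?f (\<Union>i. A i) = ?f ((\<Union>i<n. A i) \<union> ((\<Union>i. A i) - (\<Union>i<n. A i)))"
          by (rule arg_cong[of _ _ ?f]) auto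
        also have "\<dots> = ?f (\<Union>i<n. A i) + ?f ((\<Union>i. A i) - (\<Union>i<n. A i))"
          using Bm A by (intro union_eq) auto
        finally show ?thesis by simp
      qed
      \<comment> \<open>The remainders of the union decrease to the empty set within a set of finite
        measure; continuity from above makes their indicators tend to zero in norm.\<close>
      have "(\<lambda>n. measure lebesgue (?B n)) \<longlonglongrightarrow> measure lebesgue (\<Inter>n. ?B n)"
      proof (rule Lim_measure_decseq)
        show "range ?B \<subseteq> sets lebesgue" using lm[OF Bm] by (auto dest: fmeasurableD)
        show "decseq ?B" by (auto simp: decseq_def)
        show "emeasure lebesgue (?B i) \<noteq> \<infinity>" for i using fmeasurableD2[OF lm[OF Bm]] by simp
      qed
      moreover have "(\<Inter>n. ?B n) = {}" by auto
      ultimately have lim0: "(\<lambda>n. measure lebesgue (?B n)) \<longlonglongrightarrow> 0" by simp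
      have lim: "(\<lambda>n. ?f (\<Union>i<n. A i)) \<longlonglongrightarrow> ?f (\<Union>i. A i)"
      proof -
        have "(\<lambda>n. (norm (?f ((\<Union>i. A i) - (\<Union>i<n. A i))))\<^sup>2) \<longlonglongrightarrow> 0 * (norm x)\<^sup>2"
          unfolding norm_abs_L2_indicator_power2[OF lm[OF Bm]] by (intro tendsto_intros lim0)
        then have "(\<lambda>n. norm (?f ((\<Union>i. A i) - (\<Union>i<n. A i)))) \<longlonglongrightarrow> 0"
          using tendsto_real_sqrt by fastforce
        then have "(\<lambda>n. ?f (\<Union>i. A i) - ?f (\<Union>i<n. A i)) \<longlonglongrightarrow> 0"
          unfolding diff by (rule tendsto_norm_zero_cancel)
        then have "(\<lambda>n. ?f (\<Union>i. A i) - (?f (\<Union>i. A i) - ?f (\<Union>i<n. A i))) \<longlonglongrightarrow> ?f (\<Union>i. A i) - 0"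
          by (intro tendsto_diff tendsto_const)
        then show ?thesis by simp
      qed
      show ?case by (rule closed_sequentially[OF V(2) part lim])
    qed
  qed
  have lebesgue: "abs_L2 (\<lambda>t. indicator E t *\<^sub>R x) \<in> V"
    if E: "E \<in> sets lebesgue" and R: "E \<subseteq> {-R<..R}" for E R x
  proof -
    \<comment> \<open>A Lebesgue measurable set agrees with a Borel set up to a null set, which
      \<open>L2\<close> does not see.\<close>
    have "main_part lborel E \<in> sets borel" using E main_part_sets by fastforce
    then have V': "abs_L2 (\<lambda>t. indicator (main_part lborel E \<inter> {-R<..R}) t *\<^sub>R x) \<in> V" by (rule borel)
    have "main_part lborel E \<inter> {-R<..R} \<in> lmeasurable"
      using \<open>main_part lborel E \<in> sets borel\<close> by (intro lmeasurable_Int_bounded) auto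
    moreover have "AE t in lebesgue. t \<in> main_part lborel E \<longleftrightarrow> t \<in> E"
      using E by (intro AE_completion AE_in_main_part) auto
    then have "AE t in lebesgue. indicator (main_part lborel E \<inter> {-R<..R}) t *\<^sub>R x = indicator E t *\<^sub>R x"
      by eventually_elim (use R in \<open>auto simp: indicator_def\<close>)
    ultimately have "abs_L2 (\<lambda>t. indicator (main_part lborel E \<inter> {-R<..R}) t *\<^sub>R x) = abs_L2 (\<lambda>t. indicator E t *\<^sub>R x)"
      by (intro abs_L2_eqI square_integrable_indicator)
    then show ?thesis using V' by simp
  qed
  have simple: "abs_L2 s \<in> V"
    if s: "simple_function lebesgue s" and R: "\<exists>R. \<forall>t. \<bar>t\<bar> > R \<longrightarrow> s t = 0" for s
  proof -
    obtain R where R: "\<And>t. \<bar>t\<bar> > R \<Longrightarrow> s t = 0" using R by blast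
    have fin: "finite (range s)" using simple_functionD(1)[OF s] by simp
    define E where "E y = s -` {y} \<inter> {-(\<bar>R\<bar>+1)<..\<bar>R\<bar>+1}" for y
    have Em: "E y \<in> sets lebesgue" for y using simple_functionD(2)[OF s, of "{y}"] by (auto simp: E_def)
    have Elm: "E y \<in> lmeasurable" for y
      unfolding E_def using simple_functionD(2)[OF s, of "{y}"]
      by (intro lmeasurable_Int_bounded) auto
    have V': "abs_L2 (\<lambda>t. indicator (E y) t *\<^sub>R y) \<in> V" for y unfolding E_def by (rule lebesgue[OF Em[unfolded E_def] Int_lower2])
    have part: "abs_L2 (\<lambda>t. \<Sum>y\<in>Y. indicator (E y) t *\<^sub>R y) \<in> V \<and> square_integrable (\<lambda>t. \<Sum>y\<in>Y. indicator (E y) t *\<^sub>R y)"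
      if "finite Y" for Y
      using that
    proof induction
      case empty
      then show ?case using V0 by (simp add: zero_L2_def square_integrable_zero)
    next
      case (insert y Y)
      note sq = square_integrable_indicator[OF Elm, of y y] conjunct2[OF insert(3)]
      show ?case
        unfolding sum.insert[OF insert(1,2)] abs_L2_add[OF sq]
        by (intro conjI square_integrable_add sq subspace_add V(1) V' conjunct1[OF insert(3)])
    qed
    have eq: "(\<Sum>y\<in>range s. indicator (E y) t *\<^sub>R y) = s t" for t
    proof -
      have "(\<Sum>y\<in>range s. indicator (E y) t *\<^sub>R y) = (\<Sum>y\<in>range s. if y = s t then s t else 0)"
      proof (rule sum.cong)
        fix y show "indicator (E y) t *\<^sub>R y = (if y = s t then s t else 0)"
          using R[of t] by (cases "\<bar>t\<bar> > R") (auto simp: indicator_def E_def)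
      qed simp
      then show ?thesis using fin by simp
    qed
    show ?thesis using part[OF fin] unfolding eq by simp
  qed
  have "x \<in> V" for x
  proof -
    have "x \<in> closure V"
      unfolding closure_approachable
    proof (intro allI impI)
      fix e :: real assume "e > 0"
      then obtain s where "simple_function lebesgue s" "\<exists>R. \<forall>t. \<bar>t\<bar> > R \<longrightarrow> s t = 0" "norm (abs_L2 s - x) < e"
        by (rule L2_simple_approx)
      then show "\<exists>y\<in>V. dist y x < e" using simple by (auto simp: dist_norm)
    qed
    then show ?thesis using V(2) by simp
  qed
  then show ?thesis by blast
qed

section \<open>Integrals over bounded intervals\<close>

text \<open>On a common fine division the Riemann sums of \<open>f\<close> and \<open>s n\<close>
  differ by at most the Riemann sum of \<open>g n\<close>, hence by little more than its small
  integral. This makes the gauge integral available for vector-valued limits of simple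
  functions.\<close>

lemma HK_integrable_of_approx:
  fixes f :: "real \<Rightarrow> 'b::banach"
  assumes s: "\<And>n. s n integrable_on {a..b}" and g: "\<And>n. g n integrable_on {a..b}"
    and bound: "\<And>n t. t \<in> {a..b} \<Longrightarrow> norm (f t - s n t) \<le> g n t"
    and lim: "(\<lambda>n. integral {a..b} (g n)) \<longlonglongrightarrow> (0::real)"
  shows "f integrable_on {a..b}"
proof -
  define I where "I n = integral {a..b} (s n)" for n
  define d where "d n = integral {a..b} (g n)" for n
  have dist: "norm (I n - I m) \<le> d n + d m" for n m
  proof -
    have "norm (I n - I m) = norm (integral {a..b} (\<lambda>t. s n t - s m t))"
      unfolding I_def by (simp add: integral_diff s)
    also have "\<dots> \<le> integral {a..b} (\<lambda>t. g n t + g m t)"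
    proof (rule integral_norm_bound_integral)
      fix t assume t: "t \<in> {a..b}"
      have "norm (s n t - s m t) \<le> norm (f t - s n t) + norm (f t - s m t)"
        using norm_triangle_ineq4[of "f t - s m t" "f t - s n t"] by (simp add: algebra_simps)
      then show "norm (s n t - s m t) \<le> g n t + g m t" using bound[OF t, of n] bound[OF t, of m] by linarith
    qed (intro integrable_diff integrable_add s g)+
    also have "\<dots> = d n + d m" unfolding d_def by (simp add: integral_add g)
    finally show ?thesis .
  qed
  have "Cauchy I"
  proof (rule CauchyI)
    fix e :: real assume "e > 0"
    then have "eventually (\<lambda>n. d n < e / 2) sequentially" using order_tendstoD(2)[OF lim, of "e/2"] by (simp add: d_def)
    then obtain N where N: "\<And>n. n \<ge> N \<Longrightarrow> d n < e / 2" by (auto simp: eventually_sequentially)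
    have "norm (I m - I n) < e" if "m \<ge> N" "n \<ge> N" for m n
      using dist[of m n] N[OF that(1)] N[OF that(2)] by linarith
    then show "\<exists>M. \<forall>m\<ge>M. \<forall>n\<ge>M. norm (I m - I n) < e" by blast
  qed
  then obtain J where J: "I \<longlonglongrightarrow> J" using Cauchy_convergent convergent_def by blast
  have "(f has_integral J) {a..b}"
    unfolding has_integral_real
  proof (intro allI impI)
    fix e :: real assume e: "e > 0"
    have "eventually (\<lambda>n. d n < e / 4) sequentially"
      using order_tendstoD(2)[OF lim, of "e/4"] e by (simp add: d_def)
    moreover have "eventually (\<lambda>n. norm (I n - J) < e / 4) sequentially"
      using tendstoD[OF J, of "e/4"] e by (simp add: dist_norm)
    ultimately have "eventually (\<lambda>n. d n < e / 4 \<and> norm (I n - J) < e / 4) sequentially" by (rule eventually_conj)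
    then obtain n where n: "d n < e / 4" "norm (I n - J) < e / 4"
      using eventually_happens' sequentially_bot by blast
    have "(s n has_integral I n) {a..b}" "(g n has_integral d n) {a..b}"
      using s g by (auto simp: I_def d_def)
    then obtain \<gamma>1 \<gamma>2 where \<gamma>: "gauge \<gamma>1" "gauge \<gamma>2"
      and \<gamma>1: "\<And>\<D>. \<D> tagged_division_of {a..b} \<Longrightarrow> \<gamma>1 fine \<D> \<Longrightarrow>
        norm ((\<Sum>(x, k)\<in>\<D>. measure lborel k *\<^sub>R s n x) - I n) < e / 4"
      and \<gamma>2: "\<And>\<D>. \<D> tagged_division_of {a..b} \<Longrightarrow> \<gamma>2 fine \<D> \<Longrightarrow>
        norm ((\<Sum>(x, k)\<in>\<D>. measure lborel k *\<^sub>R g n x) - d n) < e / 4"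
      unfolding has_integral_real using e by (metis zero_less_divide_iff zero_less_numeral)
    show "\<exists>\<gamma>. gauge \<gamma> \<and> (\<forall>\<D>. \<D> tagged_division_of {a..b} \<and> \<gamma> fine \<D> \<longrightarrow>
        norm ((\<Sum>(x, k)\<in>\<D>. measure lborel k *\<^sub>R f x) - J) < e)"
    proof (intro exI conjI allI impI)
      show "gauge (\<lambda>x. \<gamma>1 x \<inter> \<gamma>2 x)" using \<gamma> by (rule gauge_Int)
      fix \<D> assume "\<D> tagged_division_of {a..b} \<and> (\<lambda>x. \<gamma>1 x \<inter> \<gamma>2 x) fine \<D>"
      then have D: "\<D> tagged_division_of {a..b}" "\<gamma>1 fine \<D>" "\<gamma>2 fine \<D>" by (auto simp: fine_Int)
      have "(\<Sum>(x, k)\<in>\<D>. measure lborel k *\<^sub>R f x) - (\<Sum>(x, k)\<in>\<D>. measure lborel k *\<^sub>R s n x) =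
          (\<Sum>(x, k)\<in>\<D>. measure lborel k *\<^sub>R (f x - s n x))"
        by (simp add: sum_subtractf split_def scaleR_diff_right)
      then have "norm ((\<Sum>(x, k)\<in>\<D>. measure lborel k *\<^sub>R f x) - (\<Sum>(x, k)\<in>\<D>. measure lborel k *\<^sub>R s n x)) \<le>
          (\<Sum>(x, k)\<in>\<D>. norm (measure lborel k *\<^sub>R (f x - s n x)))"
        using norm_sum[of "\<lambda>(x, k). measure lborel k *\<^sub>R (f x - s n x)" \<D>] by (simp add: split_def)
      also have "\<dots> \<le> (\<Sum>(x, k)\<in>\<D>. measure lborel k *\<^sub>R g n x)"
      proof (rule sum_mono)
        fix p assume p: "p \<in> \<D>"
        obtain x k where xk: "p = (x, k)" by (cases p)
        have "x \<in> {a..b}" using D(1) p xk by (meson subsetD tag_in_interval tagged_division_ofD(2,3))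
        then show "(case p of (x, k) \<Rightarrow> norm (measure lborel k *\<^sub>R (f x - s n x))) \<le> (case p of (x, k) \<Rightarrow> measure lborel k *\<^sub>R g n x)"
          using bound[of x n] by (simp add: xk mult_left_mono)
      qed
      also have "\<dots> < e / 2" using \<gamma>2[OF D(1,3)] n(1) unfolding real_norm_def by linarith
      finally have 1: "norm ((\<Sum>(x, k)\<in>\<D>. measure lborel k *\<^sub>R f x) - (\<Sum>(x, k)\<in>\<D>. measure lborel k *\<^sub>R s n x)) < e / 2" .
      show "norm ((\<Sum>(x, k)\<in>\<D>. measure lborel k *\<^sub>R f x) - J) < e"
        using 1 \<gamma>1[OF D(1,2)] n(2)
          norm_triangle_ineq[of "(\<Sum>(x, k)\<in>\<D>. measure lborel k *\<^sub>R f x) - (\<Sum>(x, k)\<in>\<D>. measure lborel k *\<^sub>R s n x)"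
            "(\<Sum>(x, k)\<in>\<D>. measure lborel k *\<^sub>R s n x) - I n + (I n - J)"]
          norm_triangle_ineq[of "(\<Sum>(x, k)\<in>\<D>. measure lborel k *\<^sub>R s n x) - I n" "I n - J"]
        by simp
    qed
  qed
  then show ?thesis by (rule has_integral_integrable)
qed

lemma simple_function_integrable_on:
  fixes s :: "real \<Rightarrow> 'b::banach"
  assumes "simple_function lebesgue s"
  shows "s integrable_on {a..b}"
proof -
  have fin: "finite (range s)" using simple_functionD(1)[OF assms] by simp
  have lm: "s -` {y} \<inter> {a..b} \<in> lmeasurable" for y
    using simple_functionD(2)[OF assms, of "{y}"]
    by (intro lmeasurable_Int_bounded) auto
  have "(\<Sum>y\<in>range s. indicator (s -` {y}) t *\<^sub>R y) = s t" for t
  proof -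
    have "(\<Sum>y\<in>range s. indicator (s -` {y}) t *\<^sub>R y) = (\<Sum>y\<in>range s. if y = s t then s t else 0)"
      by (rule sum.cong) (auto simp: indicator_def)
    then show ?thesis using fin by simp
  qed
  moreover have "(\<lambda>t. \<Sum>y\<in>range s. indicator (s -` {y}) t *\<^sub>R y) integrable_on {a..b}"
  proof (intro integrable_sum fin integrable_on_scaleR_left)
    show "(indicat_real (s -` {y})) integrable_on {a..b}" for y using lm by (simp add: integrable_on_indicator)
  qed
  ultimately show ?thesis by simp
qed

lemma square_integrable_norm_integrable_on:
  fixes f :: "real \<Rightarrow> 'b::complex_hilbert"
  assumes f: "square_integrable f" and "a \<le> b"
  shows "(\<lambda>t. norm (f t)) integrable_on {a..b}"
    and "integral {a..b} (\<lambda>t. norm (f t)) \<le> sqrt (b - a) * norm (abs_L2 f)"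
proof -
  have sq: "(\<lambda>t. (norm (f t))\<^sup>2) integrable_on {a..b}"
    using f integrable_on_lebesgue[of "\<lambda>t. (norm (f t))\<^sup>2"] unfolding square_integrable_def
    by (meson integrable_on_subinterval subset_UNIV)
  have sqle: "integral {a..b} (\<lambda>t. (norm (f t))\<^sup>2) \<le> (norm (abs_L2 f))\<^sup>2"
  proof -
    have "integral {a..b} (\<lambda>t. (norm (f t))\<^sup>2) \<le> integral UNIV (\<lambda>t. (norm (f t))\<^sup>2)"
      using sq f integrable_on_lebesgue[of "\<lambda>t. (norm (f t))\<^sup>2"] unfolding square_integrable_def
      by (intro integral_subset_le) auto
    then show ?thesis
      using f by (simp add: norm_abs_L2_power2 square_integrable_def integral_lebesgue)
  qed
  have int: "integrable (lebesgue_on {a..b}) (\<lambda>t. norm (f t))"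
  proof (rule Bochner_Integration.integrable_bound)
    show "integrable (lebesgue_on {a..b}) (\<lambda>t. 1 + (norm (f t))\<^sup>2)"
    proof (rule Bochner_Integration.integrable_add)
      show "integrable (lebesgue_on {a..b}) (\<lambda>t. 1::real)"
        by (rule finite_measure.integrable_const[OF finite_measure_lebesgue_on]) simp
      show "integrable (lebesgue_on {a..b}) (\<lambda>t. (norm (f t))\<^sup>2)"
        using f integrable_mult_indicator[of "{a..b}" lebesgue "\<lambda>t. (norm (f t))\<^sup>2"]
        by (simp add: integrable_restrict_space square_integrable_def)
    qed
    show "(\<lambda>t. norm (f t)) \<in> borel_measurable (lebesgue_on {a..b})"
      using f strongly_measurable_norm[of f] by (simp add: square_integrable_def measurable_restrict_space1)
    have "norm (f t) \<le> 1 + (norm (f t))\<^sup>2" for t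
      using sum_squares_bound[of 1 "norm (f t)"] norm_ge_zero[of "f t"] unfolding power_one by linarith
    then show "AE t in lebesgue_on {a..b}. norm (norm (f t)) \<le> norm (1 + (norm (f t))\<^sup>2)" by simp
  qed
  then show n: "(\<lambda>t. norm (f t)) integrable_on {a..b}" by (rule integrable_on_lebesgue_on) simp
  have "integral {a..b} (\<lambda>t. norm (f t)) \<le> sqrt (b - a) * sqrt ((norm (abs_L2 f))\<^sup>2)"
  proof (rule le_sqrt_mult_of_weighted)
    fix r :: real assume r: "r > 0"
    have "integral {a..b} (\<lambda>t. norm (f t)) \<le> integral {a..b} (\<lambda>t. r / 2 + (1 / (2 * r)) * (norm (f t))\<^sup>2)"
    proof (rule integral_le[OF n])
      show "(\<lambda>t. r / 2 + (1 / (2 * r)) * (norm (f t))\<^sup>2) integrable_on {a..b}"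
        by (intro integrable_add integrable_const_ivl integrable_on_mult_right sq)
      fix t
      have "0 \<le> (r - norm (f t))\<^sup>2 / (2 * r)" using r by simp
      also have "\<dots> = r / 2 + (1 / (2 * r)) * (norm (f t))\<^sup>2 - norm (f t)"
        using r by (simp add: power2_eq_square field_simps)
      finally show "norm (f t) \<le> r / 2 + (1 / (2 * r)) * (norm (f t))\<^sup>2" by simp
    qed
    also have "\<dots> = r / 2 * (b - a) + (1 / (2 * r)) * integral {a..b} (\<lambda>t. (norm (f t))\<^sup>2)"
      using \<open>a \<le> b\<close>
        integral_add[OF integrable_const_ivl integrable_on_mult_right[OF sq], of "r / 2" "1 / (2 * r)"] by simp
    also have "\<dots> \<le> r / 2 * (b - a) + (1 / (2 * r)) * (norm (abs_L2 f))\<^sup>2"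
      using r sqle by (intro add_left_mono mult_left_mono) auto
    finally show "2 * integral {a..b} (\<lambda>t. norm (f t)) \<le> r * (b - a) + (norm (abs_L2 f))\<^sup>2 / r"
      using r by (simp add: field_simps)
  qed (use \<open>a \<le> b\<close> in auto)
  then show "integral {a..b} (\<lambda>t. norm (f t)) \<le> sqrt (b - a) * norm (abs_L2 f)" by simp
qed

lemma square_integrable_integrable_on:
  fixes f :: "real \<Rightarrow> 'b::complex_hilbert"
  assumes f: "square_integrable f" and ab: "a \<le> b"
  shows "f integrable_on {a..b}"
    and "norm (integral {a..b} f) \<le> sqrt (b - a) * norm (abs_L2 f)"
proof -
  obtain s where s: "\<And>n. simple_function lebesgue (s n)" "\<And>n. square_integrable (s n)"
    "\<And>n t. \<bar>t\<bar> > real n \<Longrightarrow> s n t = 0" "(\<lambda>n. LINT t|lebesgue. (norm (s n t - f t))\<^sup>2) \<longlonglongrightarrow> 0"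
    by (rule square_integrable_simple_approx[OF f]) (rule that)
  have sq: "square_integrable (\<lambda>t. s n t - f t)" for n by (rule square_integrable_diff[OF s(2) f])
  show i: "f integrable_on {a..b}"
  proof (rule HK_integrable_of_approx[where s = s and g = "\<lambda>n t. norm (s n t - f t)"])
    show "s n integrable_on {a..b}" for n by (rule simple_function_integrable_on[OF s(1)])
    show "(\<lambda>t. norm (s n t - f t)) integrable_on {a..b}" for n
      by (rule square_integrable_norm_integrable_on[OF sq ab])
    show "(\<lambda>n. integral {a..b} (\<lambda>t. norm (s n t - f t))) \<longlonglongrightarrow> 0"
    proof (rule Lim_null_comparison)
      have "norm (integral {a..b} (\<lambda>t. norm (s n t - f t))) \<le> sqrt (b - a) * sqrt (LINT t|lebesgue. (norm (s n t - f t))\<^sup>2)" for n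
      proof -
        have "integral {a..b} (\<lambda>t. norm (s n t - f t)) \<ge> 0" by (rule integral_nonneg)
            (auto intro: square_integrable_norm_integrable_on[OF sq ab])
        moreover have "norm (abs_L2 (\<lambda>t. s n t - f t)) = sqrt (LINT t|lebesgue. (norm (s n t - f t))\<^sup>2)"
          using norm_abs_L2_power2[OF sq[of n]] by (metis norm_ge_zero real_sqrt_abs abs_of_nonneg)
        ultimately show ?thesis using square_integrable_norm_integrable_on(2)[OF sq ab, of n] by simp
      qed
      then show "eventually (\<lambda>n. norm (integral {a..b} (\<lambda>t. norm (s n t - f t))) \<le>
          sqrt (b - a) * sqrt (LINT t|lebesgue. (norm (s n t - f t))\<^sup>2)) sequentially" by simp
      show "(\<lambda>n. sqrt (b - a) * sqrt (LINT t|lebesgue. (norm (s n t - f t))\<^sup>2)) \<longlonglongrightarrow> 0"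
        using tendsto_mult[OF tendsto_const tendsto_real_sqrt[OF s(4)], of "sqrt (b - a)"] by simp
    qed
  qed (simp add: norm_minus_commute)
  have "norm (integral {a..b} f) \<le> integral {a..b} (\<lambda>t. norm (f t))"
    by (rule integral_norm_bound_integral[OF i square_integrable_norm_integrable_on(1)[OF f ab]]) simp
  then show "norm (integral {a..b} f) \<le> sqrt (b - a) * norm (abs_L2 f)"
    using square_integrable_norm_integrable_on(2)[OF f ab] by linarith
qed

lemma negligible_of_AE: "AE t in lebesgue. P t \<Longrightarrow> negligible {t. \<not> P t}"
  unfolding completion.AE_iff_null_sets by (simp add: negligible_iff_null_sets)

lemma integral_AE_cong:
  fixes f g :: "real \<Rightarrow> 'b::banach"
  assumes "AE t in lebesgue. t \<in> S \<longrightarrow> f t = g t"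
  shows "integral S f = integral S g" "f integrable_on S \<longleftrightarrow> g integrable_on S"
proof -
  have N: "negligible {t. \<not> (t \<in> S \<longrightarrow> f t = g t)}" using assms by (rule negligible_of_AE)
  show "integral S f = integral S g" by (rule integral_spike[OF N]) auto
  show "f integrable_on S \<longleftrightarrow> g integrable_on S" 
    using integrable_spike[OF _ N, of f S g] integrable_spike[OF _ N, of g S f] by auto
qed

text \<open>Meant for kernels such as \<open>G (t - s)\<close>, which are continuous only on each
  vector: the uniform bound \<open>M\<close> makes \<open>k s x\<close> jointly sequentially
  continuous, and this gives strong measurability of the integrand.\<close>

lemma strongly_continuous_integral:
  fixes k :: "real \<Rightarrow> 'b::complex_hilbert \<Rightarrow> 'c::complex_hilbert"
  assumes T: "0 \<le> T" and M: "0 \<le> M"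
    and lin: "\<And>s. 0 \<le> s \<Longrightarrow> s \<le> T \<Longrightarrow> linear (k s)"
    and bound: "\<And>s x. 0 \<le> s \<Longrightarrow> s \<le> T \<Longrightarrow> norm (k s x) \<le> M * norm x"
    and cont: "\<And>x. continuous_on {0..T} (\<lambda>s. k s x)"
    and f: "square_integrable f"
  shows "(\<lambda>s. k s (f s)) integrable_on {0..T}"
    and "norm (integral {0..T} (\<lambda>s. k s (f s))) \<le> M * sqrt T * norm (abs_L2 f)"
proof -
  \<comment> \<open>Clamps time to \<open>{0..T}\<close>, so that the kernel makes sense and is
    continuous on the whole line.\<close>
  define p where "p s = max 0 (min T s)" for s
  have p: "p s \<in> {0..T}" for s using T by (auto simp: p_def)
  have pid: "p s = s" if "s \<in> {0..T}" for s using that by (auto simp: p_def)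
  have sm: "strongly_measurable lebesgue (\<lambda>s. k (p s) (f s))"
  proof (rule strongly_measurable_compose2[where h = "\<lambda>s. k (p s)" and f = "\<lambda>s. s" and g = f])
    show "strongly_measurable lebesgue (\<lambda>s::real. s)" 
      unfolding strongly_measurable_lebesgue_real_iff by (rule measurable_completion) simp
    show "strongly_measurable lebesgue f" using f by (simp add: square_integrable_def)
    fix u v and x :: real and y :: 'b assume u: "u \<longlonglongrightarrow> x" and v: "v \<longlonglongrightarrow> y"
    have "(\<lambda>n. p (u n)) \<longlonglongrightarrow> p x" unfolding p_def by (intro tendsto_intros u)
    then have "(\<lambda>n. k (p (u n)) y) \<longlonglongrightarrow> k (p x) y"
      using continuous_on_tendsto_compose[OF cont, of "\<lambda>n. p (u n)" "p x" sequentially y] p by simp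
    moreover have "(\<lambda>n. k (p (u n)) (v n - y)) \<longlonglongrightarrow> 0"
    proof (rule Lim_null_comparison)
      show "(\<lambda>n. M * norm (v n - y)) \<longlonglongrightarrow> 0"
        using tendsto_mult_right_zero[OF tendsto_norm_zero[OF LIM_zero[OF v]]] by simp
      show "eventually (\<lambda>n. norm (k (p (u n)) (v n - y)) \<le> M * norm (v n - y)) sequentially"
        using bound p by simp
    qed
    ultimately have "(\<lambda>n. k (p (u n)) (v n - y) + k (p (u n)) y) \<longlonglongrightarrow> 0 + k (p x) y" by (intro tendsto_add)
    moreover have "k (p (u n)) (v n - y) + k (p (u n)) y = k (p (u n)) (v n)" for n
      using lin[of "p (u n)"] p[of "u n"] by (simp add: linear_diff)
    ultimately show "(\<lambda>n. k (p (u n)) (v n)) \<longlonglongrightarrow> k (p x) y" by simp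
  qed
  have sq: "square_integrable (\<lambda>s. k (p s) (f s))"
    by (rule square_integrable_bound[OF sm f, of M]) (use bound p in simp)
  have eq: "k (p s) (f s) = k s (f s)" if "s \<in> {0..T}" for s using pid[OF that] by simp
  have "(\<lambda>s. k (p s) (f s)) integrable_on {0..T}" by (rule square_integrable_integrable_on[OF sq T])
  then show "(\<lambda>s. k s (f s)) integrable_on {0..T}" by (rule integrable_eq) (rule eq)
  have "integral {0..T} (\<lambda>s. k s (f s)) = integral {0..T} (\<lambda>s. k (p s) (f s))"
    by (rule integral_cong) (simp add: eq)
  then have "norm (integral {0..T} (\<lambda>s. k s (f s))) \<le> sqrt T * norm (abs_L2 (\<lambda>s. k (p s) (f s)))"
    using square_integrable_integrable_on(2)[OF sq T] by simp
  also have "norm (abs_L2 (\<lambda>s. k (p s) (f s))) \<le> M * norm (abs_L2 f)"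
  proof -
    have "(norm (abs_L2 (\<lambda>s. k (p s) (f s))))\<^sup>2 \<le> (LINT s|lebesgue. M\<^sup>2 * (norm (f s))\<^sup>2)"
      unfolding norm_abs_L2_power2[OF sq]
    proof (rule integral_mono)
      show "(norm (k (p s) (f s)))\<^sup>2 \<le> M\<^sup>2 * (norm (f s))\<^sup>2" for s
        using power_mono[OF bound[of "p s" "f s"], of 2] p[of s] by (simp add: power_mult_distrib)
    qed (use sq f in \<open>simp_all add: square_integrable_def\<close>)
    also have "\<dots> = (M * norm (abs_L2 f))\<^sup>2" by (simp add: norm_abs_L2_power2[OF f] power_mult_distrib)
    finally show ?thesis by (rule power2_le_imp_le) (use M in simp)
  qed
  finally show "norm (integral {0..T} (\<lambda>s. k s (f s))) \<le> M * sqrt T * norm (abs_L2 f)"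
    using T by (simp add: mult.assoc mult.left_commute mult_left_mono)
qed

lemma bounded_linear_strongly_continuous_integral:
  fixes k :: "real \<Rightarrow> 'b::complex_hilbert \<Rightarrow> 'c::complex_hilbert"
  assumes T: "0 \<le> T" and M: "0 \<le> M"
    and lin: "\<And>s. 0 \<le> s \<Longrightarrow> s \<le> T \<Longrightarrow> linear (k s)"
    and bound: "\<And>s x. 0 \<le> s \<Longrightarrow> s \<le> T \<Longrightarrow> norm (k s x) \<le> M * norm x"
    and cont: "\<And>x. continuous_on {0..T} (\<lambda>s. k s x)"
  shows "bounded_linear (\<lambda>x. integral {0..T} (\<lambda>s. k s (rep_L2 x s)))"
proof (rule bounded_linear_intro)
  note i = strongly_continuous_integral[OF T M lin bound cont square_integrable_rep]
  fix x y :: "'b L2" and r :: real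
  have "integral {0..T} (\<lambda>s. k s (rep_L2 (x + y) s)) = integral {0..T} (\<lambda>s. k s (rep_L2 x s) + k s (rep_L2 y s))"
    by (rule integral_AE_cong) (use rep_plus_L2[of x y] in eventually_elim, use lin in \<open>simp add: linear_add\<close>)
  then show "integral {0..T} (\<lambda>s. k s (rep_L2 (x + y) s)) = integral {0..T} (\<lambda>s. k s (rep_L2 x s)) + integral {0..T} (\<lambda>s. k s (rep_L2 y s))"
    by (simp add: integral_add i)
  have "integral {0..T} (\<lambda>s. k s (rep_L2 (r *\<^sub>R x) s)) = integral {0..T} (\<lambda>s. r *\<^sub>R k s (rep_L2 x s))"
    by (rule integral_AE_cong) (use rep_scaleR_L2[of r x] in eventually_elim, use lin in \<open>simp add: linear_scale\<close>)
  then show "integral {0..T} (\<lambda>s. k s (rep_L2 (r *\<^sub>R x) s)) = r *\<^sub>R integral {0..T} (\<lambda>s. k s (rep_L2 x s))" by simp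
  show "norm (integral {0..T} (\<lambda>s. k s (rep_L2 x s))) \<le> norm x * (M * sqrt T)"
    using i(2)[of x] by (simp add: mult.commute)
qed

section \<open>Strongly continuous semigroups\<close>

locale c0_semigroup =
  fixes G :: "real \<Rightarrow> 'h::complex_hilbert \<Rightarrow> 'h"
  assumes C0: "C0_semigroup G"
begin

lemma clinear: "0 \<le> t \<Longrightarrow> bounded_clinear (G t)"
  and zero [simp]: "G 0 x = x"
  and add: "0 \<le> s \<Longrightarrow> 0 \<le> t \<Longrightarrow> G (s + t) x = G s (G t x)"
  and tendsto_right_zero: "((\<lambda>t. G t x) \<longlongrightarrow> x) (at_right 0)"
  using C0 by (auto simp: C0_semigroup_def)

lemma bounded_linear: "0 \<le> t \<Longrightarrow> bounded_linear (G t)"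
  by (rule bounded_clinear_linear[OF clinear])

lemma linear: "0 \<le> t \<Longrightarrow> linear (G t)"
  by (rule bounded_linear.linear[OF bounded_linear])

lemmas G_add = linear_add[OF linear]
lemmas G_diff = linear_diff[OF linear]
lemmas G_scaleR = linear_scale[OF linear]
lemmas G_scaleC = bounded_clinear_scaleC[OF clinear]

lemma commute: "0 \<le> s \<Longrightarrow> 0 \<le> t \<Longrightarrow> G s (G t x) = G t (G s x)"
  using add[of s t x] add[of t s x] by (simp add: add.commute)

text \<open>A failing bound yields times tending to zero with exploding operator norms, although
  every orbit converges along them. The supremum over these times is a countably subadditive
  seminorm, and its boundedness is the uniform boundedness principle.\<close>

lemma bounded_near_zero: "\<exists>\<delta>>0. \<exists>M. \<forall>t x. 0 \<le> t \<longrightarrow> t \<le> \<delta> \<longrightarrow> norm (G t x) \<le> M * norm x"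
proof (rule ccontr)
  assume neg: "\<not> ?thesis"
  have "\<exists>t x. 0 \<le> t \<and> t \<le> 1 / Suc n \<and> norm (G t x) > real n * norm x" for n
    using neg by (metis not_le_imp_less of_nat_0_less_iff zero_less_Suc zero_less_divide_1_iff)
  then obtain t x where tx: "\<And>n. 0 \<le> t n" "\<And>n. t n \<le> 1 / Suc n" "\<And>n. norm (G (t n) (x n)) > real n * norm (x n)"
    by metis
  have tlim: "t \<longlonglongrightarrow> 0"
    by (rule Lim_null_comparison[OF _ LIMSEQ_inverse_real_of_nat]) (use tx in \<open>simp add: inverse_eq_divide\<close>)
  have lim: "(\<lambda>n. G (t n) y) \<longlonglongrightarrow> y" for y
  proof (rule tendstoI)
    fix e :: real assume e: "e > 0"
    have "eventually (\<lambda>s. dist (G s y) y < e) (at_right 0)" by (rule tendstoD[OF tendsto_right_zero e])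
    then obtain d where d: "d > 0" "\<And>s. 0 < s \<Longrightarrow> s < d \<Longrightarrow> dist (G s y) y < e"
      by (auto simp: eventually_at_right_field)
    have "eventually (\<lambda>n. t n < d) sequentially" by (rule order_tendstoD(2)[OF tlim d(1)])
    then show "eventually (\<lambda>n. dist (G (t n) y) y < e) sequentially"
    proof eventually_elim
      case (elim n)
      show ?case using d(2)[of "t n"] elim tx(1)[of n] e by (cases "t n = 0") auto
    qed
  qed
  define q where "q y = (SUP n. norm (G (t n) y))" for y
  have bdd: "bdd_above (range (\<lambda>n. norm (G (t n) y)))" for y
    using convergent_imp_Bseq[OF convergentI[OF lim[of y]]]
    by (auto simp: Bseq_def bdd_above_def)
  have qu: "norm (G (t n) y) \<le> q y" for n y unfolding q_def by (rule cSUP_upper[OF _ bdd]) simp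
  have ql: "q y \<le> c" if "\<And>n. norm (G (t n) y) \<le> c" for y c unfolding q_def by (rule cSUP_least) (use that in auto)
  have "\<exists>C>0. \<forall>x. q x \<le> C * norm x"
  proof (rule countably_subadditive_seminorm_bounded)
    fix c :: real and y
    have le: "q (c *\<^sub>R y) \<le> \<bar>c\<bar> * q y" for c y
      by (rule ql) (use tx(1) qu in \<open>simp add: G_scaleR mult_left_mono\<close>)
    show "q (c *\<^sub>R y) = \<bar>c\<bar> * q y"
    proof (cases "c = 0")
      case True
      then show ?thesis using le[of 0 y] qu[of 0 "0 *\<^sub>R y"] by (simp add: order_antisym order_trans[OF norm_ge_zero])
    next
      case False
      have "q y \<le> \<bar>inverse c\<bar> * q (c *\<^sub>R y)" using le[of "inverse c" "c *\<^sub>R y"] False by simp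
      then have "\<bar>c\<bar> * q y \<le> q (c *\<^sub>R y)" using False by (simp add: field_simps)
      then show ?thesis using le[of c y] by simp
    qed
  next
    fix y z
    show "q (y + z) \<le> q y + q z"
    proof (rule ql)
      show "norm (G (t n) (y + z)) \<le> q y + q z" for n
        using norm_triangle_ineq[of "G (t n) y" "G (t n) z"] qu[of n y] qu[of n z] tx(1)[of n] by (simp add: G_add)
    qed
  next
    fix y :: "nat \<Rightarrow> 'h"
    assume 1: "summable (\<lambda>n. norm (y n))" and 2: "summable (\<lambda>n. q (y n))"
    show "q (\<Sum>n. y n) \<le> (\<Sum>n. q (y n))"
    proof (rule ql)
      fix n
      interpret Gn: bounded_linear "G (t n)" by (rule bounded_linear[OF tx(1)])
      have "G (t n) (\<Sum>k. y k) = (\<Sum>k. G (t n) (y k))" by (rule Gn.suminf[OF summable_norm_cancel[OF 1]])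
      moreover have s: "summable (\<lambda>k. norm (G (t n) (y k)))"
        by (rule summable_comparison_test'[OF 2]) (use qu in simp)
      ultimately show "norm (G (t n) (\<Sum>n. y n)) \<le> (\<Sum>n. q (y n))"
        using summable_norm[OF s] suminf_le[OF qu s 2] by simp
    qed
  qed
  then obtain C where C: "\<And>x. q x \<le> C * norm x" by blast
  obtain n :: nat where n: "C \<le> real n" using real_arch_simple by blast
  have "norm (G (t n) (x n)) \<le> real n * norm (x n)"
    using qu[of n "x n"] C[of "x n"] mult_right_mono[OF n norm_ge_zero[of "x n"]] by linarith
  then show False using tx(3)[of n] by simp
qed

text \<open>The semigroup law propagates the bound near zero in steps of \<open>\<delta>\<close>,
  one factor \<open>M\<close> per step; \<open>M \<ge> 1\<close> lets shorter times share the
  constant.\<close>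

lemma bounded_on: "\<exists>M\<ge>1. \<forall>t x. 0 \<le> t \<longrightarrow> t \<le> T \<longrightarrow> norm (G t x) \<le> M * norm x"
proof -
  obtain \<delta> M0 where \<delta>: "\<delta> > 0" and M0: "\<And>t x. 0 \<le> t \<Longrightarrow> t \<le> \<delta> \<Longrightarrow> norm (G t x) \<le> M0 * norm x"
    using bounded_near_zero by blast
  define M where "M = max 1 M0"
  have M1: "M \<ge> 1" by (simp add: M_def)
  have M: "norm (G t x) \<le> M * norm x" if "0 \<le> t" "t \<le> \<delta>" for t x
    using M0[OF that, of x] mult_right_mono[of M0 M "norm x"] by (simp add: M_def)
  have step: "norm (G t x) \<le> M^(Suc n) * norm x" if "0 \<le> t" "t \<le> real (Suc n) * \<delta>" for t x n
    using that
  proof (induction n arbitrary: t)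
    case 0
    then show ?case using M[of t x] by simp
  next
    case (Suc n)
    show ?case
    proof (cases "t \<le> \<delta>")
      case True
      have "M * norm x \<le> M^Suc (Suc n) * norm x"
        by (intro mult_right_mono self_le_power[OF M1]) auto
      then show ?thesis using M[OF Suc.prems(1) True, of x] by linarith
    next
      case False
      have "G t x = G \<delta> (G (t - \<delta>) x)" using add[of \<delta> "t - \<delta>" x] False \<delta> by simp
      then have "norm (G t x) \<le> M * norm (G (t - \<delta>) x)" using M[of \<delta>] \<delta> by simp
      also have "\<dots> \<le> M * (M^Suc n * norm x)"
        using Suc.IH[of "t - \<delta>"] False Suc.prems M1 by (intro mult_left_mono) (auto simp: algebra_simps)
      finally show ?thesis by (simp add: mult.assoc)
    qed
  qed
  obtain n where n: "T / \<delta> \<le> real n" using real_arch_simple by blast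
  have T: "T \<le> real (Suc n) * \<delta>" using n \<delta> by (simp add: field_simps)
  show ?thesis
  proof (intro exI[of _ "M^Suc n"] conjI allI impI)
    show "1 \<le> M^Suc n" by (rule one_le_power[OF M1])
    show "norm (G t x) \<le> M^Suc n * norm x" if "0 \<le> t" "t \<le> T" for t x
      by (rule step) (use that T in linarith)+
  qed
qed

lemma continuous_on_orbit: "continuous_on {0..} (\<lambda>t. G t x)"
  unfolding continuous_on_eq_continuous_within
proof
  fix t :: real assume "t \<in> {0..}"
  then have t: "0 \<le> t" by simp
  obtain M where M: "M \<ge> 1" "\<And>s y. 0 \<le> s \<Longrightarrow> s \<le> t + 1 \<Longrightarrow> norm (G s y) \<le> M * norm y"
    using bounded_on by blast
  \<comment> \<open>Continuity from both sides reduces to the increment at time zero: factor out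
    \<open>G\<close> at the smaller of the two times.\<close>
  have est: "norm (G s x - G t x) \<le> M * norm (G \<bar>s - t\<bar> x - x)" if "0 \<le> s" "s \<le> t + 1" for s
  proof (cases "s \<le> t")
    case True
    have "G t x = G s (G (t - s) x)" using add[of s "t - s" x] that True by simp
    then have "G s x - G t x = G s (x - G (t - s) x)" using that by (simp add: G_diff)
    then show ?thesis using M(2)[of s "x - G (t - s) x"] that True by (simp add: norm_minus_commute)
  next
    case False
    have "G s x = G t (G (s - t) x)" using add[of t "s - t" x] t False by simp
    then have "G s x - G t x = G t (G (s - t) x - x)" using t by (simp add: G_diff)
    then show ?thesis using M(2)[of t "G (s - t) x - x"] t False by simp
  qed
  have lim: "((\<lambda>s. G \<bar>s - t\<bar> x) \<longlongrightarrow> x) (at t within {0..})"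
  proof (rule tendstoI)
    fix e :: real assume e: "e > 0"
    have "eventually (\<lambda>s. dist (G s x) x < e) (at_right 0)" by (rule tendstoD[OF tendsto_right_zero e])
    then obtain d where d: "d > 0" "\<And>s. 0 < s \<Longrightarrow> s < d \<Longrightarrow> dist (G s x) x < e"
      by (auto simp: eventually_at_right_field)
    show "eventually (\<lambda>s. dist (G \<bar>s - t\<bar> x) x < e) (at t within {0..})"
      unfolding eventually_at using d by (intro exI[of _ d]) (auto simp: dist_real_def)
  qed
  have "((\<lambda>s. G s x - G t x) \<longlongrightarrow> 0) (at t within {0..})"
  proof (rule Lim_null_comparison)
    show "((\<lambda>s. M * norm (G \<bar>s - t\<bar> x - x)) \<longlongrightarrow> 0) (at t within {0..})"
      by (rule tendsto_mult_right_zero[OF tendsto_norm_zero[OF LIM_zero[OF lim]]])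
    show "eventually (\<lambda>s. norm (G s x - G t x) \<le> M * norm (G \<bar>s - t\<bar> x - x)) (at t within {0..})"
      unfolding eventually_at by (intro exI[of _ 1]) (auto simp: dist_real_def intro!: est)
  qed
  then show "continuous (at t within {0..}) (\<lambda>t. G t x)"
    unfolding continuous_within by (rule LIM_zero_cancel)
qed

lemma continuous_on_G: "S \<subseteq> {0..} \<Longrightarrow> continuous_on S (\<lambda>t. G t x)"
  by (rule continuous_on_subset[OF continuous_on_orbit])

lemma continuous_on_G_compose:
  "continuous_on S f \<Longrightarrow> (\<And>s. s \<in> S \<Longrightarrow> 0 \<le> f s) \<Longrightarrow> continuous_on S (\<lambda>s. G (f s) x)"
  by (rule continuous_on_compose2[OF continuous_on_orbit]) auto

text \<open>The integrated semigroup. It trades the unbounded generator for bounded operators: by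
  \<open>difference_quotient_iff\<close>, \<open>x\<close> lies in the domain with image
  \<open>y\<close> exactly when \<open>G t x - x = int_orbit t y\<close> for all
  \<open>t \<ge> 0\<close>.\<close>

definition int_orbit :: "real \<Rightarrow> 'h \<Rightarrow> 'h"
  where "int_orbit t x = integral {0..t} (\<lambda>s. G s x)"

lemma integrable_orbit: "0 \<le> a \<Longrightarrow> (\<lambda>s. G s x) integrable_on {a..b}"
  by (rule integrable_continuous_real[OF continuous_on_G]) auto

lemma int_orbit_zero [simp]: "int_orbit 0 x = 0"
  by (simp add: int_orbit_def)

lemma int_orbit_combine: "0 \<le> s \<Longrightarrow> s \<le> t \<Longrightarrow> int_orbit t x - int_orbit s x = integral {s..t} (\<lambda>r. G r x)"
  unfolding int_orbit_def using Henstock_Kurzweil_Integration.integral_combine[where a = 0 and c = s and b = t and f = "\<lambda>r. G r x"]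
    integrable_orbit[where a = 0 and b = t and x = x] by (simp add: diff_eq_eq add.commute)

lemma bounded_linear_int_orbit:
  assumes "0 \<le> t"
  shows "bounded_linear (int_orbit t)"
proof -
  obtain M where M: "M \<ge> 1" "\<And>s y. 0 \<le> s \<Longrightarrow> s \<le> t \<Longrightarrow> norm (G s y) \<le> M * norm y"
    using bounded_on by blast
  show ?thesis
  proof (rule bounded_linear_intro)
    fix x y and r :: real
    have "int_orbit t (x + y) = integral {0..t} (\<lambda>s. G s x + G s y)"
      unfolding int_orbit_def by (rule integral_cong) (simp add: G_add)
    then show "int_orbit t (x + y) = int_orbit t x + int_orbit t y"
      by (simp add: int_orbit_def integral_add integrable_orbit)
    have "int_orbit t (r *\<^sub>R x) = integral {0..t} (\<lambda>s. r *\<^sub>R G s x)"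
      unfolding int_orbit_def by (rule integral_cong) (simp add: G_scaleR)
    then show "int_orbit t (r *\<^sub>R x) = r *\<^sub>R int_orbit t x" by (simp add: int_orbit_def)
    have "norm (int_orbit t x) \<le> integral {0..t} (\<lambda>s. M * norm x)"
      unfolding int_orbit_def by (rule integral_norm_bound_integral) (auto intro: integrable_orbit M)
    then show "norm (int_orbit t x) \<le> norm x * (M * t)" using assms by (simp add: mult_ac)
  qed
qed

lemma G_int_orbit:
  assumes "0 \<le> h" "0 \<le> t"
  shows "G h (int_orbit t x) = int_orbit t (G h x)"
    and "G h (int_orbit t x) = int_orbit (h + t) x - int_orbit h x"
proof -
  have "G h (int_orbit t x) = integral {0..t} (\<lambda>s. G h (G s x))"
    unfolding int_orbit_def
    using integral_linear[OF integrable_orbit[where a = 0 and b = t and x = x] bounded_linear[OF assms(1)]] by (simp add: o_def)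
  moreover have "integral {0..t} (\<lambda>s. G h (G s x)) = integral {0..t} (\<lambda>s. G s (G h x))"
    by (rule integral_cong) (use assms commute in simp)
  ultimately show "G h (int_orbit t x) = int_orbit t (G h x)" by (simp add: int_orbit_def)
  have "integral {0..t} (\<lambda>s. G h (G s x)) = integral {0..t} ((\<lambda>r. G r x) \<circ> (+) h)"
    by (rule integral_cong) (use assms add in simp)
  also have "\<dots> = integral {0 + h..t + h} (\<lambda>r. G r x)" by (rule integral_shift_Icc_real)
  finally show "G h (int_orbit t x) = int_orbit (h + t) x - int_orbit h x"
    using \<open>G h (int_orbit t x) = integral {0..t} (\<lambda>s. G h (G s x))\<close> int_orbit_combine[of h "h + t" x] assms
    by (simp add: add.commute)
qed

text \<open>Both sides equal \<open>int_orbit (h + t) x - int_orbit h x - int_orbit t x\<close>,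
  which is symmetric in the two times.\<close>

lemma int_orbit_commute:
  assumes "0 \<le> h" "0 \<le> t"
  shows "int_orbit t (G h x - x) = int_orbit h (G t x - x)"
proof -
  interpret It: bounded_linear "int_orbit t" by (rule bounded_linear_int_orbit[OF assms(2)])
  interpret Ih: bounded_linear "int_orbit h" by (rule bounded_linear_int_orbit[OF assms(1)])
  show ?thesis
    using G_int_orbit(2)[OF assms, of x, unfolded G_int_orbit(1)[OF assms]]
      G_int_orbit(2)[OF assms(2,1), of x, unfolded G_int_orbit(1)[OF assms(2,1)]]
    by (simp only: It.diff Ih.diff add.commute[of t h]) simp
qed

lemma int_orbit_derivative_zero: "((\<lambda>h. int_orbit h x /\<^sub>R h) \<longlongrightarrow> x) (at_right 0)"
proof (rule tendstoI)
  fix e :: real assume e: "e > 0"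
  then have e2: "e / 2 > 0" by simp
  have "eventually (\<lambda>s. dist (G s x) x < e / 2) (at_right 0)" by (rule tendstoD[OF tendsto_right_zero e2])
  then obtain d where d: "d > 0" "\<And>s. 0 < s \<Longrightarrow> s < d \<Longrightarrow> dist (G s x) x < e / 2"
    by (auto simp: eventually_at_right_field)
  have "dist (int_orbit h x /\<^sub>R h) x < e" if h: "0 < h" "h < d" for h
  proof -
    have "int_orbit h x - h *\<^sub>R x = integral {0..h} (\<lambda>s. G s x - x)"
      unfolding int_orbit_def using h by (subst integral_diff) (auto intro: integrable_orbit)
    moreover have "norm (integral {0..h} (\<lambda>s. G s x - x)) \<le> integral {0..h} (\<lambda>s. e / 2)"
    proof (rule integral_norm_bound_integral)
      fix s assume s: "s \<in> {0..h}"
      show "norm (G s x - x) \<le> e / 2"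
        using d(2)[of s] s h e by (cases "s = 0") (auto simp: dist_norm)
    qed (auto intro: integrable_diff integrable_orbit)
    ultimately have "norm (int_orbit h x - h *\<^sub>R x) \<le> h * (e / 2)" using h by simp
    then have "inverse h * norm (int_orbit h x - h *\<^sub>R x) \<le> inverse h * (h * (e / 2))"
      using h by (intro mult_left_mono) auto
    moreover have "norm (int_orbit h x /\<^sub>R h - x) = inverse h * norm (int_orbit h x - h *\<^sub>R x)"
    proof -
      have "int_orbit h x /\<^sub>R h - x = (int_orbit h x - h *\<^sub>R x) /\<^sub>R h"
        using h by (simp add: scaleR_diff_right)
      then show ?thesis using h by simp
    qed
    moreover have "inverse h * (h * (e / 2)) = e / 2" using h by simp
    ultimately have "norm (int_orbit h x /\<^sub>R h - x) \<le> e / 2" by linarith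
    then show ?thesis using e by (simp add: dist_norm)
  qed
  then show "eventually (\<lambda>h. dist (int_orbit h x /\<^sub>R h) x < e) (at_right 0)"
    unfolding eventually_at_right_field using d(1) by blast
qed

text \<open>Applying the bounded operator \<open>int_orbit t\<close> to the quotient and commuting
  gives the mean over \<open>{0..h}\<close> of the orbit of \<open>G t x - x\<close>, which tends to
  \<open>G t x - x\<close>. The converse is \<open>int_orbit_derivative_zero\<close>.\<close>

lemma difference_quotient_iff:
  "((\<lambda>t. (G t x - x) /\<^sub>R t) \<longlongrightarrow> y) (at_right 0) \<longleftrightarrow> (\<forall>t\<ge>0. G t x - x = int_orbit t y)"
proof
  assume lim: "((\<lambda>t. (G t x - x) /\<^sub>R t) \<longlongrightarrow> y) (at_right 0)"
  show "\<forall>t\<ge>0. G t x - x = int_orbit t y"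
  proof (intro allI impI)
    fix t :: real assume t: "0 \<le> t"
    interpret It: bounded_linear "int_orbit t" by (rule bounded_linear_int_orbit[OF t])
    have "((\<lambda>h. int_orbit t ((G h x - x) /\<^sub>R h)) \<longlongrightarrow> int_orbit t y) (at_right 0)"
      by (rule It.tendsto[OF lim])
    moreover have "eventually (\<lambda>h. int_orbit h (G t x - x) /\<^sub>R h = int_orbit t ((G h x - x) /\<^sub>R h)) (at_right 0)"
      unfolding eventually_at_right_field
      using int_orbit_commute[OF _ t] by (intro exI[of _ 1]) (simp add: It.scaleR)
    ultimately have "((\<lambda>h. int_orbit h (G t x - x) /\<^sub>R h) \<longlongrightarrow> int_orbit t y) (at_right 0)"
      by (rule Lim_transform_eventually[OF _ eventually_mono]) simp
    then show "G t x - x = int_orbit t y"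
      by (rule tendsto_unique[OF _ int_orbit_derivative_zero, rotated]) simp
  qed
next
  assume eq: "\<forall>t\<ge>0. G t x - x = int_orbit t y"
  have "eventually (\<lambda>t. int_orbit t y /\<^sub>R t = (G t x - x) /\<^sub>R t) (at_right 0)"
    unfolding eventually_at_right_field using eq by (intro exI[of _ 1]) simp
  then show "((\<lambda>t. (G t x - x) /\<^sub>R t) \<longlongrightarrow> y) (at_right 0)"
    by (rule Lim_transform_eventually[OF int_orbit_derivative_zero])
qed

lemma continuous_on_int_orbit: "continuous_on {0..T} (\<lambda>t. int_orbit t x)"
  unfolding int_orbit_def by (rule indefinite_integral_continuous_1[OF integrable_orbit]) simp

end

section \<open>Mild solutions and their time averages\<close>

context c0_semigroup
begin

definition conv :: "(real \<Rightarrow> 'h) \<Rightarrow> real \<Rightarrow> 'h"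
  where "conv g t = integral {0..t} (\<lambda>s. G (t - s) (g s))"

lemma conv_zero [simp]: "conv g 0 = 0"
  by (simp add: conv_def)

lemma continuous_on_G_diff: "continuous_on {0..t} (\<lambda>s. G (t - s) x)"
  by (rule continuous_on_G_compose) (auto intro: continuous_intros)

lemma integrable_conv:
  assumes "square_integrable g" "0 \<le> t"
  shows "(\<lambda>s. G (t - s) (g s)) integrable_on {0..t}"
proof -
  obtain M where M: "M \<ge> 1" "\<And>s y. 0 \<le> s \<Longrightarrow> s \<le> t \<Longrightarrow> norm (G s y) \<le> M * norm y" using bounded_on by blast
  show ?thesis
    by (rule strongly_continuous_integral(1)[OF assms(2), of M "\<lambda>s. G (t - s)" g])
      (use M assms continuous_on_G_diff linear in auto)
qed

lemma norm_conv_le: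
  assumes "square_integrable g" "0 \<le> t" "0 \<le> M" "\<And>s y. 0 \<le> s \<Longrightarrow> s \<le> t \<Longrightarrow> norm (G s y) \<le> M * norm y"
  shows "norm (conv g t) \<le> M * sqrt t * norm (abs_L2 g)"
  unfolding conv_def
  by (rule strongly_continuous_integral(2)[OF assms(2,3), of "\<lambda>s. G (t - s)" g])
    (use assms continuous_on_G_diff linear in auto)

lemma bounded_linear_conv:
  assumes "0 \<le> t"
  shows "bounded_linear (\<lambda>x. conv (rep_L2 x) t)"
proof -
  obtain M where M: "M \<ge> 1" "\<And>s y. 0 \<le> s \<Longrightarrow> s \<le> t \<Longrightarrow> norm (G s y) \<le> M * norm y" using bounded_on by blast
  show ?thesis
    unfolding conv_def
    by (rule bounded_linear_strongly_continuous_integral[OF assms, of M "\<lambda>s. G (t - s)"])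
      (use M continuous_on_G_diff linear in auto)
qed

lemma conv_AE_cong:
  assumes "AE s in lebesgue. s \<in> {0<..t} \<longrightarrow> g s = g' s"
  shows "conv g t = conv g' t"
  unfolding conv_def
proof (rule integral_AE_cong)
  have "AE s in lebesgue. s \<noteq> (0::real)" by (intro AE_completion AE_lborel_singleton)
  then show "AE s in lebesgue. s \<in> {0..t} \<longrightarrow> G (t - s) (g s) = G (t - s) (g' s)"
    using assms by eventually_elim auto
qed

lemma conv_abs_L2:
  assumes "square_integrable g"
  shows "conv (rep_L2 (abs_L2 g)) = conv g"
  by (rule ext, rule conv_AE_cong) (use rep_abs_L2[OF assms] in eventually_elim, simp)

lemma has_integral_conv_step:
  assumes t: "0 \<le> t"
  shows "((\<lambda>s. G (t - s) (indicator {a<..} s *\<^sub>R x)) has_integral int_orbit (t - min t (max 0 a)) x) {0..t}"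
proof -
  \<comment> \<open>Up to \<open>c\<close> the step has not yet started; the clamping covers
    negative \<open>a\<close> and \<open>a\<close> beyond \<open>t\<close>.\<close>
  define c where "c = min t (max 0 a)"
  have c: "0 \<le> c" "c \<le> t" using t by (auto simp: c_def)
  let ?f = "\<lambda>s. G (t - s) (indicator {a<..} s *\<^sub>R x)"
  have "(?f has_integral 0) {0..c}"
  proof (rule has_integral_spike_finite[of "{c}" _ _ "\<lambda>_. 0"])
    fix s assume s: "s \<in> {0..c} - {c}"
    then have "\<not> a < s" by (auto simp: c_def min_def max_def split: if_splits)
    then show "?f s = 0" using s c linear_0[OF linear[of "t - s"]] by simp
  qed auto
  moreover have "(?f has_integral int_orbit (t - c) x) {c..t}"
  proof (rule has_integral_spike_finite[of "{c}" _ _ "\<lambda>s. G (- s + t) x"])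
    fix s assume s: "s \<in> {c..t} - {c}"
    then have "a < s" using c by (auto simp: c_def min_def max_def split: if_splits)
    then show "?f s = G (- s + t) x" by simp
  next
    have "((\<lambda>r. G r x) has_integral int_orbit (t - c) x) {0..t - c}"
      unfolding int_orbit_def by (intro integrable_integral integrable_orbit) simp
    then have "((\<lambda>r. G (r + t) x) has_integral int_orbit (t - c) x) {0 - t..t - c - t}"
      by (rule has_integral_shift_real_ivl)
    then show "((\<lambda>s. G (- s + t) x) has_integral int_orbit (t - c) x) {c..t}"
      using has_integral_reflect_real[where f = "\<lambda>r. G (r + t) x" and a = "- t" and b = "- c"] by simp
  qed auto
  ultimately have "(?f has_integral 0 + int_orbit (t - c) x) {0..t}"
    using c by (intro has_integral_combine[of 0 c t])
  then show ?thesis by (simp add: c_def)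
qed

lemma lmeasurable_Ioc [simp]: "{a<..b::real} \<in> lmeasurable"
  by (rule bounded_set_imp_lmeasurable) auto

text \<open>An interval is a difference of two steps, so the response to a constant input on it is
  explicit in \<open>int_orbit\<close>. The density arguments for \<open>conv\<close> start from
  this formula.\<close>

lemma conv_interval:
  assumes t: "0 \<le> t" and "a < b"
  shows "conv (\<lambda>s. indicator {a<..b} s *\<^sub>R x) t =
    int_orbit (t - min t (max 0 a)) x - int_orbit (t - min t (max 0 b)) x"
proof -
  have "conv (\<lambda>s. indicator {a<..b} s *\<^sub>R x) t =
      integral {0..t} (\<lambda>s. G (t - s) (indicator {a<..} s *\<^sub>R x) - G (t - s) (indicator {b<..} s *\<^sub>R x))"
    unfolding conv_def
  proof (rule integral_cong)
    fix s assume s: "s \<in> {0..t}"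
    have "indicator {a<..b} s *\<^sub>R x = indicator {a<..} s *\<^sub>R x - indicator {b<..} s *\<^sub>R x"
      using \<open>a < b\<close> by (auto simp: indicator_def)
    then show "G (t - s) (indicator {a<..b} s *\<^sub>R x) =
        G (t - s) (indicator {a<..} s *\<^sub>R x) - G (t - s) (indicator {b<..} s *\<^sub>R x)"
      using s by (simp add: G_diff)
  qed
  then show ?thesis
    using has_integral_diff[OF has_integral_conv_step[OF t, of a x] has_integral_conv_step[OF t, of b x]]
    by (simp add: integral_unique)
qed

lemma continuous_on_int_orbit_compose:
  assumes "continuous_on {0..T} f" "\<And>t. t \<in> {0..T} \<Longrightarrow> f t \<in> {0..T}"
  shows "continuous_on {0..T} (\<lambda>t. int_orbit (f t) x)"
  by (rule continuous_on_compose2[OF continuous_on_int_orbit[of T] assms(1)]) (use assms(2) in auto)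

text \<open>The response to an interval input is explicit. The bound in \<open>norm_conv_le\<close>
  is uniform over \<open>{0..T}\<close>, so the inputs with continuous response form a closed
  subspace, and \<open>L2_closed_subspace_eq_UNIV\<close> applies.\<close>

lemma continuous_on_conv:
  assumes "square_integrable g"
  shows "continuous_on {0..T} (conv g)"
proof (cases "0 \<le> T")
  case T: True
  obtain M where M: "M \<ge> 1" "\<And>s y. 0 \<le> s \<Longrightarrow> s \<le> T \<Longrightarrow> norm (G s y) \<le> M * norm y" using bounded_on by blast
  define V where "V = {x. continuous_on {0..T} (conv (rep_L2 x))}"
  have bl: "bounded_linear (\<lambda>x. conv (rep_L2 x) t)" if "t \<in> {0..T}" for t
    by (rule bounded_linear_conv) (use that in simp)
  have "V = UNIV"
  proof (rule L2_closed_subspace_eq_UNIV)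
    show "subspace V"
    proof (rule subspaceI)
      have "continuous_on {0..T} (\<lambda>t. 0 :: 'h)" by simp
      then show "0 \<in> V" unfolding V_def mem_Collect_eq
        by (rule continuous_on_eq) (simp add: linear_0[OF bounded_linear.linear[OF bl]])
      fix x y :: "'h L2" and c :: real assume x: "x \<in> V"
      have "continuous_on {0..T} (\<lambda>t. c *\<^sub>R conv (rep_L2 x) t)" using x by (auto simp: V_def intro: continuous_intros)
      then show "c *\<^sub>R x \<in> V" unfolding V_def mem_Collect_eq
        by (rule continuous_on_eq) (simp add: linear_scale[OF bounded_linear.linear[OF bl]])
      assume y: "y \<in> V"
      have "continuous_on {0..T} (\<lambda>t. conv (rep_L2 x) t + conv (rep_L2 y) t)"
        using x y by (auto simp: V_def intro: continuous_intros)
      then show "x + y \<in> V" unfolding V_def mem_Collect_eq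
        by (rule continuous_on_eq) (simp add: linear_add[OF bounded_linear.linear[OF bl]])
    qed
    show "closed V"
      unfolding closed_sequential_limits
    proof (intro allI impI)
      fix X l assume X: "(\<forall>n. X n \<in> V) \<and> X \<longlonglongrightarrow> l"
      have "uniform_limit {0..T} (\<lambda>n. conv (rep_L2 (X n))) (conv (rep_L2 l)) sequentially"
        unfolding uniform_limit_iff
      proof (intro allI impI)
        fix e :: real assume e: "e > 0"
        have "(\<lambda>n. M * sqrt T * norm (X n - l)) \<longlonglongrightarrow> 0"
          using X by (intro tendsto_mult_right_zero tendsto_norm_zero LIM_zero) simp
        then have "eventually (\<lambda>n. M * sqrt T * norm (X n - l) < e) sequentially"
          using e by (rule order_tendstoD(2))
        then show "eventually (\<lambda>n. \<forall>t\<in>{0..T}. dist (conv (rep_L2 (X n)) t) (conv (rep_L2 l) t) < e) sequentially"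
        proof eventually_elim
          case (elim n)
          show ?case
          proof
            fix t assume t: "t \<in> {0..T}"
            have "norm (conv (rep_L2 (X n - l)) t) \<le> M * sqrt t * norm (abs_L2 (rep_L2 (X n - l)))"
              by (rule norm_conv_le) (use t M in auto)
            also have "\<dots> \<le> M * sqrt T * norm (X n - l)"
              using t M by (auto intro!: mult_right_mono mult_left_mono)
            finally show "dist (conv (rep_L2 (X n)) t) (conv (rep_L2 l) t) < e"
              using elim by (simp add: dist_norm linear_diff[OF bounded_linear.linear[OF bl[OF t]]])
          qed
        qed
      qed
      moreover have "eventually (\<lambda>n. continuous_on {0..T} (conv (rep_L2 (X n)))) sequentially"
        using X by (simp add: V_def)
      ultimately show "l \<in> V" unfolding V_def mem_Collect_eq by (intro uniform_limit_theorem) auto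
    qed
    fix a b :: real and x :: 'h assume ab: "a < b"
    have "continuous_on {0..T} (\<lambda>t. int_orbit (t - min t (max 0 a)) x - int_orbit (t - min t (max 0 b)) x)"
      by (intro continuous_on_diff continuous_on_int_orbit_compose continuous_intros) auto
    then have "continuous_on {0..T} (conv (\<lambda>s. indicator {a<..b} s *\<^sub>R x))"
      by (rule continuous_on_eq) (simp add: conv_interval ab)
    then have "continuous_on {0..T} (conv (rep_L2 (abs_L2 (\<lambda>s. indicator {a<..b} s *\<^sub>R x))))"
      by (rule continuous_on_eq) (simp add: conv_abs_L2 square_integrable_indicator)
    then show "abs_L2 (\<lambda>s. indicator {a<..b} s *\<^sub>R x) \<in> V" by (simp add: V_def)
  qed
  then have "abs_L2 g \<in> V" by blast
  then have "continuous_on {0..T} (conv (rep_L2 (abs_L2 g)))" by (simp add: V_def)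
  then show ?thesis by (rule continuous_on_eq) (simp add: conv_abs_L2 assms)
qed simp

lemma integral_rep_bounded_linear:
  assumes "0 \<le> T"
  shows "bounded_linear (\<lambda>x :: 'b::complex_hilbert L2. integral {0..T} (rep_L2 x))"
  using bounded_linear_strongly_continuous_integral[OF assms, of 1 "\<lambda>_ x::'b. x"]
  by (simp add: linear_iff)

text \<open>In integrated form: the generator maps the time integral of \<open>conv g\<close> to
  \<open>conv g T\<close> minus the integral of \<open>g\<close>. Both sides are bounded and linear
  in \<open>g\<close>, so it suffices to compute on intervals, which are differences of
  steps.\<close>

lemma G_integral_conv:
  assumes g: "square_integrable g" and T: "0 \<le> T" and h: "0 \<le> h"
  shows "G h (integral {0..T} (conv g)) - integral {0..T} (conv g) =
    int_orbit h (conv g T - integral {0..T} g)"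
proof -
  interpret Gh: bounded_linear "G h" by (rule bounded_linear[OF h])
  interpret Ih: bounded_linear "int_orbit h" by (rule bounded_linear_int_orbit[OF h])
  obtain M where M: "M \<ge> 1" "\<And>s y. 0 \<le> s \<Longrightarrow> s \<le> T \<Longrightarrow> norm (G s y) \<le> M * norm y" using bounded_on by blast
  have int: "conv (rep_L2 x) integrable_on {0..T}" for x
    by (rule integrable_continuous_real[OF continuous_on_conv]) simp
  have bl: "bounded_linear (\<lambda>x. conv (rep_L2 x) t)" if "t \<in> {0..T}" for t
    by (rule bounded_linear_conv) (use that in simp)
  have U: "bounded_linear (\<lambda>x. integral {0..T} (conv (rep_L2 x)))"
  proof (rule bounded_linear_intro)
    fix x y :: "'h L2" and r :: real
    have "integral {0..T} (conv (rep_L2 (x + y))) = integral {0..T} (\<lambda>t. conv (rep_L2 x) t + conv (rep_L2 y) t)"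
      by (rule integral_cong) (simp add: linear_add[OF bounded_linear.linear[OF bl]])
    then show "integral {0..T} (conv (rep_L2 (x + y))) = integral {0..T} (conv (rep_L2 x)) + integral {0..T} (conv (rep_L2 y))"
      by (simp add: integral_add int)
    have "integral {0..T} (conv (rep_L2 (r *\<^sub>R x))) = integral {0..T} (\<lambda>t. r *\<^sub>R conv (rep_L2 x) t)"
      by (rule integral_cong) (simp add: linear_scale[OF bounded_linear.linear[OF bl]])
    then show "integral {0..T} (conv (rep_L2 (r *\<^sub>R x))) = r *\<^sub>R integral {0..T} (conv (rep_L2 x))" by simp
    have "norm (integral {0..T} (conv (rep_L2 x))) \<le> integral {0..T} (\<lambda>t. M * sqrt T * norm x)"
    proof (rule integral_norm_bound_integral[OF int])
      fix t assume t: "t \<in> {0..T}"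
      have "norm (conv (rep_L2 x) t) \<le> M * sqrt t * norm (abs_L2 (rep_L2 x))"
        by (rule norm_conv_le) (use t M in auto)
      also have "\<dots> \<le> M * sqrt T * norm x" using t M by (auto intro!: mult_right_mono mult_left_mono)
      finally show "norm (conv (rep_L2 x) t) \<le> M * sqrt T * norm x" .
    qed (rule integrable_const_ivl)
    then show "norm (integral {0..T} (conv (rep_L2 x))) \<le> norm x * (T * M * sqrt T)"
      using T by (simp add: mult_ac)
  qed
  define \<Lambda> where "\<Lambda> x = G h (integral {0..T} (conv (rep_L2 x))) - integral {0..T} (conv (rep_L2 x))
      - int_orbit h (conv (rep_L2 x) T - integral {0..T} (rep_L2 x))" for x
  have \<Lambda>: "bounded_linear \<Lambda>"
    unfolding \<Lambda>_def
    by (intro bounded_linear_sub bounded_linear_compose[OF Gh.bounded_linear] U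
        bounded_linear_compose[OF Ih.bounded_linear] bounded_linear_conv[OF T] integral_rep_bounded_linear[OF T])
  interpret \<Lambda>: bounded_linear \<Lambda> by (rule \<Lambda>)
  have step: "G h (integral {0..T} (\<lambda>t. int_orbit (t - min t (max 0 a)) x)) - integral {0..T} (\<lambda>t. int_orbit (t - min t (max 0 a)) x)
      = int_orbit h (int_orbit (T - min T (max 0 a)) x - (T - min T (max 0 a)) *\<^sub>R x)" for a x
  proof -
    define c where "c = min T (max 0 a)"
    have c: "0 \<le> c" "c \<le> T" using T by (auto simp: c_def)
    let ?f = "\<lambda>t. int_orbit (t - min t (max 0 a)) x"
    have fint: "?f integrable_on {0..T}"
      by (intro integrable_continuous_real continuous_on_int_orbit_compose continuous_intros) auto
    have "integral {0..T} ?f = integral {0..c} ?f + integral {c..T} ?f"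
      by (rule Henstock_Kurzweil_Integration.integral_combine[symmetric]) (use c fint in auto)
    also have "integral {0..c} ?f = integral {0..c} (\<lambda>_. 0)"
      by (rule integral_cong) (auto simp: c_def min_def max_def split: if_splits)
    also have "integral {c..T} ?f = integral {c..T} (\<lambda>t. int_orbit (t - c) x)"
      by (rule integral_cong) (use c in \<open>auto simp: c_def min_def max_def split: if_splits\<close>)
    also have "\<dots> = integral {0..T - c} (\<lambda>t. int_orbit t x)"
      using integral_shift_real_ivl[where a = c and b = T and c = c and f = "\<lambda>t. int_orbit (t - c) x"] by simp
    finally have eq: "integral {0..T} ?f = integral {0..T - c} (\<lambda>t. int_orbit t x)" by simp
    have io: "(\<lambda>t. int_orbit t x) integrable_on {0..T - c}"
      by (rule integrable_continuous_real[OF continuous_on_int_orbit])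
    have "G h (integral {0..T} ?f) - integral {0..T} ?f =
        integral {0..T - c} (\<lambda>t. G h (int_orbit t x)) - integral {0..T - c} (\<lambda>t. int_orbit t x)"
      unfolding eq using integral_linear[OF io Gh.bounded_linear] by (simp add: o_def)
    also have "\<dots> = integral {0..T - c} (\<lambda>t. G h (int_orbit t x) - int_orbit t x)"
      by (rule integral_diff[symmetric]) (use integrable_linear[OF io Gh.bounded_linear] io in \<open>simp_all add: o_def\<close>)
    also have "\<dots> = integral {0..T - c} (\<lambda>t. int_orbit h (G t x - x))"
    proof (rule integral_cong)
      fix t assume t: "t \<in> {0..T - c}"
      show "G h (int_orbit t x) - int_orbit t x = int_orbit h (G t x - x)"
        using int_orbit_commute[of h t x] G_int_orbit(1)[of h t x] t h
          linear_diff[OF bounded_linear.linear[OF bounded_linear_int_orbit], of t "G h x" x] by simp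
    qed
    also have "\<dots> = int_orbit h (integral {0..T - c} (\<lambda>t. G t x - x))"
    proof -
      have "(\<lambda>t. G t x - x) integrable_on {0..T - c}"
        by (intro integrable_diff integrable_orbit integrable_const_ivl) simp
      then show ?thesis using integral_linear[OF _ Ih.bounded_linear] by (simp add: o_def)
    qed
    also have "integral {0..T - c} (\<lambda>t. G t x - x) = int_orbit (T - c) x - (T - c) *\<^sub>R x"
      unfolding int_orbit_def using c by (subst integral_diff) (auto intro: integrable_orbit)
    finally show ?thesis by (simp add: c_def)
  qed
  \<comment> \<open>The defect \<open>\<Lambda>\<close> of the identity is bounded and linear in the
    input, so its kernel is a closed subspace; only interval inputs remain to be checked.\<close>
  have "{x. \<Lambda> x = 0} = UNIV"
  proof (rule L2_closed_subspace_eq_UNIV)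
    show "subspace {x. \<Lambda> x = 0}" by (rule subspaceI) (auto simp: \<Lambda>.zero \<Lambda>.add \<Lambda>.scaleR)
    have "closed (\<Lambda> -` {0})"
      using linear_continuous_on[OF \<Lambda>, of UNIV] by (intro closed_vimage) (auto simp: continuous_on_eq_continuous_at)
    then show "closed {x. \<Lambda> x = 0}" by (simp add: vimage_def)
    fix a b :: real and x :: 'h assume ab: "a < b"
    let ?g = "\<lambda>s. indicator {a<..b} s *\<^sub>R x"
    let ?f = "\<lambda>a t. int_orbit (t - min t (max 0 a)) x"
    have sq: "square_integrable ?g" by (rule square_integrable_indicator) simp
    have fint: "?f a integrable_on {0..T}" for a
      by (intro integrable_continuous_real continuous_on_int_orbit_compose continuous_intros) auto
    have "integral {0..T} (conv ?g) = integral {0..T} (\<lambda>t. ?f a t - ?f b t)"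
      by (rule integral_cong) (simp add: conv_interval ab)
    then have Ui: "integral {0..T} (conv ?g) = integral {0..T} (?f a) - integral {0..T} (?f b)"
      by (simp add: integral_diff fint)
    have gi: "integral {0..T} ?g = (T - min T (max 0 a)) *\<^sub>R x - (T - min T (max 0 b)) *\<^sub>R x"
    proof -
      define p where "p = min T (max 0 a)"
      define q where "q = min T (max 0 b)"
      have pq: "0 \<le> p" "p \<le> q" "q \<le> T" using T ab by (auto simp: p_def q_def)
      have "(?g has_integral (q - p) *\<^sub>R x) {p..q}"
      proof (rule has_integral_spike_finite[of "{p}" _ _ "\<lambda>_. x"])
        show "?g s = x" if "s \<in> {p..q} - {p}" for s
          using that by (auto simp: p_def q_def indicator_def min_def max_def split: if_splits)
        show "((\<lambda>_. x) has_integral (q - p) *\<^sub>R x) {p..q}"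
          using has_integral_const_real[of x p q] pq by simp
      qed simp
      moreover have "(?g has_integral 0) {0..p}"
      proof (rule has_integral_spike_finite[of "{p}" _ _ "\<lambda>_. 0"])
        show "?g s = 0" if "s \<in> {0..p} - {p}" for s
          using that by (auto simp: p_def indicator_def min_def max_def split: if_splits)
      qed auto
      moreover have "(?g has_integral 0) {q..T}"
      proof (rule has_integral_spike_finite[of "{q}" _ _ "\<lambda>_. 0"])
        show "?g s = 0" if "s \<in> {q..T} - {q}" for s
          using that by (auto simp: q_def indicator_def min_def max_def split: if_splits)
      qed auto
      ultimately have "(?g has_integral (0 + (q - p) *\<^sub>R x) + 0) {0..T}"
        using pq by (meson has_integral_combine order_trans)
      then have "integral {0..T} ?g = (q - p) *\<^sub>R x" by (simp add: integral_unique)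
      then show ?thesis by (simp add: p_def q_def algebra_simps)
    qed
    have "G h (integral {0..T} (conv ?g)) - integral {0..T} (conv ?g) = int_orbit h (conv ?g T - integral {0..T} ?g)"
    proof -
      let ?I = "\<lambda>a. integral {0..T} (?f a)" and ?c = "\<lambda>a. T - min T (max 0 a)"
      have "G h (?I a - ?I b) - (?I a - ?I b) = (G h (?I a) - ?I a) - (G h (?I b) - ?I b)"
        by (simp add: Gh.diff)
      also have "\<dots> = int_orbit h ((int_orbit (?c a) x - ?c a *\<^sub>R x) - (int_orbit (?c b) x - ?c b *\<^sub>R x))"
        by (simp only: step Ih.diff)
      also have "(int_orbit (?c a) x - ?c a *\<^sub>R x) - (int_orbit (?c b) x - ?c b *\<^sub>R x) =
          int_orbit (?c a) x - int_orbit (?c b) x - (?c a *\<^sub>R x - ?c b *\<^sub>R x)" by (simp only: algebra_simps)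
      finally show ?thesis unfolding Ui gi conv_interval[OF T ab] .
    qed
    moreover have "integral {0..T} (rep_L2 (abs_L2 ?g)) = integral {0..T} ?g"
      by (rule integral_AE_cong) (use rep_abs_L2[OF sq] in eventually_elim, simp)
    ultimately show "abs_L2 ?g \<in> {x. \<Lambda> x = 0}" by (simp add: \<Lambda>_def conv_abs_L2[OF sq])
  qed
  then have "\<Lambda> (abs_L2 g) = 0" by blast
  moreover have "integral {0..T} (rep_L2 (abs_L2 g)) = integral {0..T} g"
    by (rule integral_AE_cong) (use rep_abs_L2[OF g] in eventually_elim, simp)
  ultimately show ?thesis by (simp add: \<Lambda>_def conv_abs_L2[OF g])
qed

text \<open>The time integral of a mild solution lies in the domain of the generator even when the
  solution does not, with image \<open>u T - u0 - integral {0..T} g\<close>. The stationary equation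
  for Fourier coefficients originates here.\<close>

lemma mild_time_average:
  assumes g: "square_integrable g" and T: "0 \<le> T" and h: "0 \<le> h"
    and u_def: "u = (\<lambda>t. G t u0 + conv g t)"
  shows "G h (integral {0..T} u) - integral {0..T} u = int_orbit h (u T - u0 - integral {0..T} g)"
proof -
  interpret Gh: bounded_linear "G h" by (rule bounded_linear[OF h])
  interpret Ih: bounded_linear "int_orbit h" by (rule bounded_linear_int_orbit[OF h])
  have "integral {0..T} u = int_orbit T u0 + integral {0..T} (conv g)"
    unfolding u_def int_orbit_def
    by (rule integral_add) (auto intro: integrable_orbit integrable_continuous_real[OF continuous_on_conv[OF g]])
  moreover have "G h (int_orbit T u0) - int_orbit T u0 = int_orbit h (G T u0 - u0)"
    using int_orbit_commute[OF h T, of u0] G_int_orbit(1)[OF h T, of u0]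
      linear_diff[OF bounded_linear.linear[OF bounded_linear_int_orbit[OF T]], of "G h u0" u0] by simp
  ultimately show ?thesis
    using G_integral_conv[OF g T h] by (simp add: Gh.add Ih.add Ih.diff u_def algebra_simps)
qed

end

section \<open>Rotated semigroups and the stationary equation\<close>

lemma integral_flip:
  fixes f :: "real \<Rightarrow> 'b::banach"
  assumes "f integrable_on {0..t}"
  shows "integral {0..t} (\<lambda>s. f (t - s)) = integral {0..t} f"
proof (rule integral_unique)
  have "((\<lambda>r. f (r + t)) has_integral integral {0..t} f) {0 - t..t - t}"
    by (rule has_integral_shift_real_ivl) (rule integrable_integral[OF assms])
  then show "((\<lambda>s. f (t - s)) has_integral integral {0..t} f) {0..t}"
    using has_integral_reflect_real[where f = "\<lambda>r. f (r + t)" and a = "- t" and b = 0] by simp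
qed

lemma continuous_on_cis [continuous_intros]: "continuous_on S f \<Longrightarrow> continuous_on S (\<lambda>x. cis (f x))"
  unfolding cis_conv_exp by (intro continuous_intros)

lemma bounded_clinear_scaleC_const: "bounded_clinear (\<lambda>x. c *\<^sub>C (x::'a::complex_hilbert))"
  by (simp add: bounded_clinear_def bounded_linear_scaleC_right scaleC_scaleC mult.commute)

context c0_semigroup
begin

definition mild :: "'h \<Rightarrow> (real \<Rightarrow> 'h) \<Rightarrow> real \<Rightarrow> 'h"
  where "mild u0 g t = G t u0 + conv g t"

lemma mild_zero [simp]: "mild u0 g 0 = u0"
  by (simp add: mild_def)

lemma mild_AE_cong:
  assumes "AE s in lebesgue. s \<in> {0<..t} \<longrightarrow> g s = g' s"
  shows "mild u0 g t = mild u0 g' t"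
  unfolding mild_def conv_AE_cong[OF assms] ..

lemma mild_shift:
  assumes g: "square_integrable g" and T: "0 \<le> T" and t: "0 \<le> t"
  shows "mild u0 g (T + t) = mild (mild u0 g T) (\<lambda>s. g (s + T)) t"
proof -
  have i: "(\<lambda>s. G (T + t - s) (g s)) integrable_on {0..T + t}" by (rule integrable_conv[OF g]) (use T t in simp)
  have "conv g (T + t) = integral {0..T} (\<lambda>s. G (T + t - s) (g s)) + integral {T..T + t} (\<lambda>s. G (T + t - s) (g s))"
    unfolding conv_def
    by (rule Henstock_Kurzweil_Integration.integral_combine[symmetric]) (use T t i in auto)
  also have "integral {0..T} (\<lambda>s. G (T + t - s) (g s)) = integral {0..T} (\<lambda>s. G t (G (T - s) (g s)))"
    by (rule integral_cong) (use t in \<open>simp add: add[symmetric] algebra_simps\<close>)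
  also have "\<dots> = G t (conv g T)"
    unfolding conv_def
    using integral_linear[OF integrable_conv[OF g T] bounded_linear[OF t]] by (simp add: o_def)
  also have "integral {T..T + t} (\<lambda>s. G (T + t - s) (g s)) = conv (\<lambda>s. g (s + T)) t"
    unfolding conv_def
    using integral_shift_real_ivl[where a = T and b = "T + t" and c = T and f = "\<lambda>s. G (T + t - s) (g s)"] by (simp add: add.commute diff_diff_eq2)
  finally show ?thesis
    using t T add[of t T u0] by (simp add: mild_def G_add add.commute)
qed

text \<open>The semigroup generated by A - i \<omega>; in its terms the stationary equation says
  that its generator maps \<open>v\<close> to \<open>- f\<close>.\<close>

definition rotated :: "real \<Rightarrow> real \<Rightarrow> 'h \<Rightarrow> 'h"
  where "rotated \<omega> t x = cis (- (\<omega> * t)) *\<^sub>C G t x"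

lemma c0_semigroup_rotated: "c0_semigroup (rotated \<omega>)"
proof
  show "C0_semigroup (rotated \<omega>)"
    unfolding C0_semigroup_def
  proof (intro conjI allI impI)
    show "bounded_clinear (rotated \<omega> t)" if "0 \<le> t" for t
      unfolding rotated_def by (rule bounded_clinear_compose[OF bounded_clinear_scaleC_const clinear[OF that]])
    show "rotated \<omega> 0 x = x" for x by (simp add: rotated_def)
    show "rotated \<omega> (s + t) x = rotated \<omega> s (rotated \<omega> t x)" if "0 \<le> s" "0 \<le> t" for s t x
      using that by (simp add: rotated_def add G_scaleC scaleC_scaleC cis_mult algebra_simps)
    fix x
    have "((\<lambda>t. cis (- (\<omega> * t))) \<longlongrightarrow> cis (- (\<omega> * 0))) (at_right 0)"
      unfolding cis_conv_exp by (intro tendsto_intros)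
    then show "((\<lambda>t. rotated \<omega> t x) \<longlongrightarrow> x) (at_right 0)"
      unfolding rotated_def using tendsto_scaleC[OF _ tendsto_right_zero[of x]] by fastforce
  qed
qed

end

locale frequency_semigroup = c0_semigroup G
  for G :: "real \<Rightarrow> 'h::complex_hilbert \<Rightarrow> 'h"
begin

sublocale R: c0_semigroup "rotated \<omega>" for \<omega>
  by (rule c0_semigroup_rotated)

lemma conv_rotated:
  assumes g: "square_integrable g" and t: "0 \<le> t"
  shows "R.conv \<omega> (\<lambda>s. cis (- (\<omega> * s)) *\<^sub>C g s) t = cis (- (\<omega> * t)) *\<^sub>C conv g t"
proof -
  have "R.conv \<omega> (\<lambda>s. cis (- (\<omega> * s)) *\<^sub>C g s) t = integral {0..t} (\<lambda>s. cis (- (\<omega> * t)) *\<^sub>C G (t - s) (g s))"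
    unfolding R.conv_def rotated_def
    by (rule integral_cong) (simp add: G_scaleC scaleC_scaleC cis_mult algebra_simps)
  also have "\<dots> = cis (- (\<omega> * t)) *\<^sub>C conv g t"
    unfolding conv_def
    using integral_linear[OF integrable_conv[OF g t] bounded_linear_scaleC_right[of "cis (- (\<omega> * t))"]]
    by (simp add: o_def)
  finally show ?thesis .
qed

text \<open>The equation \<open>i \<omega> v = A v + f\<close> in integrated form, which makes sense for all \<open>v\<close> and is closed.\<close>

definition stationary :: "real \<Rightarrow> 'h \<Rightarrow> 'h \<Rightarrow> bool"
  where "stationary \<omega> v f \<longleftrightarrow> (\<forall>t\<ge>0. rotated \<omega> t v - v = - R.int_orbit \<omega> t f)"

lemma linear_R_int_orbit: "0 \<le> t \<Longrightarrow> linear (R.int_orbit \<omega> t)"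
  by (rule bounded_linear.linear[OF R.bounded_linear_int_orbit])

lemma stationary_add:
  assumes "stationary \<omega> v f" "stationary \<omega> w g"
  shows "stationary \<omega> (v + w) (f + g)"
  unfolding stationary_def
proof (intro allI impI)
  fix t :: real assume t: "0 \<le> t"
  have "rotated \<omega> t (v + w) - (v + w) = (rotated \<omega> t v - v) + (rotated \<omega> t w - w)" using t by (simp add: R.G_add)
  also have "rotated \<omega> t v - v = - R.int_orbit \<omega> t f" using assms(1) t by (simp add: stationary_def)
  also have "rotated \<omega> t w - w = - R.int_orbit \<omega> t g" using assms(2) t by (simp add: stationary_def)
  finally show "rotated \<omega> t (v + w) - (v + w) = - R.int_orbit \<omega> t (f + g)"
    using t by (simp add: linear_add[OF linear_R_int_orbit])
qed

lemma stationary_scaleR: "stationary \<omega> v f \<Longrightarrow> stationary \<omega> (r *\<^sub>R v) (r *\<^sub>R f)"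
  unfolding stationary_def
  by (simp add: R.G_scaleR linear_scale[OF linear_R_int_orbit] scaleR_diff_right[symmetric])

text \<open>The integrated form involves bounded operators only, hence is closed. It carries the
  equation through the infinite folding in \<open>periodization\<close>, and
  \<open>stationary_iff_generator\<close> then puts the limit into the domain.\<close>

lemma stationary_limit:
  assumes "\<And>n. stationary \<omega> (v n) (f n)" "v \<longlonglongrightarrow> w" "f \<longlonglongrightarrow> g"
  shows "stationary \<omega> w g"
  unfolding stationary_def
proof (intro allI impI)
  fix t :: real assume t: "0 \<le> t"
  interpret Rt: Real_Vector_Spaces.bounded_linear "rotated \<omega> t" by (rule R.bounded_linear[OF t])
  interpret It: Real_Vector_Spaces.bounded_linear "R.int_orbit \<omega> t" by (rule R.bounded_linear_int_orbit[OF t])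
  have "(\<lambda>n. rotated \<omega> t (v n) - v n) \<longlonglongrightarrow> rotated \<omega> t w - w"
    by (intro tendsto_diff Rt.tendsto assms)
  moreover have "(\<lambda>n. rotated \<omega> t (v n) - v n) \<longlonglongrightarrow> - R.int_orbit \<omega> t g"
    using assms(1) t tendsto_minus[OF It.tendsto[OF assms(3)]] by (simp add: stationary_def)
  ultimately show "rotated \<omega> t w - w = - R.int_orbit \<omega> t g" by (rule LIMSEQ_unique)
qed

lemma tendsto_cis_quotient: "((\<lambda>t. (cis (a * t) - 1) / of_real t) \<longlongrightarrow> \<i> * of_real a) (at_right 0)"
proof -
  have "((\<lambda>z. exp (\<i> * of_real a * z)) has_field_derivative \<i> * of_real a) (at 0)"
    by (auto intro!: derivative_eq_intros)
  then have "((\<lambda>z. (exp (\<i> * of_real a * z) - 1) / z) \<longlongrightarrow> \<i> * of_real a) (at 0)"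
    by (simp add: has_field_derivative_iff)
  moreover have "filterlim (\<lambda>t::real. complex_of_real t) (at 0) (at_right 0)"
  proof (rule filterlim_atI)
    show "((\<lambda>t::real. complex_of_real t) \<longlongrightarrow> 0) (at_right 0)"
      using tendsto_of_real[of "\<lambda>t::real. t" 0 "at_right 0"] by (simp add: tendsto_ident_at)
    show "eventually (\<lambda>t::real. complex_of_real t \<noteq> 0) (at_right 0)"
      by (rule eventually_at_right_less[THEN eventually_mono]) simp
  qed
  ultimately have "((\<lambda>t. (exp (\<i> * of_real a * complex_of_real t) - 1) / of_real t) \<longlongrightarrow> \<i> * of_real a) (at_right 0)"
    by (rule filterlim_compose)
  then show ?thesis by (simp add: cis_conv_exp mult.assoc)
qed

text \<open>The product rule at time zero for an exponential factor; rotating forth and back relates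
  the generator to its shift by i \<omega>.\<close>

lemma difference_quotient_rotate:
  fixes g :: "real \<Rightarrow> 'b::complex_hilbert"
  assumes "((\<lambda>t. (g t - v) /\<^sub>R t) \<longlongrightarrow> y) (at_right 0)"
  shows "((\<lambda>t. (cis (a * t) *\<^sub>C g t - v) /\<^sub>R t) \<longlongrightarrow> y + (\<i> * of_real a) *\<^sub>C v) (at_right 0)"
proof -
  have "((\<lambda>t. cis (a * t)) \<longlongrightarrow> cis (a * 0)) (at_right 0)"
    unfolding cis_conv_exp by (intro tendsto_intros)
  then have "((\<lambda>t. cis (a * t) *\<^sub>C ((g t - v) /\<^sub>R t) + ((cis (a * t) - 1) / of_real t) *\<^sub>C v) \<longlongrightarrow>
      1 *\<^sub>C y + (\<i> * of_real a) *\<^sub>C v) (at_right 0)"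
    by (intro tendsto_add tendsto_scaleC tendsto_cis_quotient assms tendsto_const) simp
  moreover have "cis (a * t) *\<^sub>C ((g t - v) /\<^sub>R t) + ((cis (a * t) - 1) / of_real t) *\<^sub>C v =
      (cis (a * t) *\<^sub>C g t - v) /\<^sub>R t" for t
  proof -
    have "((cis (a * t) - 1) / of_real t) *\<^sub>C v = (cis (a * t) *\<^sub>C v - v) /\<^sub>R t"
      by (simp add: divide_inverse scaleR_scaleC scaleC_scaleC scaleC_diff_left mult.commute scaleC_diff_right
          algebra_simps del: scaleC_of_real)
    then show ?thesis by (simp add: scaleC_scaleR_commute scaleC_diff_right scaleR_diff_right)
  qed
  ultimately show ?thesis by simp
qed

lemma stationary_iff_difference_quotient:
  "stationary \<omega> v f \<longleftrightarrow> ((\<lambda>t. (rotated \<omega> t v - v) /\<^sub>R t) \<longlongrightarrow> - f) (at_right 0)"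
  unfolding R.difference_quotient_iff stationary_def by (simp add: linear_neg[OF linear_R_int_orbit])

lemma stationary_iff_generator:
  assumes gen: "is_generator D A G"
  shows "stationary \<omega> v f \<longleftrightarrow> v \<in> D \<and> (\<i> * of_real \<omega>) *\<^sub>C v = A v + f"
proof
  assume "stationary \<omega> v f"
  then have "((\<lambda>t. (rotated \<omega> t v - v) /\<^sub>R t) \<longlongrightarrow> - f) (at_right 0)"
    by (simp add: stationary_iff_difference_quotient)
  then have "((\<lambda>t. (cis (\<omega> * t) *\<^sub>C rotated \<omega> t v - v) /\<^sub>R t) \<longlongrightarrow> - f + (\<i> * of_real \<omega>) *\<^sub>C v) (at_right 0)"
    by (rule difference_quotient_rotate)
  then have lim: "((\<lambda>t. (G t v - v) /\<^sub>R t) \<longlongrightarrow> - f + (\<i> * of_real \<omega>) *\<^sub>C v) (at_right 0)"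
    by (simp add: rotated_def scaleC_scaleC cis_mult)
  then have D: "v \<in> D" using gen by (auto simp: is_generator_def)
  then have "((\<lambda>t. (G t v - v) /\<^sub>R t) \<longlongrightarrow> A v) (at_right 0)" using gen by (simp add: is_generator_def)
  then have "A v = - f + (\<i> * of_real \<omega>) *\<^sub>C v" by (rule tendsto_unique[OF _ _ lim, rotated]) simp
  then show "v \<in> D \<and> (\<i> * of_real \<omega>) *\<^sub>C v = A v + f" using D by simp
next
  assume v: "v \<in> D \<and> (\<i> * of_real \<omega>) *\<^sub>C v = A v + f"
  then have "((\<lambda>t. (G t v - v) /\<^sub>R t) \<longlongrightarrow> A v) (at_right 0)" using gen by (simp add: is_generator_def)
  then have "((\<lambda>t. (cis ((- \<omega>) * t) *\<^sub>C G t v - v) /\<^sub>R t) \<longlongrightarrow> A v + (\<i> * of_real (- \<omega>)) *\<^sub>C v) (at_right 0)"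
    by (rule difference_quotient_rotate)
  moreover have "A v + (\<i> * of_real (- \<omega>)) *\<^sub>C v = - f" using v by (simp add: algebra_simps)
  ultimately show "stationary \<omega> v f"
    by (simp add: stationary_iff_difference_quotient rotated_def)
qed

text \<open>Multiplied by the exponential, a mild solution becomes one for the rotated semigroup,
  and \<open>mild_time_average\<close> applies there. The defect
  \<open>u0 - cis (- (\<omega> * T)) *\<^sub>C mild u0 g T\<close> measures the failure of
  periodicity.\<close>

lemma stationary_Fourier:
  assumes g: "square_integrable g" and T: "0 \<le> T"
  shows "stationary \<omega> (integral {0..T} (\<lambda>t. cis (- (\<omega> * t)) *\<^sub>C mild u0 g t))
    (integral {0..T} (\<lambda>t. cis (- (\<omega> * t)) *\<^sub>C g t) + u0 - cis (- (\<omega> * T)) *\<^sub>C mild u0 g T)"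
  unfolding stationary_def
proof (intro allI impI)
  fix h :: real assume h: "0 \<le> h"
  have sm: "strongly_measurable lebesgue (\<lambda>t. cis (- (\<omega> * t)) *\<^sub>C g t)"
  proof (rule strongly_measurable_compose2[where h = scaleC])
    show "strongly_measurable lebesgue (\<lambda>t. cis (- (\<omega> * t)))"
    proof (rule strongly_measurable_compose1[where h = "\<lambda>t. cis (- (\<omega> * t))" and f = "\<lambda>t. t"])
      show "strongly_measurable lebesgue (\<lambda>t::real. t)"
        unfolding strongly_measurable_lebesgue_real_iff by (rule measurable_completion) simp
      show "(\<lambda>n. cis (- (\<omega> * u n))) \<longlonglongrightarrow> cis (- (\<omega> * x))" if "u \<longlonglongrightarrow> x" for u x
        unfolding cis_conv_exp by (intro tendsto_intros that)
    qed
    show "strongly_measurable lebesgue g" using g by (simp add: square_integrable_def)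
  qed (rule tendsto_scaleC)
  have sq: "square_integrable (\<lambda>t. cis (- (\<omega> * t)) *\<^sub>C g t)"
    by (rule square_integrable_bound[OF sm g, of 1]) simp
  define u where "u = (\<lambda>t. rotated \<omega> t u0 + R.conv \<omega> (\<lambda>s. cis (- (\<omega> * s)) *\<^sub>C g s) t)"
  have u: "u t = cis (- (\<omega> * t)) *\<^sub>C mild u0 g t" if "0 \<le> t" for t
    unfolding u_def conv_rotated[OF g that] by (simp add: mild_def rotated_def scaleC_add_right)
  have U: "integral {0..T} u = integral {0..T} (\<lambda>t. cis (- (\<omega> * t)) *\<^sub>C mild u0 g t)"
    by (rule integral_cong) (simp add: u)
  have "rotated \<omega> h (integral {0..T} u) - integral {0..T} u =
      R.int_orbit \<omega> h (u T - u0 - integral {0..T} (\<lambda>t. cis (- (\<omega> * t)) *\<^sub>C g t))"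
    by (rule R.mild_time_average[OF sq T h u_def])
  then show "rotated \<omega> h (integral {0..T} (\<lambda>t. cis (- (\<omega> * t)) *\<^sub>C mild u0 g t)) -
      integral {0..T} (\<lambda>t. cis (- (\<omega> * t)) *\<^sub>C mild u0 g t) =
      - R.int_orbit \<omega> h (integral {0..T} (\<lambda>t. cis (- (\<omega> * t)) *\<^sub>C g t) + u0 - cis (- (\<omega> * T)) *\<^sub>C mild u0 g T)"
    unfolding U u[OF T]
    by (simp add: linear_diff[OF linear_R_int_orbit[OF h]] linear_add[OF linear_R_int_orbit[OF h]])
qed

text \<open>After a reversal of time the integrated equation is the variation of constants formula
  for exponential forcing, so stationary solutions yield harmonic trajectories.\<close>

lemma stationary_mild:
  assumes st: "stationary \<omega> v f" and t: "0 \<le> t"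
  shows "cis (\<omega> * t) *\<^sub>C v = mild v (\<lambda>s. cis (\<omega> * s) *\<^sub>C f) t"
proof -
  have i: "(\<lambda>s. rotated \<omega> s f) integrable_on {0..t}" by (rule R.integrable_orbit) simp
  have "cis (\<omega> * t) *\<^sub>C R.int_orbit \<omega> t f = integral {0..t} (\<lambda>s. cis (\<omega> * t) *\<^sub>C rotated \<omega> s f)"
    unfolding R.int_orbit_def
    using integral_linear[OF i bounded_linear_scaleC_right[of "cis (\<omega> * t)"]] by (simp add: o_def)
  also have "\<dots> = integral {0..t} (\<lambda>s. cis (\<omega> * t) *\<^sub>C rotated \<omega> (t - s) f)"
    by (rule integral_flip[symmetric])
      (use integrable_linear[OF i bounded_linear_scaleC_right[of "cis (\<omega> * t)"]] in \<open>simp add: o_def\<close>)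
  also have "\<dots> = conv (\<lambda>s. cis (\<omega> * s) *\<^sub>C f) t"
    unfolding conv_def
    by (rule integral_cong) (simp add: rotated_def G_scaleC scaleC_scaleC cis_mult algebra_simps)
  finally have c: "cis (\<omega> * t) *\<^sub>C R.int_orbit \<omega> t f = conv (\<lambda>s. cis (\<omega> * s) *\<^sub>C f) t" .
  have "v = rotated \<omega> t v + R.int_orbit \<omega> t f" using st t by (simp add: stationary_def algebra_simps)
  then have "cis (\<omega> * t) *\<^sub>C v = cis (\<omega> * t) *\<^sub>C (rotated \<omega> t v + R.int_orbit \<omega> t f)" by (rule arg_cong)
  then show ?thesis by (simp add: scaleC_add_right c mild_def rotated_def scaleC_scaleC cis_mult)
qed

end

section \<open>Locality of forms, and choice of good times\<close>

lemma form_L2_disjoint: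
  assumes "bounded_bilinear b" "AE t in lebesgue. rep_L2 x t = 0 \<or> rep_L2 y t = 0"
  shows "form_L2 b x y = 0"
proof -
  interpret b: bounded_bilinear b by fact
  have "form_L2 b x y = integral\<^sup>L (lebesgue :: real measure) (\<lambda>_. 0)"
  proof (rule form_L2_eq[OF assms(1)])
    show "AE t in lebesgue. b (rep_L2 x t) (rep_L2 y t) = 0"
      using assms(2) by eventually_elim (auto simp: b.zero_left b.zero_right)
  qed simp
  then show ?thesis by simp
qed

lemma form_L2_shift:
  assumes b: "bounded_bilinear b"
  shows "form_L2 b (shift_L2 c x) (shift_L2 c y) = form_L2 b x y"
proof -
  have "form_L2 b (shift_L2 c x) (shift_L2 c y) = (LINT t|lebesgue. b (rep_L2 x (t + c)) (rep_L2 y (t + c)))"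
    unfolding shift_L2_def by (rule form_L2_abs[OF b]) (simp_all add: square_integrable_shift)
  also have "\<dots> = form_L2 b x y"
    unfolding form_L2_def
    using lebesgue_integral_real_affine[of 1 "\<lambda>t. b (rep_L2 x t) (rep_L2 y t)" c] by (simp add: add.commute)
  finally show ?thesis .
qed

text \<open>A function cannot exceed its mean almost everywhere, so a value at most the mean occurs
  at a time where \<open>P\<close> holds as well. With \<open>P\<close> the identity between state
  and mild solution, this finds times at which the trajectory is in the smaller space and controlled
  by its mass in the window.\<close>

lemma L2_pick:
  fixes z :: "'b::complex_hilbert L2"
  assumes "a < b" and P: "AE t in lebesgue. t \<in> {a<..<b} \<longrightarrow> P t"
  obtains s where "a < s" "s < b" "P s"
    "(b - a) * (norm (rep_L2 z s))\<^sup>2 \<le> (norm (restrict_L2 {a<..<b} z))\<^sup>2"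
proof -
  let ?I = "{a<..<b}"
  define c where "c = (norm (restrict_L2 ?I z))\<^sup>2 / (b - a)"
  have "\<exists>s\<in>?I. P s \<and> (norm (rep_L2 z s))\<^sup>2 \<le> c"
  proof (rule ccontr)
    assume neg: "\<not> ?thesis"
    have I: "?I \<in> sets lebesgue" by simp
    have AE: "AE t in lebesgue_on ?I. P t" using P by (simp add: AE_restrict_space_iff)
    have int: "integrable (lebesgue_on ?I) (\<lambda>t. (norm (rep_L2 z t))\<^sup>2)"
      using square_integrable_rep[of z] integrable_mult_indicator[OF I, of "\<lambda>t. (norm (rep_L2 z t))\<^sup>2"]
      by (simp add: integrable_restrict_space square_integrable_def del: square_integrable_rep)
    have intc: "integrable (lebesgue_on ?I) (\<lambda>t. c)"
      by (rule finite_measure.integrable_const[OF finite_measure_lebesgue_on]) simp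
    have pos: "AE t in lebesgue_on ?I. (norm (rep_L2 z t))\<^sup>2 - c > 0"
      using AE AE_space by eventually_elim (use neg in auto)
    have "(LINT t|lebesgue_on ?I. c) = c * (b - a)"
      using \<open>a < b\<close> by (simp add: measure_restrict_space)
    moreover have "c * (b - a) = (norm (restrict_L2 ?I z))\<^sup>2" using \<open>a < b\<close> by (simp add: c_def)
    ultimately have zero: "(LINT t|lebesgue_on ?I. (norm (rep_L2 z t))\<^sup>2 - c) = 0"
      unfolding Bochner_Integration.integral_diff[OF int intc] norm_restrict_L2_power2[OF I] by simp
    have nn: "AE t in lebesgue_on ?I. 0 \<le> (norm (rep_L2 z t))\<^sup>2 - c"
      using pos by eventually_elim simp
    have "AE t in lebesgue_on ?I. (norm (rep_L2 z t))\<^sup>2 - c = 0"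
      using zero integral_nonneg_eq_0_iff_AE[OF Bochner_Integration.integrable_diff[OF int intc] nn] by simp
    with pos have "AE t in lebesgue_on ?I. False" by eventually_elim simp
    then have "AE t in lebesgue. t \<notin> ?I" by (simp add: AE_restrict_space_iff)
    then have "negligible {t. \<not> t \<notin> ?I}" by (rule negligible_of_AE)
    moreover have "{t. \<not> t \<notin> ?I} = box a b" by (auto simp: box_real)
    ultimately have "negligible (box a b)" by (simp only:)
    then have "box a b = {}" by (simp only: negligible_interval)
    then show False using \<open>a < b\<close> by (simp add: box_real)
  qed
  then show ?thesis using that \<open>a < b\<close> by (auto simp: c_def field_simps)
qed

lemma restrict_L2_cong:
  assumes "S \<in> sets lebesgue" "S' \<in> sets lebesgue"
    and "AE t in lebesgue. t \<in> (S - S') \<union> (S' - S) \<longrightarrow> rep_L2 x t = 0"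
  shows "restrict_L2 S x = restrict_L2 S' x"
  by (rule L2_eqI) (use rep_restrict_L2[OF assms(1), of x] rep_restrict_L2[OF assms(2), of x] assms(3) in
      \<open>eventually_elim, auto simp: indicator_def\<close>)

section \<open>Processes with their initial states as a closed linear relation\<close>

locale control_system = frequency_semigroup G
  for G :: "real \<Rightarrow> 'h::complex_hilbert \<Rightarrow> 'h" +
  fixes j :: "'a::complex_hilbert \<Rightarrow> 'h" and B :: "'x::complex_hilbert \<Rightarrow> 'h"
  assumes B: "bounded_clinear B" and j: "bounded_clinear j" and inj_j: "inj j"
begin

definition inp :: "(real \<Rightarrow> 'a \<times> 'x) \<Rightarrow> real \<Rightarrow> 'h"
  where "inp z s = B (snd (z s))"

lemma bounded_linear_B_snd: "bounded_linear (\<lambda>y. B (snd y))"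
  by (rule bounded_linear_compose[OF bounded_clinear_linear[OF B] bounded_linear_snd])

lemma bounded_linear_j_fst: "bounded_linear (\<lambda>y. j (fst y))"
  by (rule bounded_linear_compose[OF bounded_clinear_linear[OF j] bounded_linear_fst])

lemma square_integrable_inp: "square_integrable z \<Longrightarrow> square_integrable (inp z)"
  unfolding inp_def by (rule square_integrable_bounded_linear[OF bounded_linear_B_snd])

lemma norm_conv_inp_le:
  obtains K where "0 \<le> K"
    "\<And>s z. square_integrable z \<Longrightarrow> 0 \<le> s \<Longrightarrow> s \<le> t \<Longrightarrow> norm (conv (inp z) s) \<le> K * norm (abs_L2 z)"
proof (cases "0 \<le> t")
  case t: True
  obtain M where M: "M \<ge> 1" "\<And>s y. 0 \<le> s \<Longrightarrow> s \<le> t \<Longrightarrow> norm (G s y) \<le> M * norm y" using bounded_on by blast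
  obtain KB where KB: "0 \<le> KB" "\<And>y. norm (B (snd y)) \<le> norm (y :: 'a \<times> 'x) * KB"
    using bounded_linear.nonneg_bounded[OF bounded_linear_B_snd] by blast
  have lin: "linear (\<lambda>y::'a \<times> 'x. G s (B (snd y)))" if "0 \<le> s" for s
    by (rule bounded_linear.linear[OF bounded_linear_compose[OF bounded_linear[OF that] bounded_linear_B_snd]])
  show ?thesis
  proof (rule that)
    show "0 \<le> M * KB * sqrt t" using M KB t by simp
    fix s and z :: "real \<Rightarrow> 'a \<times> 'x" assume z: "square_integrable z" and s: "0 \<le> s" "s \<le> t"
    have "norm (conv (inp z) s) \<le> M * KB * sqrt s * norm (abs_L2 z)"
      unfolding conv_def inp_def
    proof (rule strongly_continuous_integral(2)[where k = "\<lambda>r y. G (s - r) (B (snd y))", OF s(1)])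
      show "0 \<le> M * KB" using M KB by simp
      show "linear (\<lambda>y::'a \<times> 'x. G (s - r) (B (snd y)))" if "0 \<le> r" "r \<le> s" for r using lin that by simp
      show "norm (G (s - r) (B (snd y))) \<le> M * KB * norm y" if "0 \<le> r" "r \<le> s" for r and y :: "'a \<times> 'x"
      proof -
        have "norm (G (s - r) (B (snd y))) \<le> M * norm (B (snd y))" by (rule M(2)) (use that s in auto)
        also have "\<dots> \<le> M * (norm y * KB)" by (rule mult_left_mono[OF KB(2)]) (use M in simp)
        finally show ?thesis by (simp add: mult_ac)
      qed
    qed (auto intro: continuous_on_G_diff z)
    also have "\<dots> \<le> M * KB * sqrt t * norm (abs_L2 z)"
      using s M KB by (intro mult_right_mono mult_left_mono) auto
    finally show "norm (conv (inp z) s) \<le> M * KB * sqrt t * norm (abs_L2 z)" .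
  qed
next
  case False
  then show ?thesis using that[of 0] by auto
qed

lemma inp_AE_cong:
  assumes "AE s in lebesgue. s \<in> {0<..t} \<longrightarrow> z s = z' s"
  shows "mild u0 (inp z) t = mild u0 (inp z') t"
  by (rule mild_AE_cong) (use assms in \<open>eventually_elim, auto simp: inp_def\<close>)

lemma bounded_linear_conv_inp:
  assumes "0 \<le> t"
  shows "bounded_linear (\<lambda>z. conv (inp (rep_L2 z)) t)"
proof -
  obtain K where K: "0 \<le> K" "\<And>s z. square_integrable z \<Longrightarrow> 0 \<le> s \<Longrightarrow> s \<le> t \<Longrightarrow> norm (conv (inp z) s) \<le> K * norm (abs_L2 z)"
    using norm_conv_inp_le by blast
  have c: "conv (inp z) t = conv (rep_L2 (abs_L2 (inp z))) t" if "square_integrable z" for z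
    by (simp add: conv_abs_L2 square_integrable_inp that)
  interpret C: Real_Vector_Spaces.bounded_linear "\<lambda>x. conv (rep_L2 x) t" by (rule bounded_linear_conv[OF assms])
  interpret Bs: Real_Vector_Spaces.bounded_linear "\<lambda>y::'a \<times> 'x. B (snd y)" by (rule bounded_linear_B_snd)
  show ?thesis
  proof (rule bounded_linear_intro)
    fix x y :: "('a \<times> 'x) L2" and r :: real
    have sq: "square_integrable (inp (rep_L2 x))" for x by (rule square_integrable_inp) simp
    have "abs_L2 (inp (rep_L2 (x + y))) = abs_L2 (inp (rep_L2 x)) + abs_L2 (inp (rep_L2 y))"
      by (rule L2_eqI) (use rep_abs_L2[OF sq, of "x + y"] rep_abs_L2[OF sq, of x] rep_abs_L2[OF sq, of y]
        rep_plus_L2[of x y] rep_plus_L2[of "abs_L2 (inp (rep_L2 x))" "abs_L2 (inp (rep_L2 y))"]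
        in eventually_elim, use Bs.add in \<open>simp add: inp_def\<close>)
    then show "conv (inp (rep_L2 (x + y))) t = conv (inp (rep_L2 x)) t + conv (inp (rep_L2 y)) t"
      by (simp add: c C.add)
    have "abs_L2 (inp (rep_L2 (r *\<^sub>R x))) = r *\<^sub>R abs_L2 (inp (rep_L2 x))"
      by (rule L2_eqI) (use rep_abs_L2[OF sq, of "r *\<^sub>R x"] rep_abs_L2[OF sq, of x]
        rep_scaleR_L2[of r x] rep_scaleR_L2[of r "abs_L2 (inp (rep_L2 x))"]
        in eventually_elim, use Bs.scaleR in \<open>simp add: inp_def\<close>)
    then show "conv (inp (rep_L2 (r *\<^sub>R x))) t = r *\<^sub>R conv (inp (rep_L2 x)) t"
      by (simp add: c C.scaleR)
    show "norm (conv (inp (rep_L2 x)) t) \<le> norm x * K"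
      using K(2)[of "rep_L2 x" t] assms by (simp add: mult.commute)
  qed
qed

lemma conv_inp_scaleC:
  assumes "0 \<le> t"
  shows "conv (inp (rep_L2 (c *\<^sub>C z))) t = c *\<^sub>C conv (inp (rep_L2 z)) t"
proof -
  have "conv (inp (rep_L2 (c *\<^sub>C z))) t = integral {0..t} (\<lambda>s. c *\<^sub>C G (t - s) (inp (rep_L2 z) s))"
    unfolding conv_def
  proof (rule integral_AE_cong)
    show "AE s in lebesgue. s \<in> {0..t} \<longrightarrow> G (t - s) (inp (rep_L2 (c *\<^sub>C z)) s) = c *\<^sub>C G (t - s) (inp (rep_L2 z) s)"
      using rep_scaleC_L2[of c z] by eventually_elim (simp add: inp_def bounded_clinear_scaleC[OF B] G_scaleC)
  qed
  then show ?thesis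
    unfolding conv_def
    using integral_linear[OF integrable_conv[OF square_integrable_inp[OF square_integrable_rep] assms] bounded_linear_scaleC_right[of c], of z]
    by (simp add: o_def)
qed

text \<open>Vanishing at nonpositive times lets processes live in \<open>L2\<close> over the whole
  line, where continuing one process by another means adding a delayed copy. The initial state is a
  coordinate of its own, since point values are not continuous in the norm of
  \<open>L2\<close>.\<close>

definition processes :: "('a \<times> ('a \<times> 'x) L2) set"
  where "processes = {(v0, z). AE t in lebesgue. (t \<le> 0 \<longrightarrow> rep_L2 z t = 0) \<and>
    (0 < t \<longrightarrow> j (fst (rep_L2 z t)) = mild (j v0) (inp (rep_L2 z)) t)}"

lemma processes_add:
  assumes "p \<in> processes" "q \<in> processes"
  shows "p + q \<in> processes"
proof -
  obtain v z w y where pq: "p = (v, z)" "q = (w, y)" by (metis surj_pair)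
  interpret j: Real_Vector_Spaces.bounded_linear j by (rule bounded_clinear_linear[OF j])
  have "AE t in lebesgue. (t \<le> 0 \<longrightarrow> rep_L2 (z + y) t = 0) \<and>
      (0 < t \<longrightarrow> j (fst (rep_L2 (z + y) t)) = mild (j (v + w)) (inp (rep_L2 (z + y))) t)"
    using assms unfolding pq processes_def mem_Collect_eq prod.case
  proof (elim eventually_rev_mp, intro eventually_mono[OF rep_plus_L2[of z y]] impI conjI)
    fix t assume r: "rep_L2 (z + y) t = rep_L2 z t + rep_L2 y t"
      and z: "(t \<le> 0 \<longrightarrow> rep_L2 z t = 0) \<and> (0 < t \<longrightarrow> j (fst (rep_L2 z t)) = mild (j v) (inp (rep_L2 z)) t)"
      and y: "(t \<le> 0 \<longrightarrow> rep_L2 y t = 0) \<and> (0 < t \<longrightarrow> j (fst (rep_L2 y t)) = mild (j w) (inp (rep_L2 y)) t)"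
    show "rep_L2 (z + y) t = 0" if "t \<le> 0" using that r z y by simp
    show "j (fst (rep_L2 (z + y) t)) = mild (j (v + w)) (inp (rep_L2 (z + y))) t" if t: "0 < t"
      using t r z y linear_add[OF bounded_linear.linear[OF bounded_linear_conv_inp[of t]], of z y]
      by (simp add: mild_def j.add G_add)
  qed
  then show ?thesis by (simp add: pq processes_def)
qed

lemma processes_scaleC:
  assumes "p \<in> processes"
  shows "c *\<^sub>C p \<in> processes"
proof -
  obtain v z where p: "p = (v, z)" by (metis surj_pair)
  have "AE t in lebesgue. (t \<le> 0 \<longrightarrow> rep_L2 z t = 0) \<and> (0 < t \<longrightarrow> j (fst (rep_L2 z t)) = mild (j v) (inp (rep_L2 z)) t)"
    using assms by (simp add: p processes_def)
  then have "AE t in lebesgue. (t \<le> 0 \<longrightarrow> rep_L2 (c *\<^sub>C z) t = 0) \<and>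
      (0 < t \<longrightarrow> j (fst (rep_L2 (c *\<^sub>C z) t)) = mild (j (c *\<^sub>C v)) (inp (rep_L2 (c *\<^sub>C z))) t)"
    using rep_scaleC_L2[of c z]
    by eventually_elim
      (auto simp: mild_def bounded_clinear_scaleC[OF j] G_scaleC conv_inp_scaleC scaleC_add_right)
  then show ?thesis by (simp add: p processes_def scaleC_Pair)
qed

text \<open>At each fixed time the mild solution depends continuously on the initial state and on
  the input in \<open>L2\<close>; the other side of the identity converges almost everywhere along a
  subsequence.\<close>

lemma closed_processes: "closed processes"
  unfolding closed_sequential_limits
proof (intro allI impI)
  fix p l assume "(\<forall>n. p n \<in> processes) \<and> p \<longlonglongrightarrow> l"
  then have p: "\<And>n. p n \<in> processes" and lim: "p \<longlonglongrightarrow> l" by auto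
  obtain v z where l: "l = (v, z)" by (metis surj_pair)
  interpret j: Real_Vector_Spaces.bounded_linear j by (rule bounded_clinear_linear[OF j])
  have vl: "(\<lambda>n. fst (p n)) \<longlonglongrightarrow> v" and zl: "(\<lambda>n. snd (p n)) \<longlonglongrightarrow> z"
    using tendsto_fst[OF lim] tendsto_snd[OF lim] by (simp_all add: l)
  obtain r where r: "strict_mono r" "AE t in lebesgue. (\<lambda>n. rep_L2 (snd (p (r n))) t) \<longlonglongrightarrow> rep_L2 z t"
    by (rule L2_convergent_subseq_AE[OF zl])
  have vr: "(\<lambda>n. fst (p (r n))) \<longlonglongrightarrow> v" and zr: "(\<lambda>n. snd (p (r n))) \<longlonglongrightarrow> z"
    using LIMSEQ_subseq_LIMSEQ[OF vl r(1)] LIMSEQ_subseq_LIMSEQ[OF zl r(1)] by (simp_all add: o_def)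
  have "AE t in lebesgue. \<forall>n. (t \<le> 0 \<longrightarrow> rep_L2 (snd (p (r n))) t = 0) \<and>
      (0 < t \<longrightarrow> j (fst (rep_L2 (snd (p (r n))) t)) = mild (j (fst (p (r n)))) (inp (rep_L2 (snd (p (r n))))) t)"
    unfolding AE_all_countable using p by (auto simp: processes_def split_beta)
  then have "AE t in lebesgue. (t \<le> 0 \<longrightarrow> rep_L2 z t = 0) \<and>
      (0 < t \<longrightarrow> j (fst (rep_L2 z t)) = mild (j v) (inp (rep_L2 z)) t)"
    using r(2)
  proof eventually_elim
    case (elim t)
    show ?case
    proof (intro conjI impI)
      assume "t \<le> 0"
      then have "(\<lambda>n. 0) \<longlonglongrightarrow> rep_L2 z t" using elim by simp
      then show "rep_L2 z t = 0" using LIMSEQ_unique tendsto_const by blast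
    next
      assume t: "0 < t"
      interpret Gt: Real_Vector_Spaces.bounded_linear "G t" by (rule bounded_linear) (use t in simp)
      interpret Ct: Real_Vector_Spaces.bounded_linear "\<lambda>z. conv (inp (rep_L2 z)) t"
        by (rule bounded_linear_conv_inp) (use t in simp)
      have "(\<lambda>n. mild (j (fst (p (r n)))) (inp (rep_L2 (snd (p (r n))))) t) \<longlonglongrightarrow> mild (j v) (inp (rep_L2 z)) t"
        unfolding mild_def by (intro tendsto_add Gt.tendsto j.tendsto Ct.tendsto vr zr)
      moreover have "(\<lambda>n. j (fst (rep_L2 (snd (p (r n))) t))) \<longlonglongrightarrow> j (fst (rep_L2 z t))"
        using elim by (intro j.tendsto tendsto_fst) simp
      ultimately show "j (fst (rep_L2 z t)) = mild (j v) (inp (rep_L2 z)) t"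
        using elim t LIMSEQ_unique by simp
    qed
  qed
  then show "l \<in> processes" by (simp add: l processes_def)
qed

text \<open>After \<open>T\<close> the mild solution restarts from its value there, which must come
  from a state \<open>vT\<close> of the smaller space to have a continuation \<open>y\<close>. The
  delayed \<open>y\<close> vanishes before \<open>T\<close>, and \<open>w\<close> vanishes from
  \<open>T\<close> on.\<close>

lemma processes_concat:
  assumes T: "0 \<le> T" and w: "square_integrable w" and supp: "\<And>t. t \<notin> {0<..<T} \<Longrightarrow> w t = 0"
    and sol: "AE t in lebesgue. t \<in> {0<..<T} \<longrightarrow> j (fst (w t)) = mild (j v0) (inp w) t"
    and vT: "j vT = mild (j v0) (inp w) T" and y: "(vT, y) \<in> processes"
  shows "(v0, abs_L2 w + shift_L2 (- T) y) \<in> processes"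
proof -
  let ?z = "abs_L2 w + shift_L2 (- T) y"
  have y0: "AE t in lebesgue. t \<le> 0 \<longrightarrow> rep_L2 y t = 0"
    and y1: "AE t in lebesgue. 0 < t \<longrightarrow> j (fst (rep_L2 y t)) = mild (j vT) (inp (rep_L2 y)) t"
    using y by (auto simp: processes_def elim: eventually_mono)
  have z: "AE t in lebesgue. rep_L2 ?z t = (if t \<le> T then w t else rep_L2 y (t - T))"
    using rep_plus_L2[of "abs_L2 w" "shift_L2 (- T) y"] rep_abs_L2[OF w] rep_shift_L2[of "- T" y]
      AE_lebesgue_shift[OF y0, of "- T"]
    by eventually_elim (auto simp: supp)
  have z2: "AE t in lebesgue. rep_L2 ?z (t + T) = (if t \<le> 0 then w (t + T) else rep_L2 y t)"
    using AE_lebesgue_shift[OF z, of T] by eventually_elim (auto split: if_splits)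
  have le: "mild (j v0) (inp (rep_L2 ?z)) t = mild (j v0) (inp w) t" if "t \<le> T" for t
    by (rule inp_AE_cong) (use z in eventually_elim, use that in auto)
  have gt: "mild (j v0) (inp (rep_L2 ?z)) (T + t) = mild (j vT) (inp (rep_L2 y)) t" if t: "0 < t" for t
  proof -
    have "mild (j v0) (inp (rep_L2 ?z)) (T + t) = mild (mild (j v0) (inp (rep_L2 ?z)) T) (\<lambda>s. inp (rep_L2 ?z) (s + T)) t"
      by (rule mild_shift) (use T t square_integrable_inp in auto)
    also have "\<dots> = mild (j vT) (\<lambda>s. inp (rep_L2 ?z) (s + T)) t" by (simp add: le vT)
    also have "\<dots> = mild (j vT) (inp (rep_L2 y)) t"
      by (rule mild_AE_cong) (use z2 in eventually_elim, auto simp: inp_def)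
    finally show ?thesis .
  qed
  have "AE t in lebesgue. t \<noteq> T" by (intro AE_completion AE_lborel_singleton)
  then have "AE t in lebesgue. (t \<le> 0 \<longrightarrow> rep_L2 ?z t = 0) \<and>
      (0 < t \<longrightarrow> j (fst (rep_L2 ?z t)) = mild (j v0) (inp (rep_L2 ?z)) t)"
    using z sol AE_lebesgue_shift[OF y1, of "- T"]
  proof eventually_elim
    case (elim t)
    show ?case
    proof (intro conjI impI)
      show "rep_L2 ?z t = 0" if "t \<le> 0" using that elim(2) T supp by auto
      assume t: "0 < t"
      show "j (fst (rep_L2 ?z t)) = mild (j v0) (inp (rep_L2 ?z)) t"
      proof (cases "t < T")
        case True
        then show ?thesis using elim t le[of t] by simp
      next
        case False
        then have "T < t" using elim(1) by simp
        then show ?thesis using elim gt[of "t - T"] by simp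
      qed
    qed
  qed
  then show ?thesis by (simp add: processes_def)
qed

text \<open>The supports are disjoint up to null sets, so the cross terms vanish, and the form is
  invariant under shifts.\<close>

lemma form_L2_concat:
  assumes b: "bounded_bilinear b" and w: "square_integrable w" and supp: "\<And>t. t \<notin> {0<..<T} \<Longrightarrow> w t = 0"
    and y: "(vT, y) \<in> processes"
  shows "form_L2 b (abs_L2 w + shift_L2 (- T) y) (abs_L2 w + shift_L2 (- T) y) =
    (LINT t|lebesgue. b (w t) (w t)) + form_L2 b y y"
proof -
  interpret F: bounded_bilinear "form_L2 b" by (rule bounded_bilinear_form_L2[OF b])
  have y0: "AE t in lebesgue. t \<le> 0 \<longrightarrow> rep_L2 y t = 0"
    using y by (auto simp: processes_def elim: eventually_mono)
  have d: "AE t in lebesgue. rep_L2 (abs_L2 w) t = 0 \<or> rep_L2 (shift_L2 (- T) y) t = 0"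
    using rep_abs_L2[OF w] rep_shift_L2[of "- T" y] AE_lebesgue_shift[OF y0, of "- T"]
    by eventually_elim (auto simp: supp)
  then have d': "AE t in lebesgue. rep_L2 (shift_L2 (- T) y) t = 0 \<or> rep_L2 (abs_L2 w) t = 0"
    by eventually_elim blast
  show ?thesis
    unfolding F.add_left F.add_right form_L2_disjoint[OF b d] form_L2_disjoint[OF b d']
    by (simp add: form_L2_shift[OF b] form_L2_abs[OF b w w])
qed

end

lemma restrict_L2_shift:
  assumes "S \<in> sets lebesgue" "S' \<in> sets lebesgue" "\<And>t. t \<in> S \<longleftrightarrow> t + c \<in> S'"
  shows "restrict_L2 S (shift_L2 c x) = shift_L2 c (restrict_L2 S' x)"
  by (rule L2_eqI) (use rep_restrict_L2[OF assms(1), of "shift_L2 c x"] rep_shift_L2[of c x]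
      rep_shift_L2[of c "restrict_L2 S' x"] AE_lebesgue_shift[OF rep_restrict_L2[OF assms(2), of x], of c] in
      \<open>eventually_elim, auto simp: indicator_def assms(3)\<close>)

lemma form_L2_inner_self: "form_L2 inner x x = (norm x)\<^sup>2"
  by (simp add: form_L2_inner power2_norm_eq_inner)

section \<open>Optimal processes\<close>

context control_system
begin

text \<open>One half of Bellman's principle: the given stretch followed by the optimal continuation
  is only a competitor from \<open>v0\<close>, and its cost splits at \<open>T\<close>.\<close>

lemma optimal_concat_le:
  assumes b: "bounded_bilinear b"
    and opt: "\<And>v z. (v, z) \<in> processes \<Longrightarrow> form_L2 b (z0 v) (z0 v) \<le> form_L2 b z z"
    and proc: "\<And>v. (v, z0 v) \<in> processes"
    and T: "0 \<le> T" and w: "square_integrable w" "\<And>t. t \<notin> {0<..<T} \<Longrightarrow> w t = 0"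
    and sol: "AE t in lebesgue. t \<in> {0<..<T} \<longrightarrow> j (fst (w t)) = mild (j v0) (inp w) t"
    and vT: "j vT = mild (j v0) (inp w) T"
  shows "form_L2 b (z0 v0) (z0 v0) \<le> (LINT t|lebesgue. b (w t) (w t)) + form_L2 b (z0 vT) (z0 vT)"
  using opt[OF processes_concat[OF T w sol vT proc]] form_L2_concat[OF b w proc] by simp

text \<open>Stabilizability is only qualitative. Feeding the squared norm, coercive with constant 1,
  into the minimization lemma yields a linear choice \<open>S\<close> and, through the closed graph
  theorem, a uniform constant \<open>C\<close>.\<close>

lemma minimal_norm_processes:
  assumes surj: "\<And>v. \<exists>z. (v, z) \<in> processes"
  obtains S C where "bounded_clinear S" "\<And>v. (v, S v) \<in> processes"
    "\<And>v z. (v, z) \<in> processes \<Longrightarrow> norm (S v) \<le> norm z" "0 \<le> C" "\<And>v. norm (S v) \<le> C * norm v"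
proof -
  obtain S where S: "bounded_clinear S" "\<And>v. (v, S v) \<in> processes"
    "\<And>v z. (v, z) \<in> processes \<Longrightarrow> form_L2 inner z z \<ge> form_L2 inner (S v) (S v) + 1 * (norm (z - S v))\<^sup>2"
  proof (rule quadratic_minimizer_over_relation)
    show "bounded_bilinear (form_L2 inner :: ('a \<times> 'x) L2 \<Rightarrow> _)" by (rule bounded_bilinear_form_L2[OF bounded_bilinear_inner])
    show "form_L2 inner x y = form_L2 inner y x" for x y :: "('a \<times> 'x) L2" by (simp add: form_L2_inner inner_commute)
    show "form_L2 inner (c *\<^sub>C x) y = form_L2 inner x (cnj c *\<^sub>C y)" for c and x y :: "('a \<times> 'x) L2"
      by (simp add: form_L2_inner inner_scaleC)
    show "form_L2 inner z z \<ge> 1 * (norm z)\<^sup>2" for z :: "('a \<times> 'x) L2" by (simp add: form_L2_inner_self)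
    show "p + q \<in> processes" if "p \<in> processes" "q \<in> processes" for p q by (rule processes_add[OF that])
    show "c *\<^sub>C p \<in> processes" if "p \<in> processes" for c p by (rule processes_scaleC[OF that])
    show "closed processes" by (rule closed_processes)
    show "\<exists>z. (v, z) \<in> processes" for v by (rule surj)
    show "0 < (1::real)" by simp
  qed (rule that)
  obtain C where C: "0 \<le> C" "\<And>v. norm (S v) \<le> norm v * C"
    using bounded_linear.nonneg_bounded[OF bounded_clinear_linear[OF S(1)]] by blast
  show ?thesis
  proof (rule that[OF S(1,2) _ C(1)])
    fix v z assume "(v, z) \<in> processes"
    then have "(norm z)\<^sup>2 \<ge> (norm (S v))\<^sup>2 + 1 * (norm (z - S v))\<^sup>2"
      using S(3)[of v z] by (simp only: form_L2_inner_self)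
    then have "(norm (S v))\<^sup>2 \<le> (norm z)\<^sup>2" using zero_le_power2[of "norm (z - S v)"] by linarith
    then show "norm (S v) \<le> norm z" by simp
  qed (use C in \<open>simp add: mult.commute\<close>)
qed

lemma processes_support: "(v, z) \<in> processes \<Longrightarrow> AE t in lebesgue. t \<le> 0 \<longrightarrow> rep_L2 z t = 0"
  and processes_solution:
    "(v, z) \<in> processes \<Longrightarrow> AE t in lebesgue. 0 < t \<longrightarrow> j (fst (rep_L2 z t)) = mild (j v) (inp (rep_L2 z)) t"
  by (auto simp: processes_def elim: eventually_mono)

text \<open>A tail of a process of minimal norm competes with the process of minimal norm that starts at
  the current state; picking a time at which the state is small then yields exponential decay.\<close>

lemma minimal_norm_tail_le:
  assumes proc: "\<And>v. (v, S v) \<in> processes"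
    and min: "\<And>v z. (v, z) \<in> processes \<Longrightarrow> norm (S v) \<le> norm z"
    and t: "0 < t" and w: "j w = mild (j h) (inp (rep_L2 (S h))) t"
  shows "norm (restrict_L2 {t<..} (S h)) \<le> norm (S w)"
proof -
  let ?y = "S h" let ?w = "\<lambda>s. indicator {0<..<t} s *\<^sub>R rep_L2 ?y s"
  have sq: "square_integrable ?w" by (rule square_integrable_indicator_scaleR) simp_all
  have cong: "mild (j h) (inp (rep_L2 ?y)) s = mild (j h) (inp ?w) s" if "s \<le> t" for s
  proof (rule inp_AE_cong)
    have "AE r in lebesgue. r \<noteq> t" by (intro AE_completion AE_lborel_singleton)
    then show "AE r in lebesgue. r \<in> {0<..s} \<longrightarrow> rep_L2 ?y r = ?w r"
      by eventually_elim (use that in \<open>auto simp: indicator_def\<close>)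
  qed
  have "form_L2 inner (S h) (S h) \<le> (LINT s|lebesgue. inner (?w s) (?w s)) + form_L2 inner (S w) (S w)"
  proof (rule optimal_concat_le[where vT = w and T = t, OF bounded_bilinear_inner _ proc])
    show "form_L2 inner (S v) (S v) \<le> form_L2 inner z z" if "(v, z) \<in> processes" for v z
      using power_mono[OF min[OF that], of 2] by (simp add: form_L2_inner_self)
    show "AE s in lebesgue. s \<in> {0<..<t} \<longrightarrow> j (fst (?w s)) = mild (j h) (inp ?w) s"
      using processes_solution[OF proc[of h]] by eventually_elim (auto simp: cong[symmetric])
    show "j w = mild (j h) (inp ?w) t" using w cong[of t] by simp
  qed (use sq t in auto)
  moreover have "(LINT s|lebesgue. inner (?w s) (?w s)) = (norm (restrict_L2 (- {t<..}) (S h)))\<^sup>2"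
  proof -
    \<comment> \<open>Nonpositive times carry nothing and the point \<open>t\<close> is null, so the
      complement of the tail reduces to an open interval.\<close>
    have eq: "restrict_L2 (- {t<..}) (S h) = restrict_L2 {0<..<t} (S h)"
    proof (rule restrict_L2_cong)
      have "AE r in lebesgue. r \<noteq> t" by (intro AE_completion AE_lborel_singleton)
      then show "AE r in lebesgue. r \<in> (- {t<..} - {0<..<t}) \<union> ({0<..<t} - - {t<..}) \<longrightarrow> rep_L2 (S h) r = 0"
        using processes_support[OF proc[of h]] by eventually_elim auto
    qed auto
    show ?thesis
      unfolding eq unfolding restrict_L2_def unfolding norm_abs_L2_power2[OF sq] unfolding power2_norm_eq_inner ..
  qed
  ultimately have "(norm (restrict_L2 {t<..} (S h)))\<^sup>2 \<le> (norm (S w))\<^sup>2"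
    using norm_restrict_L2_Pythagoras[of "{t<..}" "S h"] by (simp add: form_L2_inner_self)
  then show ?thesis by simp
qed

lemma minimal_norm_decay:
  assumes proc: "\<And>v. (v, S v) \<in> processes"
    and min: "\<And>v z. (v, z) \<in> processes \<Longrightarrow> norm (S v) \<le> norm z"
    and C: "0 \<le> C" "\<And>v. norm (S v) \<le> C * norm v"
    and T: "4 * C\<^sup>2 + 1 \<le> T"
  shows "norm (restrict_L2 {real n * T<..} (S h)) \<le> (1/2)^n * (C * norm h)"
proof -
  \<comment> \<open>The summand \<open>4 * C\<^sup>2\<close> in the bound for \<open>T\<close>
    produces the factor one half; the summand 1 keeps \<open>T \<ge> 1\<close> even when
    \<open>C\<close> is zero.\<close>
  have T1: "1 \<le> T" "0 < T" using T zero_le_power2[of C] by linarith+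
  have step: "norm (restrict_L2 {t + T<..} (S h)) \<le> (1/2) * norm (restrict_L2 {t<..} (S h))" if t: "0 \<le> t" for t
  proof -
    have ae: "AE s in lebesgue. s \<in> {t<..<t + T} \<longrightarrow> j (fst (rep_L2 (S h) s)) = mild (j h) (inp (rep_L2 (S h))) s"
      using processes_solution[OF proc[of h]] by eventually_elim (use t in auto)
    obtain s where s: "t < s" "s < t + T" "j (fst (rep_L2 (S h) s)) = mild (j h) (inp (rep_L2 (S h))) s"
      "(t + T - t) * (norm (rep_L2 (S h) s))\<^sup>2 \<le> (norm (restrict_L2 {t<..<t + T} (S h)))\<^sup>2"
      by (rule L2_pick[OF _ ae, where z = "S h"]) (use T1 in simp, rule that)
    let ?\<phi> = "norm (restrict_L2 {t<..} (S h))"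
    have "norm (restrict_L2 {t + T<..} (S h)) \<le> norm (restrict_L2 {s<..} (S h))"
      by (rule norm_restrict_L2_mono) (use s in auto)
    also have "\<dots> \<le> norm (S (fst (rep_L2 (S h) s)))"
      by (rule minimal_norm_tail_le[OF proc min]) (use s t in auto)
    also have "\<dots> \<le> C * norm (fst (rep_L2 (S h) s))" by (rule C)
    also have "\<dots> \<le> C * norm (rep_L2 (S h) s)"
      using C(1) norm_fst_le[of "fst (rep_L2 (S h) s)" "snd (rep_L2 (S h) s)"] by (intro mult_left_mono) auto
    finally have 1: "norm (restrict_L2 {t + T<..} (S h)) \<le> C * norm (rep_L2 (S h) s)" .
    have "norm (restrict_L2 {t<..<t + T} (S h)) \<le> ?\<phi>" by (rule norm_restrict_L2_mono) auto
    then have sq: "(norm (restrict_L2 {t<..<t + T} (S h)))\<^sup>2 \<le> ?\<phi>\<^sup>2" by (rule power_mono) simp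
    have "T * (norm (rep_L2 (S h) s))\<^sup>2 \<le> (norm (restrict_L2 {t<..<t + T} (S h)))\<^sup>2" using s(4) by simp
    then have 2: "T * (norm (rep_L2 (S h) s))\<^sup>2 \<le> ?\<phi>\<^sup>2" using sq by (rule order_trans)
    \<comment> \<open>Averaging over a window of length \<open>T\<close> made \<open>T\<close> times
      the squared state at \<open>s\<close> at most the square of \<open>?\<phi>\<close>; since
      \<open>4 * C\<^sup>2 \<le> T\<close>, \<open>C\<close> times the state is at most half of
      \<open>?\<phi>\<close>.\<close>
    have "4 * C\<^sup>2 * (norm (rep_L2 (S h) s))\<^sup>2 \<le> T * (norm (rep_L2 (S h) s))\<^sup>2"
      using T by (intro mult_right_mono) auto
    then have "(2 * (C * norm (rep_L2 (S h) s)))\<^sup>2 \<le> ?\<phi>\<^sup>2" using 2 by (simp add: power_mult_distrib)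
    then have "2 * (C * norm (rep_L2 (S h) s)) \<le> ?\<phi>" by (rule power2_le_imp_le) simp
    then show ?thesis using 1 by simp
  qed
  show ?thesis
  proof (induction n)
    case 0
    have "norm (restrict_L2 {0::real<..} (S h)) \<le> norm (restrict_L2 UNIV (S h))"
      by (rule norm_restrict_L2_mono) auto
    also have "restrict_L2 UNIV (S h) = S h" by (simp add: restrict_L2_def)
    finally show ?case using C(2)[of h] by simp
  next
    case (Suc n)
    have "norm (restrict_L2 {real (Suc n) * T<..} (S h)) \<le> (1/2) * norm (restrict_L2 {real n * T<..} (S h))"
      using step[of "real n * T"] T1 by (simp add: distrib_right add.commute)
    then show ?case using Suc by simp
  qed
qed

text \<open>Decay in the mean does not bound point values. But the state at \<open>t\<close> is
  reached within one unit of time from a small state at a picked time in the preceding unit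
  interval, so the tail after \<open>t - 1\<close> controls it in the norm of the large
  space.\<close>

lemma minimal_norm_state_tendsto_zero:
  assumes proc: "\<And>v. (v, S v) \<in> processes"
    and min: "\<And>v z. (v, z) \<in> processes \<Longrightarrow> norm (S v) \<le> norm z"
    and C: "0 \<le> C" "\<And>v. norm (S v) \<le> C * norm v"
    and T: "4 * C\<^sup>2 + 1 \<le> T"
  shows "(\<lambda>n. mild (j h) (inp (rep_L2 (S h))) (real n * T)) \<longlonglongrightarrow> 0"
proof -
  let ?y = "S h"
  have T1: "1 \<le> T" "0 < T" using T zero_le_power2[of C] by linarith+
  obtain K where K: "0 \<le> K" "\<And>s z. square_integrable z \<Longrightarrow> 0 \<le> s \<Longrightarrow> s \<le> 1 \<Longrightarrow> norm (conv (inp z) s) \<le> K * norm (abs_L2 z)"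
    using norm_conv_inp_le by blast
  obtain M where M: "M \<ge> 1" "\<And>s y. 0 \<le> s \<Longrightarrow> s \<le> 1 \<Longrightarrow> norm (G s y) \<le> M * norm y" using bounded_on by blast
  obtain Kj where Kj: "0 \<le> Kj" "\<And>y. norm (j (fst y)) \<le> norm (y :: 'a \<times> 'x) * Kj"
    using bounded_linear.nonneg_bounded[OF bounded_linear_j_fst] by blast
  have est: "norm (mild (j h) (inp (rep_L2 ?y)) t) \<le> (M * Kj + K) * norm (restrict_L2 {t - 1<..} ?y)" if t: "1 \<le> t" for t
  proof -
    let ?\<phi> = "norm (restrict_L2 {t - 1<..} ?y)"
    have ae: "AE s in lebesgue. s \<in> {t - 1<..<t} \<longrightarrow> j (fst (rep_L2 ?y s)) = mild (j h) (inp (rep_L2 ?y)) s"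
      using processes_solution[OF proc[of h]] by eventually_elim (use t in auto)
    obtain s where s: "t - 1 < s" "s < t" "j (fst (rep_L2 ?y s)) = mild (j h) (inp (rep_L2 ?y)) s"
      "(t - (t - 1)) * (norm (rep_L2 ?y s))\<^sup>2 \<le> (norm (restrict_L2 {t - 1<..<t} ?y))\<^sup>2"
      by (rule L2_pick[OF _ ae, where z = ?y]) (simp, rule that)
    have "(norm (rep_L2 ?y s))\<^sup>2 \<le> (norm (restrict_L2 {t - 1<..<t} ?y))\<^sup>2" using s(4) by simp
    then have "norm (rep_L2 ?y s) \<le> norm (restrict_L2 {t - 1<..<t} ?y)" by (rule power2_le_imp_le) simp
    also have "\<dots> \<le> ?\<phi>" by (rule norm_restrict_L2_mono) auto
    finally have ns: "norm (rep_L2 ?y s) \<le> ?\<phi>" .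
    \<comment> \<open>The process restarted at \<open>s\<close>; cutting off negative times makes
      its norm that of the tail after \<open>s\<close>.\<close>
    define z where "z = restrict_L2 {0<..} (shift_L2 s ?y)"
    have "mild (j h) (inp (rep_L2 ?y)) t = mild (mild (j h) (inp (rep_L2 ?y)) s) (\<lambda>r. inp (rep_L2 ?y) (r + s)) (t - s)"
      using mild_shift[OF square_integrable_inp[OF square_integrable_rep[of ?y]], of s "t - s" "j h"] s t by simp
    also have "\<dots> = mild (j (fst (rep_L2 ?y s))) (inp (rep_L2 z)) (t - s)"
      unfolding s(3)
    proof (rule mild_AE_cong)
      show "AE r in lebesgue. r \<in> {0<..t - s} \<longrightarrow> inp (rep_L2 ?y) (r + s) = inp (rep_L2 z) r"
        using rep_shift_L2[of s ?y] rep_restrict_L2[of "{0<..}" "shift_L2 s ?y", folded z_def, simplified]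
        by eventually_elim (auto simp: inp_def)
    qed
    finally have "norm (mild (j h) (inp (rep_L2 ?y)) t) \<le>
        norm (G (t - s) (j (fst (rep_L2 ?y s)))) + norm (conv (inp (rep_L2 z)) (t - s))"
      by (simp add: mild_def norm_triangle_ineq)
    also have "norm (G (t - s) (j (fst (rep_L2 ?y s)))) \<le> M * norm (j (fst (rep_L2 ?y s)))"
      by (rule M(2)) (use s in auto)
    also have "\<dots> \<le> M * (?\<phi> * Kj)"
      using M(1) Kj(1) by (intro mult_left_mono order_trans[OF Kj(2)] mult_right_mono ns) auto
    also have "norm (conv (inp (rep_L2 z)) (t - s)) \<le> K * ?\<phi>"
    proof -
      have "norm z = norm (restrict_L2 {s<..} ?y)"
        unfolding z_def by (subst restrict_L2_shift[where S' = "{s<..}"]) auto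
      also have "\<dots> \<le> ?\<phi>" by (rule norm_restrict_L2_mono) (use s in auto)
      finally have "K * norm z \<le> K * ?\<phi>" using K(1) by (rule mult_left_mono)
      then show ?thesis using K(2)[of "rep_L2 z" "t - s"] s by simp
    qed
    finally show ?thesis by (simp add: algebra_simps)
  qed
  have "norm (mild (j h) (inp (rep_L2 ?y)) (real (Suc n) * T)) \<le> (M * Kj + K) * ((1/2)^n * (C * norm h))" for n
  proof -
    have "1 * 1 \<le> real (Suc n) * T" by (rule mult_mono) (use T1 in auto)
    then have "1 \<le> real (Suc n) * T" by simp
    then have "norm (mild (j h) (inp (rep_L2 ?y)) (real (Suc n) * T)) \<le> (M * Kj + K) * norm (restrict_L2 {real (Suc n) * T - 1<..} ?y)"
      by (rule est)
    \<comment> \<open>Here \<open>1 \<le> T\<close> enters: one unit back from \<open>Suc n\<close>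
      periods does not pass below \<open>n\<close> periods.\<close>
    also have "norm (restrict_L2 {real (Suc n) * T - 1<..} ?y) \<le> norm (restrict_L2 {real n * T<..} ?y)"
      by (rule norm_restrict_L2_mono) (use T1 in \<open>auto simp: algebra_simps\<close>)
    also have "\<dots> \<le> (1/2)^n * (C * norm h)" by (rule minimal_norm_decay[OF proc min C T])
    finally show ?thesis using M(1) Kj(1) K(1) by (simp add: mult_left_mono)
  qed
  then have ev: "eventually (\<lambda>n. norm (mild (j h) (inp (rep_L2 ?y)) (real (Suc n) * T)) \<le>
      (M * Kj + K) * ((1/2)^n * (C * norm h))) sequentially" by simp
  have "(\<lambda>n. mild (j h) (inp (rep_L2 ?y)) (real (Suc n) * T)) \<longlonglongrightarrow> 0"
    by (rule Lim_null_comparison[OF ev])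
      (intro tendsto_mult_right_zero tendsto_mult_left_zero LIMSEQ_realpow_zero, auto)
  then show ?thesis by (rule LIMSEQ_imp_Suc)
qed

end

section \<open>Fourier series of square-integrable functions\<close>

lemma subspace_closure:
  fixes S :: "'b::real_normed_vector set"
  assumes "subspace S"
  shows "subspace (closure S)"
proof (rule subspaceI)
  show "0 \<in> closure S" using subspace_0[OF assms] closure_subset by blast
  fix x y and c :: real assume "x \<in> closure S"
  then obtain f where f: "\<And>n. f n \<in> S" "f \<longlonglongrightarrow> x" by (auto simp: closure_sequential)
  have "(\<lambda>n. c *\<^sub>R f n) \<longlonglongrightarrow> c *\<^sub>R x" by (intro tendsto_intros f)
  then show "c *\<^sub>R x \<in> closure S"
    unfolding closure_sequential by (intro exI[of _ "\<lambda>n. c *\<^sub>R f n"]) (simp add: subspace_scale assms f)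
  assume "y \<in> closure S"
  then obtain g where g: "\<And>n. g n \<in> S" "g \<longlonglongrightarrow> y" by (auto simp: closure_sequential)
  have "(\<lambda>n. f n + g n) \<longlonglongrightarrow> x + y" by (intro tendsto_intros f g)
  then show "x + y \<in> closure S"
    unfolding closure_sequential by (intro exI[of _ "\<lambda>n. f n + g n"]) (simp add: subspace_add assms f g)
qed

locale fourier =
  fixes T :: real
  assumes T: "0 < T"
begin

definition freq :: "int \<Rightarrow> real"
  where "freq k = 2 * pi * of_int k / T"

inductive trig_poly :: "(real \<Rightarrow> complex) \<Rightarrow> bool" where
  monom: "trig_poly (\<lambda>t. c * cis (freq k * t))"
| add: "trig_poly p \<Longrightarrow> trig_poly q \<Longrightarrow> trig_poly (\<lambda>t. p t + q t)"

lemma trig_poly_mult: "trig_poly p \<Longrightarrow> trig_poly q \<Longrightarrow> trig_poly (\<lambda>t. p t * q t)"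
proof (induction rule: trig_poly.induct)
  case (monom c k)
  then show ?case
  proof (induction rule: trig_poly.induct)
    case (monom c' k')
    have "(\<lambda>t. c * cis (freq k * t) * (c' * cis (freq k' * t))) = (\<lambda>t. (c * c') * cis (freq (k + k') * t))"
      by (simp add: fun_eq_iff freq_def cis_mult[symmetric] add_divide_distrib distrib_left distrib_right)
    then show ?case by (simp only: trig_poly.monom)
  qed (auto simp: distrib_left intro: trig_poly.add)
qed (auto simp: distrib_right intro: trig_poly.add)

lemma trig_poly_const: "trig_poly (\<lambda>_. c)"
  using trig_poly.monom[of c 0] by (simp add: freq_def)

text \<open>Stone-Weierstrass on the unit circle gives polynomials in real linear functionals of the
  point; such a functional at \<open>cis x\<close> is a combination of cosine and sine, hence of
  \<open>cis x\<close> and \<open>cis (- x)\<close>.\<close>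

lemma trig_poly_of_real_polynomial:
  assumes "real_polynomial_function g"
  shows "trig_poly (\<lambda>t. complex_of_real (g (cis (freq 1 * t))))"
  using assms
proof (induction g)
  case (linear f)
  then interpret f: bounded_linear f .
  have "complex_of_real (f (cis x)) = complex_of_real (f 1) * ((cis x + cis (- x)) / 2)
      + complex_of_real (f \<i>) * ((cis x - cis (- x)) / (2 * \<i>))" for x
  proof -
    have "f (cis x) = f (cos x *\<^sub>R 1 + sin x *\<^sub>R \<i>)" by (rule arg_cong[of _ _ f]) (simp add: complex_eq_iff)
    also have "\<dots> = cos x * f 1 + sin x * f \<i>" by (simp add: f.add f.scaleR)
    finally have 1: "f (cis x) = cos x * f 1 + sin x * f \<i>" .
    have 2: "(cis x + cis (- x)) / 2 = complex_of_real (cos x)" by (simp add: complex_eq_iff)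
    have 3: "(cis x - cis (- x)) / (2 * \<i>) = complex_of_real (sin x)"
    proof -
      have "cis x - cis (- x) = 2 * \<i> * complex_of_real (sin x)" by (simp add: complex_eq_iff)
      then show ?thesis by simp
    qed
    show ?thesis unfolding 1 2 3 by simp
  qed
  note cis_form = this
  have "(\<lambda>t. complex_of_real (f (cis (freq 1 * t)))) =
      (\<lambda>t. complex_of_real (f 1) / 2 * cis (freq 1 * t) + complex_of_real (f 1) / 2 * cis (freq (- 1) * t) +
        (complex_of_real (f \<i>) / (2 * \<i>) * cis (freq 1 * t) + - complex_of_real (f \<i>) / (2 * \<i>) * cis (freq (- 1) * t)))"
  proof
    fix t
    have m: "freq (- 1) * t = - (freq 1 * t)" by (simp add: freq_def)
    show "complex_of_real (f (cis (freq 1 * t))) =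
      complex_of_real (f 1) / 2 * cis (freq 1 * t) + complex_of_real (f 1) / 2 * cis (freq (- 1) * t) +
        (complex_of_real (f \<i>) / (2 * \<i>) * cis (freq 1 * t) + - complex_of_real (f \<i>) / (2 * \<i>) * cis (freq (- 1) * t))"
      unfolding cis_form m by (simp add: field_simps)
  qed
  then show ?case by (simp only:) (intro trig_poly.add trig_poly.monom)
next
  case (const c)
  show ?case by (rule trig_poly_const)
next
  case (add f g)
  then show ?case by (simp add: trig_poly.add)
next
  case (mult f g)
  then show ?case by (simp add: trig_poly_mult)
qed

lemma cis_freq_eq_imp:
  assumes "cis (freq 1 * s) = cis (freq 1 * t)" "s \<in> {0..T}" "t \<in> {0..T}"
  shows "s = t \<or> {s, t} = {0, T}"
proof -
  obtain n :: int where n: "\<i> * complex_of_real (freq 1 * s) = \<i> * complex_of_real (freq 1 * t) + (of_int (2 * n) * pi) * \<i>"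
    using assms(1) unfolding cis_conv_exp exp_eq by blast
  have "freq 1 * s = freq 1 * t + 2 * of_int n * pi"
    using arg_cong[OF n, of Im] by simp
  then have "pi * (s - t) = pi * (of_int n * T)" using T by (simp add: freq_def field_simps)
  then have st: "s - t = of_int n * T" by simp
  then have "\<bar>of_int n * T\<bar> \<le> 1 * T" using assms by auto
  then have "\<bar>of_int n :: real\<bar> \<le> 1" using T by (simp add: abs_mult)
  then have "n = 0 \<or> n = 1 \<or> n = - 1" by linarith
  then show ?thesis using st assms by auto
qed

text \<open>The interval with its ends identified is the circle: \<open>g\<close> descends to a
  function \<open>Gf\<close> there, to which Stone-Weierstrass applies.\<close>

lemma trig_poly_dense_uniform:
  assumes g: "continuous_on {0..T} g" "g 0 = g T" and e: "e > 0"
  shows "\<exists>p. trig_poly p \<and> (\<forall>t\<in>{0..T}. cmod (p t - complex_of_real (g t)) < e)"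
proof -
  let ?\<phi> = "\<lambda>t. cis (freq 1 * t)"
  define Gf where "Gf z = g (SOME t. t \<in> {0..T} \<and> ?\<phi> t = z)" for z
  have Gf: "Gf (?\<phi> t) = g t" if t: "t \<in> {0..T}" for t
  proof -
    define s where "s = (SOME s. s \<in> {0..T} \<and> ?\<phi> s = ?\<phi> t)"
    have s: "s \<in> {0..T} \<and> ?\<phi> s = ?\<phi> t" unfolding s_def by (rule someI[of _ t]) (use t in simp)
    then have "s = t \<or> {s, t} = {0, T}" using cis_freq_eq_imp t by blast
    then have "g s = g t" using g(2) by (auto simp: doubleton_eq_iff)
    then show ?thesis by (simp add: Gf_def s_def)
  qed
  have sphere: "?\<phi> ` {0..T} = sphere 0 1"
  proof (intro equalityI subsetI)
    fix z :: complex assume z: "z \<in> sphere 0 1"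
    then have nz: "cmod z = 1" by simp
    have zA: "z = cis (Arg2pi z)" using Arg2pi[of z] nz by (simp add: is_Arg_def cis_conv_exp)
    have "?\<phi> (T * Arg2pi z / (2 * pi)) = z" using T zA by (simp add: freq_def)
    moreover have "T * Arg2pi z / (2 * pi) \<in> {0..T}"
      using T Arg2pi_ge_0[of z] Arg2pi_lt_2pi[of z] by (auto simp: field_simps)
    ultimately show "z \<in> ?\<phi> ` {0..T}" by (metis imageI)
  qed auto
  have cont\<phi>: "continuous_on {0..T} ?\<phi>" by (intro continuous_intros)
  \<comment> \<open>The parametrization maps compact sets to closed ones, so preimages of closed
    sets under the descended function are closed.\<close>
  have "continuous_on (sphere 0 1) Gf"
    unfolding continuous_on_closed_vimage[OF closed_sphere]
  proof (intro allI impI)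
    fix C :: "real set" assume C: "closed C"
    have "Gf -` C \<inter> sphere 0 1 = ?\<phi> ` ({0..T} \<inter> g -` C)"
      unfolding sphere[symmetric] using Gf by auto
    moreover have "closed ({0..T} \<inter> g -` C)"
      using continuous_closed_preimage[OF g(1) closed_atLeastAtMost C] .
    then have "compact ({0..T} \<inter> g -` C)"
      using compact_Icc[of 0 T] by (metis Int_commute compact_Int_closed inf.idem inf_assoc)
    then have "compact (?\<phi> ` ({0..T} \<inter> g -` C))"
      by (intro compact_continuous_image continuous_on_subset[OF cont\<phi>]) auto
    ultimately show "closed (Gf -` C \<inter> sphere 0 1)" by (simp add: compact_imp_closed)
  qed
  then obtain q where q: "polynomial_function q" "\<And>z. z \<in> sphere 0 1 \<Longrightarrow> norm (Gf z - q z) < e"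
    using Stone_Weierstrass_polynomial_function[of "sphere (0::complex) 1" Gf e] e by auto
  then have "real_polynomial_function q" by (simp add: real_polynomial_function_eq)
  then have tp: "trig_poly (\<lambda>t. complex_of_real (q (?\<phi> t)))" by (rule trig_poly_of_real_polynomial)
  show ?thesis
  proof (intro exI conjI ballI, rule tp)
    fix t assume t: "t \<in> {0..T}"
    have "norm (Gf (?\<phi> t) - q (?\<phi> t)) < e" by (rule q) (use t sphere in auto)
    then show "cmod (complex_of_real (q (?\<phi> t)) - complex_of_real (g t)) < e"
      using Gf[OF t] by (simp add: norm_minus_commute flip: of_real_diff)
  qed
qed

definition mode :: "int \<Rightarrow> 'b::complex_hilbert \<Rightarrow> 'b L2"
  where "mode k x = abs_L2 (\<lambda>t. indicator {0<..<T} t *\<^sub>R (cis (freq k * t) *\<^sub>C x))"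

definition fourier_coeff :: "'b::complex_hilbert L2 \<Rightarrow> int \<Rightarrow> 'b"
  where "fourier_coeff u k = integral {0..T} (\<lambda>t. cis (- (freq k * t)) *\<^sub>C rep_L2 u t) /\<^sub>R T"

lemma strongly_measurable_continuous:
  fixes f :: "real \<Rightarrow> 'b::topological_space"
  assumes "continuous_on UNIV f"
  shows "strongly_measurable lebesgue f"
proof (rule strongly_measurable_compose1[where h = f and f = "\<lambda>t. t"])
  show "strongly_measurable lebesgue (\<lambda>t::real. t)"
    unfolding strongly_measurable_lebesgue_real_iff by (rule measurable_completion) simp
  show "(\<lambda>n. f (u n)) \<longlonglongrightarrow> f x" if "u \<longlonglongrightarrow> x" for u x
    using continuous_on_tendsto_compose[OF assms that] by simp
qed

lemma square_integrable_continuous_scaleC: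
  assumes p: "continuous_on UNIV p" "\<And>t. t \<in> {0<..<T} \<Longrightarrow> cmod (p t) \<le> C"
  shows "square_integrable (\<lambda>t. indicator {0<..<T} t *\<^sub>R (p t *\<^sub>C (x::'b::complex_hilbert)))"
proof (rule square_integrable_bound)
  show "strongly_measurable lebesgue (\<lambda>t. indicator {0<..<T} t *\<^sub>R (p t *\<^sub>C x))"
    by (intro strongly_measurable_indicator_scaleR strongly_measurable_continuous
        continuous_on_scaleC p(1) continuous_on_const) simp
  show "square_integrable (\<lambda>t. indicator {0<..<T} t *\<^sub>R x)"
    by (rule square_integrable_indicator) simp
  show "AE t in lebesgue. norm (indicator {0<..<T} t *\<^sub>R (p t *\<^sub>C x)) \<le> C * norm (indicator {0<..<T} t *\<^sub>R x)"
    using p(2) by (intro always_eventually allI) (auto simp: indicator_def mult_right_mono)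
qed

lemma square_integrable_mode: "square_integrable (\<lambda>t. indicator {0<..<T} t *\<^sub>R (cis (freq k * t) *\<^sub>C x))"
  by (rule square_integrable_continuous_scaleC[where C = 1]) (auto intro: continuous_intros)

lemma trig_poly_in_span:
  "trig_poly p \<Longrightarrow> square_integrable (\<lambda>t. indicator {0<..<T} t *\<^sub>R (p t *\<^sub>C x)) \<and>
    abs_L2 (\<lambda>t. indicator {0<..<T} t *\<^sub>R (p t *\<^sub>C x)) \<in> span (\<Union>k. range (mode k))"
proof (induction rule: trig_poly.induct)
  case (monom c k)
  have "(\<lambda>t. indicator {0<..<T} t *\<^sub>R ((c * cis (freq k * t)) *\<^sub>C x)) =
      (\<lambda>t. indicator {0<..<T} t *\<^sub>R (cis (freq k * t) *\<^sub>C (c *\<^sub>C x)))"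
    by (simp add: scaleC_scaleC mult.commute)
  then show ?case
    using square_integrable_mode[of k "c *\<^sub>C x"] by (auto simp: mode_def[symmetric] intro!: span_base)
next
  case (add p q)
  have "(\<lambda>t. indicator {0<..<T} t *\<^sub>R ((p t + q t) *\<^sub>C x)) =
      (\<lambda>t. indicator {0<..<T} t *\<^sub>R (p t *\<^sub>C x) + indicator {0<..<T} t *\<^sub>R (q t *\<^sub>C x))"
    by (simp add: scaleC_add_left scaleR_add_right)
  then show ?case using add.IH by (simp add: square_integrable_add abs_L2_add span_add)
qed

text \<open>The indicator is replaced by a trapezoid, which vanishes at both ends of the period and
  so has uniform trigonometric approximations; the two functions differ only on two short
  ramps.\<close>

lemma interval_in_closure_span:
  assumes ab: "0 \<le> a" "a < b" "b \<le> T"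
  shows "abs_L2 (\<lambda>t. indicator {a<..<b} t *\<^sub>R x) \<in> closure (span (\<Union>k. range (mode k)))"
  unfolding closure_approachable
proof (intro allI impI)
  fix e0 :: real assume e0: "e0 > 0"
  \<comment> \<open>The pointwise error is \<open>\<eta>\<close> off the ramps and at most 2 on
    them, each times \<open>norm x\<close>. Two ramps of length \<open>\<delta>\<close> contribute
    \<open>8 * \<delta>\<close> to the square, and \<open>\<delta> \<le> \<eta>\<^sup>2\<close>
    bounds the total by \<open>\<eta>\<^sup>2 * (T + 8)\<close> times
    \<open>(norm x)\<^sup>2\<close>. Writing \<open>norm x + 1\<close> avoids a zero
    denominator.\<close>
  define \<eta> where "\<eta> = min 1 (e0 / (sqrt (T + 8) * (norm x + 1)))"
  have \<eta>: "0 < \<eta>" "\<eta> \<le> 1" using e0 T by (auto simp: \<eta>_def intro!: divide_pos_pos mult_pos_pos add_nonneg_pos)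
  define \<delta> where "\<delta> = min (\<eta>\<^sup>2) ((b - a) / 2)"
  have \<delta>: "0 < \<delta>" "\<delta> \<le> \<eta>\<^sup>2" "\<delta> \<le> (b - a) / 2"
  proof -
    show "0 < \<delta>" using \<eta> ab by (simp add: \<delta>_def)
    show "\<delta> \<le> \<eta>\<^sup>2" unfolding \<delta>_def by (rule min.cobounded1)
    show "\<delta> \<le> (b - a) / 2" unfolding \<delta>_def by (rule min.cobounded2)
  qed
  define g where "g t = max 0 (min 1 (min ((t - a) / \<delta>) ((b - t) / \<delta>)))" for t
  have gc: "continuous_on {0..T} g" unfolding g_def using \<delta>(1) by (intro continuous_intros) auto
  have gout: "g t = 0" if "t \<le> a \<or> b \<le> t" for t
    using that \<delta>(1) unfolding g_def by (intro max_absorb1) (auto simp: min_le_iff_disj divide_le_0_iff)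
  have gin: "g t = 1" if "a + \<delta> \<le> t" "t \<le> b - \<delta>" for t
    using that \<delta>(1) by (auto simp: g_def max_def min_def field_simps)
  have g01: "0 \<le> g t" "g t \<le> 1" for t by (auto simp: g_def)
  obtain p where p: "trig_poly p" "\<And>t. t \<in> {0..T} \<Longrightarrow> cmod (p t - complex_of_real (g t)) < \<eta>"
    using trig_poly_dense_uniform[OF gc _ \<eta>(1)] gout[of 0] gout[of T] ab by auto
  let ?f = "\<lambda>t. indicator {a<..<b} t *\<^sub>R x"
  let ?p = "\<lambda>t. indicator {0<..<T} t *\<^sub>R (p t *\<^sub>C x)"
  have lm: "{c<..<d::real} \<in> lmeasurable" "{c..d::real} \<in> lmeasurable" for c d
    by (auto intro: bounded_set_imp_lmeasurable)
  have sf: "square_integrable ?f" by (rule square_integrable_indicator[OF lm(1)])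
  have sp: "square_integrable ?p" "abs_L2 ?p \<in> span (\<Union>k. range (mode k))"
    using trig_poly_in_span[OF p(1), of x] by auto
  have sd: "square_integrable (\<lambda>t. ?p t - ?f t)" by (rule square_integrable_diff[OF sp(1) sf])
  have deq: "abs_L2 ?p - abs_L2 ?f = abs_L2 (\<lambda>t. ?p t - ?f t)"
    by (rule L2_eqI) (use rep_diff_L2[of "abs_L2 ?p" "abs_L2 ?f"] rep_abs_L2[OF sp(1)] rep_abs_L2[OF sf] rep_abs_L2[OF sd]
      in eventually_elim, simp)
  have "(norm (abs_L2 ?p - abs_L2 ?f))\<^sup>2 = (LINT t|lebesgue. (norm (?p t - ?f t))\<^sup>2)"
    unfolding deq by (rule norm_abs_L2_power2[OF sd])
  also have "\<dots> \<le> (LINT t|lebesgue. (norm x)\<^sup>2 * (\<eta>\<^sup>2 * indicat_real {0<..<T} t +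
      4 * indicat_real {a..a + \<delta>} t + 4 * indicat_real {b - \<delta>..b} t))"
  proof (rule integral_mono)
    show "integrable lebesgue (\<lambda>t. (norm (?p t - ?f t))\<^sup>2)" using sd by (simp add: square_integrable_def)
    show "integrable lebesgue (\<lambda>t. (norm x)\<^sup>2 * (\<eta>\<^sup>2 * indicat_real {0<..<T} t +
        4 * indicat_real {a..a + \<delta>} t + 4 * indicat_real {b - \<delta>..b} t))"
      using lm by (intro integrable_mult_right Bochner_Integration.integrable_add)
        (simp_all add: lmeasurable_iff_integrable)
    fix t
    show "(norm (?p t - ?f t))\<^sup>2 \<le> (norm x)\<^sup>2 * (\<eta>\<^sup>2 * indicat_real {0<..<T} t +
        4 * indicat_real {a..a + \<delta>} t + 4 * indicat_real {b - \<delta>..b} t)"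
    proof (cases "t \<in> {0<..<T}")
      case False
      then have "?p t - ?f t = 0" using ab by (auto simp: indicator_def)
      then show ?thesis by simp
    next
      case True
      have "?f t = complex_of_real (indicat_real {a<..<b} t) *\<^sub>C x" by simp
      then have "?p t - ?f t = (p t - complex_of_real (indicat_real {a<..<b} t)) *\<^sub>C x"
        unfolding scaleC_diff_left using True by simp
      then have n: "(norm (?p t - ?f t))\<^sup>2 = (norm x)\<^sup>2 * (cmod (p t - complex_of_real (indicat_real {a<..<b} t)))\<^sup>2"
        by (simp add: power_mult_distrib)
      have pg: "cmod (p t - complex_of_real (g t)) \<le> \<eta>" using p(2)[of t] True by simp
      have "(cmod (p t - complex_of_real (indicat_real {a<..<b} t)))\<^sup>2 \<le>
          \<eta>\<^sup>2 + 4 * indicat_real {a..a + \<delta>} t + 4 * indicat_real {b - \<delta>..b} t"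
      proof (cases "t \<in> {a..a + \<delta>} \<union> {b - \<delta>..b}")
        case False
        then have "g t = indicat_real {a<..<b} t"
          using gin[of t] gout[of t] by (auto simp: indicator_def)
        then have "(cmod (p t - complex_of_real (indicat_real {a<..<b} t)))\<^sup>2 \<le> \<eta>\<^sup>2"
          using pg by (simp add: power_mono)
        then show ?thesis by (simp add: add_increasing2)
      next
        case in_ends: True
        have "\<bar>g t - indicat_real {a<..<b} t\<bar> \<le> 1" using g01[of t] by (auto simp: indicator_def)
        then have "cmod (complex_of_real (g t) - complex_of_real (indicat_real {a<..<b} t)) \<le> 1"
          by (simp flip: of_real_diff)
        then have "cmod (p t - complex_of_real (indicat_real {a<..<b} t)) \<le> 2"
          using pg \<eta>(2) norm_triangle_ineq[of "p t - complex_of_real (g t)" "complex_of_real (g t) - complex_of_real (indicat_real {a<..<b} t)"]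
          by simp
        then have "(cmod (p t - complex_of_real (indicat_real {a<..<b} t)))\<^sup>2 \<le> 2\<^sup>2" by (rule power_mono) simp
        also have "(2::real)\<^sup>2 \<le> 4 * indicat_real {a..a + \<delta>} t + 4 * indicat_real {b - \<delta>..b} t"
          using in_ends by (auto simp: indicator_def)
        finally show ?thesis by (simp add: add.assoc add_increasing)
      qed
      then show ?thesis unfolding n using True by (intro mult_left_mono) auto
    qed
  qed
  also have "\<dots> = (norm x)\<^sup>2 * (\<eta>\<^sup>2 * T + 4 * \<delta> + 4 * \<delta>)"
  proof -
    have "has_bochner_integral lebesgue (indicat_real {0<..<T}) T"
      "has_bochner_integral lebesgue (indicat_real {a..a + \<delta>}) \<delta>"
      "has_bochner_integral lebesgue (indicat_real {b - \<delta>..b}) \<delta>"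
      using lm[of 0 T] lm[of a "a + \<delta>"] lm[of "b - \<delta>" b] T \<delta>(1)
      by (simp_all add: has_bochner_integral_iff lmeasurable_iff_integrable)
    then show ?thesis
      by (intro has_bochner_integral_integral_eq has_bochner_integral_mult_right has_bochner_integral_add) auto
  qed
  also have "\<dots> \<le> (norm x)\<^sup>2 * (\<eta>\<^sup>2 * (T + 8))"
    using \<delta>(2) by (intro mult_left_mono) (auto simp: algebra_simps)
  also have "\<dots> = (norm x * (\<eta> * sqrt (T + 8)))\<^sup>2" using T by (simp add: power_mult_distrib)
  finally have "norm (abs_L2 ?p - abs_L2 ?f) \<le> norm x * (\<eta> * sqrt (T + 8))"
    by (rule power2_le_imp_le) (use T \<eta> in simp)
  also have "\<dots> < (norm x + 1) * (\<eta> * sqrt (T + 8))"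
    using T \<eta> by (intro mult_strict_right_mono) auto
  also have "\<dots> \<le> e0"
  proof -
    have pos: "0 < sqrt (T + 8) * (norm x + 1)" using T by (intro mult_pos_pos add_nonneg_pos) auto
    have "\<eta> \<le> e0 / (sqrt (T + 8) * (norm x + 1))" by (simp add: \<eta>_def)
    then have "\<eta> * (sqrt (T + 8) * (norm x + 1)) \<le> e0" using pos by (simp add: pos_le_divide_eq)
    then show ?thesis by (simp add: mult_ac)
  qed
  finally show "\<exists>y\<in>span (\<Union>k. range (mode k)). dist y (abs_L2 ?f) < e0"
    using sp(2) by (auto simp: dist_norm)
qed

theorem modes_dense: "restrict_L2 {0<..<T} (u::'b::complex_hilbert L2) \<in> closure (span (\<Union>k. range (mode k)))"
proof -
  let ?Y = "closure (span (\<Union>k. range (mode k))) :: 'b L2 set"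
  have Y: "subspace ?Y" by (rule subspace_closure[OF subspace_span])
  have r: "bounded_linear (restrict_L2 {0<..<T} :: 'b L2 \<Rightarrow> _)" by (rule bounded_linear_restrict_L2) simp
  interpret r: bounded_linear "restrict_L2 {0<..<T} :: 'b L2 \<Rightarrow> _" by (rule r)
  have "{u. restrict_L2 {0<..<T} u \<in> ?Y} = UNIV"
  proof (rule L2_closed_subspace_eq_UNIV)
    show "subspace {u. restrict_L2 {0<..<T} u \<in> ?Y}"
      using Y by (auto simp: subspace_def r.zero r.add r.scaleR)
    have "closed (restrict_L2 {0<..<T} -` ?Y)"
      using linear_continuous_on[OF r, of UNIV] by (intro closed_vimage) (auto simp: continuous_on_eq_continuous_at)
    then show "closed {u. restrict_L2 {0<..<T} u \<in> ?Y}" by (simp add: vimage_def)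
    fix a b :: real and x :: 'b assume "a < b"
    let ?f = "\<lambda>t. indicator {a<..b} t *\<^sub>R x"
    have sf: "square_integrable ?f" by (rule square_integrable_indicator) (auto intro: bounded_set_imp_lmeasurable)
    \<comment> \<open>Cutting to the period turns the half-open interval into an open one up to the
      point \<open>b\<close>, which is the shape treated above.\<close>
    have AE: "AE t in lebesgue. rep_L2 (restrict_L2 {0<..<T} (abs_L2 ?f)) t = indicator {max 0 a<..<min T b} t *\<^sub>R x"
    proof -
      have "AE t in lebesgue. t \<noteq> b" by (intro AE_completion AE_lborel_singleton)
      then show ?thesis
        using rep_restrict_L2[of "{0<..<T}" "abs_L2 ?f", simplified] rep_abs_L2[OF sf]
        by eventually_elim (auto simp: indicator_def)
    qed
    have eq: "restrict_L2 {0<..<T} (abs_L2 ?f) = abs_L2 (\<lambda>t. indicator {max 0 a<..<min T b} t *\<^sub>R x)"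
    proof (rule L2_eqI)
      have "square_integrable (\<lambda>t. indicator {max 0 a<..<min T b} t *\<^sub>R x)"
        by (rule square_integrable_indicator) (auto intro: bounded_set_imp_lmeasurable)
      from rep_abs_L2[OF this] AE
      show "AE t in lebesgue. rep_L2 (restrict_L2 {0<..<T} (abs_L2 ?f)) t =
          rep_L2 (abs_L2 (\<lambda>t. indicator {max 0 a<..<min T b} t *\<^sub>R x)) t" by eventually_elim simp
    qed
    have "abs_L2 (\<lambda>t. indicator {max 0 a<..<min T b} t *\<^sub>R x) \<in> ?Y"
    proof (cases "max 0 a < min T b")
      case True
      then show ?thesis by (intro interval_in_closure_span) auto
    next
      case False
      then have "{max 0 a<..<min T b} = {}" by (rule greaterThanLessThan_empty[OF leI])
      then have "abs_L2 (\<lambda>t. indicator {max 0 a<..<min T b} t *\<^sub>R x) = 0"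
        by (simp only: zero_L2_def indicator_def empty_iff of_bool_eq scaleR_zero_left)
      then show ?thesis using subspace_0[OF Y] by simp
    qed
    then show "abs_L2 ?f \<in> {u. restrict_L2 {0<..<T} u \<in> ?Y}" by (simp add: eq)
  qed
  then show ?thesis by blast
qed

lemma cis_freq_T [simp]: "cis (freq k * T) = 1" "cis (- (freq k * T)) = 1"
  using T cis_multiple_2pi[of "of_int k"] cis_multiple_2pi[of "- of_int k"] by (simp_all add: freq_def)

lemma integral_cis_freq:
  assumes "k \<noteq> 0"
  shows "integral {0..T} (\<lambda>t. cis (freq k * t)) = 0"
proof -
  have f: "freq k \<noteq> 0" using assms T by (simp add: freq_def)
  have "((\<lambda>t. cis (freq k * t)) has_integral
      cis (freq k * T) / (\<i> * of_real (freq k)) - cis (freq k * 0) / (\<i> * of_real (freq k))) {0..T}"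
  proof (rule fundamental_theorem_of_calculus)
    fix t
    have "((\<lambda>t. cis (freq k * t)) has_vector_derivative freq k *\<^sub>R (\<i> * cis (freq k * t))) (at t within {0..T})"
      by (auto intro!: derivative_eq_intros simp: has_vector_derivative_def)
    then have "((\<lambda>t. cis (freq k * t) / (\<i> * of_real (freq k))) has_vector_derivative
        (freq k *\<^sub>R (\<i> * cis (freq k * t))) / (\<i> * of_real (freq k))) (at t within {0..T})"
      by (rule has_vector_derivative_divide)
    then show "((\<lambda>t. cis (freq k * t) / (\<i> * of_real (freq k))) has_vector_derivative
        cis (freq k * t)) (at t within {0..T})"
      using f by (simp add: scaleR_conv_of_real)
  qed (use T in simp)
  then show ?thesis by (simp add: integral_unique)
qed

lemma square_integrable_cis_scaleC:
  assumes "square_integrable f"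
  shows "square_integrable (\<lambda>t. cis (a * t) *\<^sub>C f t)"
proof (rule square_integrable_bound[OF _ assms, of _ 1])
  show "strongly_measurable lebesgue (\<lambda>t. cis (a * t) *\<^sub>C f t)"
  proof (rule strongly_measurable_compose2[where h = scaleC])
    show "strongly_measurable lebesgue (\<lambda>t. cis (a * t))"
      by (intro strongly_measurable_continuous continuous_intros)
    show "strongly_measurable lebesgue f" using assms by (simp add: square_integrable_def)
  qed (rule tendsto_scaleC)
qed simp

lemma coeff_mode: "fourier_coeff (mode l x) k = (if l = k then x else 0)"
proof -
  have "integral {0..T} (\<lambda>t. cis (- (freq k * t)) *\<^sub>C rep_L2 (mode l x) t) = integral {0..T} (\<lambda>t. cis (freq (l - k) * t) *\<^sub>C x)"
  proof (rule integral_AE_cong)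
    have "AE t in lebesgue. t \<noteq> 0 \<and> t \<noteq> T" by (intro AE_conjI AE_completion AE_lborel_singleton)
    then show "AE t in lebesgue. t \<in> {0..T} \<longrightarrow> cis (- (freq k * t)) *\<^sub>C rep_L2 (mode l x) t = cis (freq (l - k) * t) *\<^sub>C x"
      using rep_abs_L2[OF square_integrable_mode[of l x], folded mode_def]
      by eventually_elim
        (auto simp: indicator_def scaleC_scaleC cis_mult freq_def diff_divide_distrib algebra_simps)
  qed
  also have "\<dots> = integral {0..T} (\<lambda>t. cis (freq (l - k) * t)) *\<^sub>C x"
    using integral_linear[OF _ bounded_bilinear.bounded_linear_left[OF bounded_bilinear_scaleC, of x],
        of "\<lambda>t. cis (freq (l - k) * t)" "{0..T}"]
    by (simp add: o_def integrable_continuous_real continuous_intros)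
  finally show ?thesis
    unfolding fourier_coeff_def using T integral_cis_freq[of "l - k"] by (auto simp: freq_def bounded_bilinear.scaleR_left[OF bounded_bilinear_scaleC])
qed

text \<open>The exponential moves to the other argument as its conjugate and there builds the
  Fourier coefficient: tested against a mode, a form compatible with complex scalars sees one
  coefficient only.\<close>

lemma form_L2_mode:
  assumes b: "bounded_bilinear b" and bC: "\<And>c x y. b (c *\<^sub>C x) y = b x (cnj c *\<^sub>C y)"
  shows "form_L2 b u (mode k y) = T * b (fourier_coeff u k) y"
proof -
  interpret b: bounded_bilinear b by (rule b)
  let ?w = "\<lambda>t. cis (- freq k * t) *\<^sub>C rep_L2 u t"
  have w: "square_integrable ?w" by (rule square_integrable_cis_scaleC) simp
  have int: "integrable lebesgue (\<lambda>t. b (?w t) (indicator {0<..<T} t *\<^sub>R y))"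
    by (rule integrable_bilinear[OF b w square_integrable_indicator]) (auto intro: bounded_set_imp_lmeasurable)
  have "form_L2 b u (mode k y) = (LINT t|lebesgue. b (?w t) (indicator {0<..<T} t *\<^sub>R y))"
  proof (rule form_L2_eq[OF b])
    show "AE t in lebesgue. b (rep_L2 u t) (rep_L2 (mode k y) t) = b (?w t) (indicator {0<..<T} t *\<^sub>R y)"
      using rep_abs_L2[OF square_integrable_mode[of k y], folded mode_def]
      by eventually_elim (simp add: bC cis_cnj b.scaleR_right scaleC_scaleR_commute)
  qed (rule borel_measurable_integrable[OF int])
  also have "\<dots> = integral UNIV (\<lambda>t. b (?w t) (indicator {0<..<T} t *\<^sub>R y))"
    by (rule integral_lebesgue[OF int, symmetric])
  also have "\<dots> = integral UNIV (\<lambda>t. if t \<in> {0<..<T} then b (?w t) y else 0)"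
    by (rule integral_cong) (auto simp: b.zero_right)
  also have "\<dots> = integral {0<..<T} (\<lambda>t. b (?w t) y)" by (rule integral_restrict_UNIV)
  also have "\<dots> = integral {0..T} (\<lambda>t. b (?w t) y)" by (rule integral_open_interval_real[symmetric])
  also have "\<dots> = b (integral {0..T} ?w) y"
    using integral_linear[OF square_integrable_integrable_on(1)[OF w] b.bounded_linear_left[of y], of 0 T] T
    by (simp add: o_def)
  finally show ?thesis using T by (simp add: fourier_coeff_def b.scaleR_left)
qed

text \<open>By \<open>form_L2_mode\<close> for \<open>inner\<close>, the partial sum is the
  orthogonal projection onto the modes of index at most \<open>N\<close> with arbitrary vector
  coefficients, hence the best approximation there; density of the modes gives convergence.\<close>

lemma fourier_partial_sums_tendsto:
  assumes u: "restrict_L2 {0<..<T} u = (u :: 'b::complex_hilbert L2)"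
  shows "(\<lambda>N. \<Sum>k\<in>{- int N..int N}. mode k (fourier_coeff u k)) \<longlonglongrightarrow> u"
proof -
  define A where "A N = (\<Union>k\<in>{- int N..int N}. range (mode k :: 'b \<Rightarrow> 'b L2))" for N
  define s where "s N = (\<Sum>k\<in>{- int N..int N}. mode k (fourier_coeff u k))" for N
  note form = form_L2_mode[OF bounded_bilinear_inner inner_scaleC, unfolded form_L2_inner]
  have sA: "s N \<in> span (A N)" for N
    unfolding s_def A_def by (intro span_sum, rule span_base, rule UN_I, assumption, rule rangeI)
  have orth: "inner (u - s N) p = 0" if "p \<in> span (A N)" for N p
  proof -
    have "orthogonal (u - s N) p"
    proof (rule orthogonal_to_span[OF that])
      fix q assume "q \<in> A N"
      then obtain k y where k: "k \<in> {- int N..int N}" and q: "q = mode k y" by (auto simp: A_def)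
      have "inner (s N) q = (\<Sum>l\<in>{- int N..int N}. if l = k then T * inner (fourier_coeff u k) y else 0)"
        unfolding s_def q inner_sum_left unfolding form coeff_mode by (rule sum.cong) auto
      also have "\<dots> = inner u q" using k by (simp add: q form)
      finally show "orthogonal (u - s N) q" by (simp add: orthogonal_def inner_diff_left)
    qed
    then show ?thesis by (simp add: orthogonal_def)
  qed
  have best: "norm (u - s N) \<le> norm (u - p)" if p: "p \<in> span (A N)" for N p
  proof -
    have "s N - p \<in> span (A N)" using sA p by (rule span_diff)
    then have "inner (u - s N) (s N - p) = 0" by (rule orth)
    then have "(norm (u - p))\<^sup>2 = (norm (u - s N))\<^sup>2 + (norm (s N - p))\<^sup>2"
      using norm_add_Pythagorean[of "u - s N" "s N - p"] by (simp add: orthogonal_def)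
    then have "(norm (u - s N))\<^sup>2 \<le> (norm (u - p))\<^sup>2" by simp
    then show ?thesis by (rule power2_le_imp_le) simp
  qed
  have mono: "span (A N) \<subseteq> span (A N')" if "N \<le> N'" for N N'
    using that unfolding A_def by (intro span_mono UN_mono) auto
  \<comment> \<open>An element of the span involves finitely many modes, so some
    \<open>span (A N)\<close> contains it.\<close>
  have "span (\<Union>k. range (mode k :: 'b \<Rightarrow> 'b L2)) \<subseteq> (\<Union>N. span (A N))"
  proof (rule span_minimal)
    show "(\<Union>k. range (mode k :: 'b \<Rightarrow> 'b L2)) \<subseteq> (\<Union>N. span (A N))"
    proof
      fix q :: "'b L2" assume "q \<in> (\<Union>k. range (mode k))"
      then obtain k y where "q = mode k y" by blast
      then have "q \<in> A (nat \<bar>k\<bar>)" unfolding A_def by (intro UN_I[of k]) auto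
      then show "q \<in> (\<Union>N. span (A N))" using span_base by blast
    qed
    show "subspace (\<Union>N. span (A N))"
    proof (rule subspaceI)
      show "0 \<in> (\<Union>N. span (A N))" using span_zero by blast
      show "c *\<^sub>R x \<in> (\<Union>N. span (A N))" if "x \<in> (\<Union>N. span (A N))" for c x
        using that span_scale by blast
      fix x y assume "x \<in> (\<Union>N. span (A N))" "y \<in> (\<Union>N. span (A N))"
      then obtain n m where "x \<in> span (A n)" "y \<in> span (A m)" by blast
      then have "x \<in> span (A (max n m))" "y \<in> span (A (max n m))"
        using mono[of n "max n m"] mono[of m "max n m"] by auto
      then show "x + y \<in> (\<Union>N. span (A N))" using span_add by blast
    qed
  qed
  note cover = this
  have "s \<longlonglongrightarrow> u"
  proof (rule LIMSEQ_I)
    fix e :: real assume "e > 0"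
    have "u \<in> closure (span (\<Union>k. range (mode k)))" using modes_dense[of u] u by simp
    then obtain p where p: "p \<in> span (\<Union>k. range (mode k))" "dist p u < e"
      using \<open>e > 0\<close> by (meson closure_approachable)
    then obtain N where N: "p \<in> span (A N)" using cover by blast
    have "norm (s n - u) < e" if "n \<ge> N" for n
      using best[of p n] mono[OF that] N p(2) by (auto simp: dist_norm norm_minus_commute)
    then show "\<exists>N. \<forall>n\<ge>N. norm (s n - u) < e" by blast
  qed
  then show ?thesis by (simp add: s_def[abs_def])
qed

text \<open>Parseval's identity is used for the partial sums, where it is a finite sum;
  nonnegativity passes to the limit by continuity of the form.\<close>

theorem form_L2_nonneg_of_coeff:
  assumes b: "bounded_bilinear b" and bC: "\<And>c x y. b (c *\<^sub>C x) y = b x (cnj c *\<^sub>C y)"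
    and u: "restrict_L2 {0<..<T} u = (u :: 'b::complex_hilbert L2)"
    and nonneg: "\<And>k. b (fourier_coeff u k) (fourier_coeff u k) \<ge> 0"
  shows "form_L2 b u u \<ge> 0"
proof -
  interpret b: bounded_bilinear b by (rule b)
  interpret F: bounded_bilinear "form_L2 b" by (rule bounded_bilinear_form_L2[OF b])
  define s where "s N = (\<Sum>k\<in>{- int N..int N}. mode k (fourier_coeff u k))" for N
  have s: "s \<longlonglongrightarrow> u" using fourier_partial_sums_tendsto[OF u] by (simp add: s_def[abs_def])
  have "form_L2 b (s N) (s N) \<ge> 0" for N
  proof -
    have "form_L2 b (s N) (mode k y) = T * b (fourier_coeff u k) y" if "k \<in> {- int N..int N}" for k y
    proof -
      have "form_L2 b (s N) (mode k y) = (\<Sum>l\<in>{- int N..int N}. if l = k then T * b (fourier_coeff u k) y else 0)"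
        unfolding s_def F.sum_left unfolding form_L2_mode[OF b bC] coeff_mode by (rule sum.cong) (auto simp: b.zero_left)
      then show ?thesis using that by simp
    qed
    then have "form_L2 b (s N) (s N) = (\<Sum>k\<in>{- int N..int N}. T * b (fourier_coeff u k) (fourier_coeff u k))"
      by (subst (2) s_def) (simp add: F.sum_right)
    then show ?thesis using nonneg T by (simp add: sum_nonneg)
  qed
  moreover have "(\<lambda>N. form_L2 b (s N) (s N)) \<longlonglongrightarrow> form_L2 b u u" by (intro F.tendsto s)
  ultimately show ?thesis by (intro LIMSEQ_le_const) auto
qed

end

section \<open>The frequency condition controls processes starting at zero\<close>

lemma restrict_L2_tail_tendsto_zero: "(\<lambda>m. norm (restrict_L2 {real m<..} z)) \<longlonglongrightarrow> 0"
proof -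
  have int: "integrable lebesgue (\<lambda>t. (norm (rep_L2 z t))\<^sup>2)"
    using square_integrable_rep[of z] unfolding square_integrable_def by blast
  have eq: "(norm (restrict_L2 {real m<..} z))\<^sup>2 = (LINT t|lebesgue. indicator {real m<..} t *\<^sub>R (norm (rep_L2 z t))\<^sup>2)" for m
    by (subst norm_restrict_L2_power2) (simp_all add: integral_restrict_space)
  have "(\<lambda>m. LINT t|lebesgue. indicator {real m<..} t *\<^sub>R (norm (rep_L2 z t))\<^sup>2) \<longlonglongrightarrow> integral\<^sup>L (lebesgue :: real measure) (\<lambda>_. 0::real)"
  proof (rule integral_dominated_convergence[where w = "\<lambda>t. (norm (rep_L2 z t))\<^sup>2"])
    show "(\<lambda>t. indicator {real m<..} t *\<^sub>R (norm (rep_L2 z t))\<^sup>2) \<in> borel_measurable lebesgue" for m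
      by (rule borel_measurable_integrable[OF integrable_mult_indicator[OF _ int]]) simp
    have "(\<lambda>m. indicator {real m<..} t *\<^sub>R (norm (rep_L2 z t))\<^sup>2) \<longlonglongrightarrow> 0" for t
    proof (rule tendsto_eventually)
      show "eventually (\<lambda>m. indicator {real m<..} t *\<^sub>R (norm (rep_L2 z t))\<^sup>2 = 0) sequentially"
      proof (rule eventually_sequentiallyI[of "nat \<lceil>t\<rceil>"])
        fix m assume "nat \<lceil>t\<rceil> \<le> m"
        then have "t \<le> real m" by linarith
        then show "indicator {real m<..} t *\<^sub>R (norm (rep_L2 z t))\<^sup>2 = 0" by simp
      qed
    qed
    then show "AE t in lebesgue. (\<lambda>m. indicator {real m<..} t *\<^sub>R (norm (rep_L2 z t))\<^sup>2) \<longlonglongrightarrow> 0" by simp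
    show "AE t in lebesgue. norm (indicator {real m<..} t *\<^sub>R (norm (rep_L2 z t))\<^sup>2) \<le> (norm (rep_L2 z t))\<^sup>2" for m
      by (intro always_eventually allI) (simp add: indicator_def)
  qed (use int in simp_all)
  then have "(\<lambda>m. (norm (restrict_L2 {real m<..} z))\<^sup>2) \<longlonglongrightarrow> 0" by (simp add: eq)
  then have "(\<lambda>m. sqrt ((norm (restrict_L2 {real m<..} z))\<^sup>2)) \<longlonglongrightarrow> sqrt 0" by (rule tendsto_real_sqrt)
  then show ?thesis by simp
qed

lemma restrict_L2_Compl:
  assumes "S \<in> sets lebesgue"
  shows "z - restrict_L2 S z = restrict_L2 (- S) z"
proof (rule L2_eqI)
  have "- S \<in> sets lebesgue" using assms by (simp add: Compl_in_sets_lebesgue)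
  from rep_restrict_L2[OF this, of z] rep_restrict_L2[OF assms, of z] rep_diff_L2[of z "restrict_L2 S z"]
  show "AE t in lebesgue. rep_L2 (z - restrict_L2 S z) t = rep_L2 (restrict_L2 (- S) z) t"
    by eventually_elim (simp add: indicator_def)
qed

lemma (in fourier) bounded_linear_fourier_coeff: "bounded_linear (\<lambda>u. fourier_coeff u k)"
  unfolding fourier_coeff_def
proof (intro bounded_linear_compose[OF bounded_linear_scaleR_right])
  show "bounded_linear (\<lambda>u. integral {0..T} (\<lambda>t. cis (- (freq k * t)) *\<^sub>C rep_L2 u t))"
  proof (rule bounded_linear_strongly_continuous_integral[where M = 1])
    show "continuous_on {0..T} (\<lambda>s. cis (- (freq k * s)) *\<^sub>C x)" for x
      by (intro continuous_on_scaleC continuous_intros)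
  qed (use T in \<open>auto intro: bounded_linear.linear[OF bounded_linear_scaleC_right]\<close>)
qed

context control_system
begin

text \<open>\<open>w0\<close> ranges over the large space, because pieces of a process cut at
  multiples of \<open>T\<close> start from states that need not come from the smaller one. The only
  defect is the jump between the two ends of the interval, divided by \<open>T\<close>.\<close>

lemma stationary_fourier_coeff:
  assumes T: "0 < T"
    and sol: "AE t in lebesgue. t \<in> {0<..<T} \<longrightarrow> j (fst (rep_L2 x t)) = mild w0 (inp (rep_L2 x)) t"
  shows "stationary (fourier.freq T k) (j (fst (fourier.fourier_coeff T x k)))
    (B (snd (fourier.fourier_coeff T x k)) + (w0 - mild w0 (inp (rep_L2 x)) T) /\<^sub>R T)"
proof -
  interpret fourier T by standard (rule T)
  let ?e = "\<lambda>t. cis (- (freq k * t))"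
  have sq: "square_integrable (\<lambda>t. ?e t *\<^sub>C rep_L2 x t)"
    using square_integrable_cis_scaleC[OF square_integrable_rep, of "- freq k" x] by simp
  have int: "(\<lambda>t. ?e t *\<^sub>C rep_L2 x t) integrable_on {0..T}"
    by (rule square_integrable_integrable_on[OF sq]) (use T in simp)
  interpret Bs: Real_Vector_Spaces.bounded_linear "\<lambda>y::'a \<times> 'x. B (snd y)" by (rule bounded_linear_B_snd)
  interpret jf: Real_Vector_Spaces.bounded_linear "\<lambda>y::'a \<times> 'x. j (fst y)" by (rule bounded_linear_j_fst)
  have Bint: "B (snd (integral {0..T} (\<lambda>t. ?e t *\<^sub>C rep_L2 x t))) = integral {0..T} (\<lambda>t. ?e t *\<^sub>C inp (rep_L2 x) t)"
    using integral_linear[OF int bounded_linear_B_snd]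
    by (simp add: o_def inp_def bounded_clinear_scaleC[OF B])
  have "j (fst (integral {0..T} (\<lambda>t. ?e t *\<^sub>C rep_L2 x t))) = integral {0..T} (\<lambda>t. ?e t *\<^sub>C j (fst (rep_L2 x t)))"
    using integral_linear[OF int bounded_linear_j_fst]
    by (simp add: o_def bounded_clinear_scaleC[OF j])
  also have "\<dots> = integral {0..T} (\<lambda>t. ?e t *\<^sub>C mild w0 (inp (rep_L2 x)) t)"
  proof (rule integral_AE_cong)
    have "AE t in lebesgue. t \<noteq> 0 \<and> t \<noteq> T" by (intro AE_conjI AE_completion AE_lborel_singleton)
    then show "AE t in lebesgue. t \<in> {0..T} \<longrightarrow> ?e t *\<^sub>C j (fst (rep_L2 x t)) = ?e t *\<^sub>C mild w0 (inp (rep_L2 x)) t"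
      using sol by eventually_elim auto
  qed
  finally have jint: "j (fst (integral {0..T} (\<lambda>t. ?e t *\<^sub>C rep_L2 x t))) =
      integral {0..T} (\<lambda>t. ?e t *\<^sub>C mild w0 (inp (rep_L2 x)) t)" .
  have "stationary (freq k) (j (fst (integral {0..T} (\<lambda>t. ?e t *\<^sub>C rep_L2 x t))))
      (B (snd (integral {0..T} (\<lambda>t. ?e t *\<^sub>C rep_L2 x t))) + w0 - mild w0 (inp (rep_L2 x)) T)"
    using stationary_Fourier[OF square_integrable_inp[OF square_integrable_rep[of x]], of T "freq k" w0] T
    by (simp add: Bint jint)
  from stationary_scaleR[OF this, of "inverse T"] show ?thesis
    by (simp only: fourier_coeff_def jf.scaleR Bs.scaleR scaleR_add_right scaleR_diff_right add_diff_eq)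
qed

text \<open>A process on \<open>[0, T]\<close> that starts at zero is made \<open>T\<close>-periodic by adding the folded process of
  minimal norm that starts at its end point; the Fourier coefficients of the periodic process satisfy
  the stationary equation exactly.\<close>

lemma periodization:
  assumes S: "\<And>v. (v, S v) \<in> processes" "\<And>v z. (v, z) \<in> processes \<Longrightarrow> norm (S v) \<le> norm z"
    and C: "0 \<le> C" "\<And>v. norm (S v) \<le> C * norm v"
    and TL: "4 * C\<^sup>2 + 1 \<le> T"
    and z: "(0, z) \<in> processes" and h: "j h = mild 0 (inp (rep_L2 z)) T"
  obtains u where "restrict_L2 {0<..<T} u = u" "norm (u - restrict_L2 {0<..<T} z) \<le> 2 * C * norm h"
    "\<And>k. stationary (fourier.freq T k) (j (fst (fourier.fourier_coeff T u k))) (B (snd (fourier.fourier_coeff T u k)))"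
proof -
  have T0: "0 < T" "1 \<le> T" using TL zero_le_power2[of C] by linarith+
  interpret fourier T by standard (rule T0)
  let ?I = "{0<..<T}"
  have I: "?I \<in> sets lebesgue" by simp
  interpret rI: Real_Vector_Spaces.bounded_linear "restrict_L2 ?I :: ('a \<times> 'x) L2 \<Rightarrow> _" by (rule bounded_linear_restrict_L2[OF I])
  let ?y = "S h"
  \<comment> \<open>The stretch of the steering process over the period with index \<open>n\<close>,
    moved back to the base interval.\<close>
  define q where "q n = restrict_L2 ?I (shift_L2 (real n * T) ?y)" for n :: nat
  define W where "W t = mild (j h) (inp (rep_L2 ?y)) t" for t
  have rI: "restrict_L2 ?I (restrict_L2 ?I x) = restrict_L2 ?I x" for x :: "('a \<times> 'x) L2"
    by (simp add: restrict_L2_restrict_L2)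
  have qn: "norm (q n) \<le> (1/2)^n * (C * norm h)" for n
  proof -
    have "norm (q n) \<le> norm (restrict_L2 {0<..} (shift_L2 (real n * T) ?y))"
      unfolding q_def by (rule norm_restrict_L2_mono) auto
    also have "\<dots> = norm (restrict_L2 {real n * T<..} ?y)"
      by (subst restrict_L2_shift[where S' = "{real n * T<..}"]) auto
    also have "\<dots> \<le> (1/2)^n * (C * norm h)" by (rule minimal_norm_decay[OF S C TL])
    finally show ?thesis .
  qed
  have gs: "summable (\<lambda>n. (1/2)^n * (C * norm h))" by (intro summable_mult2 summable_geometric) simp
  have sn: "summable (\<lambda>n. norm (q n))" by (rule summable_comparison_test'[OF gs, of 0]) (use qn in simp)
  note sq = summable_norm_cancel[OF sn]
  define u where "u = restrict_L2 ?I z + (\<Sum>n. q n)"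
  have "restrict_L2 ?I (\<Sum>n. q n) = (\<Sum>n. restrict_L2 ?I (q n))" by (rule rI.suminf[OF sq])
  then have u1: "restrict_L2 ?I u = u" by (simp add: u_def rI.add rI q_def)
  have u2: "norm (u - restrict_L2 ?I z) \<le> 2 * C * norm h"
  proof -
    have "norm (\<Sum>n. q n) \<le> (\<Sum>n. norm (q n))" by (rule summable_norm[OF sn])
    also have "\<dots> \<le> (\<Sum>n. (1/2)^n * (C * norm h))" by (rule suminf_le[OF qn sn gs])
    also have "\<dots> = 2 * (C * norm h)"
      using suminf_mult2[OF summable_geometric[of "1/2::real"], of "C * norm h"] suminf_geometric[of "1/2::real"] by simp
    finally show ?thesis by (simp add: u_def)
  qed
  have u3: "stationary (freq k) (j (fst (fourier_coeff u k))) (B (snd (fourier_coeff u k)))" for k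
  proof -
    interpret c: Real_Vector_Spaces.bounded_linear "\<lambda>u :: ('a \<times> 'x) L2. fourier_coeff u k" by (rule bounded_linear_fourier_coeff)
    interpret Bs: Real_Vector_Spaces.bounded_linear "\<lambda>y::'a \<times> 'x. B (snd y)" by (rule bounded_linear_B_snd)
    interpret jf: Real_Vector_Spaces.bounded_linear "\<lambda>y::'a \<times> 'x. j (fst y)" by (rule bounded_linear_j_fst)
    have neT: "AE t in lebesgue. t \<noteq> T" by (intro AE_completion AE_lborel_singleton)
    have stz: "stationary (freq k) (j (fst (fourier_coeff (restrict_L2 ?I z) k)))
        (B (snd (fourier_coeff (restrict_L2 ?I z) k)) + (0 - j h) /\<^sub>R T)"
    proof -
      have m: "mild 0 (inp (rep_L2 (restrict_L2 ?I z))) t = mild 0 (inp (rep_L2 z)) t" if "t \<le> T" for t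
      proof (rule inp_AE_cong)
        show "AE s in lebesgue. s \<in> {0<..t} \<longrightarrow> rep_L2 (restrict_L2 ?I z) s = rep_L2 z s"
          using rep_restrict_L2[OF I, of z] neT by eventually_elim (use that in \<open>auto simp: indicator_def\<close>)
      qed
      have "AE t in lebesgue. t \<in> ?I \<longrightarrow> j (fst (rep_L2 (restrict_L2 ?I z) t)) = mild 0 (inp (rep_L2 (restrict_L2 ?I z))) t"
        using processes_solution[OF z] rep_restrict_L2[OF I, of z]
        by eventually_elim (auto simp: m linear_0[OF bounded_linear.linear[OF bounded_clinear_linear[OF j]]])
      from stationary_fourier_coeff[OF T0(1) this, of k] show ?thesis by (simp only: m[OF order_refl] h)
    qed
    \<comment> \<open>The jumps telescope: the cut process contributes \<open>- j h\<close>, that is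
      \<open>- W 0\<close>, and each piece the difference of \<open>W\<close> at its two ends. After
      \<open>N\<close> pieces only \<open>- W (real N * T)\<close> is left, which tends to
      zero.\<close>
    have stq: "stationary (freq k) (j (fst (fourier_coeff (q n) k)))
        (B (snd (fourier_coeff (q n) k)) + (W (real n * T) - W (real (Suc n) * T)) /\<^sub>R T)" for n
    proof -
      have rq: "AE s in lebesgue. s \<in> ?I \<longrightarrow> rep_L2 (q n) s = rep_L2 ?y (s + real n * T)"
        unfolding q_def using rep_restrict_L2[OF I, of "shift_L2 (real n * T) ?y"] rep_shift_L2[of "real n * T" ?y]
        by eventually_elim simp
      have m: "mild (W (real n * T)) (inp (rep_L2 (q n))) t = W (t + real n * T)" if t: "0 \<le> t" "t \<le> T" for t
      proof -
        have "W (t + real n * T) = mild (W (real n * T)) (\<lambda>s. inp (rep_L2 ?y) (s + real n * T)) t"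
          unfolding W_def using mild_shift[OF square_integrable_inp[OF square_integrable_rep[of ?y]], of "real n * T" t "j h"] t T0
          by (simp add: add.commute)
        also have "\<dots> = mild (W (real n * T)) (inp (rep_L2 (q n))) t"
        proof (rule mild_AE_cong)
          show "AE s in lebesgue. s \<in> {0<..t} \<longrightarrow> inp (rep_L2 ?y) (s + real n * T) = inp (rep_L2 (q n)) s"
            using rq neT by eventually_elim (use t in \<open>auto simp: inp_def\<close>)
        qed
        finally show ?thesis by simp
      qed
      have "AE t in lebesgue. t \<in> ?I \<longrightarrow> j (fst (rep_L2 (q n) t)) = mild (W (real n * T)) (inp (rep_L2 (q n))) t"
        using rq AE_lebesgue_shift[OF processes_solution[OF S(1)[of h], folded W_def], of "real n * T"]
        by eventually_elim (use T0 in \<open>auto simp: m add_pos_nonneg\<close>)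
      from stationary_fourier_coeff[OF T0(1) this, of k] show ?thesis
        using m[of T] T0 by (simp add: distrib_right)
    qed
    define uN where "uN N = restrict_L2 ?I z + (\<Sum>n<N. q n)" for N
    have stN: "stationary (freq k) (j (fst (fourier_coeff (uN N) k)))
        (B (snd (fourier_coeff (uN N) k)) - W (real N * T) /\<^sub>R T)" for N
    proof (induction N)
      case 0
      show ?case using stz by (simp add: uN_def W_def)
    next
      case (Suc N)
      have "uN (Suc N) = uN N + q N" by (simp add: uN_def)
      then show ?case
        using stationary_add[OF Suc stq[of N]] by (simp add: c.add jf.add[unfolded fst_add] Bs.add[unfolded snd_add] scaleR_diff_right algebra_simps)
    qed
    have uN: "uN \<longlonglongrightarrow> u"
      unfolding uN_def u_def by (intro tendsto_add tendsto_const summable_LIMSEQ[OF sq])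
    show ?thesis
    proof (rule stationary_limit[OF stN])
      show "(\<lambda>N. j (fst (fourier_coeff (uN N) k))) \<longlonglongrightarrow> j (fst (fourier_coeff u k))"
        by (intro jf.tendsto c.tendsto uN)
      have "(\<lambda>N. B (snd (fourier_coeff (uN N) k)) - W (real N * T) /\<^sub>R T) \<longlonglongrightarrow> B (snd (fourier_coeff u k)) - 0 /\<^sub>R T"
        unfolding W_def by (intro tendsto_diff Bs.tendsto c.tendsto uN tendsto_scaleR tendsto_const
            minimal_norm_state_tendsto_zero[OF S C TL])
      then show "(\<lambda>N. B (snd (fourier_coeff (uN N) k)) - W (real N * T) /\<^sub>R T) \<longlonglongrightarrow> B (snd (fourier_coeff u k))"
        by simp
    qed
  qed
  show ?thesis by (rule that[OF u1 u2 u3])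
qed

text \<open>Periodic processes built from ever later cuts of \<open>z\<close> have a nonnegative
  form by their Fourier coefficients, and they converge to \<open>z\<close>. Coercivity is obtained
  by applying this to the form reduced by a multiple of the inner product.\<close>

theorem frequency_nonneg:
  assumes b: "bounded_bilinear b" and bC: "\<And>c x y. b (c *\<^sub>C x) y = b x (cnj c *\<^sub>C y)"
    and surj: "\<And>v. \<exists>z. (v, z) \<in> processes"
    and freq: "\<And>\<omega> v \<xi>. stationary \<omega> (j v) (B \<xi>) \<Longrightarrow> b (v, \<xi>) (v, \<xi>) \<ge> 0"
    and z: "(0, z) \<in> processes"
  shows "form_L2 b z z \<ge> 0"
proof -
  interpret F: bounded_bilinear "form_L2 b" by (rule bounded_bilinear_form_L2[OF b])
  obtain S C where S: "bounded_clinear S" "\<And>v. (v, S v) \<in> processes"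
    "\<And>v z. (v, z) \<in> processes \<Longrightarrow> norm (S v) \<le> norm z" and C: "0 \<le> C" "\<And>v. norm (S v) \<le> C * norm v"
    by (rule minimal_norm_processes[OF surj]) (rule that)
  have j0: "j 0 = 0" by (rule linear_0[OF bounded_linear.linear[OF bounded_clinear_linear[OF j]]])
  have "\<exists>u. form_L2 b u u \<ge> 0 \<and> norm (u - z) \<le> (2 * C + 1) * norm (restrict_L2 {real m<..} z)" for m
  proof -
    let ?L = "4 * C\<^sup>2 + 1"
    let ?\<rho> = "norm (restrict_L2 {real m<..} z)"
    have L: "0 < ?L" using zero_le_power2[of C] by linarith
    \<comment> \<open>Starting the window \<open>?L\<close> beyond \<open>m\<close> ensures
      \<open>?L \<le> T\<close>, as the decay estimate requires of the period. Since the window has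
      length 1, the state at the picked time is bounded by the tail after \<open>m\<close>.\<close>
    have ae: "AE t in lebesgue. t \<in> {real m + ?L<..<real m + ?L + 1} \<longrightarrow> j (fst (rep_L2 z t)) = mild 0 (inp (rep_L2 z)) t"
      using processes_solution[OF z] by eventually_elim (use L j0 in auto)
    obtain T where Tm: "real m + ?L < T" "T < real m + ?L + 1" "j (fst (rep_L2 z T)) = mild 0 (inp (rep_L2 z)) T"
      "(real m + ?L + 1 - (real m + ?L)) * (norm (rep_L2 z T))\<^sup>2 \<le> (norm (restrict_L2 {real m + ?L<..<real m + ?L + 1} z))\<^sup>2"
      by (rule L2_pick[OF _ ae, where z = z]) (simp, rule that)
    have TL: "?L \<le> T" and T0: "0 < T" and mT: "real m < T" using Tm(1) L by linarith+
    interpret fourier T by standard (rule T0)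
    define h where "h = fst (rep_L2 z T)"
    have hj: "j h = mild 0 (inp (rep_L2 z)) T" using Tm(3) by (simp add: h_def)
    have "(norm (rep_L2 z T))\<^sup>2 \<le> (norm (restrict_L2 {real m + ?L<..<real m + ?L + 1} z))\<^sup>2" using Tm(4) by simp
    then have "norm (rep_L2 z T) \<le> norm (restrict_L2 {real m + ?L<..<real m + ?L + 1} z)"
      by (rule power2_le_imp_le) simp
    also have "\<dots> \<le> ?\<rho>" by (rule norm_restrict_L2_mono) (use L in auto)
    finally have "norm (rep_L2 z T) \<le> ?\<rho>" .
    then have h: "norm h \<le> ?\<rho>"
      using norm_fst_le[of h "snd (rep_L2 z T)"] by (simp add: h_def)
    obtain u where u: "restrict_L2 {0<..<T} u = u" "norm (u - restrict_L2 {0<..<T} z) \<le> 2 * C * norm h"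
      "\<And>k. stationary (freq k) (j (fst (fourier_coeff u k))) (B (snd (fourier_coeff u k)))"
      by (rule periodization[OF S(2,3) C TL z hj], assumption, rule that)
    have "form_L2 b u u \<ge> 0"
      by (rule form_L2_nonneg_of_coeff[OF b bC u(1)]) (use freq[OF u(3)] in simp)
    \<comment> \<open>\<open>2 * C\<close> accounts for the folded correction and 1 for the part of
      \<open>z\<close> after the cut.\<close>
    moreover have "norm (u - z) \<le> (2 * C + 1) * ?\<rho>"
    proof -
      have "norm (z - restrict_L2 {0<..<T} z) = norm (restrict_L2 (- {0<..<T}) z)"
        by (simp add: restrict_L2_Compl)
      also have "restrict_L2 (- {0<..<T}) z = restrict_L2 {T..} z"
        by (rule restrict_L2_cong) (use processes_support[OF z] T0 in \<open>auto elim!: eventually_mono\<close>)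
      also have "norm (restrict_L2 {T..} z) \<le> ?\<rho>" by (rule norm_restrict_L2_mono) (use mT in auto)
      finally have 1: "norm (restrict_L2 {0<..<T} z - z) \<le> ?\<rho>" by (simp add: norm_minus_commute)
      have "2 * C * norm h \<le> 2 * C * ?\<rho>" using C(1) h by (intro mult_left_mono) auto
      then have "norm (u - restrict_L2 {0<..<T} z) \<le> 2 * C * ?\<rho>" using u(2) by linarith
      then show ?thesis
        using 1 norm_triangle_ineq[of "u - restrict_L2 {0<..<T} z" "restrict_L2 {0<..<T} z - z"]
        by (simp add: distrib_right)
    qed
    ultimately show ?thesis by blast
  qed
  then obtain u where u: "\<And>m. form_L2 b (u m) (u m) \<ge> 0"
    "\<And>m. norm (u m - z) \<le> (2 * C + 1) * norm (restrict_L2 {real m<..} z)" by metis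
  have "u \<longlonglongrightarrow> z"
  proof (rule LIM_zero_cancel)
    have "(\<lambda>m. (2 * C + 1) * norm (restrict_L2 {real m<..} z)) \<longlonglongrightarrow> 0"
      by (rule tendsto_mult_right_zero[OF restrict_L2_tail_tendsto_zero])
    then show "(\<lambda>m. u m - z) \<longlonglongrightarrow> 0" by (rule Lim_null_comparison[rotated]) (use u(2) in simp)
  qed
  then have "(\<lambda>m. form_L2 b (u m) (u m)) \<longlonglongrightarrow> form_L2 b z z" by (intro F.tendsto)
  then show ?thesis by (rule LIMSEQ_le_const) (use u(1) in blast)
qed

end

section \<open>Quadratic functionals\<close>

lemma bounded_bilinear_add:
  fixes f g :: "'b::real_normed_vector \<Rightarrow> 'c::real_normed_vector \<Rightarrow> 'd::real_normed_vector"
  assumes "bounded_bilinear f" "bounded_bilinear g"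
  shows "bounded_bilinear (\<lambda>x y. f x y + g x y)"
proof -
  interpret f: bounded_bilinear f by fact
  interpret g: bounded_bilinear g by fact
  obtain K L where K: "\<And>x y. norm (f x y) \<le> norm x * norm y * K" and L: "\<And>x y. norm (g x y) \<le> norm x * norm y * L"
    using f.bounded g.bounded by blast
  show ?thesis
  proof
    show "\<exists>K. \<forall>x y. norm (f x y + g x y) \<le> norm x * norm y * K"
    proof (intro exI allI)
      show "norm (f x y + g x y) \<le> norm x * norm y * (K + L)" for x y
        using norm_triangle_ineq[of "f x y" "g x y"] K[of x y] L[of x y] by (simp add: distrib_left)
    qed
  qed (simp_all add: f.add_left f.add_right g.add_left g.add_right f.scaleR_left f.scaleR_right
      g.scaleR_left g.scaleR_right scaleR_add_right)
qed

text \<open>The polarization of \<open>quad_form\<close> minus \<open>\<delta>\<close> times the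
  squared norm; the two terms with \<open>F2\<close> share its factor 2. With
  \<open>\<delta>\<close> as a parameter, one family contains the functional itself and the
  perturbations used in both directions of the equivalence.\<close>

definition polar_form :: "('a \<Rightarrow> 'a) \<Rightarrow> ('a \<Rightarrow> 'x) \<Rightarrow> ('x \<Rightarrow> 'x) \<Rightarrow> real \<Rightarrow>
    'a::complex_hilbert \<times> 'x::complex_hilbert \<Rightarrow> 'a \<times> 'x \<Rightarrow> real"
  where "polar_form F1 F2 F3 \<delta> p q = inner (F1 (fst p)) (fst q) + inner (F2 (fst p)) (snd q)
    + inner (snd p) (F2 (fst q)) + inner (F3 (snd p)) (snd q) + (- \<delta>) * inner p q"

lemma polar_form_diag:
  "polar_form F1 F2 F3 \<delta> p p = quad_form F1 F2 F3 (fst p) (snd p) - \<delta> * (norm p)\<^sup>2"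
  by (simp add: polar_form_def quad_form_def inner_eq_Re_cinner[symmetric] inner_commute[of "snd p"] power2_norm_eq_inner)

lemma bounded_bilinear_polar_form:
  assumes "bounded_clinear F1" "bounded_clinear F2" "bounded_clinear F3"
  shows "bounded_bilinear (polar_form F1 F2 F3 \<delta>)"
proof -
  note F1 = bounded_linear_compose[OF bounded_clinear_linear[OF assms(1)] bounded_linear_fst]
  note F2 = bounded_linear_compose[OF bounded_clinear_linear[OF assms(2)] bounded_linear_fst]
  note F3 = bounded_linear_compose[OF bounded_clinear_linear[OF assms(3)] bounded_linear_snd]
  note comp = bounded_bilinear.comp[OF bounded_bilinear_inner]
  have "bounded_bilinear (\<lambda>p q. (- \<delta>) * inner p q)"
    using comp[OF bounded_linear_scaleR_right[of "- \<delta>"] bounded_linear_ident] by simp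
  then show ?thesis
    unfolding polar_form_def[abs_def]
    by (intro bounded_bilinear_add comp[OF F1 bounded_linear_fst] comp[OF F2 bounded_linear_snd]
        comp[OF bounded_linear_snd F2] comp[OF F3 bounded_linear_snd])
qed

lemma inner_self_adjoint: "self_adjoint f \<Longrightarrow> inner (f x) y = inner x (f y)"
  by (simp add: self_adjoint_def inner_eq_Re_cinner)

lemma polar_form_sym:
  assumes "self_adjoint F1" "self_adjoint F3"
  shows "polar_form F1 F2 F3 \<delta> p q = polar_form F1 F2 F3 \<delta> q p"
  unfolding polar_form_def
  using inner_self_adjoint[OF assms(1), of "fst p" "fst q"] inner_self_adjoint[OF assms(2), of "snd p" "snd q"]
    inner_commute[of "fst p" "F1 (fst q)"] inner_commute[of "snd p" "F3 (snd q)"]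
    inner_commute[of "F2 (fst p)" "snd q"] inner_commute[of "snd p" "F2 (fst q)"] inner_commute[of p q]
  by simp

lemma polar_form_scaleC:
  assumes "bounded_clinear F1" "bounded_clinear F2" "bounded_clinear F3"
  shows "polar_form F1 F2 F3 \<delta> (c *\<^sub>C p) q = polar_form F1 F2 F3 \<delta> p (cnj c *\<^sub>C q)"
  unfolding polar_form_def
  by (simp add: bounded_clinear_scaleC[OF assms(1)] bounded_clinear_scaleC[OF assms(2)]
      bounded_clinear_scaleC[OF assms(3)] inner_scaleC)

section \<open>Processes as pairs of functions and as elements of \<open>L2\<close>\<close>

lemma strongly_measurable_Pair:
  "strongly_measurable M f \<Longrightarrow> strongly_measurable M g \<Longrightarrow> strongly_measurable M (\<lambda>t. (f t, g t))"
  by (rule strongly_measurable_compose2[where h = Pair]) (auto intro: tendsto_Pair)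

lemma square_integrable_Pair:
  fixes f :: "real \<Rightarrow> 'b::real_normed_vector" and g :: "real \<Rightarrow> 'c::real_normed_vector"
  assumes "square_integrable f" "square_integrable g"
  shows "square_integrable (\<lambda>t. (f t, g t))"
  using assms strongly_measurable_Pair[of lebesgue f g]
  by (simp add: square_integrable_def norm_prod_def)

definition L2_of_process :: "('a::complex_hilbert, 'x::complex_hilbert) process \<Rightarrow> ('a \<times> 'x) L2"
  where "L2_of_process p = abs_L2 (\<lambda>t. indicator {0<..} t *\<^sub>R (fst p t, snd p t))"

definition process_of_L2 :: "('a::complex_hilbert \<times> 'x::complex_hilbert) L2 \<Rightarrow> ('a, 'x) process"
  where "process_of_L2 z = (\<lambda>t. fst (rep_L2 z t), \<lambda>t. snd (rep_L2 z t))"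

lemma square_integrable_process:
  assumes "p \<in> Z_space"
  shows "square_integrable (\<lambda>t. indicator {0<..} t *\<^sub>R (fst p t, snd p t))"
proof -
  have "square_integrable (\<lambda>t. indicator {0<..} t *\<^sub>R fst p t)" "square_integrable (\<lambda>t. indicator {0<..} t *\<^sub>R snd p t)"
    using assms by (auto simp: Z_space_def L2_on_iff_square_integrable)
  then show ?thesis using square_integrable_Pair by fastforce
qed

lemma process_of_L2_in_Z: "process_of_L2 z \<in> Z_space"
proof -
  have "square_integrable (\<lambda>t. fst (rep_L2 z t))" "square_integrable (\<lambda>t. snd (rep_L2 z t))"
    by (auto intro: square_integrable_bounded_linear[OF bounded_linear_fst]
        square_integrable_bounded_linear[OF bounded_linear_snd])
  then show ?thesis
    by (simp add: process_of_L2_def Z_space_def L2_on_iff_square_integrable square_integrable_indicator_scaleR)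
qed

lemma L2_of_process_of_L2:
  assumes "AE t in lebesgue. t \<le> 0 \<longrightarrow> rep_L2 z t = 0"
  shows "L2_of_process (process_of_L2 z) = z"
proof (rule L2_eqI)
  show "AE t in lebesgue. rep_L2 (L2_of_process (process_of_L2 z)) t = rep_L2 z t"
    using rep_abs_L2[OF square_integrable_process[OF process_of_L2_in_Z[of z]]] assms
    unfolding L2_of_process_def by eventually_elim (auto simp: process_of_L2_def indicator_def)
qed

lemma Z_eq_of_L2_eq:
  assumes "p \<in> Z_space" "p' \<in> Z_space" "L2_of_process p = L2_of_process p'"
  shows "Z_eq p p'"
proof -
  have "AE t in lebesgue. indicator {0<..} t *\<^sub>R (fst p t, snd p t) = indicator {0<..} t *\<^sub>R (fst p' t, snd p' t)"
    using assms(3) abs_L2_eq_iff[OF square_integrable_process[OF assms(1)] square_integrable_process[OF assms(2)]]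
    by (simp add: L2_of_process_def)
  then have "AE t in lebesgue. t \<in> {0<..} \<longrightarrow> fst p t = fst p' t \<and> snd p t = snd p' t"
    by eventually_elim (auto simp: indicator_def)
  then show ?thesis
    by (auto simp: Z_eq_def AE_restrict_space_iff elim: eventually_mono)
qed

lemma Z_norm_eq:
  assumes "p \<in> Z_space"
  shows "(L2_norm_on {0<..} (fst p))\<^sup>2 + (L2_norm_on {0<..} (snd p))\<^sup>2 = (norm (L2_of_process p))\<^sup>2"
proof -
  let ?I = "{0::real<..}"
  have int: "integrable lebesgue (\<lambda>t. indicator ?I t *\<^sub>R (norm (fst p t))\<^sup>2)" "integrable lebesgue (\<lambda>t. indicator ?I t *\<^sub>R (norm (snd p t))\<^sup>2)"
    using assms by (auto simp: Z_space_def L2_on_def integrable_restrict_space)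
  have "(norm (L2_of_process p))\<^sup>2 = (LINT t|lebesgue. (norm (indicator ?I t *\<^sub>R (fst p t, snd p t)))\<^sup>2)"
    unfolding L2_of_process_def by (rule norm_abs_L2_power2[OF square_integrable_process[OF assms]])
  also have "\<dots> = (LINT t|lebesgue. indicator ?I t *\<^sub>R (norm (fst p t))\<^sup>2 + indicator ?I t *\<^sub>R (norm (snd p t))\<^sup>2)"
    by (rule Bochner_Integration.integral_cong) (auto simp: indicator_def norm_prod_def)
  also have "\<dots> = (LINT t|lebesgue_on ?I. (norm (fst p t))\<^sup>2) + (LINT t|lebesgue_on ?I. (norm (snd p t))\<^sup>2)"
    unfolding Bochner_Integration.integral_add[OF int] by (simp add: integral_restrict_space)
  finally show ?thesis by (simp add: L2_norm_on_def)
qed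

lemma functional_J_eq:
  assumes "bounded_clinear F1" "bounded_clinear F2" "bounded_clinear F3" "p \<in> Z_space"
  shows "functional_J (quad_form F1 F2 F3) p = form_L2 (polar_form F1 F2 F3 0) (L2_of_process p) (L2_of_process p)"
proof -
  note sq = square_integrable_process[OF assms(4)]
  interpret b: bounded_bilinear "polar_form F1 F2 F3 0" by (rule bounded_bilinear_polar_form[OF assms(1-3)])
  have q0: "quad_form F1 F2 F3 0 0 = 0"
    using polar_form_diag[of F1 F2 F3 0 0] b.zero_left[of 0] by simp
  have "form_L2 (polar_form F1 F2 F3 0) (L2_of_process p) (L2_of_process p) =
      (LINT t|lebesgue. polar_form F1 F2 F3 0 (indicator {0<..} t *\<^sub>R (fst p t, snd p t)) (indicator {0<..} t *\<^sub>R (fst p t, snd p t)))"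
    unfolding L2_of_process_def by (rule form_L2_abs[OF b.bounded_bilinear_axioms sq sq])
  also have "\<dots> = (LINT t|lebesgue. indicator {0<..} t *\<^sub>R quad_form F1 F2 F3 (fst p t) (snd p t))"
    by (rule Bochner_Integration.integral_cong)
      (auto simp: indicator_def polar_form_diag q0)
  finally show ?thesis by (simp add: functional_J_def integral_restrict_space)
qed

lemma form_L2_polar_form_shift:
  assumes "bounded_clinear F1" "bounded_clinear F2" "bounded_clinear F3"
  shows "form_L2 (polar_form F1 F2 F3 \<delta>) z z = form_L2 (polar_form F1 F2 F3 0) z z - \<delta> * (norm z)\<^sup>2"
proof -
  note b0 = bounded_bilinear_polar_form[OF assms, of 0]
  have int: "integrable lebesgue (\<lambda>t. (norm (rep_L2 z t))\<^sup>2)"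
    using square_integrable_rep[of z] unfolding square_integrable_def by blast
  have "form_L2 (polar_form F1 F2 F3 \<delta>) z z =
      (LINT t|lebesgue. polar_form F1 F2 F3 0 (rep_L2 z t) (rep_L2 z t) - \<delta> * (norm (rep_L2 z t))\<^sup>2)"
    unfolding form_L2_def by (simp add: polar_form_diag)
  also have "\<dots> = form_L2 (polar_form F1 F2 F3 0) z z - \<delta> * (norm z)\<^sup>2"
    unfolding form_L2_def norm_L2_power2
    by (subst Bochner_Integration.integral_diff) (use integrable_form_L2[OF b0] int in auto)
  finally show ?thesis .
qed

context control_system
begin

lemma mild_solution_eq: "mild_solution G B v0 \<xi> t = mild v0 (\<lambda>s. B (\<xi> s)) t"
  by (simp add: mild_solution_def mild_def conv_def)

lemma mild_L2_of_process:
  assumes "p \<in> Z_space"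
  shows "mild v0 (inp (rep_L2 (L2_of_process p))) t = mild_solution G B v0 (snd p) t"
  unfolding mild_solution_eq
proof (rule mild_AE_cong)
  show "AE s in lebesgue. s \<in> {0<..t} \<longrightarrow> inp (rep_L2 (L2_of_process p)) s = B (snd p s)"
    unfolding L2_of_process_def using rep_abs_L2[OF square_integrable_process[OF assms]]
    by eventually_elim (simp add: inp_def)
qed

text \<open>The bridge between pairs of functions on the half-line and the relation
  \<open>processes\<close>; the results in \<open>L2\<close> reach the admissible sets through
  it.\<close>

lemma admissible_iff: "p \<in> admissible j G B v0 \<longleftrightarrow> p \<in> Z_space \<and> (v0, L2_of_process p) \<in> processes"
proof (cases "p \<in> Z_space")
  case True
  note sq = square_integrable_process[OF True]
  have rep: "AE t in lebesgue. rep_L2 (L2_of_process p) t = indicator {0<..} t *\<^sub>R (fst p t, snd p t)"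
    unfolding L2_of_process_def by (rule rep_abs_L2[OF sq])
  have "(v0, L2_of_process p) \<in> processes \<longleftrightarrow>
      (AE t in lebesgue. t \<in> {0<..} \<longrightarrow> j (fst p t) = mild_solution G B (j v0) (snd p) t)"
  proof
    assume "(v0, L2_of_process p) \<in> processes"
    from processes_solution[OF this] rep
    show "AE t in lebesgue. t \<in> {0<..} \<longrightarrow> j (fst p t) = mild_solution G B (j v0) (snd p) t"
      by eventually_elim (auto simp: mild_L2_of_process[OF True])
  next
    assume "AE t in lebesgue. t \<in> {0<..} \<longrightarrow> j (fst p t) = mild_solution G B (j v0) (snd p) t"
    then have "AE t in lebesgue. (t \<le> 0 \<longrightarrow> rep_L2 (L2_of_process p) t = 0) \<and>
        (0 < t \<longrightarrow> j (fst (rep_L2 (L2_of_process p) t)) = mild (j v0) (inp (rep_L2 (L2_of_process p))) t)"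
      using rep by eventually_elim (auto simp: mild_L2_of_process[OF True] zero_prod_def)
    then show "(v0, L2_of_process p) \<in> processes" by (simp add: processes_def)
  qed
  then show ?thesis using True by (auto simp: admissible_def AE_restrict_space_iff)
qed (auto simp: admissible_def)

lemma process_of_L2_admissible:
  assumes "(v0, z) \<in> processes"
  shows "process_of_L2 z \<in> admissible j G B v0" "L2_of_process (process_of_L2 z) = z"
proof -
  show eq: "L2_of_process (process_of_L2 z) = z"
    by (rule L2_of_process_of_L2[OF processes_support[OF assms]])
  show "process_of_L2 z \<in> admissible j G B v0"
    unfolding admissible_iff eq using assms process_of_L2_in_Z by blast
qed

text \<open>Running the optimal process from the end point of a given one gives a competitor.\<close>

lemma dissipation:
  assumes b: "bounded_bilinear b"
    and opt: "\<And>v z. (v, z) \<in> processes \<Longrightarrow> form_L2 b (z0 v) (z0 v) \<le> form_L2 b z z"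
    and proc: "\<And>v. (v, z0 v) \<in> processes"
    and T: "0 \<le> T" and xi: "\<xi> \<in> L2_on {0<..<T}"
    and v: "continuous_on {0..T} v" "\<And>t. t \<in> {0..T} \<Longrightarrow> j (v t) = mild_solution G B (j v0) \<xi> t"
  shows "form_L2 b (z0 (v T)) (z0 (v T)) - form_L2 b (z0 v0) (z0 v0)
    + (LINT t|lebesgue_on {0..T}. b (v t, \<xi> t) (v t, \<xi> t)) \<ge> 0"
proof -
  interpret b: bounded_bilinear b by (rule b)
  let ?I = "{0<..<T}"
  let ?w = "\<lambda>t. indicator ?I t *\<^sub>R (v t, \<xi> t)"
  have xi': "square_integrable (\<lambda>t. indicator ?I t *\<^sub>R \<xi> t)" using xi by (simp add: L2_on_iff_square_integrable)
  \<comment> \<open>\<open>v\<close> is controlled only on \<open>{0..T}\<close>, where continuity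
    makes it bounded; freezing time outside gives a continuous function on the line, hence strong
    measurability.\<close>
  have v': "square_integrable (\<lambda>t. indicator ?I t *\<^sub>R v t)"
  proof -
    obtain C where "\<forall>x\<in>v ` {0..T}. norm x \<le> C"
      using compact_imp_bounded[OF compact_continuous_image[OF v(1) compact_Icc]] unfolding bounded_iff by blast
    then have C: "norm (v t) \<le> C" if "t \<in> {0..T}" for t using that by blast
    define p where "p t = max 0 (min T t)" for t
    have pT: "p t \<in> {0..T}" for t using T by (auto simp: p_def)
    have "continuous_on UNIV (\<lambda>t. v (p t))"
      by (rule continuous_on_compose2[OF v(1)]) (use pT in \<open>auto simp: p_def intro!: continuous_intros\<close>)
    then have "strongly_measurable lebesgue (\<lambda>t. v (p t))"
    proof (intro strongly_measurable_compose1[where h = "\<lambda>t. v (p t)" and f = "\<lambda>t. t"])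
      show "strongly_measurable lebesgue (\<lambda>t::real. t)"
        unfolding strongly_measurable_lebesgue_real_iff by (rule measurable_completion) simp
      show "(\<lambda>n. v (p (u n))) \<longlonglongrightarrow> v (p x)" if "continuous_on UNIV (\<lambda>t. v (p t))" "u \<longlonglongrightarrow> x" for u x
        using continuous_on_tendsto_compose[OF that] by simp
    qed
    then have "strongly_measurable lebesgue (\<lambda>t. indicator ?I t *\<^sub>R v (p t))"
      by (intro strongly_measurable_indicator_scaleR) simp_all
    moreover have "(\<lambda>t. indicator ?I t *\<^sub>R v (p t)) = (\<lambda>t. indicator ?I t *\<^sub>R v t)"
      by (auto simp: indicator_def p_def fun_eq_iff)
    ultimately have sm: "strongly_measurable lebesgue (\<lambda>t. indicator ?I t *\<^sub>R v t)" by simp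
    show ?thesis
    proof (rule square_integrable_bound[OF sm, of "\<lambda>t. indicator ?I t *\<^sub>R (1::real)" C])
      show "square_integrable (\<lambda>t. indicator ?I t *\<^sub>R (1::real))"
        by (rule square_integrable_indicator) (auto intro: bounded_set_imp_lmeasurable)
      show "AE t in lebesgue. norm (indicator ?I t *\<^sub>R v t) \<le> C * norm (indicator ?I t *\<^sub>R (1::real))"
        using C by (intro always_eventually allI) (auto simp: indicator_def)
    qed
  qed
  have sq: "square_integrable ?w" using square_integrable_Pair[OF v' xi'] by simp
  have neT: "AE t in lebesgue. t \<noteq> T" by (intro AE_completion AE_lborel_singleton)
  have mild: "mild (j v0) (inp ?w) t = mild_solution G B (j v0) \<xi> t" if "t \<le> T" for t
    unfolding mild_solution_eq
    by (rule mild_AE_cong) (use neT in eventually_elim, use that in \<open>auto simp: inp_def\<close>)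
  have "form_L2 b (z0 v0) (z0 v0) \<le> (LINT t|lebesgue. b (?w t) (?w t)) + form_L2 b (z0 (v T)) (z0 (v T))"
  proof (rule optimal_concat_le[OF b opt proc T sq])
    show "AE t in lebesgue. t \<in> ?I \<longrightarrow> j (fst (?w t)) = mild (j v0) (inp ?w) t"
    proof (intro always_eventually allI impI)
      fix t assume t: "t \<in> ?I"
      then show "j (fst (?w t)) = mild (j v0) (inp ?w) t"
        by (subst mild) (use v(2)[of t] in auto)
    qed
    show "j (v T) = mild (j v0) (inp ?w) T"
      unfolding mild[OF order_refl] using v(2)[of T] T by simp
  qed (auto simp: zero_prod_def)
  \<comment> \<open>\<open>?w\<close> lives on the open interval, the asserted integral on the
    closed one; the end points are null, and measurability of the second integrand is inherited from
    the first.\<close>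
  also have "(LINT t|lebesgue. b (?w t) (?w t)) = (LINT t|lebesgue_on {0..T}. b (v t, \<xi> t) (v t, \<xi> t))"
  proof -
    have m: "(\<lambda>t. b (?w t) (?w t)) \<in> borel_measurable lebesgue"
      by (rule borel_measurable_integrable[OF integrable_bilinear[OF b sq sq]])
    have ne0: "AE t in lebesgue. t \<noteq> (0::real)" by (intro AE_completion AE_lborel_singleton)
    have ae: "AE t in lebesgue. b (?w t) (?w t) = indicator {0..T} t *\<^sub>R b (v t, \<xi> t) (v t, \<xi> t)"
      using neT ne0 by eventually_elim (auto simp: indicator_def b.zero_left simp flip: zero_prod_def)
    have "(LINT t|lebesgue. b (?w t) (?w t)) = (LINT t|lebesgue. indicator {0..T} t *\<^sub>R b (v t, \<xi> t) (v t, \<xi> t))"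
      by (rule integral_cong_AE[OF m borel_measurable_AE[OF m ae] ae])
    then show ?thesis by (simp add: integral_restrict_space)
  qed
  finally show ?thesis by simp
qed

end

section \<open>Equivalence of the frequency conditions\<close>

text \<open>A positive infimum leaves room for a real \<open>\<delta>\<close> below it. Over the
  empty set the infimum is \<infinity> and every \<open>\<delta>\<close> works, in agreement with
  the right-hand side.\<close>

lemma Inf_ereal_pos_iff:
  "0 < Inf {ereal (f x) | x. P x} \<longleftrightarrow> (\<exists>\<delta>>0. \<forall>x. P x \<longrightarrow> \<delta> \<le> f x)"
proof
  assume "0 < Inf {ereal (f x) | x. P x}"
  then obtain \<delta> where \<delta>: "0 < ereal \<delta>" "ereal \<delta> < Inf {ereal (f x) | x. P x}"
    using ereal_dense2 by blast
  have "\<delta> \<le> f x" if "P x" for x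
  proof -
    have "Inf {ereal (f x) | x. P x} \<le> ereal (f x)" by (rule Inf_lower) (use that in blast)
    then show ?thesis using \<delta>(2) by (simp add: less_le_trans order_less_imp_le flip: ereal_less_eq(3))
  qed
  then show "\<exists>\<delta>>0. \<forall>x. P x \<longrightarrow> \<delta> \<le> f x" using \<delta>(1) by auto
next
  assume "\<exists>\<delta>>0. \<forall>x. P x \<longrightarrow> \<delta> \<le> f x"
  then obtain \<delta> where \<delta>: "0 < \<delta>" "\<And>x. P x \<Longrightarrow> \<delta> \<le> f x" by blast
  have "ereal \<delta> \<le> Inf {ereal (f x) | x. P x}" by (rule Inf_greatest) (use \<delta>(2) in auto)
  then show "0 < Inf {ereal (f x) | x. P x}" by (rule less_le_trans[rotated]) (simp add: \<delta>(1))
qed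

lemma alpha1_pos_iff:
  "0 < alpha1 j G B F \<longleftrightarrow> (\<exists>\<delta>>0. \<forall>p\<in>admissible j G B 0.
    \<delta> * ((L2_norm_on {0<..} (fst p))\<^sup>2 + (L2_norm_on {0<..} (snd p))\<^sup>2) \<le> functional_J F p \<or>
    (L2_norm_on {0<..} (fst p))\<^sup>2 + (L2_norm_on {0<..} (snd p))\<^sup>2 = 0)"
proof -
  let ?n = "\<lambda>p. (L2_norm_on {0<..} (fst p))\<^sup>2 + (L2_norm_on {0<..} (snd p))\<^sup>2"
  have "alpha1 j G B F = Inf {ereal (functional_J F p / ?n p) | p. p \<in> admissible j G B 0 \<and> ?n p \<noteq> 0}"
    unfolding alpha1_def by (rule arg_cong[of _ _ Inf]) auto
  then have "0 < alpha1 j G B F \<longleftrightarrow>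
      (\<exists>\<delta>>0. \<forall>p. p \<in> admissible j G B 0 \<and> ?n p \<noteq> 0 \<longrightarrow> \<delta> \<le> functional_J F p / ?n p)"
    by (simp only: Inf_ereal_pos_iff)
  moreover have "\<delta> \<le> functional_J F p / ?n p \<longleftrightarrow> \<delta> * ?n p \<le> functional_J F p" if "?n p \<noteq> 0" for \<delta> p
  proof -
    have "0 \<le> ?n p" by simp
    then have "0 < ?n p" using that by (rule le_neq_trans[OF _ not_sym])
    then show ?thesis by (rule pos_le_divide_eq)
  qed
  ultimately show ?thesis by (simp only: Ball_def) blast
qed

lemma alpha2_pos_iff:
  "0 < alpha2 j D A B F \<longleftrightarrow> (\<exists>\<delta>>0. \<forall>\<omega> v \<xi>. j v \<in> D \<and> (\<i> * complex_of_real \<omega>) *\<^sub>C j v = A (j v) + B \<xi> \<and>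
    (norm v)\<^sup>2 + (norm \<xi>)\<^sup>2 \<noteq> 0 \<longrightarrow> \<delta> * ((norm v)\<^sup>2 + (norm \<xi>)\<^sup>2) \<le> F v \<xi>)"
proof -
  let ?P = "\<lambda>(\<omega>, v, \<xi>). j v \<in> D \<and> (\<i> * complex_of_real \<omega>) *\<^sub>C j v = A (j v) + B \<xi> \<and> (norm v)\<^sup>2 + (norm \<xi>)\<^sup>2 \<noteq> 0"
  let ?f = "\<lambda>(\<omega> :: real, v, \<xi>). F v \<xi> / ((norm v)\<^sup>2 + (norm \<xi>)\<^sup>2)"
  have "alpha2 j D A B F = Inf {ereal (?f x) | x. ?P x}"
    unfolding alpha2_def by (rule arg_cong[of _ _ Inf]) auto
  then have "0 < alpha2 j D A B F \<longleftrightarrow> (\<exists>\<delta>>0. \<forall>x. ?P x \<longrightarrow> \<delta> \<le> ?f x)"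
    by (simp only: Inf_ereal_pos_iff)
  also have "\<dots> \<longleftrightarrow> (\<exists>\<delta>>0. \<forall>\<omega> v \<xi>. ?P (\<omega>, v, \<xi>) \<longrightarrow> \<delta> \<le> F v \<xi> / ((norm v)\<^sup>2 + (norm \<xi>)\<^sup>2))"
    by (simp only: split_paired_All prod.case)
  moreover have "\<delta> \<le> F v \<xi> / ((norm v)\<^sup>2 + (norm \<xi>)\<^sup>2) \<longleftrightarrow> \<delta> * ((norm v)\<^sup>2 + (norm \<xi>)\<^sup>2) \<le> F v \<xi>"
    if "(norm v)\<^sup>2 + (norm \<xi>)\<^sup>2 \<noteq> 0" for \<delta> v \<xi>
  proof -
    have "0 < (norm v)\<^sup>2 + (norm \<xi>)\<^sup>2" using that by (rule le_neq_trans[OF _ not_sym, rotated]) simp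
    then show ?thesis by (rule pos_le_divide_eq)
  qed
  ultimately show ?thesis by (simp only: prod.case) blast
qed

lemma alpha3_pos_iff:
  fixes F :: "'a::complex_hilbert \<Rightarrow> 'x::complex_hilbert \<Rightarrow> real"
  shows "0 < alpha3 j D A B F \<longleftrightarrow> (\<exists>\<delta>>0. \<forall>\<omega> \<xi>. \<xi> \<noteq> 0 \<longrightarrow>
    \<delta> * (norm \<xi>)\<^sup>2 \<le> F (- transfer_op j D A B \<omega> \<xi>) \<xi>)"
proof -
  let ?f = "\<lambda>(\<omega>, \<xi>). F (- transfer_op j D A B \<omega> \<xi>) \<xi> / (norm \<xi>)\<^sup>2"
  have "alpha3 j D A B F = Inf {ereal (?f x) | x. snd x \<noteq> 0}"
  proof (rule antisym)
    show "alpha3 j D A B F \<le> Inf {ereal (?f x) | x. snd x \<noteq> 0}"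
      unfolding alpha3_def by (rule Inf_greatest) (auto intro!: INF_lower2)
    show "Inf {ereal (?f x) | x. snd x \<noteq> 0} \<le> alpha3 j D A B F"
      unfolding alpha3_def by (intro INF_greatest Inf_lower) auto
  qed
  then have "0 < alpha3 j D A B F \<longleftrightarrow> (\<exists>\<delta>>0. \<forall>x. snd x \<noteq> 0 \<longrightarrow> \<delta> \<le> ?f x)"
    by (simp only: Inf_ereal_pos_iff)
  then have *: "0 < alpha3 j D A B F \<longleftrightarrow> (\<exists>\<delta>>0. \<forall>\<omega> \<xi>. \<xi> \<noteq> 0 \<longrightarrow> \<delta> \<le> F (- transfer_op j D A B \<omega> \<xi>) \<xi> / (norm \<xi>)\<^sup>2)"
    by (simp only: split_paired_All prod.case snd_conv)
  have "\<delta> \<le> y / (norm \<xi>)\<^sup>2 \<longleftrightarrow> \<delta> * (norm \<xi>)\<^sup>2 \<le> y" if "\<xi> \<noteq> 0" for \<delta> y and \<xi> :: 'x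
    by (rule pos_le_divide_eq) (use that in simp)
  then show ?thesis unfolding * by (simp cong: imp_cong)
qed

text \<open>Off the spectrum the shifted operator is a bijection from \<open>D\<close>, and
  \<open>D \<subseteq> range j\<close> puts the preimage into the range of \<open>j\<close>; so the
  inverse functions in \<open>transfer_op\<close> take their intended values.\<close>

lemma transfer_op_solves:
  assumes wd: "alpha3_well_defined j D A B" and D: "D \<subseteq> range j" and j: "inj j"
  shows "j (transfer_op j D A B \<omega> \<xi>) \<in> D"
    "A (j (transfer_op j D A B \<omega> \<xi>)) - (\<i> * complex_of_real \<omega>) *\<^sub>C j (transfer_op j D A B \<omega> \<xi>) = B \<xi>"
    "x \<in> D \<Longrightarrow> A x - (\<i> * complex_of_real \<omega>) *\<^sub>C x = B \<xi> \<Longrightarrow> j (transfer_op j D A B \<omega> \<xi>) = x"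
proof -
  let ?f = "\<lambda>x. A x - (\<i> * complex_of_real \<omega>) *\<^sub>C x"
  have "\<i> * complex_of_real \<omega> \<notin> op_spectrum D A" using wd by (auto simp: alpha3_well_defined_def)
  then have bij: "bij_betw ?f D UNIV" by (simp add: op_spectrum_def)
  have r: "inv_into D ?f (B \<xi>) \<in> D" "?f (inv_into D ?f (B \<xi>)) = B \<xi>"
    using bij inv_into_into[of "B \<xi>" ?f D] f_inv_into_f[of "B \<xi>" ?f D] by (auto simp: bij_betw_def)
  have jt: "j (transfer_op j D A B \<omega> \<xi>) = inv_into D ?f (B \<xi>)"
    unfolding transfer_op_def resolvent_def using r(1) D by (intro f_inv_into_f) blast
  show "j (transfer_op j D A B \<omega> \<xi>) \<in> D" "?f (j (transfer_op j D A B \<omega> \<xi>)) = B \<xi>"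
    using r by (simp_all add: jt)
  show "j (transfer_op j D A B \<omega> \<xi>) = x" if "x \<in> D" "?f x = B \<xi>"
    using inv_into_f_f[of ?f D x] bij that by (simp add: jt bij_betw_def)
qed

context control_system
begin

lemma optimal_control:
  assumes b: "bounded_bilinear b" and sym: "\<And>x y. b x y = b y x"
    and bC: "\<And>c x y. b (c *\<^sub>C x) y = b x (cnj c *\<^sub>C y)"
    and surj: "\<And>v. \<exists>z. (v, z) \<in> processes"
    and \<delta>: "\<delta> > 0" "\<And>z. (0, z) \<in> processes \<Longrightarrow> form_L2 b z z \<ge> \<delta> * (norm z)\<^sup>2"
  obtains z0 P where "bounded_clinear z0" "\<And>v. (v, z0 v) \<in> processes"
    "\<And>v z. (v, z) \<in> processes \<Longrightarrow> form_L2 b z z \<ge> form_L2 b (z0 v) (z0 v) + \<delta> * (norm (z - z0 v))\<^sup>2"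
    "bounded_clinear P" "self_adjoint P"
    "\<And>v. cinner (P v) v = complex_of_real (form_L2 b (z0 v) (z0 v))"
proof -
  note F = bounded_bilinear_form_L2[OF b] form_L2_sym[OF b sym] form_L2_scaleC[OF b bC]
  obtain z0 where z0: "bounded_clinear z0" "\<And>v. (v, z0 v) \<in> processes"
    "\<And>v z. (v, z) \<in> processes \<Longrightarrow> form_L2 b z z \<ge> form_L2 b (z0 v) (z0 v) + \<delta> * (norm (z - z0 v))\<^sup>2"
    by (rule quadratic_minimizer_over_relation[OF F processes_add processes_scaleC closed_processes surj \<delta>])
      (assumption | rule that)+
  obtain P where P: "bounded_clinear P" "self_adjoint P"
    "\<And>v. cinner (P v) v = complex_of_real (form_L2 b (z0 v) (z0 v))"
    by (rule form_represented_by_self_adjoint[OF F z0(1)]) (rule that)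
  show ?thesis by (rule that[OF z0 P])
qed

text \<open>The dissipation inequality on \<open>[0, 1]\<close> for the process \<open>exp (i \<omega> t) (v, \<xi>)\<close>, along which the
  value function is constant, gives the frequency inequality.\<close>

lemma frequency_nonneg_of_coercive:
  assumes b: "bounded_bilinear b" and sym: "\<And>x y. b x y = b y x"
    and bC: "\<And>c x y. b (c *\<^sub>C x) y = b x (cnj c *\<^sub>C y)"
    and surj: "\<And>v. \<exists>z. (v, z) \<in> processes"
    and \<delta>: "\<delta> > 0" "\<And>z. (0, z) \<in> processes \<Longrightarrow> form_L2 b z z \<ge> \<delta> * (norm z)\<^sup>2"
    and st: "stationary \<omega> (j v) (B \<xi>)"
  shows "b (v, \<xi>) (v, \<xi>) \<ge> 0"
proof -
  obtain z0 P where z0: "bounded_clinear z0" "\<And>v. (v, z0 v) \<in> processes"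
    "\<And>v z. (v, z) \<in> processes \<Longrightarrow> form_L2 b z z \<ge> form_L2 b (z0 v) (z0 v) + \<delta> * (norm (z - z0 v))\<^sup>2"
    by (rule optimal_control[OF b sym bC surj \<delta>]) (assumption | rule that)+
  have opt: "form_L2 b (z0 v) (z0 v) \<le> form_L2 b z z" if "(v, z) \<in> processes" for v z
  proof -
    have "0 \<le> \<delta> * (norm (z - z0 v))\<^sup>2" using \<delta>(1) by simp
    then show ?thesis using z0(3)[OF that] by linarith
  qed
  have unit: "cnj (cis x) * cis x = 1" for x by (simp add: cis_cnj cis_mult)
  let ?v = "\<lambda>t. cis (\<omega> * t) *\<^sub>C v" and ?xi = "\<lambda>t. cis (\<omega> * t) *\<^sub>C \<xi>"
  have xi: "?xi \<in> L2_on {0<..<1}"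
  proof -
    have "square_integrable (\<lambda>t. cis (\<omega> * t) *\<^sub>C (indicator {0<..<1::real} t *\<^sub>R \<xi>))"
      by (rule fourier.square_integrable_cis_scaleC[of 1])
        (auto simp: fourier_def intro!: square_integrable_indicator bounded_set_imp_lmeasurable)
    then show ?thesis by (simp add: L2_on_iff_square_integrable scaleC_scaleR_commute)
  qed
  have "form_L2 b (z0 (?v 1)) (z0 (?v 1)) - form_L2 b (z0 v) (z0 v)
    + (LINT t|lebesgue_on {0..1}. b (?v t, ?xi t) (?v t, ?xi t)) \<ge> 0"
  proof (rule dissipation[where v = ?v and ?v0.0 = v and T = 1 and \<xi> = ?xi, OF b opt z0(2) zero_le_one xi])
    show "continuous_on {0..1} ?v" by (intro continuous_on_scaleC continuous_intros)
    show "j (?v t) = mild_solution G B (j v) ?xi t" if "t \<in> {0..1}" for t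
      using stationary_mild[OF st, of t] that
      by (simp add: mild_solution_eq bounded_clinear_scaleC[OF j] bounded_clinear_scaleC[OF B])
  qed
  \<comment> \<open>Complex linearity of \<open>z0\<close> makes the value function invariant under
    unimodular scalars.\<close>
  moreover have "form_L2 b (z0 (?v 1)) (z0 (?v 1)) = form_L2 b (z0 v) (z0 v)"
    by (simp add: bounded_clinear_scaleC[OF z0(1)] form_L2_scaleC[OF b bC] scaleC_scaleC unit)
  moreover have "b (?v t, ?xi t) (?v t, ?xi t) = b (v, \<xi>) (v, \<xi>)" for t
    using bC[of "cis (\<omega> * t)" "(v, \<xi>)" "cis (\<omega> * t) *\<^sub>C (v, \<xi>)"]
    by (simp only: scaleC_Pair[symmetric] scaleC_scaleC unit scaleC_one)
  ultimately show ?thesis by (simp add: measure_restrict_space)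
qed

end

section \<open>The minimum problem and the three constants for the given system\<close>

theorem theorem2:
  fixes j :: "'a::complex_hilbert \<Rightarrow> 'h::complex_hilbert"
    and G :: "real \<Rightarrow> 'h \<Rightarrow> 'h"
    and D :: "'h set"
    and A :: "'h \<Rightarrow> 'h"
    and B :: "'x::complex_hilbert \<Rightarrow> 'h"
    and F1 :: "'a \<Rightarrow> 'a"
    and F2 :: "'a \<Rightarrow> 'x"
    and F3 :: "'x \<Rightarrow> 'x"
    and F :: "'a \<Rightarrow> 'x \<Rightarrow> real"
  assumes semigroup: "C0_semigroup G"
    and generator: "is_generator D A G"
    and B: "bounded_clinear B"
    and embedding: "bounded_clinear j" "inj j" "closure (range j) = UNIV"
    and domain: "D \<subseteq> range j"
    and F1: "bounded_clinear F1" "self_adjoint F1"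
    and F2: "bounded_clinear F2"
    and F3: "bounded_clinear F3" "self_adjoint F3"
    and F: "F = quad_form F1 F2 F3"
    and stabilizable: "\<forall>v0. \<exists>\<xi>\<in>L2_on {0<..}. \<exists>v\<in>L2_on {0<..}.
      AE t in lebesgue_on {0<..}. j (v t) = mild_solution G B (j v0) \<xi> t"
  shows "(alpha1 j G B F > 0 \<longrightarrow>
      (\<exists>z0 :: 'a \<Rightarrow> ('a, 'x) process.
        (\<forall>v0. minimizer_on (functional_J F) (admissible j G B v0) (z0 v0) \<and>
          (\<forall>z. minimizer_on (functional_J F) (admissible j G B v0) z \<longrightarrow> Z_eq z (z0 v0))) \<and>
        bounded_clinear_Z z0 \<and>
        (\<exists>P. bounded_clinear P \<and> self_adjoint P \<and>
          (\<forall>v0. cinner (P v0) v0 = complex_of_real (functional_J F (z0 v0))) \<and>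
          (\<forall>T\<ge>0. \<forall>v0. \<forall>\<xi>\<in>L2_on {0<..<T}. \<forall>v.
            continuous_on {0..T} v \<and>
            (\<forall>t\<in>{0..T}. j (v t) = mild_solution G B (j v0) \<xi> t) \<longrightarrow>
            Re (cinner (P (v T)) (v T)) - Re (cinner (P v0) v0)
              + (LINT t|lebesgue_on {0..T}. F (v t) (\<xi> t)) \<ge> 0)))) \<and>
    (alpha1 j G B F > 0 \<longleftrightarrow> alpha2 j D A B F > 0) \<and>
    (alpha3_well_defined j D A B \<longrightarrow> (alpha2 j D A B F > 0 \<longleftrightarrow> alpha3 j D A B F > 0))"
proof -
  interpret control_system G j B
    by unfold_locales (use semigroup B embedding in auto)
  note forms = F1(1) F2(1) F3(1)
  let ?b = "polar_form F1 F2 F3"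
  let ?J = "form_L2 (?b 0)"
  have bb: "bounded_bilinear (?b \<delta>)" for \<delta> by (rule bounded_bilinear_polar_form[OF forms])
  have sym: "?b \<delta> x y = ?b \<delta> y x" for \<delta> x y by (rule polar_form_sym[OF F1(2) F3(2)])
  have bC: "?b \<delta> (c *\<^sub>C x) y = ?b \<delta> x (cnj c *\<^sub>C y)" for \<delta> c x y by (rule polar_form_scaleC[OF forms])
  have shift: "form_L2 (?b \<delta>) z z = ?J z z - \<delta> * (norm z)\<^sup>2" for \<delta> z
    by (rule form_L2_polar_form_shift[OF forms])
  have JF: "functional_J F p = ?J (L2_of_process p) (L2_of_process p)" if "p \<in> Z_space" for p
    unfolding F by (rule functional_J_eq[OF forms that])
  have bF: "?b \<delta> (v, \<xi>) (v, \<xi>) = F v \<xi> - \<delta> * ((norm v)\<^sup>2 + (norm \<xi>)\<^sup>2)" for \<delta> v \<xi>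
    by (simp add: polar_form_diag F norm_Pair_power2)
  have surj: "\<exists>z. (v0, z) \<in> processes" for v0
  proof -
    obtain \<xi> v where "\<xi> \<in> L2_on {0<..}" "v \<in> L2_on {0<..}"
      "AE t in lebesgue_on {0<..}. j (v t) = mild_solution G B (j v0) \<xi> t" using stabilizable by blast
    then have "(v, \<xi>) \<in> admissible j G B v0" by (simp add: admissible_def Z_space_def)
    then show ?thesis using admissible_iff by blast
  qed
  have st: "stationary \<omega> w f \<longleftrightarrow> w \<in> D \<and> (\<i> * complex_of_real \<omega>) *\<^sub>C w = A w + f" for \<omega> w f
    by (rule stationary_iff_generator[OF generator])
  have alpha1: "0 < alpha1 j G B F \<longleftrightarrow>
      (\<exists>\<delta>>0. \<forall>z. (0, z) \<in> processes \<longrightarrow> \<delta> * (norm z)\<^sup>2 \<le> ?J z z)" (is "_ \<longleftrightarrow> ?coercive")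
  proof
    assume "0 < alpha1 j G B F"
    then obtain \<delta> where \<delta>: "\<delta> > 0" "\<And>p. p \<in> admissible j G B 0 \<Longrightarrow>
        \<delta> * ((L2_norm_on {0<..} (fst p))\<^sup>2 + (L2_norm_on {0<..} (snd p))\<^sup>2) \<le> functional_J F p \<or>
        (L2_norm_on {0<..} (fst p))\<^sup>2 + (L2_norm_on {0<..} (snd p))\<^sup>2 = 0"
      unfolding alpha1_pos_iff by blast
    have "\<delta> * (norm z)\<^sup>2 \<le> ?J z z" if z: "(0, z) \<in> processes" for z
    proof -
      note p = process_of_L2_admissible[OF z]
      \<comment> \<open>Processes of norm zero are excluded from the infimum, but for them both
        sides vanish.\<close>
      have "\<delta> * (norm z)\<^sup>2 \<le> ?J z z \<or> (norm z)\<^sup>2 = 0"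
        using \<delta>(2)[OF p(1)] unfolding Z_norm_eq[OF process_of_L2_in_Z] JF[OF process_of_L2_in_Z] p(2) .
      then show ?thesis
        using bounded_bilinear.zero_left[OF bounded_bilinear_form_L2[OF bb]] by auto
    qed
    then show ?coercive using \<delta>(1) by blast
  next
    assume ?coercive
    then obtain \<delta> where \<delta>: "\<delta> > 0" "\<And>z. (0, z) \<in> processes \<Longrightarrow> \<delta> * (norm z)\<^sup>2 \<le> ?J z z" by blast
    have "\<delta> * ((L2_norm_on {0<..} (fst p))\<^sup>2 + (L2_norm_on {0<..} (snd p))\<^sup>2) \<le> functional_J F p"
      if "p \<in> admissible j G B 0" for p
    proof -
      have p: "p \<in> Z_space" "(0, L2_of_process p) \<in> processes" using that by (auto simp: admissible_iff)
      show ?thesis unfolding Z_norm_eq[OF p(1)] JF[OF p(1)] by (rule \<delta>(2)[OF p(2)])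
    qed
    then show "0 < alpha1 j G B F" unfolding alpha1_pos_iff using \<delta>(1) by blast
  qed
  have part1: "\<exists>z0 :: 'a \<Rightarrow> ('a, 'x) process.
        (\<forall>v0. minimizer_on (functional_J F) (admissible j G B v0) (z0 v0) \<and>
          (\<forall>z. minimizer_on (functional_J F) (admissible j G B v0) z \<longrightarrow> Z_eq z (z0 v0))) \<and>
        bounded_clinear_Z z0 \<and>
        (\<exists>P. bounded_clinear P \<and> self_adjoint P \<and>
          (\<forall>v0. cinner (P v0) v0 = complex_of_real (functional_J F (z0 v0))) \<and>
          (\<forall>T\<ge>0. \<forall>v0. \<forall>\<xi>\<in>L2_on {0<..<T}. \<forall>v.
            continuous_on {0..T} v \<and>
            (\<forall>t\<in>{0..T}. j (v t) = mild_solution G B (j v0) \<xi> t) \<longrightarrow>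
            Re (cinner (P (v T)) (v T)) - Re (cinner (P v0) v0)
              + (LINT t|lebesgue_on {0..T}. F (v t) (\<xi> t)) \<ge> 0))"
    if pos: "0 < alpha1 j G B F"
  proof -
    obtain \<delta> where \<delta>: "\<delta> > 0" "\<And>z. (0, z) \<in> processes \<Longrightarrow> \<delta> * (norm z)\<^sup>2 \<le> ?J z z"
      using pos alpha1 by blast
    obtain Z P where Z: "bounded_clinear Z" "\<And>v. (v, Z v) \<in> processes"
      "\<And>v z. (v, z) \<in> processes \<Longrightarrow> ?J z z \<ge> ?J (Z v) (Z v) + \<delta> * (norm (z - Z v))\<^sup>2"
      and P: "bounded_clinear P" "self_adjoint P" "\<And>v. cinner (P v) v = complex_of_real (?J (Z v) (Z v))"
      by (rule optimal_control[OF bb sym bC surj \<delta>]) (assumption | rule that)+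
    have opt: "?J (Z v) (Z v) \<le> ?J z z" if "(v, z) \<in> processes" for v z
    proof -
      have "0 \<le> \<delta> * (norm (z - Z v))\<^sup>2" using \<delta>(1) by simp
      then show ?thesis using Z(3)[OF that] by linarith
    qed
    define z0 where "z0 v = process_of_L2 (Z v)" for v
    have z0: "z0 v \<in> Z_space" "L2_of_process (z0 v) = Z v" "z0 v \<in> admissible j G B v" for v
      unfolding z0_def using process_of_L2_in_Z process_of_L2_admissible[OF Z(2)] by auto
    have Jz0: "functional_J F (z0 v) = ?J (Z v) (Z v)" for v using JF[OF z0(1)] by (simp add: z0(2))
    have min: "minimizer_on (functional_J F) (admissible j G B v0) (z0 v0)" for v0
      unfolding minimizer_on_def using z0(3) opt by (auto simp: Jz0 admissible_iff JF)
    have uniq: "Z_eq p (z0 v0)" if "minimizer_on (functional_J F) (admissible j G B v0) p" for v0 p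
    proof -
      have p: "p \<in> Z_space" "(v0, L2_of_process p) \<in> processes" and le: "functional_J F p \<le> functional_J F (z0 v0)"
        using that z0(3)[of v0] by (auto simp: minimizer_on_def admissible_iff)
      \<comment> \<open>The quadratic growth around the minimizer forces any other minimizer to
        coincide with it in \<open>L2\<close>.\<close>
      have "\<delta> * (norm (L2_of_process p - Z v0))\<^sup>2 \<le> 0"
        using Z(3)[OF p(2)] le by (simp add: JF[OF p(1)] Jz0)
      then have "(norm (L2_of_process p - Z v0))\<^sup>2 \<le> 0" using \<delta>(1) by (simp add: mult_le_0_iff)
      then have "L2_of_process p = L2_of_process (z0 v0)" by (simp add: z0(2))
      then show ?thesis by (rule Z_eq_of_L2_eq[OF p(1) z0(1)])
    qed
    have lin: "bounded_clinear_Z z0"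
      unfolding bounded_clinear_Z_def
    proof (intro conjI allI)
      show "z0 v \<in> Z_space" for v by (rule z0(1))
      interpret Z: Real_Vector_Spaces.bounded_linear Z by (rule bounded_clinear_linear[OF Z(1)])
      show "Z_eq (z0 (x + y)) (\<lambda>t. fst (z0 x) t + fst (z0 y) t, \<lambda>t. snd (z0 x) t + snd (z0 y) t)" for x y
        unfolding Z_eq_def z0_def process_of_L2_def Z.add fst_conv snd_conv
        using rep_plus_L2[of "Z x" "Z y"] by (auto simp: AE_restrict_space_iff elim: eventually_mono)
      show "Z_eq (z0 (c *\<^sub>C x)) (\<lambda>t. c *\<^sub>C fst (z0 x) t, \<lambda>t. c *\<^sub>C snd (z0 x) t)" for c x
        unfolding Z_eq_def z0_def process_of_L2_def bounded_clinear_scaleC[OF Z(1)] fst_conv snd_conv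
        using rep_scaleC_L2[of c "Z x"] by (auto simp: AE_restrict_space_iff elim: eventually_mono)
      obtain C where "\<And>v. norm (Z v) \<le> norm v * C" using Z.bounded by blast
      moreover have "Z_norm (z0 v) = norm (Z v)" for v
        unfolding Z_norm_def Z_norm_eq[OF z0(1)] z0(2) by simp
      ultimately show "\<exists>C. \<forall>v. Z_norm (z0 v) \<le> C * norm v" by (metis mult.commute)
    qed
    have ineq: "Re (cinner (P (v T)) (v T)) - Re (cinner (P v0) v0) + (LINT t|lebesgue_on {0..T}. F (v t) (\<xi> t)) \<ge> 0"
      if "T \<ge> 0" "\<xi> \<in> L2_on {0<..<T}" "continuous_on {0..T} v" "\<And>t. t \<in> {0..T} \<Longrightarrow> j (v t) = mild_solution G B (j v0) \<xi> t"
      for T v0 \<xi> v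
      using dissipation[OF bb opt Z(2) that] by (simp add: P(3) bF)
    show ?thesis
      by (intro exI[of _ z0] exI[of _ P] conjI allI ballI impI min uniq lin P(1,2) ineq)
        (auto simp: P(3) Jz0)
  qed
  have alpha12: "0 < alpha1 j G B F \<longleftrightarrow> 0 < alpha2 j D A B F"
  proof
    assume "0 < alpha1 j G B F"
    then obtain \<delta> where \<delta>: "\<delta> > 0" "\<And>z. (0, z) \<in> processes \<Longrightarrow> \<delta> * (norm z)\<^sup>2 \<le> ?J z z"
      using alpha1 by blast
    \<comment> \<open>Half of \<open>\<delta>\<close> keeps the perturbed form coercive; the other
      half becomes the lower bound in the frequency inequality.\<close>
    have coer: "form_L2 (?b (\<delta> / 2)) z z \<ge> \<delta> / 2 * (norm z)\<^sup>2" if "(0, z) \<in> processes" for z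
      using \<delta>(2)[OF that] unfolding shift[of "\<delta> / 2"] by (simp add: field_simps)
    have "\<delta> / 2 * ((norm v)\<^sup>2 + (norm \<xi>)\<^sup>2) \<le> F v \<xi>"
      if "j v \<in> D" "(\<i> * complex_of_real \<omega>) *\<^sub>C j v = A (j v) + B \<xi>" for \<omega> v \<xi>
      using frequency_nonneg_of_coercive[OF bb sym bC surj _ coer, of \<omega> v \<xi>] that \<delta>(1) by (simp add: st bF)
    then show "0 < alpha2 j D A B F" unfolding alpha2_pos_iff using \<delta>(1) half_gt_zero by blast
  next
    assume "0 < alpha2 j D A B F"
    then obtain \<delta> where \<delta>: "\<delta> > 0" "\<And>\<omega> v \<xi>. j v \<in> D \<Longrightarrow> (\<i> * complex_of_real \<omega>) *\<^sub>C j v = A (j v) + B \<xi> \<Longrightarrow>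
        (norm v)\<^sup>2 + (norm \<xi>)\<^sup>2 \<noteq> 0 \<Longrightarrow> \<delta> * ((norm v)\<^sup>2 + (norm \<xi>)\<^sup>2) \<le> F v \<xi>"
      unfolding alpha2_pos_iff by blast
    have freq: "?b \<delta> (v, \<xi>) (v, \<xi>) \<ge> 0" if "stationary \<omega> (j v) (B \<xi>)" for \<omega> v \<xi>
    proof (cases "(norm v)\<^sup>2 + (norm \<xi>)\<^sup>2 = 0")
      case True
      then have "(v, \<xi>) = 0" by (simp add: sum_power2_eq_zero_iff zero_prod_def)
      then show ?thesis using bounded_bilinear.zero_left[OF bb] by simp
    next
      case False
      then show ?thesis using \<delta>(2)[of v \<omega> \<xi>] that by (simp add: st bF)
    qed
    have "\<delta> * (norm z)\<^sup>2 \<le> ?J z z" if "(0, z) \<in> processes" for z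
      using frequency_nonneg[OF bb bC surj freq that] unfolding shift[of \<delta>] by simp
    then show "0 < alpha1 j G B F" using alpha1 \<delta>(1) by blast
  qed
  have alpha23: "0 < alpha2 j D A B F \<longleftrightarrow> 0 < alpha3 j D A B F" if wd: "alpha3_well_defined j D A B"
  proof -
    let ?t = "transfer_op j D A B"
    have jneg: "j (- x) = - j x" for x
      by (rule linear_neg[OF bounded_linear.linear[OF bounded_clinear_linear[OF embedding(1)]]])
    note solves = transfer_op_solves[OF wd domain embedding(2)]
    \<comment> \<open>\<open>A\<close> enters only through \<open>is_generator\<close>, so its
      oddness is read off from the difference quotients. It accounts for the sign:
      \<open>transfer_op\<close> solves (A - i \<omega>) x = B \<xi>, and the stationary equation is
      solved by -x.\<close>
    have neg: "- x \<in> D" "A (- x) = - A x" if x: "x \<in> D" for x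
    proof -
      have lim: "((\<lambda>t. (G t x - x) /\<^sub>R t) \<longlongrightarrow> A x) (at_right 0)"
        using generator x by (simp add: is_generator_def)
      have "eventually (\<lambda>t. - ((G t x - x) /\<^sub>R t) = (G t (- x) - - x) /\<^sub>R t) (at_right 0)"
        unfolding eventually_at_right_field
        by (intro exI[of _ 1]) (simp add: linear_neg[OF linear] scaleR_diff_right)
      then have lim': "((\<lambda>t. (G t (- x) - - x) /\<^sub>R t) \<longlongrightarrow> - A x) (at_right 0)"
        by (rule Lim_transform_eventually[OF tendsto_minus[OF lim]])
      then show D: "- x \<in> D" using generator by (auto simp: is_generator_def)
      have "((\<lambda>t. (G t (- x) - - x) /\<^sub>R t) \<longlongrightarrow> A (- x)) (at_right 0)"
        using generator D unfolding is_generator_def by blast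
      then show "A (- x) = - A x" by (rule tendsto_unique[OF _ _ lim', rotated]) simp
    qed
    have sol: "j (- ?t \<omega> \<xi>) \<in> D \<and> (\<i> * complex_of_real \<omega>) *\<^sub>C j (- ?t \<omega> \<xi>) = A (j (- ?t \<omega> \<xi>)) + B \<xi>" for \<omega> \<xi>
      unfolding jneg neg(2)[OF solves(1)[of \<omega> \<xi>]]
      using neg(1)[OF solves(1)[of \<omega> \<xi>]] solves(2)[of \<omega> \<xi>] by (simp add: algebra_simps)
    have uniq: "v = - ?t \<omega> \<xi>" if v: "j v \<in> D" "(\<i> * complex_of_real \<omega>) *\<^sub>C j v = A (j v) + B \<xi>" for \<omega> v \<xi>
    proof -
      have "j (?t \<omega> \<xi>) = - j v"
        using neg[OF v(1)] v(2) by (intro solves(3)) (simp_all add: algebra_simps)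
      then have "j (- ?t \<omega> \<xi>) = j v" by (simp add: jneg)
      then show ?thesis using embedding(2) by (simp add: inj_eq)
    qed
    obtain C where C: "\<And>\<omega>. bounded_clinear (?t \<omega>)" "\<And>\<omega>. onorm (?t \<omega>) \<le> C"
      using wd unfolding alpha3_well_defined_def by blast
    have tb: "norm (?t \<omega> \<xi>) \<le> C * norm \<xi>" for \<omega> \<xi>
      using onorm[OF bounded_clinear_linear[OF C(1)], of \<omega> \<xi>] mult_right_mono[OF C(2) norm_ge_zero, of \<omega> \<xi>]
      by linarith
    have t0: "?t \<omega> 0 = 0" for \<omega> by (rule linear_0[OF bounded_linear.linear[OF bounded_clinear_linear[OF C(1)]]])
    show ?thesis
    proof
      assume "0 < alpha2 j D A B F"
      then obtain \<delta> where \<delta>: "\<delta> > 0" "\<And>\<omega> v \<xi>. j v \<in> D \<Longrightarrow> (\<i> * complex_of_real \<omega>) *\<^sub>C j v = A (j v) + B \<xi> \<Longrightarrow>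
          (norm v)\<^sup>2 + (norm \<xi>)\<^sup>2 \<noteq> 0 \<Longrightarrow> \<delta> * ((norm v)\<^sup>2 + (norm \<xi>)\<^sup>2) \<le> F v \<xi>"
        unfolding alpha2_pos_iff by blast
      have "\<delta> * (norm \<xi>)\<^sup>2 \<le> F (- ?t \<omega> \<xi>) \<xi>" if "\<xi> \<noteq> 0" for \<omega> \<xi>
      proof -
        have "\<delta> * (norm \<xi>)\<^sup>2 \<le> \<delta> * ((norm (- ?t \<omega> \<xi>))\<^sup>2 + (norm \<xi>)\<^sup>2)" using \<delta>(1) by (intro mult_left_mono) auto
        also have "\<dots> \<le> F (- ?t \<omega> \<xi>) \<xi>"
          by (rule \<delta>(2)[of _ \<omega>]) (use sol[of \<omega> \<xi>] that in \<open>auto simp: sum_power2_eq_zero_iff\<close>)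
        finally show ?thesis .
      qed
      then show "0 < alpha3 j D A B F" unfolding alpha3_pos_iff using \<delta>(1) by blast
    next
      assume "0 < alpha3 j D A B F"
      then obtain \<delta> where \<delta>: "\<delta> > 0" "\<And>\<omega> \<xi>. \<xi> \<noteq> 0 \<Longrightarrow> \<delta> * (norm \<xi>)\<^sup>2 \<le> F (- ?t \<omega> \<xi>) \<xi>"
        unfolding alpha3_pos_iff by blast
      have K: "0 < C\<^sup>2 + 1" using zero_le_power2[of C] by linarith
      \<comment> \<open>Since \<open>norm v \<le> C * norm \<xi>\<close>, the denominator in
        \<open>alpha2\<close> is at most \<open>C\<^sup>2 + 1\<close> times the one in
        \<open>alpha3\<close>.\<close>
      have "\<delta> / (C\<^sup>2 + 1) * ((norm v)\<^sup>2 + (norm \<xi>)\<^sup>2) \<le> F v \<xi>"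
        if v: "j v \<in> D" "(\<i> * complex_of_real \<omega>) *\<^sub>C j v = A (j v) + B \<xi>" "(norm v)\<^sup>2 + (norm \<xi>)\<^sup>2 \<noteq> 0" for \<omega> v \<xi>
      proof -
        have veq: "v = - ?t \<omega> \<xi>" by (rule uniq[OF v(1,2)])
        \<comment> \<open>A zero control would make \<open>v\<close> zero as well, which the nonzero
          denominator excludes.\<close>
        have "\<xi> \<noteq> 0" using v(3) veq t0 by auto
        have "(norm v)\<^sup>2 \<le> (C * norm \<xi>)\<^sup>2" unfolding veq norm_minus_cancel by (rule power_mono[OF tb]) simp
        then have "(norm v)\<^sup>2 + (norm \<xi>)\<^sup>2 \<le> (C\<^sup>2 + 1) * (norm \<xi>)\<^sup>2" by (simp add: power_mult_distrib distrib_right)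
        then have "\<delta> / (C\<^sup>2 + 1) * ((norm v)\<^sup>2 + (norm \<xi>)\<^sup>2) \<le> \<delta> / (C\<^sup>2 + 1) * ((C\<^sup>2 + 1) * (norm \<xi>)\<^sup>2)"
          using \<delta>(1) K by (intro mult_left_mono) auto
        also have "\<dots> = \<delta> * (norm \<xi>)\<^sup>2" using K by simp
        also have "\<dots> \<le> F v \<xi>" unfolding veq by (rule \<delta>(2)[OF \<open>\<xi> \<noteq> 0\<close>])
        finally show ?thesis .
      qed
      moreover have "0 < \<delta> / (C\<^sup>2 + 1)" using \<delta>(1) K by simp
      ultimately show "0 < alpha2 j D A B F" unfolding alpha2_pos_iff by blast
    qed
  qed
  show ?thesis using part1 alpha12 alpha23 by blast
qed

end
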